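(* Let $w(z)$ be a Speiser function with ${\tt q}\ge2$ distinct singular values. 1) The Riemann surface $\mathcal R_{w(z)}$ associated to $w(z)$ can be constructed by isometric glueing of sheets, denoted by $\sim$, as follows: $$\mathcal R_{w(z)}=\Big[\bigcup_\vartheta\mathfrak L_{\Xi,\vartheta}\Big]\Big/\sim\ =\ \Bigg[\bigcup_\vartheta\Bigg(\widehat{\mathbb C}_w\setminus\Big(\bigcup_{{\tt j}(\mathfrak a),{\tt j}(\mathfrak r)\in\Xi}\overline{{\tt w}_{{\tt j}(\mathfrak a)}{\tt w}_{{\tt j}(\mathfrak r)}}\Big)\Bigg)_\vartheta\Bigg]\Bigg/\sim,$$ where the index $\Xi$ indicates the type of sheet, i.e. the particular collection $\{\overline{{\tt w}_{{\tt j}(\mathfrak a)}{\tt w}_{{\tt j}(\mathfrak r)}}\mid{\tt j}(\mathfrak a)\ne{\tt j}(\mathfrak r)\}$ of branch cuts that is considered on each sheet $\vartheta$, and only a finite number of types of sheets $\mathfrak L_\Xi$ appears. 2) The number of sheets in this decomposition is $n=|\{\vartheta\}|$, with $2\le n\le\infty$. Moreover $n<\infty$ if and only if $w(z)$ is a rational function of degree $n\ge2$.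
   Context: $\Omega_z$ is $\widehat{\mathbb C}_z$, $\mathbb C_z$ or the unit disk $\Delta_z$; in the last two cases functions have $\infty$, resp. $\{|z|=1\}$, as natural boundary. A Speiser function is a meromorphic $w:\Omega_z\to\widehat{\mathbb C}_w$ with finitely many, ${\tt q}\ge2$, distinct singular (critical or asymptotic) values. $\mathcal R_{w(z)}=\{(z,w(z))\}\subset\Omega_z\times\widehat{\mathbb C}_w$, with projections $\pi_1$ (a biholomorphism) and $\pi_2$; its branch points correspond to the singularities of $w^{-1}$ (critical points, of finite ramification index, and logarithmic singularities, of infinite ramification index), and ${\tt w}_{{\tt j}(\iota)}$ is the singular value over which the $\iota$-th branch point lies. $(\widehat{\mathbb C}_w,\partial/\partial w)$ is the sphere with the flat metric having a singularity at $\infty$, and $\mathcal R_{w(z)}$ carries the pulled back flat metric. A geodesic segment between distinct ${\tt w}_\alpha,{\tt w}_\beta\in\widehat{\mathbb C}_w$ is: if both are finite, either the oriented straight segment $\overline{{\tt w}_\alpha{\tt w}_\beta}\subset\mathbb C_w$ or the oriented arc from ${\tt w}_\alpha$ through $\infty$ to ${\tt w}_\beta$ complementary to it in the circle through ${\tt w}_\alpha,\infty,{\tt w}_\beta$; if one is $\infty$, one of the two oriented arcs of the horizontal circle ($\mathrm{Im}\,w$ constant) joining the finite point and $\infty$. A sheet with branch cuts is $\mathfrak L_\Xi=\widehat{\mathbb C}_w\setminus\bigcup_{\Xi}\overline{{\tt w}_{{\tt j}(\mathfrak a)}{\tt w}_{{\tt j}(\mathfrak r)}}$, where $\Xi\ne\emptyset$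 is a collection of geodesic segments (branch cuts) between distinct singular values, meeting at most at their endpoints, such that $\mathfrak L_\Xi$ is simply connected. Isometric glueing of sheets is along branch cuts (boundary geodesic segments). *)

theory Defs
  imports "HOL-Analysis.Analysis" "HOL-Computational_Algebra.Polynomial"
begin

section \<open>The Riemann sphere and meromorphic functions\<close>

text \<open>
  A point of the Riemann sphere is an element of \<^typ>\<open>complex option\<close>; \<^const>\<open>None\<close> is the
  point at infinity.
\<close>

definition riemann_sphere :: "complex option topology" where
  "riemann_sphere = Alexandroff_compactification euclidean"

fun finite_part :: "complex option \<Rightarrow> complex" where
  "finite_part None = 0"
| "finite_part (Some v) = v"

fun sphere_inversion :: "complex option \<Rightarrow> complex option" where
  "sphere_inversion None = Some 0"
| "sphere_inversion (Some z) = (if z = 0 then None else Some (1 / z))"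

text \<open>
  The standard parametrisation around \<open>p\<close>, sending \<open>0\<close> to \<open>p\<close>, and the standard
  coordinate around \<open>p\<close>, sending \<open>p\<close> to \<open>0\<close>.  The coordinate takes a meaningless value at
  a single point (infinity for finite \<open>p\<close>, \<open>0\<close> for \<open>p\<close> infinite); the continuity requirement
  in \<open>meromorphic_map\<close> keeps \<open>w\<close> away from that point near \<open>p\<close>.
\<close>

fun sphere_chart :: "complex option \<Rightarrow> complex \<Rightarrow> complex option" where
  "sphere_chart None \<zeta> = sphere_inversion (Some \<zeta>)"
| "sphere_chart (Some a) \<zeta> = Some (a + \<zeta>)"

fun sphere_coord :: "complex option \<Rightarrow> complex option \<Rightarrow> complex" where
  "sphere_coord None v = finite_part (sphere_inversion v)"
| "sphere_coord (Some b) v = finite_part v - b"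

definition local_expression ::
    "(complex option \<Rightarrow> complex option) \<Rightarrow> complex option \<Rightarrow> complex \<Rightarrow> complex" where
  "local_expression w p = (\<lambda>\<zeta>. sphere_coord (w p) (w (sphere_chart p \<zeta>)))"

text \<open>
  Meromorphic functions are holomorphic maps to the sphere.  The constant map with value
  infinity is admitted here, but it has only one singular value.
\<close>

definition meromorphic_map ::
    "complex option set \<Rightarrow> (complex option \<Rightarrow> complex option) \<Rightarrow> bool" where
  "meromorphic_map \<Omega> w \<longleftrightarrow>
     continuous_map (subtopology riemann_sphere \<Omega>) riemann_sphere w \<and>
     (\<forall>p\<in>\<Omega>. local_expression w p analytic_on {0})"

definition natural_boundary ::
    "complex option set \<Rightarrow> (complex option \<Rightarrow> complex option) \<Rightarrow> bool" where
  "natural_boundary \<Omega> w \<longleftrightarrow>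
     (\<forall>p \<in> riemann_sphere frontier_of \<Omega>.
        \<not> (\<exists>V g. openin riemann_sphere V \<and> p \<in> V \<and> meromorphic_map V g \<and>
                 (\<forall>z \<in> V \<inter> \<Omega>. g z = w z)))"


section \<open>Speiser functions\<close>

definition critical_point ::
    "complex option set \<Rightarrow> (complex option \<Rightarrow> complex option) \<Rightarrow> complex option \<Rightarrow> bool" where
  "critical_point \<Omega> w p \<longleftrightarrow> p \<in> \<Omega> \<and> deriv (local_expression w p) 0 = 0"

text \<open>
  An asymptotic path \<open>\<gamma>\<close> is defined on \<open>[0,1)\<close> and leaves every compact subset of \<open>\<Omega>\<close>; there
  is none when \<open>\<Omega>\<close> is the sphere.
\<close>

definition asymptotic_value ::
    "complex option set \<Rightarrow> (complex option \<Rightarrow> complex option) \<Rightarrow> complex option \<Rightarrow> bool" where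
  "asymptotic_value \<Omega> w a \<longleftrightarrow>
     (\<exists>\<gamma> :: real \<Rightarrow> complex option.
        continuous_map (top_of_set {0..<1}) (subtopology riemann_sphere \<Omega>) \<gamma> \<and>
        (\<forall>K. compactin riemann_sphere K \<and> K \<subseteq> \<Omega> \<longrightarrow> (\<forall>\<^sub>F t in at_left 1. \<gamma> t \<notin> K)) \<and>
        limitin riemann_sphere (w \<circ> \<gamma>) a (at_left 1))"

definition singular_values ::
    "complex option set \<Rightarrow> (complex option \<Rightarrow> complex option) \<Rightarrow> complex option set" where
  "singular_values \<Omega> w = w ` {p. critical_point \<Omega> w p} \<union> {a. asymptotic_value \<Omega> w a}"

definition speiser_function ::
    "complex option set \<Rightarrow> (complex option \<Rightarrow> complex option) \<Rightarrow> nat \<Rightarrow> bool" where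
  "speiser_function \<Omega> w q \<longleftrightarrow>
     \<Omega> \<in> {UNIV, range Some, Some ` ball 0 1} \<and>
     meromorphic_map \<Omega> w \<and> natural_boundary \<Omega> w \<and>
     finite (singular_values \<Omega> w) \<and> card (singular_values \<Omega> w) = q \<and> 2 \<le> q"

definition rational_map :: "complex poly \<Rightarrow> complex poly \<Rightarrow> complex option \<Rightarrow> complex option" where
  "rational_map P Q p =
     (case p of
        Some z \<Rightarrow> if poly Q z = 0 then None else Some (poly P z / poly Q z)
      | None \<Rightarrow> if degree Q < degree P then None
                else Some (coeff P (degree Q) / lead_coeff Q))"

definition rational_of_degree ::
    "complex option set \<Rightarrow> (complex option \<Rightarrow> complex option) \<Rightarrow> nat \<Rightarrow> bool" where
  "rational_of_degree \<Omega> w d \<longleftrightarrow>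
     (\<exists>P Q. Q \<noteq> 0 \<and> coprime P Q \<and> max (degree P) (degree Q) = d \<and>
            (\<forall>p\<in>\<Omega>. w p = rational_map P Q p))"


section \<open>The Riemann surface of a function and its flat metric\<close>

text \<open>
  The graph of \<open>w\<close>.  The projections \<open>\<pi>\<^sub>1\<close> and \<open>\<pi>\<^sub>2\<close> are \<^const>\<open>fst\<close> and \<^const>\<open>snd\<close>.
\<close>

definition riemann_surface_of ::
    "complex option set \<Rightarrow> (complex option \<Rightarrow> complex option)
      \<Rightarrow> (complex option \<times> complex option) topology" where
  "riemann_surface_of \<Omega> w =
     subtopology (prod_topology riemann_sphere riemann_sphere) ((\<lambda>z. (z, w z)) ` \<Omega>)"

text \<open>
  Length in the flat metric \<open>\<bar>dw\<bar>\<close> of a path in the sphere, parametrised by \<open>[0,1]\<close>.  The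
  singularity at infinity is at infinite distance.
\<close>

definition flat_length :: "(real \<Rightarrow> complex option) \<Rightarrow> ennreal" where
  "flat_length g =
     (if None \<in> g ` {0..1} then \<infinity>
      else SUP ts \<in> {ts. sorted ts \<and> set ts \<subseteq> {0..1}}.
             \<Sum>i<length ts - 1.
               ennreal (cmod (finite_part (g (ts ! Suc i)) - finite_part (g (ts ! i)))))"

text \<open>
  The distance on a space \<open>X\<close> of the flat metric pulled back by a map \<open>\<pi>\<close> from \<open>X\<close> to the
  sphere.
\<close>

definition pullback_flat_dist ::
    "'a topology \<Rightarrow> ('a \<Rightarrow> complex option) \<Rightarrow> 'a \<Rightarrow> 'a \<Rightarrow> ennreal" where
  "pullback_flat_dist X \<pi> x y =
     (INF \<gamma> \<in> {\<gamma>. pathin X \<gamma> \<and> \<gamma> 0 = x \<and> \<gamma> 1 = y}. flat_length (\<pi> \<circ> \<gamma>))"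


section \<open>Geodesic segments and sheets\<close>

text \<open>
  \<open>Direct a b\<close> is the straight segment from \<open>a\<close> to \<open>b\<close>; \<open>Around a b\<close> is the complementary arc
  from \<open>a\<close> through infinity to \<open>b\<close>; \<open>Outward a d\<close> is the ray from \<open>a\<close> to infinity in direction
  \<open>d\<close>; \<open>Inward d b\<close> comes from infinity to \<open>b\<close> travelling in direction \<open>d\<close>, where
  \<open>d\<close> is \<open>1\<close> or \<open>-1\<close>.
\<close>

datatype geodesic =
    Direct complex complex
  | Around complex complex
  | Outward complex complex
  | Inward complex complex

fun source :: "geodesic \<Rightarrow> complex option" where
  "source (Direct a b) = Some a"
| "source (Around a b) = Some a"
| "source (Outward a d) = Some a"
| "source (Inward d b) = None"

fun target :: "geodesic \<Rightarrow> complex option" where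
  "target (Direct a b) = Some b"
| "target (Around a b) = Some b"
| "target (Outward a d) = None"
| "target (Inward d b) = Some b"

fun opposite :: "geodesic \<Rightarrow> geodesic" where
  "opposite (Direct a b) = Direct b a"
| "opposite (Around a b) = Around b a"
| "opposite (Outward a d) = Inward (- d) a"
| "opposite (Inward d b) = Outward b (- d)"

fun segment_points :: "geodesic \<Rightarrow> complex option set" where
  "segment_points (Direct a b) = Some ` closed_segment a b"
| "segment_points (Around a b) =
     insert None (Some ` ({a + of_real t * (a - b) |t. 0 \<le> t} \<union>
                          {b + of_real t * (b - a) |t. 0 \<le> t}))"
| "segment_points (Outward a d) = insert None (Some ` {a + of_real t * d |t. 0 \<le> t})"
| "segment_points (Inward d b) = insert None (Some ` {b - of_real t * d |t. 0 \<le> t})"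

definition endpoints :: "geodesic \<Rightarrow> complex option set" where
  "endpoints e = {source e, target e}"

fun geodesic_between :: "complex option set \<Rightarrow> geodesic \<Rightarrow> bool" where
  "geodesic_between S (Direct a b) \<longleftrightarrow> a \<noteq> b \<and> Some a \<in> S \<and> Some b \<in> S"
| "geodesic_between S (Around a b) \<longleftrightarrow> a \<noteq> b \<and> Some a \<in> S \<and> Some b \<in> S"
| "geodesic_between S (Outward a d) \<longleftrightarrow> d \<in> {1, -1} \<and> Some a \<in> S \<and> None \<in> S"
| "geodesic_between S (Inward d b) \<longleftrightarrow> d \<in> {1, -1} \<and> Some b \<in> S \<and> None \<in> S"

text \<open>
  Every geodesic segment lies on a straight line; \<open>left_side\<close> is the open half plane to
  the left of that line, for the direction of travel.
\<close>

fun basepoint :: "geodesic \<Rightarrow> complex" where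
  "basepoint (Direct a b) = a"
| "basepoint (Around a b) = a"
| "basepoint (Outward a d) = a"
| "basepoint (Inward d b) = b"

fun heading :: "geodesic \<Rightarrow> complex" where
  "heading (Direct a b) = b - a"
| "heading (Around a b) = a - b"
| "heading (Outward a d) = d"
| "heading (Inward d b) = d"

definition left_side :: "geodesic \<Rightarrow> complex option set" where
  "left_side e = Some ` {v. 0 < Im ((v - basepoint e) / heading e)}"

definition sheet :: "geodesic set \<Rightarrow> complex option set" where
  "sheet \<Xi> = - (\<Union>e\<in>\<Xi>. segment_points e)"

text \<open>
  \<^const>\<open>simply_connected\<close> for an abstract topology: any two loops are freely homotopic.
\<close>

definition simply_connected_space :: "'a topology \<Rightarrow> bool" where
  "simply_connected_space X \<longleftrightarrow>
     (\<forall>p q. pathin X p \<and> p 1 = p 0 \<and> pathin X q \<and> q 1 = q 0 \<longrightarrow>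
            homotopic_with (\<lambda>r. r 1 = r 0) (top_of_set {0..1}) X p q)"

text \<open>Admissible collections of branch cuts, for the set \<open>S\<close> of singular values.\<close>

definition sheet_type :: "complex option set \<Rightarrow> geodesic set \<Rightarrow> bool" where
  "sheet_type S \<Xi> \<longleftrightarrow>
     \<Xi> \<noteq> {} \<and> (\<forall>e\<in>\<Xi>. geodesic_between S e) \<and>
     (\<forall>e\<in>\<Xi>. \<forall>f\<in>\<Xi>. e \<noteq> f \<longrightarrow> segment_points e \<inter> segment_points f \<subseteq> endpoints e \<inter> endpoints f) \<and>
     simply_connected_space (subtopology riemann_sphere (sheet \<Xi>))"


section \<open>Sheets with boundary\<close>

text \<open>
  The glueing takes place along the boundary of a sheet \<open>L\<close>, in which every branch cut
  appears twice, once for each side, and a vertex appears once for each corner of \<open>L\<close>.  A point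
  of the sheet with boundary is a point \<open>p\<close> of the sphere together with a coherent choice,
  for all open neighbourhoods \<open>U\<close> of \<open>p\<close>, of a component \<open>C U\<close> of \<open>U \<inter> L\<close>.  Over \<open>p \<in> L\<close>
  there is one such choice, over a relative interior point of a cut there are two (the
  sides), and over a vertex one for each corner.
\<close>

type_synonym bpoint = "complex option \<times> (complex option set \<Rightarrow> complex option set)"

definition boundary_germ ::
    "complex option set \<Rightarrow> complex option \<Rightarrow> (complex option set \<Rightarrow> complex option set) \<Rightarrow> bool" where
  "boundary_germ L p C \<longleftrightarrow>
     (\<forall>U. openin riemann_sphere U \<and> p \<in> U \<longrightarrow>
          C U \<in> connected_components_of (subtopology riemann_sphere (U \<inter> L))) \<and>
     (\<forall>U V. openin riemann_sphere U \<and> openin riemann_sphere V \<and> p \<in> U \<and> U \<subseteq> V \<longrightarrow> C U \<subseteq> C V) \<and>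
     (\<forall>U. \<not> (openin riemann_sphere U \<and> p \<in> U) \<longrightarrow> C U = {})"

text \<open>
  Each open \<open>W\<close> contributes the basic open set of all points of which some neighbourhood
  in \<open>L\<close>, within the chosen component, is contained in \<open>W\<close>.
\<close>

definition bordered_sheet :: "geodesic set \<Rightarrow> bpoint topology" where
  "bordered_sheet \<Xi> = topology_generated_by
     {{(p, C). boundary_germ (sheet \<Xi>) p C \<and>
               (\<exists>V. openin riemann_sphere V \<and> p \<in> V \<and> C V \<subseteq> W)} |W. openin riemann_sphere W}"

text \<open>
  The point \<open>(p, C)\<close> is on the left side of \<open>e\<close> (endpoints included): arbitrarily near \<open>p\<close> there
  are relative interior points of \<open>e\<close> at which the left side of \<open>e\<close> belongs to the chosen
  component.
\<close>

fun on_left_of :: "bpoint \<Rightarrow> geodesic \<Rightarrow> bool" where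
  "on_left_of (p, C) e \<longleftrightarrow>
     p \<in> segment_points e \<and>
     (\<forall>U. openin riemann_sphere U \<and> p \<in> U \<longrightarrow>
          (\<exists>x \<in> U \<inter> (segment_points e - endpoints e).
             \<exists>V. openin riemann_sphere V \<and> x \<in> V \<and> V \<inter> left_side e \<subseteq> C U))"


section \<open>Glueing of sheets\<close>

text \<open>The two sides of a cut \<open>e\<close> are the left sides of \<open>e\<close> and of \<open>opposite e\<close>.\<close>

definition boundary_sides :: "geodesic set \<Rightarrow> geodesic set" where
  "boundary_sides \<Xi> = \<Xi> \<union> opposite ` \<Xi>"

text \<open>
  Sheets are indexed by natural numbers: a connected Riemann surface is second countable, so
  it has at most countably many sheets.  \<open>across G \<theta> e\<close> is the sheet whose left side of
  \<open>opposite e\<close> is glued to the left side of \<open>e\<close> on the sheet \<open>\<theta>\<close>.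
\<close>

record glueing =
  sheets :: "nat set"
  cuts :: "nat \<Rightarrow> geodesic set"
  across :: "nat \<Rightarrow> geodesic \<Rightarrow> nat"

definition valid_glueing :: "complex option set \<Rightarrow> glueing \<Rightarrow> bool" where
  "valid_glueing S G \<longleftrightarrow>
     (\<forall>\<theta> \<in> sheets G. sheet_type S (cuts G \<theta>) \<and>
        (\<forall>e \<in> boundary_sides (cuts G \<theta>).
           across G \<theta> e \<in> sheets G \<and>
           opposite e \<in> boundary_sides (cuts G (across G \<theta> e)) \<and>
           across G (across G \<theta> e) (opposite e) = \<theta>))"

definition disjoint_sheets :: "glueing \<Rightarrow> (nat \<times> bpoint) topology" where
  "disjoint_sheets G = sum_topology (\<lambda>\<theta>. bordered_sheet (cuts G \<theta>)) (sheets G)"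

text \<open>
  Sides are identified by the identity of the underlying geodesic segment, which is an
  isometry for the flat metric.
\<close>

definition glue_step :: "glueing \<Rightarrow> ((nat \<times> bpoint) \<times> (nat \<times> bpoint)) set" where
  "glue_step G =
     {((\<theta>, p, C), (\<theta>', p', C')).
        (\<theta>, p, C) \<in> topspace (disjoint_sheets G) \<and> (\<theta>', p', C') \<in> topspace (disjoint_sheets G) \<and>
        p' = p \<and>
        (\<exists>e \<in> boundary_sides (cuts G \<theta>). \<theta>' = across G \<theta> e \<and>
           on_left_of (p, C) e \<and> on_left_of (p, C') (opposite e))}"

definition glue_rel :: "glueing \<Rightarrow> ((nat \<times> bpoint) \<times> (nat \<times> bpoint)) set" where
  "glue_rel G = (glue_step G \<union> (glue_step G)\<inverse>)\<^sup>*"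

definition quotient_topology :: "'a topology \<Rightarrow> ('a \<times> 'a) set \<Rightarrow> 'a set topology" where
  "quotient_topology X r =
     topology (\<lambda>A. A \<subseteq> (\<lambda>x. r `` {x}) ` topspace X \<and> openin X {x \<in> topspace X. r `` {x} \<in> A})"

text \<open>
  A vertex at which infinitely many corners are glued together is a logarithmic branch point;
  such points do not belong to the Riemann surface and are left out.  A vertex with finitely many
  corners is a point of finite ramification index.
\<close>

definition glued_surface :: "glueing \<Rightarrow> (nat \<times> bpoint) set topology" where
  "glued_surface G =
     quotient_topology
       (subtopology (disjoint_sheets G) {x. finite (glue_rel G `` {x})}) (glue_rel G)"

text \<open>All members of a class \<open>c\<close> have the same underlying point of the sphere.\<close>

definition glued_projection :: "(nat \<times> bpoint) set \<Rightarrow> complex option" where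
  "glued_projection c = the_elem ((\<lambda>(\<theta>, p, C). p) ` c)"

definition constructed_by_glueing ::
    "complex option set \<Rightarrow> (complex option \<Rightarrow> complex option) \<Rightarrow> glueing \<Rightarrow> bool" where
  "constructed_by_glueing \<Omega> w G \<longleftrightarrow>
     valid_glueing (singular_values \<Omega> w) G \<and>
     (\<exists>h. homeomorphic_map (glued_surface G) (riemann_surface_of \<Omega> w) h \<and>
          (\<forall>c \<in> topspace (glued_surface G). snd (h c) = glued_projection c) \<and>
          (\<forall>c \<in> topspace (glued_surface G). \<forall>d \<in> topspace (glued_surface G).
             pullback_flat_dist (riemann_surface_of \<Omega> w) snd (h c) (h d) =
             pullback_flat_dist (glued_surface G) glued_projection c d))"

definition num_sheets :: "glueing \<Rightarrow> enat" where
  "num_sheets G = (if finite (sheets G) then enat (card (sheets G)) else \<infinity>)"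


section \<open>Basic facts\<close>

lemma opposite_opposite [simp]: "opposite (opposite e) = e"
  by (cases e) auto

lemma segment_points_opposite [simp]: "segment_points (opposite e) = segment_points e"
  by (cases e) (auto simp: closed_segment_commute)

lemma istopology_quotient:
  "istopology (\<lambda>A. A \<subseteq> f ` topspace X \<and> openin X {x \<in> topspace X. f x \<in> A})"
  unfolding istopology_def
proof (intro conjI allI impI)
  fix A B
  assume A: "A \<subseteq> f ` topspace X \<and> openin X {x \<in> topspace X. f x \<in> A}"
    and B: "B \<subseteq> f ` topspace X \<and> openin X {x \<in> topspace X. f x \<in> B}"
  show "A \<inter> B \<subseteq> f ` topspace X"
    using A by auto
  have "{x \<in> topspace X. f x \<in> A \<inter> B} = {x \<in> topspace X. f x \<in> A} \<inter> {x \<in> topspace X. f x \<in> B}"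
    by auto
  then show "openin X {x \<in> topspace X. f x \<in> A \<inter> B}"
    using A B by (simp only: openin_Int)
next
  fix \<K>
  assume K: "\<forall>A\<in>\<K>. A \<subseteq> f ` topspace X \<and> openin X {x \<in> topspace X. f x \<in> A}"
  show "\<Union>\<K> \<subseteq> f ` topspace X"
    using K by (simp add: Union_least)
  have eq: "{x \<in> topspace X. f x \<in> \<Union>\<K>} = (\<Union>A\<in>\<K>. {x \<in> topspace X. f x \<in> A})"
    by auto
  show "openin X {x \<in> topspace X. f x \<in> \<Union>\<K>}"
    unfolding eq by (rule openin_clauses(3)) (use K in auto)
qed

lemma openin_quotient_topology:
  "openin (quotient_topology X r) A \<longleftrightarrow>
     A \<subseteq> (\<lambda>x. r `` {x}) ` topspace X \<and> openin X {x \<in> topspace X. r `` {x} \<in> A}"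
  unfolding quotient_topology_def by (simp add: topology_inverse' [OF istopology_quotient])

lemma topspace_quotient_topology:
  "topspace (quotient_topology X r) = (\<lambda>x. r `` {x}) ` topspace X"
proof
  show "topspace (quotient_topology X r) \<subseteq> (\<lambda>x. r `` {x}) ` topspace X"
    using openin_quotient_topology openin_topspace by blast
  have "{x \<in> topspace X. r `` {x} \<in> (\<lambda>x. r `` {x}) ` topspace X} = topspace X"
    by auto
  then have "openin (quotient_topology X r) ((\<lambda>x. r `` {x}) ` topspace X)"
    by (simp add: openin_quotient_topology)
  then show "(\<lambda>x. r `` {x}) ` topspace X \<subseteq> topspace (quotient_topology X r)"
    by (rule openin_subset)
qed

lemma quotient_map_quotient_topology:
  "quotient_map X (quotient_topology X r) (\<lambda>x. r `` {x})"
  unfolding quotient_map_def by (auto simp: topspace_quotient_topology openin_quotient_topology)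

end

theory Submission
  imports Defs "HOL-Complex_Analysis.Complex_Analysis" "HOL-Computational_Algebra.Computational_Algebra" "HOL-Real_Asymp.Real_Asymp"
begin

text \<open>
  Cut the sphere along a chain of geodesic segments through all singular values.  Away from the
  singular values paths lift through \<open>w\<close>, because a lift leaving every compact set would end at an
  asymptotic value; the slit sphere is star-shaped in suitable coordinates, so \<open>w\<close> splits over it
  into sections, and these are the sheets.  The glueing classes of the corners over \<open>p\<close> correspond to
  the components of the preimage of a punctured neighbourhood of \<open>p\<close>.  A component with finitely
  many corners is a finite covering of the punctured neighbourhood and is closed up by a point of
  \<open>\<Omega>\<close>: otherwise \<open>w\<close> would tend to \<open>p\<close> along the whole boundary of \<open>\<Omega>\<close>, which the natural
  boundary excludes.  The infinite classes are the logarithmic singularities.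

  In an arbitrary decomposition a value off the cuts is taken exactly once on each sheet, so the number
  of sheets is the number of preimages of a generic value.  If it is finite, then \<open>\<Omega>\<close> is the sphere
  and Liouville's theorem makes \<open>w\<close> rational; a single sheet would make \<open>w\<close> injective, hence free of
  singular values.
\<close>

text \<open>The delicate point is that the glued surface keeps every class with finitely many
  corners, also over a vertex. Such a class bounds a finite covering of a punctured disc, and
  nothing local prevents its puncture from being an end of \<Omega>. But \<Omega> has at most one
  end, and over the rim of the disc the covering is compact; so it would contain a whole
  neighbourhood of that end, and \<open>w\<close> would have a limit there. What this requires of
  \<open>w\<close> is collected in the locale \<open>branched\<close>, what is required of the cuts
  in \<open>tame_cuts\<close>, and \<open>glue\<close> combines the two. Corners are compared in two
  ways: combinatorially, by crossing cuts at \<open>p\<close> (relation \<open>adj\<close>), and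
  topologically, by the component of the preimage that contains them. That both give the same
  classes makes the quotient a copy of \<Omega>. The count of sheets has to treat every
  decomposition, not only the one constructed. Between finitely many singular values there are only
  finitely many admissible segments, since rays have horizontal directions; so almost every value
  lies off all possible cuts, and over it no glueing takes place.\<close>

section \<open>Topology of the Riemann sphere\<close>

text \<open>
  A point of norm \<open>r\<close> is sent to a point of norm \<open>r / (1 + r\<^sup>2)\<close> at height \<open>1 / (1 + r\<^sup>2)\<close>: up to
  scaling this is stereographic projection, and it provides a metric for the topology of the sphere.
\<close>

definition sphere_embed :: "'a::euclidean_space option \<Rightarrow> 'a \<times> real" where
  "sphere_embed p = (case p of None \<Rightarrow> (0, 0) | Some x \<Rightarrow> (x /\<^sub>R (1 + (norm x)\<^sup>2), 1 / (1 + (norm x)\<^sup>2)))"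

lemma one_plus_norm_sq_pos: "0 < 1 + (norm x)\<^sup>2"
  by (smt (verit) zero_le_power2)

lemma inj_sphere_embed: "inj sphere_embed"
proof (rule injI)
  fix p q :: "'a option" assume eq: "sphere_embed p = sphere_embed q"
  show "p = q"
  proof (cases p; cases q)
    fix x y assume xy: "p = Some x" "q = Some y"
    then have "1 / (1 + (norm x)\<^sup>2) = 1 / (1 + (norm y)\<^sup>2)" "x /\<^sub>R (1 + (norm x)\<^sup>2) = y /\<^sub>R (1 + (norm y)\<^sup>2)"
      using eq by (auto simp: sphere_embed_def)
    moreover have "1 + (norm x)\<^sup>2 \<noteq> 0"
      using one_plus_norm_sq_pos[of x] by linarith
    ultimately have "x = y"
      by (simp add: inverse_eq_divide)
    then show ?thesis using xy by simp
  qed (use eq less_imp_neq[OF one_plus_norm_sq_pos] in \<open>auto simp: sphere_embed_def\<close>)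
qed

instantiation option :: (euclidean_space) metric_space
begin

definition dist_option :: "'a option \<Rightarrow> 'a option \<Rightarrow> real" where
  "dist_option p q = dist (sphere_embed p) (sphere_embed q)"

definition uniformity_option :: "('a option \<times> 'a option) filter" where
  "uniformity_option = (INF e\<in>{0 <..}. principal {(x, y). dist x y < e})"

definition open_option :: "'a option set \<Rightarrow> bool" where
  "open_option U \<longleftrightarrow> (\<forall>x\<in>U. eventually (\<lambda>(x', y). x' = x \<longrightarrow> y \<in> U) uniformity)"

instance
proof
  show "dist x y = 0 \<longleftrightarrow> x = y" for x y :: "'a option"
    by (simp add: dist_option_def inj_eq inj_sphere_embed)
  show "dist x y \<le> dist x z + dist y z" for x y z :: "'a option"
    by (simp add: dist_option_def dist_triangle2)
qed (rule uniformity_option_def open_option_def)+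

end

text \<open>The metric on the option type is pulled back along \<open>sphere_embed\<close>, so balls
  correspond to balls in the image; this links the type class topology to a subspace
  topology.\<close>

lemma continuous_on_sphere_embed_iff_open:
  "open (U :: 'a::euclidean_space option set) \<longleftrightarrow> openin (top_of_set (range sphere_embed)) (sphere_embed ` U)"
proof
  assume U: "open U"
  show "openin (top_of_set (range sphere_embed)) (sphere_embed ` U)"
    unfolding openin_euclidean_subtopology_iff
  proof (intro conjI ballI)
    fix x assume "x \<in> sphere_embed ` U"
    then obtain p where p: "p \<in> U" "x = sphere_embed p" by auto
    then obtain e where "e > 0" "\<forall>y. dist y p < e \<longrightarrow> y \<in> U"
      using U by (auto simp: open_dist)
    then show "\<exists>e>0. \<forall>x'\<in>range sphere_embed. dist x' x < e \<longrightarrow> x' \<in> sphere_embed ` U"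
      using p by (auto simp: dist_option_def)
  qed auto
next
  assume U: "openin (top_of_set (range sphere_embed)) (sphere_embed ` U)"
  show "open U"
    unfolding open_dist
  proof
    fix p assume "p \<in> U"
    then obtain e where "e > 0" "\<And>x'. x' \<in> range sphere_embed \<Longrightarrow> dist x' (sphere_embed p) < e \<Longrightarrow> x' \<in> sphere_embed ` U"
      using conjunct2[OF U[unfolded openin_euclidean_subtopology_iff], rule_format, OF imageI[OF \<open>p \<in> U\<close>]]
      by blast
    then show "\<exists>e>0. \<forall>y. dist y p < e \<longrightarrow> y \<in> U"
      unfolding dist_option_def by (meson inj_image_mem_iff[OF inj_sphere_embed] rangeI)
  qed
qed

text \<open>Both coordinates of \<open>sphere_embed\<close> decay at infinity, the first like 1/r
  and the second like 1/r^2. Hence the points sent outside a neighbourhood of the image of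
  \<open>None\<close> form a bounded closed set, as the one-point compactification demands.\<close>

lemma sphere_embed_continuous_map:
  "continuous_map (Alexandroff_compactification euclidean) euclidean (sphere_embed :: 'a::euclidean_space option \<Rightarrow> _)"
proof -
  let ?A = "Alexandroff_compactification (euclidean :: 'a topology)"
  have "openin ?A {p. sphere_embed p \<in> U}" if U: "open U" for U
  proof -
    have cont: "continuous_on UNIV (\<lambda>x::'a. sphere_embed (Some x))"
      unfolding sphere_embed_def by (auto intro!: continuous_intros simp: less_imp_neq[OF one_plus_norm_sq_pos, symmetric])
    have o: "open {x. sphere_embed (Some x) \<in> U}"
      using continuous_open_preimage[OF cont open_UNIV U] by (simp add: vimage_def)
    show ?thesis
    proof (cases "(0, 0) \<in> U")
      case True
      have "((\<lambda>x::'a. sphere_embed (Some x)) \<longlongrightarrow> (0, 0)) at_infinity"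
        unfolding sphere_embed_def option.case
      proof (intro tendsto_intros)
        have l: "filterlim (\<lambda>x::'a. norm x) at_top at_infinity"
          by (simp add: filterlim_norm_at_top)
        have "((\<lambda>r::real. r / (1 + r\<^sup>2)) \<longlongrightarrow> 0) at_top" "((\<lambda>r::real. 1 / (1 + r\<^sup>2)) \<longlongrightarrow> 0) at_top"
          by real_asymp+
        from this[THEN filterlim_compose, OF l]
        have l1: "((\<lambda>x::'a. norm x / (1 + (norm x)\<^sup>2)) \<longlongrightarrow> 0) at_infinity"
          and l2: "((\<lambda>x::'a. 1 / (1 + (norm x)\<^sup>2)) \<longlongrightarrow> 0) at_infinity" by auto
        show "((\<lambda>x::'a. 1 / (1 + (norm x)\<^sup>2)) \<longlongrightarrow> 0) at_infinity" by (rule l2)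
        show "((\<lambda>x::'a. x /\<^sub>R (1 + (norm x)\<^sup>2)) \<longlongrightarrow> 0) at_infinity"
        proof (rule Lim_null_comparison[OF _ l1])
          show "\<forall>\<^sub>F x::'a in at_infinity. norm (x /\<^sub>R (1 + (norm x)\<^sup>2)) \<le> norm x / (1 + (norm x)\<^sup>2)"
            using one_plus_norm_sq_pos by (auto simp: field_simps abs_of_pos intro!: always_eventually)
        qed
      qed
      then have "eventually (\<lambda>x::'a. sphere_embed (Some x) \<in> U) at_infinity"
        using True U by (metis topological_tendstoD)
      then obtain b where b: "\<And>x::'a. b \<le> norm x \<Longrightarrow> sphere_embed (Some x) \<in> U"
        by (auto simp: eventually_at_infinity)
      let ?C = "- {x::'a. sphere_embed (Some x) \<in> U}"
      have "bounded ?C"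
        unfolding bounded_iff using b by (intro exI[of _ b]) (auto intro: linear)
      then have "compact ?C" using o by (simp only: compact_eq_bounded_closed closed_Compl simp_thms)
      moreover have "{p. sphere_embed p \<in> U} = insert None (Some ` (UNIV - ?C))"
      proof (rule set_eqI)
        fix p :: "'a option"
        show "p \<in> {p. sphere_embed p \<in> U} \<longleftrightarrow> p \<in> insert None (Some ` (UNIV - ?C))"
          using True by (cases p) (auto simp: sphere_embed_def)
      qed
      ultimately show ?thesis
        using o by (auto simp: openin_Alexandroff_compactification)
    next
      case False
      then have "{p. sphere_embed p \<in> U} = Some ` {x. sphere_embed (Some x) \<in> U}"
      proof -
        have "p \<in> {p. sphere_embed p \<in> U} \<longleftrightarrow> p \<in> Some ` {x. sphere_embed (Some x) \<in> U}" for p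
          using False by (cases p) (auto simp: sphere_embed_def)
        then show ?thesis by blast
      qed
      then show ?thesis using o by (auto simp: openin_Alexandroff_compactification)
    qed
  qed
  moreover have "topspace ?A = UNIV"
    by (auto simp: notin_range_Some)
  ultimately show ?thesis by (simp add: continuous_map_def)
qed

text \<open>A continuous injection of a compact space into a Hausdorff space is an embedding, so the
  compactification carries exactly the topology induced by \<open>sphere_embed\<close>. From here on
  \<open>open\<close>, \<open>continuous_on\<close> and \<open>compact\<close> apply to the sphere
  directly.\<close>

lemma Alexandroff_eq_euclidean:
  "Alexandroff_compactification euclidean = (euclidean :: 'a::euclidean_space option topology)"
proof -
  let ?A = "Alexandroff_compactification (euclidean :: 'a topology)"
  have emb: "embedding_map ?A euclidean (sphere_embed :: 'a option \<Rightarrow> _)"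
  proof (rule continuous_imp_embedding_map[OF sphere_embed_continuous_map])
    show "inj_on (sphere_embed :: 'a option \<Rightarrow> _) (topspace ?A)"
      by (rule inj_on_subset[OF inj_sphere_embed]) simp
  qed (simp_all add: compact_space_Alexandroff_compactification)
  then have h: "homeomorphic_map ?A (top_of_set (range sphere_embed)) (sphere_embed :: 'a option \<Rightarrow> _)"
    using topspace_Alexandroff_compactification[of "euclidean :: 'a topology"]
    by (simp add: embedding_map_def UNIV_option_conv del: topspace_Alexandroff_compactification)
  show ?thesis
  proof (rule topology_eq[THEN iffD2], intro allI)
    fix U :: "'a option set"
    have "openin ?A U \<longleftrightarrow> openin (top_of_set (range sphere_embed)) (sphere_embed ` U)"
      using homeomorphic_map_openness[OF h, of U] by (simp add: UNIV_option_conv[symmetric])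
    then show "openin ?A U = openin euclidean U"
      by (simp add: continuous_on_sphere_embed_iff_open[symmetric])
  qed
qed

lemma riemann_sphere_eq [simp]: "riemann_sphere = euclidean"
  by (simp add: riemann_sphere_def Alexandroff_eq_euclidean)

lemma open_sphere_iff:
  fixes V :: "'a::euclidean_space option set"
  shows "open V \<longleftrightarrow> open (Some -` V) \<and> (None \<in> V \<longrightarrow> (\<exists>R. \<forall>v. R < norm v \<longrightarrow> Some v \<in> V))"
proof -
  have "open V \<longleftrightarrow> openin (Alexandroff_compactification euclidean) V"
    by (simp add: Alexandroff_eq_euclidean)
  also have "\<dots> \<longleftrightarrow> open (Some -` V) \<and> (None \<in> V \<longrightarrow> (\<exists>R. \<forall>v. R < norm v \<longrightarrow> Some v \<in> V))"
  proof
    assume "openin (Alexandroff_compactification euclidean) V"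
    then consider U where "open U" "V = Some ` U"
      | C where "compact C" "V = insert None (Some ` (- C))"
      by (auto simp: openin_Alexandroff_compactification Compl_eq_Diff_UNIV)
    then show "open (Some -` V) \<and> (None \<in> V \<longrightarrow> (\<exists>R. \<forall>v. R < norm v \<longrightarrow> Some v \<in> V))"
    proof cases
      case 1
      then show ?thesis by (auto simp: inj_vimage_image_eq)
    next
      case 2
      have e: "Some -` V = - C" using 2 by auto
      obtain R where "\<forall>x\<in>C. norm x \<le> R"
        using 2 compact_imp_bounded bounded_iff by blast
      then have "\<forall>v. R < norm v \<longrightarrow> Some v \<in> V" using 2 by force
      then show ?thesis using e 2 by (auto simp: compact_imp_closed open_Compl)
    qed
  next
    assume *: "open (Some -` V) \<and> (None \<in> V \<longrightarrow> (\<exists>R. \<forall>v. R < norm v \<longrightarrow> Some v \<in> V))"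
    show "openin (Alexandroff_compactification euclidean) V"
    proof (cases "None \<in> V")
      case True
      then obtain R where R: "\<And>v. R < norm v \<Longrightarrow> Some v \<in> V" using * by auto
      have "bounded (- (Some -` V))"
        unfolding bounded_iff using R by (intro exI[of _ R]) (auto intro: leI)
      then have "compact (- (Some -` V))"
        using * by (simp only: compact_eq_bounded_closed closed_Compl simp_thms)
      moreover have "V = insert None (Some ` (UNIV - - (Some -` V)))"
      proof (rule set_eqI)
        fix p show "p \<in> V \<longleftrightarrow> p \<in> insert None (Some ` (UNIV - - (Some -` V)))"
          using True by (cases p) auto
      qed
      ultimately show ?thesis
        unfolding openin_Alexandroff_compactification
        by (metis closed_closedin compact_imp_closed compactin_euclidean_iff topspace_euclidean)
    next
      case False
      have "p \<in> V \<longleftrightarrow> p \<in> Some ` (Some -` V)" for p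
        using False by (cases p) auto
      then have "V = Some ` (Some -` V)" by blast
      then show ?thesis
        unfolding openin_Alexandroff_compactification using * by auto
    qed
  qed
  finally show ?thesis .
qed

lemma compact_UNIV_sphere: "compact (UNIV :: 'a::euclidean_space option set)"
proof -
  have "compact_space (euclidean :: 'a option topology)"
    unfolding Alexandroff_eq_euclidean[symmetric] by (rule compact_space_Alexandroff_compactification)
  then show ?thesis by (simp add: compact_space_def)
qed

lemma compact_sphere_iff: "compact (K :: 'a::euclidean_space option set) \<longleftrightarrow> closed K"
  using compact_UNIV_sphere compact_imp_closed compact_Int_closed by (metis inf_top_left)

lemma open_Some_image [simp]: "open (Some ` U) \<longleftrightarrow> open (U :: 'a::euclidean_space set)"
  by (auto simp: open_sphere_iff inj_vimage_image_eq)

lemma continuous_on_Some [continuous_intros]: "continuous_on A (Some :: 'a::euclidean_space \<Rightarrow> _)"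
  by (rule continuous_on_subset[of UNIV]) (auto simp: continuous_on_open_vimage open_sphere_iff)

lemma continuous_on_finite_part: "A \<subseteq> range Some \<Longrightarrow> continuous_on A finite_part"
proof (rule continuous_on_subset)
  show "continuous_on (range Some) finite_part"
  proof (subst continuous_on_open_vimage)
    show "\<forall>B. open B \<longrightarrow> open (finite_part -` B \<inter> range Some)"
    proof (intro allI impI)
      fix B :: "complex set" assume "open B"
      moreover have "finite_part -` B \<inter> range Some = Some ` B" by auto
      ultimately show "open (finite_part -` B \<inter> range Some)" by simp
    qed
  qed simp
qed

lemma sphere_inversion_invol [simp]: "sphere_inversion (sphere_inversion p) = p"
  by (cases p) auto

lemma open_sphere_inversion_vimage:
  assumes "open V" shows "open (sphere_inversion -` V)"
  unfolding open_sphere_iff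
proof (intro conjI impI)
  have V: "open (Some -` V)" "None \<in> V \<Longrightarrow> \<exists>R. \<forall>v. R < norm v \<longrightarrow> Some v \<in> V"
    using assms by (auto simp: open_sphere_iff)
  have c: "continuous_on (- {0}) (\<lambda>z::complex. 1 / z)"
    by (auto intro!: continuous_intros)
  have o: "open ((\<lambda>z. 1 / z) -` (Some -` V) \<inter> - {0})"
    using c V(1) by (subst (asm) continuous_on_open_vimage) auto
  show "open (Some -` sphere_inversion -` V)"
  proof (cases "None \<in> V")
    case False
    then have "Some -` sphere_inversion -` V = (\<lambda>z. 1 / z) -` (Some -` V) \<inter> - {0}"
      by (auto split: if_splits)
    then show ?thesis using o by simp
  next
    case True
    then obtain R where R: "\<And>v. R < norm v \<Longrightarrow> Some v \<in> V" using V by auto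
    \<comment> \<open>Inversion sends this ball, without its centre, to norms above \<bar>R\<bar> +
      1, hence above \<open>R\<close>; absolute value and summand keep the radius positive for every
      real \<open>R\<close>.\<close>
    have "Some -` sphere_inversion -` V = ((\<lambda>z. 1 / z) -` (Some -` V) \<inter> - {0}) \<union> ball 0 (1 / (\<bar>R\<bar> + 1))"
    proof (rule set_eqI)
      fix z :: complex
      have "R < norm (1 / z)" if "z \<noteq> 0" "norm z < 1 / (\<bar>R\<bar> + 1)"
      proof -
        have "(\<bar>R\<bar> + 1) * norm z < 1" using that(2) by (simp add: field_simps)
        then have "\<bar>R\<bar> + 1 < 1 / norm z" using that(1) by (simp add: field_simps)
        then show ?thesis by (simp add: norm_divide)
      qed
      then show "z \<in> Some -` sphere_inversion -` V \<longleftrightarrow>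
          z \<in> ((\<lambda>z. 1 / z) -` (Some -` V) \<inter> - {0}) \<union> ball 0 (1 / (\<bar>R\<bar> + 1))"
        using R True by (cases "z = 0") auto
    qed
    then show ?thesis using o by (metis open_Un open_ball)
  qed
  assume "None \<in> sphere_inversion -` V"
  then have "0 \<in> Some -` V" by simp
  then obtain e where e: "e > 0" "ball 0 e \<subseteq> Some -` V" using V(1) open_contains_ball by blast
  show "\<exists>R. \<forall>v. R < norm v \<longrightarrow> Some v \<in> sphere_inversion -` V"
  proof (intro exI allI impI)
    fix v :: complex assume v: "1 / e < norm v"
    then have "v \<noteq> 0" using e by (auto simp: field_simps)
    moreover from this have "norm (1 / v) < e" using v e by (simp add: field_simps norm_divide)
    ultimately show "Some v \<in> sphere_inversion -` V" using e(2) by (auto simp: subset_iff)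
  qed
qed

lemma continuous_on_sphere_inversion: "continuous_on A sphere_inversion"
  by (rule continuous_on_subset[of UNIV])
     (auto simp: continuous_on_open_vimage open_sphere_inversion_vimage)

lemma sphere_inversion_open_image: "open V \<Longrightarrow> open (sphere_inversion ` V)"
proof -
  assume "open V"
  moreover have "sphere_inversion ` V = sphere_inversion -` V"
    by (force simp: image_iff intro: sphere_inversion_invol[symmetric])
  ultimately show ?thesis by (simp add: open_sphere_inversion_vimage)
qed

section \<open>Connected and star-shaped neighbourhoods\<close>

lemma sphere_connected_nbhd:
  assumes "open U" "p \<in> U"
  obtains V where "open V" "connected V" "p \<in> V" "V \<subseteq> (U :: complex option set)"
proof -
  have *: "\<exists>V. open V \<and> connected V \<and> Some a \<in> V \<and> V \<subseteq> U'" if "open U'" "Some a \<in> U'" for U' and a :: complex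
  proof -
    have "open (Some -` U')" using that(1) by (simp add: open_sphere_iff)
    then obtain e where "e > 0" "ball a e \<subseteq> Some -` U'"
      using \<open>Some a \<in> U'\<close> openE[of "Some -` U'" a] by blast
    moreover have "connected (Some ` ball a e)"
      by (intro connected_continuous_image continuous_intros) auto
    ultimately show ?thesis by (intro exI[of _ "Some ` ball a e"]) auto
  qed
  show thesis
  proof (cases p)
    case (Some a)
    then show ?thesis using * assms that by blast
  next
    case None
    then have "Some 0 \<in> sphere_inversion ` U"
      using assms(2) by force
    then obtain V where V: "open V" "connected V" "Some 0 \<in> V" "V \<subseteq> sphere_inversion ` U"
      using *[OF sphere_inversion_open_image[OF assms(1)]] by blast
    show ?thesis
    proof (rule that[of "sphere_inversion ` V"])
      show "open (sphere_inversion ` V)" by (rule sphere_inversion_open_image) fact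
      show "connected (sphere_inversion ` V)"
        by (intro connected_continuous_image continuous_on_sphere_inversion V)
      show "p \<in> sphere_inversion ` V" using V(3) None by (auto intro: rev_image_eqI)
      show "sphere_inversion ` V \<subseteq> U" using V(4) by (auto dest!: subsetD)
    qed
  qed
qed

lemma open_connected_component_sphere:
  assumes "open (U :: complex option set)"
  shows "open (connected_component_set U x)"
proof (rule open_subopen[THEN iffD2, rule_format])
  fix y assume y: "y \<in> connected_component_set U x"
  then have "y \<in> U" using connected_component_in by fastforce
  then obtain V where V: "open V" "connected V" "y \<in> V" "V \<subseteq> U"
    using sphere_connected_nbhd[OF assms] by blast
  then have "V \<subseteq> connected_component_set U y" by (simp add: connected_component_maximal)
  then show "\<exists>T. open T \<and> y \<in> T \<and> T \<subseteq> connected_component_set U x"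
    using V y by (metis connected_component_eq)
qed

text \<open>
  Domains with a coordinate in which they are star-shaped; sections are lifted along the rays.
\<close>

definition star_domain :: "complex option set \<Rightarrow> bool" where
  "star_domain L \<longleftrightarrow> (\<exists>(A :: complex set) \<phi> \<phi>' a. open A \<and> a \<in> A \<and>
     (\<forall>x\<in>A. closed_segment a x \<subseteq> A) \<and> homeomorphism A L \<phi> \<phi>')"

lemma star_domain_connected: "star_domain L \<Longrightarrow> connected L"
proof -
  assume "star_domain L"
  then obtain A \<phi> \<phi>' and a :: complex where A: "open A" "a \<in> A" "\<forall>x\<in>A. closed_segment a x \<subseteq> A"
    "homeomorphism A L \<phi> \<phi>'" by (auto simp: star_domain_def)
  have "starlike A" using A unfolding starlike_def by blast
  then have "connected A" by (rule starlike_imp_connected)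
  then have "connected (\<phi> ` A)" using A(4) by (intro connected_continuous_image) (auto simp: homeomorphism_def)
  then show ?thesis using A(4) by (simp add: homeomorphism_def)
qed

lemma star_domainI:
  assumes "open (A :: complex set)" "a \<in> A" "\<And>x. x \<in> A \<Longrightarrow> closed_segment a x \<subseteq> A" "homeomorphism A L \<phi> \<phi>'"
  shows "star_domain L"
  using assms unfolding star_domain_def by blast

lemma homeomorphism_Some: "homeomorphism A (Some ` A) Some finite_part"
  by (auto simp: homeomorphism_def image_image intro: continuous_on_Some continuous_on_finite_part)

lemma star_domain_convex:
  assumes "open A" "convex A" "A \<noteq> {}" shows "star_domain (Some ` A)"
proof -
  obtain a where "a \<in> A" using assms by blast
  then show ?thesis
    using assms by (intro star_domainI[OF _ _ _ homeomorphism_Some, of A a]) (auto dest: closed_segment_subset)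
qed

lemma homeomorphism_sphere_inversion: "homeomorphism A (sphere_inversion ` A) sphere_inversion sphere_inversion"
  by (auto simp: homeomorphism_def image_image intro: continuous_on_sphere_inversion)

lemma sphere_disc_nbhd:
  assumes "open U" "p \<in> U"
  obtains V where "open V" "star_domain V" "p \<in> V" "V \<subseteq> (U :: complex option set)"
proof -
  have *: "\<exists>e>0. Some ` ball a e \<subseteq> U'" if "open U'" "Some a \<in> U'" for U' and a :: complex
  proof -
    have "open (Some -` U')" using that(1) by (simp add: open_sphere_iff)
    then obtain e where "e > 0" "ball a e \<subseteq> Some -` U'"
      using \<open>Some a \<in> U'\<close> openE[of "Some -` U'" a] by blast
    then show ?thesis by blast
  qed
  show thesis
  proof (cases p)
    case (Some a)
    then obtain e where "e > 0" "Some ` ball a e \<subseteq> U" using * assms by blast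
    then show ?thesis using Some by (intro that[of "Some ` ball a e"] star_domain_convex) auto
  next
    case None
    then have "Some 0 \<in> sphere_inversion ` U"
      using assms(2) by force
    then obtain e where e: "e > 0" "Some ` ball 0 e \<subseteq> sphere_inversion ` U"
      using *[OF sphere_inversion_open_image[OF assms(1)]] by blast
    show ?thesis
    proof (rule that[of "sphere_inversion ` Some ` ball 0 e"])
      show "open (sphere_inversion ` Some ` ball 0 e)" by (rule sphere_inversion_open_image) simp
      show "star_domain (sphere_inversion ` Some ` ball 0 e)"
      proof (rule star_domainI)
        show "homeomorphism (ball 0 e) (sphere_inversion ` Some ` ball 0 e) (sphere_inversion \<circ> Some) (finite_part \<circ> sphere_inversion)"
          by (rule homeomorphism_compose[OF homeomorphism_Some homeomorphism_sphere_inversion])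
        show "closed_segment 0 x \<subseteq> ball 0 e" if "x \<in> ball 0 e" for x :: complex
          using that e by (intro closed_segment_subset) auto
      qed (use e in auto)
      show "p \<in> sphere_inversion ` Some ` ball 0 e" using e None by (auto intro!: rev_image_eqI[of "Some 0"])
      show "sphere_inversion ` Some ` ball 0 e \<subseteq> U" using e(2) by (auto dest!: subsetD)
    qed
  qed
qed

section \<open>Lifting paths and sections\<close>

lemma connected_disjoint_UN:
  assumes "connected C" "C \<subseteq> (\<Union>s\<in>I. W s)" "\<And>s. s \<in> I \<Longrightarrow> open (W s)"
    "\<And>s t. s \<in> I \<Longrightarrow> t \<in> I \<Longrightarrow> s \<noteq> t \<Longrightarrow> W s \<inter> W t = {}" "s \<in> I" "C \<inter> W s \<noteq> {}"
  shows "C \<subseteq> W s"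
proof -
  let ?R = "\<Union>t\<in>I - {s}. W t"
  have "open (W s)" "open ?R" using assms(3,5) by auto
  moreover have "W s \<inter> ?R \<inter> C = {}" using assms(4,5) by fastforce
  moreover have "C \<subseteq> W s \<union> ?R" using assms(2) by blast
  ultimately have "?R \<inter> C = {}" using connectedD[OF assms(1), of "W s" ?R] assms(6) by blast
  then show ?thesis using \<open>C \<subseteq> W s \<union> ?R\<close> by blast
qed

text \<open>
  The properties of a Speiser function on which the glueing rests.  By \<open>no_limit\<close>, \<open>w\<close> has no limit
  along the whole ideal boundary of \<open>\<Omega>\<close>; by \<open>ends\<close>, that boundary is connected.
\<close>

locale branched =
  fixes \<Omega> :: "complex option set" and w :: "complex option \<Rightarrow> complex option" and S :: "complex option set"
  assumes open_dom: "open \<Omega>" and dom_nonempty: "\<Omega> \<noteq> {}"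
    and cont: "continuous_on \<Omega> w"
    and finS: "finite S"
    and loc_inj: "\<And>z. z \<in> \<Omega> \<Longrightarrow> w z \<notin> S \<Longrightarrow> \<exists>N. open N \<and> z \<in> N \<and> N \<subseteq> \<Omega> \<and> inj_on w N"
    and open_map: "\<And>U. open U \<Longrightarrow> U \<subseteq> \<Omega> \<Longrightarrow> open (w ` U)"
    and isolated: "\<And>z. z \<in> \<Omega> \<Longrightarrow> \<exists>N. open N \<and> z \<in> N \<and> (\<forall>x\<in>N \<inter> \<Omega>. w x = w z \<longrightarrow> x = z)"
    and no_asym: "\<And>\<gamma> a. continuous_on {0..<1::real} \<gamma> \<Longrightarrow> \<gamma> ` {0..<1} \<subseteq> \<Omega> \<Longrightarrow>
        ((w \<circ> \<gamma>) \<longlongrightarrow> a) (at_left 1) \<Longrightarrow> a \<notin> S \<Longrightarrow>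
        \<exists>K. compact K \<and> K \<subseteq> \<Omega> \<and> (\<exists>\<^sub>F t in at_left 1. \<gamma> t \<in> K)"
    and no_limit: "\<And>p. \<Omega> \<noteq> UNIV \<Longrightarrow>
        \<exists>V. open V \<and> p \<in> V \<and> (\<forall>K. compact K \<longrightarrow> K \<subseteq> \<Omega> \<longrightarrow> \<not> w ` (\<Omega> - K) \<subseteq> V)"
    and ends: "\<And>K. compact K \<Longrightarrow> K \<subseteq> \<Omega> \<Longrightarrow>
        \<exists>K'. compact K' \<and> K \<subseteq> K' \<and> K' \<subseteq> \<Omega> \<and> connected (\<Omega> - K')"
    and exhaustion: "\<exists>K :: nat \<Rightarrow> _. (\<forall>n. compact (K n)) \<and> (\<Union>n. K n) = \<Omega>"
begin

lemma open_preimage: "open V \<Longrightarrow> open (\<Omega> \<inter> w -` V)"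
  using continuous_open_preimage[OF cont open_dom] by blast

lemma local_inverse:
  assumes "z \<in> \<Omega>" "w z \<notin> S"
  obtains N h where "open N" "z \<in> N" "N \<subseteq> \<Omega>" "inj_on w N" "open (w ` N)" "continuous_on (w ` N) h"
    "\<And>x. x \<in> N \<Longrightarrow> h (w x) = x"
proof -
  obtain N where N: "open N" "z \<in> N" "N \<subseteq> \<Omega>" "inj_on w N"
    using loc_inj[OF assms] by blast
  have "continuous_on (w ` N) (inv_into N w)"
  proof (rule continuous_on_inverse_open_map)
    show "continuous_on N w" using cont N continuous_on_subset by blast
    show "openin (top_of_set (w ` N)) (w ` U)" if "openin (top_of_set N) U" for U
    proof -
      have "open U" "U \<subseteq> N" using that N by (auto simp: openin_open)
      then show ?thesis using open_map[of U] N by (intro open_subset) auto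
    qed
  qed (use N in auto)
  then show thesis
    by (rule that[OF N open_map[OF N(1,3)]]) (simp add: inv_into_f_f N(4))
qed

text \<open>The path returns to a compact set \<open>K\<close> arbitrarily late. Without a cluster
  point in \<open>K\<close>, every point of \<open>K\<close> would have a neighbourhood that the
  path finally avoids, and finitely many of these cover \<open>K\<close>. Continuity of
  \<open>w\<close> forces the value at the cluster point to be the limit.\<close>

lemma accumulation:
  assumes "continuous_on {0..<1::real} \<gamma>" "\<gamma> ` {0..<1} \<subseteq> \<Omega>"
    "((w \<circ> \<gamma>) \<longlongrightarrow> a) (at_left 1)" "a \<notin> S"
  obtains z where "z \<in> \<Omega>" "w z = a" "\<And>U. open U \<Longrightarrow> z \<in> U \<Longrightarrow> \<exists>\<^sub>F t in at_left 1. \<gamma> t \<in> U"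
proof -
  obtain K where K: "compact K" "K \<subseteq> \<Omega>" "\<exists>\<^sub>F t in at_left 1. \<gamma> t \<in> K"
    using no_asym[OF assms] by blast
  have "\<exists>z\<in>K. \<forall>U. open U \<longrightarrow> z \<in> U \<longrightarrow> (\<exists>\<^sub>F t in at_left 1. \<gamma> t \<in> U)"
  proof (rule ccontr)
    assume "\<not> ?thesis"
    then have "\<forall>z\<in>K. \<exists>U. open U \<and> z \<in> U \<and> (\<forall>\<^sub>F t in at_left 1. \<gamma> t \<notin> U)"
      by (auto simp: not_frequently)
    then obtain U where U: "\<And>z. z \<in> K \<Longrightarrow> open (U z) \<and> z \<in> U z \<and> (\<forall>\<^sub>F t in at_left 1. \<gamma> t \<notin> U z)"
      by metis
    obtain D where D: "D \<subseteq> K" "finite D" "K \<subseteq> (\<Union>z\<in>D. U z)"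
      by (rule compactE_image[OF K(1), of K U]) (use U in auto)
    have "\<forall>\<^sub>F t in at_left 1. \<forall>z\<in>D. \<gamma> t \<notin> U z"
      using D U by (intro eventually_ball_finite) auto
    then have "\<forall>\<^sub>F t in at_left 1. \<gamma> t \<notin> K"
      by eventually_elim (use D in blast)
    then show False using K(3) by (simp add: frequently_def)
  qed
  then obtain z where z: "z \<in> K" "\<And>U. open U \<Longrightarrow> z \<in> U \<Longrightarrow> \<exists>\<^sub>F t in at_left 1. \<gamma> t \<in> U" by blast
  have "w z = a"
  proof (rule ccontr)
    assume "w z \<noteq> a"
    then obtain A B where AB: "open A" "open B" "w z \<in> A" "a \<in> B" "A \<inter> B = {}"
      using hausdorff by metis
    have "\<exists>\<^sub>F t in at_left 1. \<gamma> t \<in> \<Omega> \<inter> w -` A"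
      using z K AB by (intro z(2) open_preimage) auto
    moreover have "\<forall>\<^sub>F t in at_left 1. w (\<gamma> t) \<in> B"
      using topological_tendstoD[OF assms(3) AB(2,4)] by simp
    then have "\<forall>\<^sub>F t in at_left 1. \<not> \<gamma> t \<in> \<Omega> \<inter> w -` A"
      by eventually_elim (use AB(5) in auto)
    ultimately show False by (simp add: frequently_def)
  qed
  then show thesis using that z K by blast
qed

text \<open>The set of agreement is open because \<open>w\<close> is injective near a point with
  nonsingular value, and closed because the sphere is Hausdorff. The domain is left general, since
  intervals, balls and subsets of the sphere all occur.\<close>

lemma lift_unique:
  assumes "connected A" "continuous_on A f" "continuous_on A g" "f ` A \<subseteq> \<Omega>" "g ` A \<subseteq> \<Omega>"
    and eq: "\<And>x. x \<in> A \<Longrightarrow> w (f x) = w (g x)" and nS: "\<And>x. x \<in> A \<Longrightarrow> w (f x) \<notin> S"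
    and "a \<in> A" "f a = g a" "b \<in> A"
  shows "f b = g b"
proof (rule connected_induction_simple[OF \<open>connected A\<close>, where P = "\<lambda>x. f x = g x" and a = a and b = b])
  fix x assume x: "x \<in> A"
  show "\<exists>T. openin (top_of_set A) T \<and> x \<in> T \<and> (\<forall>x\<in>T. \<forall>y\<in>T. f x = g x \<longrightarrow> f y = g y)"
  proof (cases "f x = g x")
    case True
    have "f x \<in> \<Omega>" "w (f x) \<notin> S" using nS x assms(4) by auto
    then obtain N where N: "open N" "f x \<in> N" "N \<subseteq> \<Omega>" "inj_on w N"
      using loc_inj by metis
    have "openin (top_of_set A) ((A \<inter> f -` N) \<inter> (A \<inter> g -` N))"
      using continuous_openin_preimage_gen[OF assms(2) N(1)] continuous_openin_preimage_gen[OF assms(3) N(1)]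
      by (rule openin_Int)
    moreover have "f y = g y" if "y \<in> (A \<inter> f -` N) \<inter> (A \<inter> g -` N)" for y
      using that N(4) eq by (auto simp: inj_on_def)
    moreover have "x \<in> (A \<inter> f -` N) \<inter> (A \<inter> g -` N)" using x True N by auto
    ultimately show ?thesis by blast
  next
    case False
    then obtain U V where UV: "open U" "open V" "f x \<in> U" "g x \<in> V" "U \<inter> V = {}"
      using hausdorff by metis
    have "openin (top_of_set A) ((A \<inter> f -` U) \<inter> (A \<inter> g -` V))"
      using continuous_openin_preimage_gen[OF assms(2) UV(1)] continuous_openin_preimage_gen[OF assms(3) UV(2)]
      by (rule openin_Int)
    moreover have "f y \<noteq> g y" if "y \<in> (A \<inter> f -` U) \<inter> (A \<inter> g -` V)" for y
      using that UV by auto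
    moreover have "x \<in> (A \<inter> f -` U) \<inter> (A \<inter> g -` V)" using x UV by auto
    ultimately show ?thesis by blast
  qed
qed (use assms in auto)

text \<open>Local inverses of \<open>w\<close> extend the lift around each point of
  \<open>K\<close>, and compactness makes the radius uniform. Two of these extensions agree at
  \<open>y\<close> once their balls of radius \<delta> contain both \<open>y\<close> and a common
  point of \<open>K\<close>, where both equal \<open>g\<close>; hence they are kept only on balls of
  half the radius.\<close>

lemma lift_extend:
  fixes \<psi> :: "'a::real_normed_vector \<Rightarrow> complex option"
  assumes A: "open A" "continuous_on A \<psi>" "\<psi> ` A \<inter> S = {}" and K: "compact K" "K \<subseteq> A"
    and g: "continuous_on K g" "g ` K \<subseteq> \<Omega>" "\<And>x. x \<in> K \<Longrightarrow> w (g x) = \<psi> x"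
  obtains \<delta> f where "\<delta> > 0" "(\<Union>x\<in>K. ball x \<delta>) \<subseteq> A" "continuous_on (\<Union>x\<in>K. ball x \<delta>) f"
    "f ` (\<Union>x\<in>K. ball x \<delta>) \<subseteq> \<Omega>" "\<And>x. x \<in> (\<Union>x\<in>K. ball x \<delta>) \<Longrightarrow> w (f x) = \<psi> x"
    "\<And>x. x \<in> K \<Longrightarrow> f x = g x"
proof -
  define good where "good B l \<longleftrightarrow> B \<subseteq> A \<and> continuous_on B l \<and> l ` B \<subseteq> \<Omega> \<and> (\<forall>y\<in>B. w (l y) = \<psi> y) \<and> (\<forall>y\<in>K \<inter> B. l y = g y)"
    for B and l :: "'a \<Rightarrow> complex option"
  have nS: "\<psi> x \<notin> S" if "x \<in> A" for x using that A(3) by blast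
  have loc: "\<exists>B. open B \<and> x \<in> B \<and> (\<exists>l. good B l)" if x: "x \<in> K" for x
  proof -
    have "g x \<in> \<Omega>" "w (g x) \<notin> S" using x g nS K by auto
    then obtain N h where N: "open N" "g x \<in> N" "N \<subseteq> \<Omega>" "inj_on w N" "open (w ` N)" "continuous_on (w ` N) h"
      "\<And>x. x \<in> N \<Longrightarrow> h (w x) = x" using local_inverse by metis
    obtain T where T: "open T" "K \<inter> g -` N = K \<inter> T"
      using continuous_openin_preimage_gen[OF g(1) N(1)] by (auto simp: openin_open)
    define B where "B = A \<inter> \<psi> -` (w ` N) \<inter> T"
    have "open B" unfolding B_def using continuous_open_preimage[OF A(2,1) N(5)] T by blast
    moreover have "x \<in> B" using x T N g(3) K unfolding B_def by (auto intro!: rev_image_eqI[of "g x"])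
    moreover have "good B (h \<circ> \<psi>)"
      unfolding good_def
    proof (intro conjI ballI)
      show "continuous_on B (h \<circ> \<psi>)"
        by (intro continuous_on_compose continuous_on_subset[OF A(2)] continuous_on_subset[OF N(6)]) (auto simp: B_def)
      have h: "h v \<in> N \<and> w (h v) = v" if "v \<in> w ` N" for v using that N(7) by auto
      show "(h \<circ> \<psi>) ` B \<subseteq> \<Omega>" using h N(3) by (auto simp: B_def)
      show "w ((h \<circ> \<psi>) y) = \<psi> y" if "y \<in> B" for y using h that by (auto simp: B_def)
      show "(h \<circ> \<psi>) y = g y" if "y \<in> K \<inter> B" for y
      proof -
        have "g y \<in> N" using that T by (auto simp: B_def)
        then show ?thesis using N(7) g(3) that by (metis IntD1 comp_apply)
      qed
    qed (auto simp: B_def)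
    ultimately show ?thesis by blast
  qed
  obtain \<delta> where \<delta>: "\<delta> > 0" "\<And>x. x \<in> K \<Longrightarrow> \<exists>B \<in> {B. open B \<and> (\<exists>l. good B l)}. ball x \<delta> \<subseteq> B"
  proof (rule Heine_Borel_lemma[OF K(1), of "{B. open B \<and> (\<exists>l. good B l)}"])
    show "K \<subseteq> \<Union> {B. open B \<and> (\<exists>l. good B l)}" using loc by blast
  qed auto
  have "\<exists>l. good (ball x \<delta>) l" if x: "x \<in> K" for x
  proof -
    obtain B l where "ball x \<delta> \<subseteq> B" "good B l" using \<delta>(2)[OF x] by blast
    then have "good (ball x \<delta>) l" unfolding good_def by (auto intro: continuous_on_subset)
    then show ?thesis by blast
  qed
  then obtain l where l: "\<And>x. x \<in> K \<Longrightarrow> good (ball x \<delta>) (l x)" by metis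
  define c where "c y = (SOME x. x \<in> K \<and> dist x y < \<delta> / 2)" for y
  define f where "f y = l (c y) y" for y
  have fl: "f y = l x y" if x: "x \<in> K" "dist x y < \<delta> / 2" for x y
  proof -
    have "\<exists>x. x \<in> K \<and> dist x y < \<delta> / 2" using x by blast
    from someI_ex[OF this] have c: "c y \<in> K" "dist (c y) y < \<delta> / 2" by (auto simp: c_def)
    let ?B = "ball (c y) \<delta> \<inter> ball x \<delta>"
    have d: "dist x (c y) < \<delta>" using x c by (smt (verit) dist_commute dist_triangle field_sum_of_halves)
    have G: "good (ball (c y) \<delta>) (l (c y))" "good (ball x \<delta>) (l x)" using l c x by auto
    have "l (c y) y = l x y"
    proof (rule lift_unique[of ?B "l (c y)" "l x" x y])
      show "connected ?B" by (intro convex_connected convex_Int convex_ball)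
      show "continuous_on ?B (l (c y))" "continuous_on ?B (l x)"
        using G by (auto simp: good_def intro: continuous_on_subset)
      show "w (l (c y) u) \<notin> S" if "u \<in> ?B" for u
        using G(1) that nS by (auto simp: good_def)
      show "x \<in> ?B" using d \<delta> by (auto simp: dist_commute)
      show "l (c y) x = l x x"
        using G d \<delta> x by (auto simp: good_def dist_commute)
      have "dist x y < \<delta>" "dist (c y) y < \<delta>" using x c \<delta> by auto
      then show "y \<in> ?B" by auto
    qed (use G in \<open>auto simp: good_def\<close>)
    then show ?thesis by (simp add: f_def)
  qed
  let ?U = "\<Union>x\<in>K. ball x (\<delta> / 2)"
  have lf: "good (ball x (\<delta> / 2)) (l x)" if "x \<in> K" for x
  proof -
    have "ball x (\<delta> / 2) \<subseteq> ball x \<delta>" using \<delta> by auto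
    then show ?thesis using l[OF that] unfolding good_def by (auto intro: continuous_on_subset)
  qed
  show thesis
  proof (rule that[of "\<delta> / 2" f])
    show "continuous_on ?U f"
    proof (rule continuous_on_open_UN)
      fix x assume x: "x \<in> K"
      show "continuous_on (ball x (\<delta> / 2)) f"
        using lf[OF x] fl[OF x] by (subst continuous_on_cong[OF refl, of _ f "l x"]) (auto simp: good_def)
    qed auto
    show "f ` ?U \<subseteq> \<Omega>" using lf fl by (force simp: good_def)
    show "w (f x) = \<psi> x" if "x \<in> ?U" for x using that lf fl by (force simp: good_def)
    show "f x = g x" if "x \<in> K" for x using fl[OF that, of x] lf[OF that] \<delta> that by (auto simp: good_def)
    show "?U \<subseteq> A" using lf by (force simp: good_def)
  qed (use \<delta> in auto)
qed

text \<open>Continuity method for the supremum \<open>m\<close> of the times up to which a lift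
  exists. At \<open>m\<close> the lifts accumulate at a point over \<open>p m\<close> by
  \<open>accumulation\<close>, and a local inverse of \<open>w\<close> there, attached at a late
  time spent in its range, gives a lift up to \<open>m\<close> itself. For \<open>m\<close> below 1
  that lift would continue by \<open>lift_extend\<close>, which is why the path is given on an open
  set around [0,1].\<close>

lemma path_lift:
  fixes p :: "real \<Rightarrow> complex option"
  assumes A: "open A" "{0..1} \<subseteq> A" "continuous_on A p" "p ` A \<inter> S = {}" and z0: "z0 \<in> \<Omega>" "w z0 = p 0"
  obtains \<gamma> where "continuous_on {0..1} \<gamma>" "\<gamma> ` {0..1} \<subseteq> \<Omega>" "\<And>t. t \<in> {0..1} \<Longrightarrow> w (\<gamma> t) = p t" "\<gamma> 0 = z0"
proof -
  define lift where "lift s \<gamma> \<longleftrightarrow> continuous_on {0..s} \<gamma> \<and> \<gamma> ` {0..s} \<subseteq> \<Omega> \<and> (\<forall>t\<in>{0..s}. w (\<gamma> t) = p t) \<and> \<gamma> 0 = z0"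
    for s :: real and \<gamma>
  have nS: "p t \<notin> S" if "t \<in> A" for t using that A(4) by blast
  have mono: "lift s \<gamma>" if "lift t \<gamma>" "s \<le> t" for s t \<gamma>
    using that continuous_on_subset[of "{0..t}" \<gamma> "{0..s}"] by (auto simp: lift_def)
  have uniq: "\<gamma> t = \<gamma>' t" if "lift s \<gamma>" "lift s' \<gamma>'" "0 \<le> t" "t \<le> s" "t \<le> s'" "t \<le> 1" for s s' \<gamma> \<gamma>' t
  proof -
    have L: "lift t \<gamma>" "lift t \<gamma>'" using mono that by auto
    show ?thesis
    proof (rule lift_unique[of "{0..t}" \<gamma> \<gamma>' 0 t])
      show "w (\<gamma> x) \<notin> S" if "x \<in> {0..t}" for x
        using L(1) that nS A(2) \<open>t \<le> 1\<close> by (auto simp: lift_def subset_iff)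
    qed (use L that in \<open>auto simp: lift_def\<close>)
  qed
  define T where "T = {s \<in> {0..1}. \<exists>\<gamma>. lift s \<gamma>}"
  have T0: "0 \<in> T" using z0 by (auto simp: T_def lift_def intro!: exI[of _ "\<lambda>_. z0"])
  have bdd: "bdd_above T" by (auto simp: T_def)
  define m where "m = Sup T"
  have m: "0 \<le> m" "m \<le> 1"
    unfolding m_def using T0 bdd by (auto simp: T_def intro!: cSup_upper cSup_least)
  have below: "\<exists>\<gamma>. lift s \<gamma>" if "s < m" for s
  proof -
    obtain t where "t \<in> T" "s < t" using \<open>s < m\<close> T0 less_cSupD[of T s] by (auto simp: m_def)
    then show ?thesis using mono[of t _ s] by (auto simp: T_def)
  qed
  have mT: "m \<in> T"
  proof (cases "m = 0")
    case True then show ?thesis using T0 by simp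
  next
    case False
    then have m0: "m > 0" using m by simp
    obtain \<Gamma> where \<Gamma>: "\<And>s. s < m \<Longrightarrow> lift s (\<Gamma> s)" using below by metis
    define \<gamma> where "\<gamma> t = \<Gamma> t t" for t
    have \<gamma>\<Gamma>: "\<gamma> t = \<Gamma> s t" if "0 \<le> t" "t \<le> s" "s < m" for s t
      unfolding \<gamma>_def using \<Gamma> that m by (intro uniq[of t _ s]) auto
    have lift\<gamma>: "lift s \<gamma>" if "0 \<le> s" "s < m" for s
    proof -
      have "continuous_on {0..s} \<gamma> \<longleftrightarrow> continuous_on {0..s} (\<Gamma> s)"
        using \<gamma>\<Gamma> that by (intro continuous_on_cong) auto
      then show ?thesis using \<Gamma>[OF that(2)] \<gamma>\<Gamma>[of _ s] that by (auto simp: lift_def)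
    qed
    have cont\<gamma>: "continuous_on {0..<m} \<gamma>"
      unfolding continuous_on_eq_continuous_within
    proof
      fix t assume t: "t \<in> {0..<m}"
      let ?s = "(t + m) / 2"
      have "continuous (at t within {0..?s}) \<gamma>"
        using lift\<gamma>[of ?s] t by (auto simp: lift_def continuous_on_eq_continuous_within)
      moreover have "at t within {0..<m} = at t within {0..?s}"
        by (rule at_within_nhd[of t "{..<?s}"]) (use t in auto)
      ultimately show "continuous (at t within {0..<m}) \<gamma>" by (simp add: continuous_within)
    qed
    have cm: "continuous (at m) p"
      using A m by (auto simp: continuous_on_eq_continuous_at)
    \<comment> \<open>The absence of asymptotic values is stated for paths on [0,1); multiplication
      by \<open>m\<close> transports it to [0,m).\<close>
    obtain z where z: "z \<in> \<Omega>" "w z = p m" "\<And>U. open U \<Longrightarrow> z \<in> U \<Longrightarrow> \<exists>\<^sub>F t in at_left 1. (\<lambda>t. \<gamma> (t * m)) t \<in> U"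
    proof (rule accumulation[of "\<lambda>t. \<gamma> (t * m)" "p m"])
      have sub: "(\<lambda>t. t * m) ` {0..<1} \<subseteq> {0..<m}" using m0 by auto
      show "continuous_on {0..<1} (\<lambda>t. \<gamma> (t * m))"
        by (rule continuous_on_compose2[OF cont\<gamma> _ sub]) (intro continuous_intros)
      show "(\<lambda>t. \<gamma> (t * m)) ` {0..<1} \<subseteq> \<Omega>"
      proof safe
        fix t :: real assume t: "t \<in> {0..<1}"
        then have "t * m < m" "0 \<le> t * m" using m0 by auto
        then show "\<gamma> (t * m) \<in> \<Omega>" using lift\<gamma>[of "t * m"] by (auto simp: lift_def)
      qed
      have ev: "\<forall>\<^sub>F t::real in at_left 1. t > 0 \<and> t < 1"
        using eventually_at_left_real[of 0 1] by (auto elim: eventually_mono)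
      have "((\<lambda>t::real. t * m) \<longlongrightarrow> 1 * m) (at_left 1)" by (intro tendsto_intros)
      then have "((\<lambda>t. p (t * m)) \<longlongrightarrow> p m) (at_left 1)"
        using isCont_tendsto_compose[OF cm] by auto
      moreover have "\<forall>\<^sub>F t in at_left 1. p (t * m) = (w \<circ> (\<lambda>t. \<gamma> (t * m))) t"
        using ev
      proof eventually_elim
        case (elim t)
        then have "t * m < m" "0 \<le> t * m" using m0 by auto
        then show ?case using lift\<gamma>[of "t * m"] by (auto simp: lift_def)
      qed
      ultimately show "((w \<circ> (\<lambda>t. \<gamma> (t * m))) \<longlongrightarrow> p m) (at_left 1)"
        by (rule Lim_transform_eventually)
      show "p m \<notin> S" using nS m A by auto
    qed blast
    have "w z \<notin> S" using z nS m A by auto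
    with z(1) obtain N h where N: "open N" "z \<in> N" "N \<subseteq> \<Omega>" "inj_on w N" "open (w ` N)" "continuous_on (w ` N) h"
      "\<And>x. x \<in> N \<Longrightarrow> h (w x) = x" using local_inverse by metis
    have "\<forall>\<^sub>F t in at m. p t \<in> w ` N"
      using cm N z(2) unfolding continuous_at by (metis image_eqI topological_tendstoD)
    then obtain e where e: "e > 0" "\<And>t. dist t m < e \<Longrightarrow> p t \<in> w ` N"
      using z(2) N unfolding eventually_at by (metis UNIV_I image_eqI)
    \<comment> \<open>The threshold 1 - e/m gives t m > m - e, so that \<open>p\<close> maps all of
      [t m, m] into the image of \<open>N\<close>, the domain of \<open>h\<close>.\<close>
    have "\<forall>\<^sub>F t in at_left (1::real). max 0 (1 - e / m) < t \<and> t < 1"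
      using eventually_at_left_real[of "max 0 (1 - e / m)" 1] e m0 by (auto elim: eventually_mono)
    with z(3)[OF N(1,2)] have "\<exists>\<^sub>F t in at_left 1. \<gamma> (t * m) \<in> N \<and> max 0 (1 - e / m) < t \<and> t < 1"
      by (rule frequently_eventually_frequently)
    from frequently_ex[OF this]
    obtain t1 where t1: "\<gamma> (t1 * m) \<in> N" "0 < t1" "1 - e / m < t1" "t1 < 1"
      by auto
    define s1 where "s1 = t1 * m"
    have s1: "0 \<le> s1" "s1 < m" "m - e < s1" "\<gamma> s1 \<in> N"
      using t1 m0 by (auto simp: s1_def field_simps)
    have lm: "lift m (\<lambda>t. if t \<le> s1 then \<gamma> t else h (p t))"
      unfolding lift_def
    proof (intro conjI ballI)
      have pN: "p t \<in> w ` N" if "t \<in> {s1..m}" for t using that s1 e(2)[of t] by (auto simp: dist_real_def)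
      have hN: "h v \<in> N \<and> w (h v) = v" if "v \<in> w ` N" for v using that N(7) by auto
      have L: "lift s1 \<gamma>" by (rule lift\<gamma>) (use s1 in auto)
      have "continuous_on ({0..s1} \<union> {s1..m}) (\<lambda>t. if t \<le> s1 then \<gamma> t else h (p t))"
      proof (rule continuous_on_If)
        show "continuous_on {0..s1} \<gamma>" using L by (simp add: lift_def)
        show "continuous_on {s1..m} (\<lambda>t. h (p t))"
        proof (rule continuous_on_compose2[OF N(6)])
          show "continuous_on {s1..m} p" by (rule continuous_on_subset[OF A(3)]) (use s1 m A in auto)
        qed (use pN in auto)
        have "h (p s1) = \<gamma> s1" using L s1 N(7)[of "\<gamma> s1"] by (auto simp: lift_def)
        then show "\<gamma> x = h (p x)" if "x \<in> {0..s1}" "\<not> x \<le> s1" for x using that by auto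
        show "\<gamma> x = h (p x)" if "x \<in> {s1..m}" "x \<le> s1" for x
        proof -
          have "x = s1" using that by auto
          then show ?thesis using \<open>h (p s1) = \<gamma> s1\<close> by simp
        qed
      qed auto
      moreover have "{0..s1} \<union> {s1..m} = {0..m}" using s1 by auto
      ultimately show "continuous_on {0..m} (\<lambda>t. if t \<le> s1 then \<gamma> t else h (p t))" by simp
      show "(\<lambda>t. if t \<le> s1 then \<gamma> t else h (p t)) ` {0..m} \<subseteq> \<Omega>"
        using L hN pN N(3) by (auto simp: lift_def)
      show "w (if t \<le> s1 then \<gamma> t else h (p t)) = p t" if "t \<in> {0..m}" for t
        using L hN pN that by (auto simp: lift_def)
      show "(if 0 \<le> s1 then \<gamma> 0 else h (p 0)) = z0" using L s1 by (auto simp: lift_def)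
    qed
    show ?thesis using lm m unfolding T_def by auto
  qed
  then obtain \<gamma> where \<gamma>: "lift m \<gamma>" by (auto simp: T_def)
  have "m = 1"
  proof (rule ccontr)
    assume "m \<noteq> 1"
    then have m1: "m < 1" using m by simp
    obtain d f where d: "d > 0" "(\<Union>x\<in>{0..m}. ball x d) \<subseteq> A" "continuous_on (\<Union>x\<in>{0..m}. ball x d) f"
      "f ` (\<Union>x\<in>{0..m}. ball x d) \<subseteq> \<Omega>" "\<And>x. x \<in> (\<Union>x\<in>{0..m}. ball x d) \<Longrightarrow> w (f x) = p x"
      "\<And>x. x \<in> {0..m} \<Longrightarrow> f x = \<gamma> x"
      by (rule lift_extend[OF A(1,3,4), of "{0..m}" \<gamma>]) (use \<gamma> m A(2) in \<open>auto simp: lift_def\<close>)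
    define s where "s = min 1 (m + d / 2)"
    have sub: "{0..s} \<subseteq> (\<Union>x\<in>{0..m}. ball x d)"
    proof
      fix t assume t: "t \<in> {0..s}"
      have "t \<le> m + d / 2" using t by (auto simp: s_def)
      then have "t \<in> ball (min t m) d" "min t m \<in> {0..m}" using t d m by (auto simp: dist_real_def min_def)
      then show "t \<in> (\<Union>x\<in>{0..m}. ball x d)" by blast
    qed
    have "lift s f"
      unfolding lift_def
    proof (intro conjI ballI)
      show "continuous_on {0..s} f" using continuous_on_subset[OF d(3) sub] .
      show "f ` {0..s} \<subseteq> \<Omega>" using d(4) sub by blast
      show "w (f t) = p t" if "t \<in> {0..s}" for t using d(5) sub that by blast
      show "f 0 = z0" using d(6)[of 0] m \<gamma> by (auto simp: lift_def)
    qed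
    then have "s \<in> T" using m d by (auto simp: T_def s_def)
    then have "s \<le> m" unfolding m_def using bdd by (rule cSup_upper)
    then show False using m1 d by (auto simp: s_def)
  qed
  then show thesis using that[of \<gamma>] \<gamma> by (auto simp: lift_def)
qed

text \<open>Lifting along the rays from \<open>a0\<close> defines \<open>g\<close> as the value at
  time 1. Continuity of \<open>g\<close> at \<open>a\<close> comes from extending the lift along the
  single ray to \<open>a\<close> over a neighbourhood of [0,1] \<times> {a}: the extension restricts
  to lifts along the neighbouring rays.\<close>

lemma star_lift:
  fixes \<psi> :: "'a::real_normed_vector \<Rightarrow> complex option"
  assumes A: "open A" "continuous_on A \<psi>" "\<psi> ` A \<inter> S = {}" and a0: "a0 \<in> A"
    and star: "\<And>x. x \<in> A \<Longrightarrow> closed_segment a0 x \<subseteq> A" and z0: "z0 \<in> \<Omega>" "w z0 = \<psi> a0"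
  obtains g where "continuous_on A g" "g ` A \<subseteq> \<Omega>" "\<And>x. x \<in> A \<Longrightarrow> w (g x) = \<psi> x" "g a0 = z0"
proof -
  have nS: "\<psi> x \<notin> S" if "x \<in> A" for x using that A(3) by blast
  define P where "P x t = a0 + t *\<^sub>R (x - a0)" for x t
  have PA: "P x t \<in> A" if "x \<in> A" "t \<in> {0..1}" for x t
  proof -
    have "P x t \<in> closed_segment a0 x"
      unfolding in_segment P_def using that(2) by (intro exI[of _ t]) (auto simp: algebra_simps)
    then show ?thesis using star[OF that(1)] by blast
  qed
  define lift where "lift x \<gamma> \<longleftrightarrow> continuous_on {0..1} \<gamma> \<and> \<gamma> ` {0..1} \<subseteq> \<Omega> \<and> (\<forall>t\<in>{0..1}. w (\<gamma> t) = \<psi> (P x t)) \<and> \<gamma> 0 = z0"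
    for x and \<gamma> :: "real \<Rightarrow> complex option"
  have ex: "\<exists>\<gamma>. lift x \<gamma>" if x: "x \<in> A" for x
  proof -
    have c: "continuous_on UNIV (P x)" unfolding P_def by (intro continuous_intros)
    have o: "open (P x -` A)" using A(1) c continuous_on_open_vimage[of UNIV "P x"] by auto
    show ?thesis
    proof (rule path_lift[of "P x -` A" "\<lambda>t. \<psi> (P x t)" z0])
      show "continuous_on (P x -` A) (\<lambda>t. \<psi> (P x t))"
        by (rule continuous_on_compose2[OF A(2) continuous_on_subset[OF c]]) auto
      show "(\<lambda>t. \<psi> (P x t)) ` (P x -` A) \<inter> S = {}" using nS by auto
      show "w z0 = \<psi> (P x 0)" using z0 by (simp add: P_def)
      show "{0..1} \<subseteq> P x -` A" using PA x by auto
      show ?thesis if "continuous_on {0..1} \<gamma>" "\<gamma> ` {0..1} \<subseteq> \<Omega>" "\<And>t. t \<in> {0..1} \<Longrightarrow> w (\<gamma> t) = \<psi> (P x t)"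
        "\<gamma> 0 = z0" for \<gamma> using that by (auto simp: lift_def)
    qed (use o z0 in auto)
  qed
  have uniq: "\<gamma> 1 = \<gamma>' 1" if "x \<in> A" "lift x \<gamma>" "lift x \<gamma>'" for x \<gamma> \<gamma>'
    by (rule lift_unique[of "{0..1}" \<gamma> \<gamma>' 0 1]) (use that nS PA in \<open>auto simp: lift_def\<close>)
  obtain \<Gamma> where \<Gamma>: "\<And>x. x \<in> A \<Longrightarrow> lift x (\<Gamma> x)" using ex by metis
  define g where "g x = \<Gamma> x 1" for x
  have local: "\<exists>T. open T \<and> a \<in> T \<and> T \<subseteq> A \<and> continuous_on T g" if a: "a \<in> A" for a
  proof -
    define B where "B = (\<lambda>(t, x). P x t) -` A"
    have c: "continuous_on UNIV (\<lambda>(t, x). P x t)"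
      unfolding P_def case_prod_unfold by (intro continuous_intros)
    have o: "open B" unfolding B_def using A(1) c continuous_on_open_vimage[of UNIV "\<lambda>(t, x). P x t"] by auto
    obtain d f where d: "d > 0" "(\<Union>x\<in>{0..1} \<times> {a}. ball x d) \<subseteq> B" "continuous_on (\<Union>x\<in>{0..1} \<times> {a}. ball x d) f"
      "f ` (\<Union>x\<in>{0..1} \<times> {a}. ball x d) \<subseteq> \<Omega>"
      "\<And>x. x \<in> (\<Union>x\<in>{0..1} \<times> {a}. ball x d) \<Longrightarrow> w (f x) = \<psi> (case x of (t, x) \<Rightarrow> P x t)"
      "\<And>x. x \<in> {0..1} \<times> {a} \<Longrightarrow> f x = \<Gamma> a (fst x)"
    proof (rule lift_extend[of B "\<lambda>x. \<psi> (case x of (t, x) \<Rightarrow> P x t)" "{0..1} \<times> {a}" "\<lambda>x. \<Gamma> a (fst x)"])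
      show "continuous_on B (\<lambda>x. \<psi> (case x of (t, x) \<Rightarrow> P x t))"
        by (rule continuous_on_compose2[OF A(2) continuous_on_subset[OF c]]) (auto simp: B_def)
      show "(\<lambda>x. \<psi> (case x of (t, x) \<Rightarrow> P x t)) ` B \<inter> S = {}" using nS by (auto simp: B_def)
      show "{0..1} \<times> {a} \<subseteq> B" using PA a by (auto simp: B_def)
      show "continuous_on ({0..1} \<times> {a}) (\<lambda>x. \<Gamma> a (fst x))"
        by (rule continuous_on_compose2[of "{0..1}" "\<Gamma> a"]) (use \<Gamma>[OF a] in \<open>auto simp: lift_def intro: continuous_intros\<close>)
    qed (use o \<Gamma>[OF a] in \<open>auto simp: lift_def intro!: compact_Times\<close>)
    define U where "U = (\<Union>x\<in>{0..1::real} \<times> {a}. ball x d)"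
    note d' = d(2-6)[folded U_def]
    have mem: "(t, x) \<in> U" if "t \<in> {0..1}" "x \<in> ball a d" for t x
      using that by (auto simp: U_def dist_Pair_Pair intro!: bexI[of _ t])
    have ballA: "x \<in> A" if "x \<in> ball a d" for x
    proof -
      have "(1, x) \<in> B" by (rule subsetD[OF d'(1) mem]) (use that in auto)
      then show ?thesis by (simp add: B_def P_def)
    qed
    have sub: "(\<lambda>x. (t, x)) ` ball a d \<subseteq> U" if "t \<in> {0..1}" for t
      using mem[OF that] by blast
    \<comment> \<open>At time 0 all rays sit at \<open>a0\<close>, so the extension lifts a constant
      map there, and uniqueness of lifts makes it constant.\<close>
    have f0: "f (0, x) = z0" if x: "x \<in> ball a d" for x
    proof (rule lift_unique[of "ball a d" "\<lambda>x. f (0, x)" "\<lambda>_. z0" a x])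
      show "continuous_on (ball a d) (\<lambda>x. f (0, x))"
        by (rule continuous_on_compose2[OF d'(2) _ sub]) (auto intro!: continuous_intros)
      show "(\<lambda>x. f (0, x)) ` ball a d \<subseteq> \<Omega>" using d'(3) sub[of 0] by fastforce
      have wf: "w (f (0, y)) = \<psi> a0" if "y \<in> ball a d" for y
        using d'(4)[OF mem[of 0 y]] that by (simp add: P_def)
      show "w (f (0, y)) = w z0" "w (f (0, y)) \<notin> S" if "y \<in> ball a d" for y
        using wf[OF that] z0 nS[OF a0] by auto
      show "f (0, a) = z0" using d'(5)[of "(0, a)"] \<Gamma>[OF a] by (auto simp: lift_def)
    qed (use d x z0 in auto)
    have fg: "f (1, x) = g x" if x: "x \<in> ball a d" for x
    proof -
      have "lift x (\<lambda>t. f (t, x))"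
        unfolding lift_def
      proof (intro conjI ballI)
        show "continuous_on {0..1} (\<lambda>t. f (t, x))"
        proof (rule continuous_on_compose2[OF d'(2)])
          show "(\<lambda>t. (t, x)) ` {0..1} \<subseteq> U" using mem[OF _ x] by blast
        qed (auto intro!: continuous_intros)
        show "(\<lambda>t. f (t, x)) ` {0..1} \<subseteq> \<Omega>" using d'(3) mem[OF _ x] by blast
        show "w (f (t, x)) = \<psi> (P x t)" if "t \<in> {0..1}" for t using d'(4)[OF mem[OF that x]] by simp
        show "f (0, x) = z0" by (rule f0[OF x])
      qed
      then show ?thesis using uniq[OF ballA[OF x] _ \<Gamma>[OF ballA[OF x]]] by (simp add: g_def)
    qed
    have "continuous_on (ball a d) (\<lambda>x. f (1, x))"
      by (rule continuous_on_compose2[OF d'(2) _ sub]) (auto intro!: continuous_intros)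
    then have "continuous_on (ball a d) g"
      using fg by (subst continuous_on_cong[OF refl, of _ g "\<lambda>x. f (1, x)"]) auto
    then show ?thesis using d(1) ballA by (intro exI[of _ "ball a d"]) auto
  qed
  show thesis
  proof (rule that[of g])
    show "continuous_on A g"
      unfolding continuous_on_eq_continuous_at[OF A(1)]
      using local by (metis continuous_on_eq_continuous_at)
    have "\<Gamma> x 1 \<in> \<Omega>" if "x \<in> A" for x
    proof -
      have "\<Gamma> x 1 \<in> \<Gamma> x ` {0..1}" by simp
      then show ?thesis using \<Gamma>[OF that] by (auto simp: lift_def)
    qed
    then show "g ` A \<subseteq> \<Omega>" by (auto simp: g_def)
    show "w (g x) = \<psi> x" if "x \<in> A" for x using \<Gamma>[OF that] by (auto simp: lift_def g_def P_def)
    have "lift a0 (\<lambda>_. z0)" using z0 by (auto simp: lift_def P_def)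
    then show "g a0 = z0" using uniq[OF a0 _ \<Gamma>[OF a0], of "\<lambda>_. z0"] by (simp add: g_def)
  qed
qed

section \<open>Sections over parts of the sphere\<close>

definition sect :: "complex option set \<Rightarrow> (complex option \<Rightarrow> complex option) \<Rightarrow> bool" where
  "sect L \<sigma> \<longleftrightarrow> continuous_on L \<sigma> \<and> \<sigma> ` L \<subseteq> \<Omega> \<and> (\<forall>v\<in>L. w (\<sigma> v) = v)"

lemma sect_subset: "sect L \<sigma> \<Longrightarrow> L' \<subseteq> L \<Longrightarrow> sect L' \<sigma>"
  unfolding sect_def by (auto intro: continuous_on_subset)

lemma sect_unique:
  assumes "connected L" "L \<inter> S = {}" "sect L \<sigma>" "sect L \<tau>" "v \<in> L" "\<sigma> v = \<tau> v" "u \<in> L"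
  shows "\<sigma> u = \<tau> u"
  by (rule lift_unique[of L \<sigma> \<tau> v u]) (use assms in \<open>auto simp: sect_def\<close>)

text \<open>Near \<sigma> v the section inverts \<open>w\<close> on a set \<open>N\<close> where
  \<open>w\<close> is injective, so all points of \<open>N\<close> over a small neighbourhood of
  \<open>v\<close> lie on the section.\<close>

lemma sect_open_image:
  assumes "open U" "sect U \<sigma>" "U \<inter> S = {}"
  shows "open (\<sigma> ` U)"
proof (rule open_subopen[THEN iffD2, rule_format])
  fix z assume "z \<in> \<sigma> ` U"
  then obtain v where v: "v \<in> U" "z = \<sigma> v" by blast
  then have "z \<in> \<Omega>" "w z \<notin> S" using assms by (auto simp: sect_def)
  then obtain N where N: "open N" "z \<in> N" "N \<subseteq> \<Omega>" "inj_on w N" using loc_inj by metis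
  have c: "continuous_on U \<sigma>" "\<And>v. v \<in> U \<Longrightarrow> w (\<sigma> v) = v" using assms by (auto simp: sect_def)
  define B where "B = U \<inter> \<sigma> -` N"
  have oB: "open B" unfolding B_def by (rule continuous_open_preimage[OF c(1) assms(1) N(1)])
  have "open (N \<inter> (\<Omega> \<inter> w -` B))" using N(1) open_preimage[OF oB] by blast
  moreover have "z \<in> N \<inter> (\<Omega> \<inter> w -` B)" using N v c by (auto simp: B_def)
  moreover have "N \<inter> (\<Omega> \<inter> w -` B) \<subseteq> \<sigma> ` U"
  proof
    fix x assume x: "x \<in> N \<inter> (\<Omega> \<inter> w -` B)"
    then have "\<sigma> (w x) \<in> N" "w (\<sigma> (w x)) = w x" "w x \<in> U" using c by (auto simp: B_def)
    then have "\<sigma> (w x) = x" using x N(4) by (auto simp: inj_on_def)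
    then show "x \<in> \<sigma> ` U" using \<open>w x \<in> U\<close> by force
  qed
  ultimately show "\<exists>T. open T \<and> z \<in> T \<and> T \<subseteq> \<sigma> ` U" by blast
qed

text \<open>\<open>star_lift\<close> prescribes the value at the centre only. The given point is
  therefore first moved over the centre by lifting the segment from \<open>a\<close> to
  \<open>a0\<close>; back along the same segment the section must return to \<open>z\<close>, by
  uniqueness of lifts.\<close>

lemma sect_exists:
  assumes "star_domain L" "L \<inter> S = {}" "z \<in> \<Omega>" "w z \<in> L"
  obtains \<sigma> where "sect L \<sigma>" "\<sigma> (w z) = z"
proof -
  obtain A \<phi> \<phi>' and a0 :: complex where A: "open A" "a0 \<in> A" "\<And>x. x \<in> A \<Longrightarrow> closed_segment a0 x \<subseteq> A"
    and h: "homeomorphism A L \<phi> \<phi>'" using assms(1) by (auto simp: star_domain_def)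
  have h': "continuous_on A \<phi>" "\<phi> ` A = L" "continuous_on L \<phi>'" "\<phi>' ` L = A" "\<And>x. x \<in> A \<Longrightarrow> \<phi>' (\<phi> x) = x"
    "\<And>y. y \<in> L \<Longrightarrow> \<phi> (\<phi>' y) = y"
    using h by (auto simp: homeomorphism_def)
  define a where "a = \<phi>' (w z)"
  have a: "a \<in> A" "\<phi> a = w z" using assms h' by (auto simp: a_def)
  define P where "P t = a + t *\<^sub>R (a0 - a)" for t
  have cP: "continuous_on X P" for X unfolding P_def by (intro continuous_intros)
  have PA: "P t \<in> A" if "t \<in> {0..1}" for t
  proof -
    have "P t \<in> closed_segment a a0"
      unfolding in_segment P_def using that by (intro exI[of _ t]) (auto simp: algebra_simps)
    then show ?thesis using A(3)[OF a(1)] by (auto simp: closed_segment_commute)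
  qed
  obtain \<gamma> where \<gamma>: "continuous_on {0..1} \<gamma>" "\<gamma> ` {0..1} \<subseteq> \<Omega>" "\<And>t. t \<in> {0..1} \<Longrightarrow> w (\<gamma> t) = \<phi> (P t)" "\<gamma> 0 = z"
  proof (rule path_lift[of "P -` A" "\<lambda>t. \<phi> (P t)" z])
    show "open (P -` A)" using continuous_on_open_vimage[of UNIV P] cP A(1) by auto
    show "continuous_on (P -` A) (\<lambda>t. \<phi> (P t))"
      by (rule continuous_on_compose2[OF h'(1) cP]) auto
    show "(\<lambda>t. \<phi> (P t)) ` (P -` A) \<inter> S = {}" using h'(2) assms(2) by auto
  qed (use PA a assms in \<open>auto simp: P_def\<close>)
  have P1: "P 1 = a0" "P 0 = a" by (auto simp: P_def)
  obtain g where g: "continuous_on A g" "g ` A \<subseteq> \<Omega>" "\<And>x. x \<in> A \<Longrightarrow> w (g x) = \<phi> x" "g a0 = \<gamma> 1"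
  proof (rule star_lift[of A \<phi> a0 "\<gamma> 1"])
    show "w (\<gamma> 1) = \<phi> a0" using \<gamma>(3)[of 1] P1 by simp
  qed (use A h' assms \<gamma> in auto)
  have "g (P 0) = \<gamma> 0"
  proof (rule lift_unique[of "{0..1}" "\<lambda>t. g (P t)" \<gamma> 1 0])
    show "continuous_on {0..1} (\<lambda>t. g (P t))"
      by (rule continuous_on_compose2[OF g(1) cP]) (use PA in auto)
    have *: "w (g (P t)) = \<phi> (P t)" "\<phi> (P t) \<in> L" if "t \<in> {0..1}" for t using g(3)[OF PA[OF that]] h'(2) PA[OF that] by auto
    show "w (g (P t)) = w (\<gamma> t)" "w (g (P t)) \<notin> S" if "t \<in> {0..1}" for t
      using *[OF that] \<gamma>(3)[OF that] assms(2) by auto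
  qed (use g PA \<gamma> P1 in auto)
  show thesis
  proof (rule that[of "g \<circ> \<phi>'"])
    show "sect L (g \<circ> \<phi>')"
      unfolding sect_def
    proof (intro conjI ballI)
      show "continuous_on L (g \<circ> \<phi>')" by (rule continuous_on_compose[OF h'(3)]) (use g(1) h'(4) in simp)
    qed (use g h' in auto)
    show "(g \<circ> \<phi>') (w z) = z" using \<open>g (P 0) = \<gamma> 0\<close> \<gamma>(4) P1 by (simp add: a_def)
  qed
qed

section \<open>Fibres, properness and the end of the domain\<close>

lemma fibre_finite:
  assumes "compact K" "K \<subseteq> \<Omega>"
  shows "finite {z \<in> K. w z = v}"
proof -
  have "{z \<in> K. w z = v} = K \<inter> w -` {v}" by auto
  moreover have "closed (K \<inter> w -` {v})"
    using assms by (intro continuous_closed_preimage continuous_on_subset[OF cont]) (auto intro: compact_imp_closed)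
  ultimately have c: "compact {z \<in> K. w z = v}"
    using assms by (metis compact_Int_closed inf.left_idem inf_commute)
  obtain N where N: "\<And>z. z \<in> \<Omega> \<Longrightarrow> open (N z) \<and> z \<in> N z \<and> (\<forall>x\<in>N z \<inter> \<Omega>. w x = w z \<longrightarrow> x = z)"
    using isolated by metis
  obtain D where D: "D \<subseteq> {z \<in> K. w z = v}" "finite D" "{z \<in> K. w z = v} \<subseteq> (\<Union>z\<in>D. N z)"
  proof (rule compactE_image[OF c, of "{z \<in> K. w z = v}" N])
    show "open (N z)" if "z \<in> {z \<in> K. w z = v}" for z using that N assms by auto
    show "{z \<in> K. w z = v} \<subseteq> (\<Union>z\<in>{z \<in> K. w z = v}. N z)" using N assms by blast
  qed
  have "{z \<in> K. w z = v} \<subseteq> D"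
  proof
    fix x assume x: "x \<in> {z \<in> K. w z = v}"
    then obtain z where "z \<in> D" "x \<in> N z" using D by blast
    moreover from this have "z \<in> \<Omega>" "x \<in> \<Omega>" "w x = w z" using x D assms by auto
    ultimately show "x \<in> D" using N[of z] by blast
  qed
  then show ?thesis using D(2) finite_subset by blast
qed

text \<open>Each compact set of the exhaustion contains only finitely many points of a fibre.
  Countability is what later permits natural numbers as indices of sheets.\<close>

lemma fibre_countable: "countable {z \<in> \<Omega>. w z = v}"
proof -
  obtain K :: "nat \<Rightarrow> _" where K: "\<And>n. compact (K n)" "(\<Union>n. K n) = \<Omega>" using exhaustion by metis
  have "{z \<in> \<Omega>. w z = v} = (\<Union>n. {z \<in> K n. w z = v})" using K(2) by blast
  moreover have "finite {z \<in> K n. w z = v}" for n using K by (intro fibre_finite) auto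
  ultimately show ?thesis by (simp add: countable_finite)
qed

text \<open>
  Here \<open>M\<close> is a union of components of the part of \<open>\<Omega>\<close> over \<open>O'\<close>.
\<close>

lemma proper_over:
  assumes O: "open O'" "O' \<inter> S = {}" and M: "M \<subseteq> \<Omega> \<inter> w -` O'"
    and sat: "\<And>C. connected C \<Longrightarrow> C \<subseteq> \<Omega> \<inter> w -` O' \<Longrightarrow> C \<inter> M \<noteq> {} \<Longrightarrow> C \<subseteq> M"
    and fin: "\<And>U. open U \<Longrightarrow> U \<noteq> {} \<Longrightarrow> U \<subseteq> O' \<Longrightarrow> \<exists>v\<in>U. finite {z \<in> M. w z = v}"
    and K: "compact K" "K \<subseteq> O'"
  shows "compact (M \<inter> w -` K)"
proof -
  have loc: "\<exists>e>0. compact (M \<inter> w -` cball v e)" if v: "v \<in> O'" for v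
  proof -
    obtain D where D: "open D" "star_domain D" "v \<in> D" "D \<subseteq> O'" using sphere_disc_nbhd[OF O(1) v] by blast
    have cD: "connected D" using D star_domain_connected by blast
    have DS: "D \<inter> S = {}" using D O by blast
    obtain v1 where v1: "v1 \<in> D" "finite {z \<in> M. w z = v1}" using fin[OF D(1) _ D(4)] D(3) by blast
    obtain e where e: "e > 0" "cball v e \<subseteq> D" using D(1,3) open_contains_cball by blast
    have "\<exists>\<sigma>. sect D \<sigma> \<and> \<sigma> v1 = z" if "z \<in> M" "w z = v1" for z
    proof -
      have "z \<in> \<Omega>" "w z \<in> D" using that M v1 by auto
      then show ?thesis using sect_exists[OF D(2) DS] that(2) by metis
    qed
    then obtain \<sigma> where \<sigma>: "\<And>z. z \<in> M \<Longrightarrow> w z = v1 \<Longrightarrow> sect D (\<sigma> z) \<and> \<sigma> z v1 = z" by metis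
    have im: "\<tau> ` D \<subseteq> M" if "sect D \<tau>" "\<tau> ` D \<inter> M \<noteq> {}" for \<tau>
    proof (rule sat[OF _ _ that(2)])
      show "connected (\<tau> ` D)" using that cD by (intro connected_continuous_image) (auto simp: sect_def)
      show "\<tau> ` D \<subseteq> \<Omega> \<inter> w -` O'" using that D by (auto simp: sect_def)
    qed
    \<comment> \<open>Over the star-shaped \<open>D\<close> every point of \<open>M\<close> lies on
      a section, the section stays in \<open>M\<close> because its image is connected, and it is
      determined by its value at \<open>v1\<close>. Only finitely many points of \<open>M\<close>
      lie over \<open>v1\<close>, so the part over a closed ball is a finite union of compact
      images.\<close>
    have "M \<inter> w -` cball v e = (\<Union>z\<in>{z \<in> M. w z = v1}. \<sigma> z ` cball v e)"
    proof (intro equalityI subsetI)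
      fix x assume x: "x \<in> M \<inter> w -` cball v e"
      then have wx: "w x \<in> D" "x \<in> \<Omega>" using e M by auto
      then obtain \<tau> where \<tau>: "sect D \<tau>" "\<tau> (w x) = x" using sect_exists[OF D(2) DS] by metis
      have "\<tau> ` D \<inter> M \<noteq> {}" using \<tau> wx x by (metis IntD1 disjoint_iff imageI)
      then have "\<tau> v1 \<in> M" using im[OF \<tau>(1)] v1 by auto
      moreover have "w (\<tau> v1) = v1" using \<tau> v1 by (auto simp: sect_def)
      ultimately have s: "sect D (\<sigma> (\<tau> v1))" "\<sigma> (\<tau> v1) v1 = \<tau> v1" using \<sigma> by auto
      have "\<sigma> (\<tau> v1) (w x) = \<tau> (w x)" using sect_unique[OF cD DS s(1) \<tau>(1) v1(1) s(2) wx(1)] .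
      then have "x = \<sigma> (\<tau> v1) (w x)" using \<tau> by simp
      then show "x \<in> (\<Union>z\<in>{z \<in> M. w z = v1}. \<sigma> z ` cball v e)"
        using x \<open>\<tau> v1 \<in> M\<close> \<open>w (\<tau> v1) = v1\<close> by blast
    next
      fix x assume "x \<in> (\<Union>z\<in>{z \<in> M. w z = v1}. \<sigma> z ` cball v e)"
      then obtain z u where z: "z \<in> M" "w z = v1" "u \<in> cball v e" "x = \<sigma> z u" by blast
      then have s: "sect D (\<sigma> z)" "\<sigma> z v1 = z" using \<sigma> by auto
      have "\<sigma> z ` D \<inter> M \<noteq> {}" using s z v1 by (metis disjoint_iff imageI)
      then have "\<sigma> z ` D \<subseteq> M" by (rule im[OF s(1)])
      moreover have "u \<in> D" using z(3) e(2) by blast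
      ultimately show "x \<in> M \<inter> w -` cball v e" using z s by (auto simp: sect_def)
    qed
    moreover have "compact (\<Union>z\<in>{z \<in> M. w z = v1}. \<sigma> z ` cball v e)"
    proof (rule compact_UN[OF v1(2)])
      fix z assume "z \<in> {z \<in> M. w z = v1}"
      then have "continuous_on (cball v e) (\<sigma> z)" using \<sigma> e by (auto simp: sect_def intro: continuous_on_subset)
      then show "compact (\<sigma> z ` cball v e)"
        by (rule compact_continuous_image) (simp add: compact_sphere_iff)
    qed
    ultimately show ?thesis using e by auto
  qed
  then obtain r where r: "\<And>v. v \<in> K \<Longrightarrow> r v > 0 \<and> compact (M \<inter> w -` cball v (r v))"
    using loc[OF subsetD[OF K(2)]] by metis
  obtain T where T: "T \<subseteq> K" "finite T" "K \<subseteq> (\<Union>v\<in>T. ball v (r v))"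
  proof (rule compactE_image[OF K(1), of K "\<lambda>v. ball v (r v)"])
    show "K \<subseteq> (\<Union>v\<in>K. ball v (r v))" using r by force
  qed auto
  define C where "C = (\<Union>v\<in>T. M \<inter> w -` cball v (r v))"
  have C: "compact C" unfolding C_def using T r by (intro compact_UN) auto
  have CO: "C \<subseteq> \<Omega>" using M by (auto simp: C_def)
  have "M \<inter> w -` K = C \<inter> (C \<inter> w -` K)"
  proof -
    have "x \<in> C" if "x \<in> M" "w x \<in> K" for x
    proof -
      obtain v where "v \<in> T" "w x \<in> ball v (r v)" using T(3) \<open>w x \<in> K\<close> by blast
      then show ?thesis using that unfolding C_def by (auto intro!: bexI[of _ v])
    qed
    then show ?thesis by (auto simp: C_def)
  qed
  moreover have "closed (C \<inter> w -` K)"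
    using C CO K by (intro continuous_closed_preimage continuous_on_subset[OF cont]) (auto intro: compact_imp_closed)
  ultimately show ?thesis using compact_Int_closed[OF C] by (simp only:)
qed

text \<open>Finite fibres over a dense set of values make \<open>w\<close> proper over the
  complement of \<open>S\<close>. Outside a compact subset of \<Omega>, which may be chosen with
  connected complement, \<open>w\<close> takes values only in disjoint neighbourhoods of the
  singular values, hence near a single one. These neighbourhoods are taken from
  \<open>no_limit\<close>, which yields the contradiction.\<close>

lemma finite_fibres_imp_UNIV:
  assumes fin: "\<And>U. open U \<Longrightarrow> U \<noteq> {} \<Longrightarrow> \<exists>v\<in>U. finite {z \<in> \<Omega>. w z = v}"
  shows "\<Omega> = UNIV"
proof (rule ccontr)
  assume ne: "\<Omega> \<noteq> UNIV"
  obtain V where V: "\<And>p. open (V p) \<and> p \<in> V p \<and> (\<forall>K. compact K \<longrightarrow> K \<subseteq> \<Omega> \<longrightarrow> \<not> w ` (\<Omega> - K) \<subseteq> V p)"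
    using no_limit[OF ne] by metis
  obtain d where d: "d > 0" "\<And>s t. s \<in> S \<Longrightarrow> t \<in> S \<Longrightarrow> s \<noteq> t \<Longrightarrow> d \<le> dist s t"
  proof -
    \<comment> \<open>The element 1 keeps the minimum defined when \<open>S\<close> has no two
      distinct points.\<close>
    let ?D = "insert 1 ((\<lambda>(s, t). dist s t) ` {(s, t) \<in> S \<times> S. s \<noteq> t})"
    have f: "finite ?D"
    proof -
      have "finite {(s, t) \<in> S \<times> S. s \<noteq> t}"
        by (rule finite_subset[of _ "S \<times> S"]) (use finS in auto)
      then show ?thesis by simp
    qed
    show thesis
    proof (rule that[of "Min ?D"])
      show "0 < Min ?D" using f by (simp add: Min_gr_iff)
      show "Min ?D \<le> dist s t" if "s \<in> S" "t \<in> S" "s \<noteq> t" for s t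
      proof (rule Min_le[OF f])
        have "(s, t) \<in> {(s, t) \<in> S \<times> S. s \<noteq> t}" using that by simp
        from imageI[OF this, of "\<lambda>(s, t). dist s t"] show "dist s t \<in> ?D" by simp
      qed
    qed
  qed
  define W where "W s = V s \<inter> ball s (d / 2)" for s
  have W: "open (W s)" "s \<in> W s" for s using V d by (auto simp: W_def)
  have Wd: "W s \<inter> W t = {}" if "s \<in> S" "t \<in> S" "s \<noteq> t" for s t
  proof -
    have "dist s t < d" if "x \<in> W s \<inter> W t" for x
      using dist_triangle_half_l[of s x d t] that by (simp add: W_def)
    then show ?thesis using d(2)[OF that] by force
  qed
  define K where "K = - (\<Union>s\<in>S. W s)"
  have K: "compact K" "K \<subseteq> - S" using W by (auto simp: K_def compact_sphere_iff)
  have Sc: "open (- S)" using finS by (simp add: finite_imp_closed open_Compl)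
  have "compact ((\<Omega> \<inter> w -` (- S)) \<inter> w -` K)"
  proof (rule proper_over[OF Sc _ _ _ _ K])
    show "\<exists>v\<in>U. finite {z \<in> \<Omega> \<inter> w -` (- S). w z = v}" if U: "open U" "U \<noteq> {}" for U
    proof -
      obtain v where "v \<in> U" "finite {z \<in> \<Omega>. w z = v}" using fin[OF U] by blast
      then show ?thesis by (intro bexI[of _ v]) (auto elim: rev_finite_subset)
    qed
  qed auto
  then obtain K' where K': "compact K'" "(\<Omega> \<inter> w -` (- S)) \<inter> w -` K \<subseteq> K'" "K' \<subseteq> \<Omega>" "connected (\<Omega> - K')"
    using ends[of "(\<Omega> \<inter> w -` (- S)) \<inter> w -` K"] by blast
  have sub: "w ` (\<Omega> - K') \<subseteq> (\<Union>s\<in>S. W s)"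
  proof (rule image_subsetI)
    fix x assume x: "x \<in> \<Omega> - K'"
    then have "w x \<notin> K" using K'(2) K(2) by blast
    then show "w x \<in> (\<Union>s\<in>S. W s)" unfolding K_def by blast
  qed
  have con: "connected (w ` (\<Omega> - K'))"
    by (intro connected_continuous_image K' continuous_on_subset[OF cont]) auto
  have "\<exists>s. w ` (\<Omega> - K') \<subseteq> W s"
  proof (cases "w ` (\<Omega> - K') = {}")
    case False
    then obtain s where "s \<in> S" "w ` (\<Omega> - K') \<inter> W s \<noteq> {}" using sub by blast
    then show ?thesis using connected_disjoint_UN[OF con sub W(1) Wd] by blast
  qed auto
  then obtain s where "w ` (\<Omega> - K') \<subseteq> V s" by (auto simp: W_def)
  then show False using V[of s] K' by blast
qed

text \<open>Let \<open>M1\<close> be the part of \<open>M\<close> over a small ball around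
  \<open>p\<close>. Over the rim of the ball \<open>M\<close> is compact by
  \<open>proper_over\<close>; if no point over \<open>p\<close> is a limit of \<open>M\<close>, then
  off a compact \<open>K'\<close> around that part, with connected complement, \<open>M1\<close> is
  both open and closed. So \<open>M1\<close> either lies in a compact set, which produces a limit
  point over \<open>p\<close> after all, or contains everything outside \<open>K'\<close>, and then
  \<open>w\<close> would tend to \<open>p\<close> at the end of \<Omega>.\<close>

lemma puncture_filled:
  assumes V: "open V" "p \<in> V" "V \<inter> S \<subseteq> {p}" and M: "M \<subseteq> \<Omega> \<inter> w -` (V - {p})"
    and sat: "\<And>C. connected C \<Longrightarrow> C \<subseteq> \<Omega> \<inter> w -` (V - {p}) \<Longrightarrow> C \<inter> M \<noteq> {} \<Longrightarrow> C \<subseteq> M"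
    and fin: "\<And>U. open U \<Longrightarrow> U \<noteq> {} \<Longrightarrow> U \<subseteq> V - {p} \<Longrightarrow> \<exists>v\<in>U. finite {z \<in> M. w z = v}"
    and p: "p \<in> closure (w ` M)"
  shows "\<exists>z\<in>\<Omega>. z \<in> closure M \<and> w z = p"
proof (rule ccontr)
  assume "\<not> ?thesis"
  then have A: "w z \<noteq> p" if "z \<in> \<Omega>" "z \<in> closure M" for z using that by blast
  have oV: "open (V - {p})" using V(1) by (simp add: open_delete)
  have VS: "(V - {p}) \<inter> S = {}" using V(3) by blast
  have proper: "compact (M \<inter> w -` K)" if "compact K" "K \<subseteq> V - {p}" for K
    by (rule proper_over[OF oV VS M sat fin that])
  obtain e where e: "e > 0" "cball p e \<subseteq> V" using V open_contains_cball by blast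
  define M1 where "M1 = M \<inter> w -` ball p e"
  have nbhd: "\<exists>C. open C \<and> x \<in> C \<and> C \<subseteq> M" if x: "x \<in> \<Omega> \<inter> w -` (V - {p})" "x \<in> closure M" for x
  proof -
    obtain C where C: "open C" "connected C" "x \<in> C" "C \<subseteq> \<Omega> \<inter> w -` (V - {p})"
      by (rule sphere_connected_nbhd[OF open_preimage[OF oV] x(1)])
    have "C \<inter> M \<noteq> {}" using x(2) C(3) open_Int_closure_eq_empty[OF C(1), of M] by blast
    then show ?thesis using sat[OF C(2,4)] C by blast
  qed
  have "open M"
    by (rule open_subopen[THEN iffD2, rule_format]) (use nbhd M closure_subset in blast)
  then have oM1: "open M1"
  proof -
    have "M1 = M \<inter> (\<Omega> \<inter> w -` ball p e)" using M by (auto simp: M1_def)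
    then show ?thesis using \<open>open M\<close> open_preimage[of "ball p e"] by auto
  qed
  have pM1: "p \<in> closure (w ` M1)"
  proof (rule ccontr)
    assume "p \<notin> closure (w ` M1)"
    then have "p \<in> (- closure (w ` M1) \<inter> ball p e) \<inter> closure (w ` M)" using p e by auto
    moreover have "open (- closure (w ` M1) \<inter> ball p e)" by auto
    ultimately have "(- closure (w ` M1) \<inter> ball p e) \<inter> w ` M \<noteq> {}"
      using open_Int_closure_eq_empty[of "- closure (w ` M1) \<inter> ball p e" "w ` M"] by (metis empty_iff)
    then obtain y where y: "y \<in> - closure (w ` M1) \<inter> ball p e \<inter> w ` M"
      unfolding ex_in_conv[symmetric] ..
    then obtain x where x: "x \<in> M" "y = w x" by auto
    then have "y \<in> w ` M1" using y by (auto simp: M1_def)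
    then show False using y closure_subset[of "w ` M1"] by auto
  qed
  have B: False if K: "compact K" "K \<subseteq> \<Omega>" "M1 \<subseteq> K" for K
  proof -
    have c: "closure M1 \<subseteq> K" using K by (simp add: closure_minimal compact_imp_closed)
    have "compact (closure M1)" by (simp add: compact_sphere_iff)
    then have "compact (w ` closure M1)"
      by (intro compact_continuous_image continuous_on_subset[OF cont]) (use c K in auto)
    then have "closed (w ` closure M1)" by (rule compact_imp_closed)
    then have "closure (w ` M1) \<subseteq> w ` closure M1"
      by (intro closure_minimal image_mono closure_subset)
    then obtain z where z: "z \<in> closure M1" "w z = p" using pM1 by blast
    moreover have "z \<in> closure M" using z(1) closure_mono[of M1 M] by (auto simp: M1_def)
    ultimately show False using A c K by blast
  qed
  show False
  proof (cases "\<Omega> = UNIV")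
    case True
    then show ?thesis using B[of UNIV] compact_UNIV_sphere by blast
  next
    case False
    have "compact (M \<inter> w -` (cball p e - ball p e))"
    proof (rule proper)
      show "compact (cball p e - ball p e)" by (simp add: compact_sphere_iff closed_Diff)
    qed (use e in auto)
    then obtain K' where K': "compact K'" "M \<inter> w -` (cball p e - ball p e) \<subseteq> K'" "K' \<subseteq> \<Omega>" "connected (\<Omega> - K')"
      using ends[of "M \<inter> w -` (cball p e - ball p e)"] M by blast
    \<comment> \<open>The assumption that no point of the closure of \<open>M\<close> lies over
      \<open>p\<close> enters here: it keeps w z in the punctured neighbourhood, over which
      \<open>M\<close> is relatively closed. Leaving \<open>K'\<close> then excludes the
      rim.\<close>
    have cl: "z \<in> M1" if z: "z \<in> \<Omega> - K'" "z \<in> closure M1" for z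
    proof -
      have zM: "z \<in> closure M" using z(2) closure_mono[of M1 M] by (auto simp: M1_def)
      have "w z \<in> cball p e"
      proof (rule ccontr)
        assume "w z \<notin> cball p e"
        then have "z \<in> \<Omega> \<inter> w -` (- cball p e)" "open (\<Omega> \<inter> w -` (- cball p e))"
          using z open_preimage[of "- cball p e"] by auto
        then have "M1 \<inter> (\<Omega> \<inter> w -` (- cball p e)) \<noteq> {}"
          using z(2) open_Int_closure_eq_empty[of "\<Omega> \<inter> w -` (- cball p e)" M1] by blast
        then show False by (auto simp: M1_def)
      qed
      then have wz: "w z \<in> V - {p}" using e A[OF _ zM] z by auto
      then have "z \<in> M" using nbhd[OF _ zM] z by auto
      then show ?thesis using \<open>w z \<in> cball p e\<close> z K'(2) by (auto simp: M1_def)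
    qed
    have dis: "M1 \<inter> - closure M1 \<inter> (\<Omega> - K') = {}" using closure_subset[of M1] by blast
    have cov: "\<Omega> - K' \<subseteq> M1 \<union> - closure M1" using cl by blast
    have "open (- closure M1)" by auto
    from connectedD[OF K'(4) oM1 this dis cov]
    have "M1 \<inter> (\<Omega> - K') = {} \<or> - closure M1 \<inter> (\<Omega> - K') = {}" .
    then show False
    proof
      assume *: "M1 \<inter> (\<Omega> - K') = {}"
      have "M1 \<subseteq> \<Omega>" using M by (auto simp: M1_def)
      then have "M1 \<subseteq> K'" using * by blast
      then show False using B K' by blast
    next
      assume "- closure M1 \<inter> (\<Omega> - K') = {}"
      then have sub: "\<Omega> - K' \<subseteq> M1" using cl by blast
      obtain V2 where V2: "open V2" "p \<in> V2" "\<And>K. compact K \<Longrightarrow> K \<subseteq> \<Omega> \<Longrightarrow> \<not> w ` (\<Omega> - K) \<subseteq> V2"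
        using no_limit[OF False, of p] by metis
      obtain e2 where e2: "e2 > 0" "ball p e2 \<subseteq> V2" using openE[OF V2(1,2)] .
      \<comment> \<open>The part of \<open>M\<close> over the shell between the radii
        \<open>e2\<close> and \<open>e\<close> is compact too; removing it as well leaves only
        values in \<open>V2\<close>, against the choice of \<open>V2\<close>.\<close>
      have K2: "compact (M \<inter> w -` (cball p e - ball p e2))"
      proof (rule proper)
        show "compact (cball p e - ball p e2)" by (simp add: compact_sphere_iff closed_Diff)
      qed (use e e2 in auto)
      have "w ` (\<Omega> - (K' \<union> (M \<inter> w -` (cball p e - ball p e2)))) \<subseteq> V2"
      proof (rule image_subsetI)
        fix x assume x: "x \<in> \<Omega> - (K' \<union> (M \<inter> w -` (cball p e - ball p e2)))"
        then have "x \<in> M1" using sub by blast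
        then have "w x \<in> ball p e2" using x by (auto simp: M1_def)
        then show "w x \<in> V2" using e2 by blast
      qed
      moreover have "compact (K' \<union> (M \<inter> w -` (cball p e - ball p e2)))" using K' K2 by (simp add: compact_Un)
      moreover have "K' \<union> (M \<inter> w -` (cball p e - ball p e2)) \<subseteq> \<Omega>" using K' M by blast
      ultimately show False using V2(3) by blast
    qed
  qed
qed

end

section \<open>Local behaviour of meromorphic maps\<close>

text \<open>
  The one point at which the coordinate around \<open>p\<close> is meaningless.
\<close>

fun antipode :: "complex option \<Rightarrow> complex option" where
  "antipode None = Some 0"
| "antipode (Some b) = None"

lemma sphere_coord_chart [simp]: "sphere_coord p (sphere_chart p \<zeta>) = \<zeta>"
  by (cases p) (auto simp del: sphere_inversion.simps)

lemma sphere_chart_coord: "v \<noteq> antipode p \<Longrightarrow> sphere_chart p (sphere_coord p v) = v"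
  by (cases p; cases v) auto

lemma sphere_chart_neq_antipode [simp]: "sphere_chart p \<zeta> \<noteq> antipode p"
  by (cases p) auto

lemma sphere_chart_zero [simp]: "sphere_chart p 0 = p"
  by (cases p) auto

lemma sphere_coord_self [simp]: "sphere_coord p p = 0"
  by (cases p) auto

lemma antipode_neq [simp]: "antipode p \<noteq> p" "p \<noteq> antipode p"
  by (cases p; simp)+

lemma continuous_on_sphere_chart: "continuous_on A (sphere_chart p)"
proof (cases p)
  case None
  have "sphere_chart None = sphere_inversion \<circ> Some" by auto
  moreover have "continuous_on A (sphere_inversion \<circ> Some)"
    by (rule continuous_on_compose[OF continuous_on_Some continuous_on_sphere_inversion])
  ultimately show ?thesis using None by (simp only:)
next
  case (Some a)
  have "continuous_on A (\<lambda>\<zeta>. Some (a + \<zeta>))"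
    by (rule continuous_on_compose2[OF continuous_on_Some[of UNIV]]) (auto intro!: continuous_intros)
  then show ?thesis using Some by simp
qed

lemma continuous_on_sphere_coord:
  assumes "A \<subseteq> - {antipode p}" shows "continuous_on A (sphere_coord p)"
proof (rule continuous_on_subset[OF _ assms])
  show "continuous_on (- {antipode p}) (sphere_coord p)"
  proof (cases p)
    case None
    have "continuous_on (- {Some 0}) (\<lambda>v. finite_part (sphere_inversion v))"
    proof (rule continuous_on_compose2[OF continuous_on_finite_part[of "range Some"]])
      show "sphere_inversion ` (- {Some 0}) \<subseteq> range Some"
      proof (rule image_subsetI)
        fix v :: "complex option" assume "v \<in> - {Some 0}"
        then show "sphere_inversion v \<in> range Some" by (cases v) auto
      qed
    qed (auto intro: continuous_on_sphere_inversion)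
    then show ?thesis using None by simp
  next
    case (Some b)
    have "continuous_on (- {None}) (\<lambda>v. finite_part v - b)"
      by (intro continuous_intros continuous_on_finite_part) (auto simp: notin_range_Some)
    then show ?thesis using Some by simp
  qed
qed

lemma open_sphere_chart_image: "open U \<Longrightarrow> open (sphere_chart p ` U)"
proof -
  assume U: "open U"
  have "sphere_chart p ` U = - {antipode p} \<inter> sphere_coord p -` U"
    by (auto simp: image_iff) (metis sphere_chart_coord)
  then show ?thesis
    using continuous_open_preimage[OF continuous_on_sphere_coord[OF order_refl] open_Compl[OF closed_singleton] U] by simp
qed

lemma inj_sphere_chart: "inj_on (sphere_chart p) A"
  by (rule inj_on_inverseI[of _ "sphere_coord p"]) simp

lemma sphere_chart_nbhd:
  assumes "open U" "p \<in> U"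
  obtains r where "r > 0" "sphere_chart p ` ball 0 r \<subseteq> U"
proof -
  have "open (sphere_chart p -` U)"
    using continuous_open_preimage[OF continuous_on_sphere_chart[of UNIV] open_UNIV assms(1)] by simp
  moreover have "0 \<in> sphere_chart p -` U" using assms by simp
  ultimately obtain r where "r > 0" "ball 0 r \<subseteq> sphere_chart p -` U" using openE by blast
  then show thesis by (intro that) auto
qed

text \<open>The radius is shrunk until \<open>w\<close> stays away from the antipode of w z; there
  the coordinate can be inverted and \<open>w\<close> recovered from its local expression.\<close>

lemma meromorphic_local_rep:
  assumes "open \<Omega>" "meromorphic_map \<Omega> w" "z \<in> \<Omega>"
  obtains r where "r > 0" "sphere_chart z ` ball 0 r \<subseteq> \<Omega>" "local_expression w z holomorphic_on ball 0 r"
    "\<And>\<zeta>. \<zeta> \<in> ball 0 r \<Longrightarrow> w (sphere_chart z \<zeta>) = sphere_chart (w z) (local_expression w z \<zeta>)"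
proof -
  have cont: "continuous_on \<Omega> w" and an: "local_expression w z analytic_on {0}"
    using assms by (auto simp: meromorphic_map_def)
  obtain r1 where r1: "r1 > 0" "local_expression w z holomorphic_on ball 0 r1"
    using an by (auto simp: analytic_on_def)
  have "open (\<Omega> \<inter> w -` (- {antipode (w z)}))"
    by (rule continuous_open_preimage[OF cont assms(1)]) auto
  then obtain r2 where r2: "r2 > 0" "sphere_chart z ` ball 0 r2 \<subseteq> \<Omega> \<inter> w -` (- {antipode (w z)})"
    by (rule sphere_chart_nbhd[of _ z]) (use assms in auto)
  show thesis
  proof (rule that[of "min r1 r2"])
    show "w (sphere_chart z \<zeta>) = sphere_chart (w z) (local_expression w z \<zeta>)" if "\<zeta> \<in> ball 0 (min r1 r2)" for \<zeta>
    proof -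
      have "sphere_chart z \<zeta> \<in> sphere_chart z ` ball 0 r2" using that by auto
      then have "w (sphere_chart z \<zeta>) \<noteq> antipode (w z)" using r2(2) by blast
      then show ?thesis unfolding local_expression_def by (subst sphere_chart_coord) auto
    qed
    show "sphere_chart z ` ball 0 (min r1 r2) \<subseteq> \<Omega>" using r2 by auto
    show "local_expression w z holomorphic_on ball 0 (min r1 r2)"
      by (rule holomorphic_on_subset[OF r1(2)]) auto
  qed (use r1 r2 in auto)
qed

lemma local_expression_zero [simp]: "local_expression w z 0 = 0"
  by (simp add: local_expression_def)

text \<open>The definition of a meromorphic map controls only the coordinate around the value at
  \<open>Some a\<close> itself. Passing to the coordinate around a finite \<open>p\<close> is a
  translation; for \<open>p\<close> infinite and a finite value \<open>c\<close> it is 1/(F + c),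
  with \<open>c\<close> nonzero because \<open>Some 0\<close> is the antipode.\<close>

lemma analytic_sphere_coord:
  assumes "open \<Omega>" "meromorphic_map \<Omega> w" "Some a \<in> \<Omega>" "w (Some a) \<noteq> antipode p"
  shows "(\<lambda>\<zeta>. sphere_coord p (w (Some \<zeta>))) analytic_on {a}"
proof -
  have cont: "continuous_on \<Omega> w" and an: "local_expression w (Some a) analytic_on {0}"
    using assms by (auto simp: meromorphic_map_def)
  define F where "F \<zeta> = sphere_coord (w (Some a)) (w (Some \<zeta>))" for \<zeta>
  have "(local_expression w (Some a) \<circ> (\<lambda>\<zeta>. \<zeta> - a)) analytic_on {a}"
    by (rule analytic_on_compose) (use an in \<open>auto intro!: analytic_intros\<close>)
  moreover have "local_expression w (Some a) \<circ> (\<lambda>\<zeta>. \<zeta> - a) = F"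
    by (auto simp: local_expression_def F_def)
  ultimately have F: "F analytic_on {a}" by simp
  show ?thesis
  proof (cases p)
    case (Some b)
    then obtain c where c: "w (Some a) = Some c" using assms(4) by (cases "w (Some a)") auto
    have "(\<lambda>\<zeta>. sphere_coord p (w (Some \<zeta>))) = (\<lambda>\<zeta>. F \<zeta> + (c - b))"
      using Some c by (auto simp: F_def)
    then show ?thesis using F by (auto intro!: analytic_intros)
  next
    case None
    show ?thesis
    proof (cases "w (Some a)")
      case None
      then show ?thesis using F \<open>p = None\<close> by (simp add: F_def[abs_def])
    next
      case (Some c)
      then have c0: "c \<noteq> 0" using assms(4) None by auto
      have "open (\<Omega> \<inter> w -` (- {None, Some 0}))"
        by (rule continuous_open_preimage[OF cont assms(1)]) auto
      moreover have "Some a \<in> \<Omega> \<inter> w -` (- {None, Some 0})" using assms(3) Some c0 by auto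
      ultimately have "open (Some -` (\<Omega> \<inter> w -` (- {None, Some 0})))" "a \<in> Some -` (\<Omega> \<inter> w -` (- {None, Some 0}))"
        by (auto simp: open_sphere_iff)
      then have ev: "\<forall>\<^sub>F \<zeta> in nhds a. sphere_coord p (w (Some \<zeta>)) = 1 / (F \<zeta> + c)"
        unfolding eventually_nhds
      proof (intro exI conjI ballI)
        fix \<zeta> assume "\<zeta> \<in> Some -` (\<Omega> \<inter> w -` (- {None, Some 0}))"
        then obtain u where "w (Some \<zeta>) = Some u" "u \<noteq> 0" by (cases "w (Some \<zeta>)") auto
        then show "sphere_coord p (w (Some \<zeta>)) = 1 / (F \<zeta> + c)" using None Some by (simp add: F_def)
      qed auto
      have "(\<lambda>\<zeta>. 1 / (F \<zeta> + c)) analytic_on {a}"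
      proof -
        have "F a + c \<noteq> 0" using c0 by (simp add: F_def)
        then show ?thesis using F by (auto intro!: analytic_intros)
      qed
      then show ?thesis using analytic_at_cong[OF ev refl] by simp
    qed
  qed
qed

section \<open>A uniqueness principle at the boundary circle\<close>

text \<open>
  Pulled back by the exponential function, \<open>f\<close> tends to \<open>0\<close> along a straight line and hence extends by
  \<open>0\<close> across it.
\<close>

lemma annulus_boundary_zero:
  assumes R: "0 < R" "R < 1" and hol: "f holomorphic_on {z. R < norm z \<and> norm z < 1}"
    and lim: "\<And>e. e > 0 \<Longrightarrow> \<exists>r<1. \<forall>z. r < norm z \<and> norm z < 1 \<longrightarrow> norm (f z) < e"
    and z: "R < norm z" "norm z < 1"
  shows "f z = 0"
proof -
  \<comment> \<open>The exponential maps the part of \<open>T\<close> with negative real part onto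
    the annulus, and the unit circle corresponds to the line Re s = 0. From that line on,
    \<open>g\<close> is continued by 0.\<close>
  define T where "T = {s. ln R < Re s}"
  define g where "g s = (if Re s < 0 then f (exp s) else 0)" for s
  have oT: "open T" unfolding T_def by (simp add: open_halfspace_Re_gt)
  have half: "{z. 1 \<bullet> z < (0::real)} = {z. Re z < 0}" "{z. (0::real) < 1 \<bullet> z} = {z. 0 < Re z}"
    by (auto simp: inner_complex_def)
  have expA: "exp s \<in> {z. R < norm z \<and> norm z < 1}" if "s \<in> T" "Re s < 0" for s
    using that R by (auto simp: T_def) (metis exp_less_cancel_iff exp_ln)
  have hexp: "(\<lambda>s. f (exp s)) holomorphic_on (T \<inter> {s. Re s < 0})"
    using holomorphic_on_compose_gen[OF holomorphic_on_exp hol image_subsetI, of "T \<inter> {s. Re s < 0}"] expA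
    by (simp add: o_def)
  have g1: "g holomorphic_on (T \<inter> {s. Re s < 0})"
    by (rule holomorphic_transform[OF hexp]) (auto simp: g_def)
  have g2: "g holomorphic_on (T \<inter> {s. 0 < Re s})"
    by (rule holomorphic_transform[of "\<lambda>_. 0"]) (auto simp: g_def)
  have cont: "continuous_on T g"
    unfolding continuous_on_eq_continuous_at[OF oT]
  proof
    fix s assume s: "s \<in> T"
    consider "Re s < 0" | "Re s > 0" | "Re s = 0" by linarith
    then show "isCont g s"
    proof cases
      case 1
      moreover have "open (T \<inter> {s. Re s < 0})" using oT by (simp add: open_Int open_halfspace_Re_lt)
      ultimately show ?thesis
        using holomorphic_on_imp_continuous_on[OF g1] s by (auto simp: continuous_on_eq_continuous_at)
    next
      case 2
      moreover have "open (T \<inter> {s. 0 < Re s})" using oT by (simp add: open_Int open_halfspace_Re_gt)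
      ultimately show ?thesis
        using holomorphic_on_imp_continuous_on[OF g2] s by (auto simp: continuous_on_eq_continuous_at)
    next
      case 3
      show ?thesis
        unfolding continuous_at tendsto_iff
      proof (intro allI impI)
        fix e :: real assume "e > 0"
        then obtain r where r: "r < 1" "\<And>z. r < norm z \<Longrightarrow> norm z < 1 \<Longrightarrow> norm (f z) < e" using lim by blast
        have "((\<lambda>x. norm (exp x)) \<longlongrightarrow> norm (exp s)) (at s)"
          by (intro tendsto_intros)
        then have "\<forall>\<^sub>F x in at s. r < norm (exp x)"
          using r(1) 3 by (intro order_tendstoD(1)) auto
        then show "\<forall>\<^sub>F x in at s. dist (g x) (g s) < e"
        proof eventually_elim
          case (elim x)
          then show ?case using r(2)[of "exp x"] 3 \<open>e > 0\<close> by (auto simp: g_def)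
        qed
      qed
    qed
  qed
  \<comment> \<open>A continuous function holomorphic on both sides of a line is holomorphic across
    it; as \<open>g\<close> vanishes on the right, the identity theorem makes it vanish on the left
    as well.\<close>
  have gT: "g holomorphic_on T"
    by (rule holomorphic_on_paste_across_line[OF oT, of 1 _ 0]) (use g1 g2 cont half in auto)
  have "g (Ln z) = 0"
  proof (rule analytic_continuation_open[of "T \<inter> {s. 0 < Re s}" T g "\<lambda>_. 0"])
    show "open (T \<inter> {s. 0 < Re s})" using oT by (simp add: open_Int open_halfspace_Re_gt)
    have "1 \<in> T \<inter> {s. 0 < Re s}" using R by (auto simp: T_def) (smt (verit) ln_less_zero)
    then show "T \<inter> {s. 0 < Re s} \<noteq> {}" by blast
    show "connected T" unfolding T_def by (intro convex_connected convex_halfspace_Re_gt)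
    have "z \<noteq> 0" using z R by auto
    then show "Ln z \<in> T" using z R by (simp add: T_def)
  qed (use oT gT in \<open>auto simp: g_def\<close>)
  moreover have "z \<noteq> 0" using z R by auto
  ultimately show ?thesis using z by (auto simp: g_def split: if_splits)
qed

lemma sphere_dense_Some: "open V \<Longrightarrow> None \<in> V \<Longrightarrow> \<exists>v::complex. Some v \<in> V"
proof -
  assume "open V" "None \<in> V"
  then obtain R where "\<forall>v::complex. R < norm v \<longrightarrow> Some v \<in> V" by (auto simp: open_sphere_iff)
  then have "Some (complex_of_real (\<bar>R\<bar> + 1)) \<in> V" by (auto simp del: of_real_add)
  then show ?thesis by blast
qed

lemma closure_range_Some: "closure (range Some) = (UNIV :: complex option set)"
proof -
  have "p \<in> closure (range Some)" for p :: "complex option"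
  proof (cases p)
    case None
    show ?thesis
    proof (rule ccontr)
      assume "p \<notin> closure (range Some)"
      then obtain v :: complex where "Some v \<in> - closure (range Some)"
        using sphere_dense_Some[of "- closure (range Some)"] None by auto
      then show False using closure_subset[of "range Some"] by blast
    qed
  next
    case (Some a) then show ?thesis using closure_subset[of "range Some"] by blast
  qed
  then show ?thesis by blast
qed

section \<open>The three domains and their ends\<close>

definition standard_domain :: "complex option set \<Rightarrow> bool" where
  "standard_domain \<Omega> \<longleftrightarrow> \<Omega> \<in> {UNIV, range Some, Some ` ball 0 1}"

lemma standard_domain_cases:
  assumes "standard_domain \<Omega>"
  obtains "\<Omega> = UNIV" | "\<Omega> = range Some" | "\<Omega> = Some ` ball 0 1"
  using assms by (auto simp: standard_domain_def)

lemma standard_domain_open: "standard_domain \<Omega> \<Longrightarrow> open \<Omega>"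
  by (erule standard_domain_cases) auto

lemma connected_UNIV_sphere: "connected (UNIV :: complex option set)"
proof -
  have "connected (range (Some :: complex \<Rightarrow> _))"
    by (intro connected_continuous_image continuous_on_Some convex_connected convex_UNIV)
  then show ?thesis using connected_imp_connected_closure closure_range_Some by metis
qed

lemma standard_domain_connected:
  assumes "standard_domain \<Omega>" shows "connected \<Omega>"
  using assms
proof (cases rule: standard_domain_cases)
  case 1 then show ?thesis by (simp add: connected_UNIV_sphere)
next
  case 2 then show ?thesis
    by (auto intro!: connected_continuous_image continuous_on_Some convex_connected)
next
  case 3 then show ?thesis
    by (auto intro!: connected_continuous_image continuous_on_Some convex_connected)
qed

lemma compact_Some_image: "compact A \<Longrightarrow> compact (Some ` (A :: complex set))"
  by (intro compact_continuous_image continuous_on_Some)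

lemma standard_domain_exhaustion:
  assumes "standard_domain \<Omega>"
  shows "\<exists>K :: nat \<Rightarrow> _. (\<forall>n. compact (K n)) \<and> (\<Union>n. K n) = \<Omega>"
  using assms
proof (cases rule: standard_domain_cases)
  case 1
  then show ?thesis using compact_UNIV_sphere by (intro exI[of _ "\<lambda>_. UNIV"]) auto
next
  case 2
  have "(\<Union>n. Some ` cball (0::complex) (real n)) = range Some"
  proof (intro equalityI subsetI)
    fix x assume "x \<in> range (Some :: complex \<Rightarrow> _)"
    then obtain v :: complex where v: "x = Some v" by blast
    obtain n :: nat where "norm v \<le> real n" using real_arch_simple by blast
    then have "x \<in> Some ` cball 0 (real n)" using v by simp
    then show "x \<in> (\<Union>n. Some ` cball (0::complex) (real n))" by blast
  qed auto
  then show ?thesis using 2 by (intro exI[of _ "\<lambda>n. Some ` cball 0 (real n)"]) (simp add: compact_Some_image)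
next
  case 3
  have "(\<Union>n. Some ` cball (0::complex) (1 - 1 / real (Suc n))) = Some ` ball 0 1"
  proof (intro equalityI subsetI)
    fix x assume "x \<in> Some ` ball (0::complex) 1"
    then obtain v :: complex where v: "x = Some v" "norm v < 1" by auto
    then obtain n :: nat where "1 / real (Suc n) < 1 - norm v"
      using reals_Archimedean[of "1 - norm v"] by (auto simp: inverse_eq_divide)
    then have "x \<in> Some ` cball 0 (1 - 1 / real (Suc n))" using v by simp
    then show "x \<in> (\<Union>n. Some ` cball (0::complex) (1 - 1 / real (Suc n)))" by blast
  next
    fix x assume "x \<in> (\<Union>n. Some ` cball (0::complex) (1 - 1 / real (Suc n)))"
    then obtain n v where v: "x = Some v" "norm v \<le> 1 - 1 / real (Suc n)" by auto
    moreover have "1 / real (Suc n) > 0" by simp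
    ultimately have "norm v < 1" by linarith
    then show "x \<in> Some ` ball 0 1" using v by auto
  qed
  then show ?thesis using 3 by (intro exI[of _ "\<lambda>n. Some ` cball 0 (1 - 1 / real (Suc n))"]) (simp add: compact_Some_image)
qed

lemma compact_subset_standard_domain:
  assumes "standard_domain \<Omega>" "\<Omega> \<noteq> UNIV" "compact K" "K \<subseteq> \<Omega>"
  obtains R where "0 < R" "K \<subseteq> Some ` cball 0 R" "Some ` cball 0 R \<subseteq> \<Omega>" "\<Omega> = range Some \<or> R < 1"
proof -
  have K: "K \<subseteq> range Some" using assms by (cases rule: standard_domain_cases[OF assms(1)]) auto
  have c: "compact (finite_part ` K)"
    by (rule compact_continuous_image[OF continuous_on_finite_part[OF K] assms(3)])
  have in_K: "Some v \<in> K" if "v \<in> finite_part ` K" for v using that K by auto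
  have sub: "K \<subseteq> Some ` cball 0 R" if "\<And>v. v \<in> finite_part ` K \<Longrightarrow> norm v \<le> R" for R
  proof
    fix x assume "x \<in> K"
    then obtain v where "x = Some v" using K by blast
    moreover from this have "v \<in> finite_part ` K" using \<open>x \<in> K\<close> by force
    ultimately show "x \<in> Some ` cball 0 R" using that by auto
  qed
  from assms(1) show thesis
  proof (cases rule: standard_domain_cases)
    case 1 then show ?thesis using assms by simp
  next
    case 2
    obtain B where "\<And>v. v \<in> finite_part ` K \<Longrightarrow> norm v \<le> B"
      using compact_imp_bounded[OF c] unfolding bounded_iff by blast
    then show ?thesis using 2 by (intro that[of "max B 1"] sub) (auto simp: le_max_iff_disj)
  next
    case 3
    show ?thesis
    proof (cases "K = {}")
      case True then show ?thesis using 3 by (intro that[of "1/2"]) auto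
    next
      case False
      then obtain u where u: "u \<in> finite_part ` K" "\<And>v. v \<in> finite_part ` K \<Longrightarrow> norm v \<le> norm u"
        using continuous_attains_sup[OF c, of norm] by (auto intro: continuous_intros)
      then have "norm u < 1" using in_K[OF u(1)] 3 assms(4) by auto
      \<comment> \<open>The value 1/2 ensures a positive radius even when 0 is the only point of
        \<open>K\<close>.\<close>
      then show ?thesis using 3 u(2)
        by (intro that[of "max (norm u) (1/2)"] sub) (auto simp: le_max_iff_disj)
    qed
  qed
qed

text \<open>\<open>K\<close> is enlarged to a closed round disc; what remains of the plane or of the
  unit disk is the exterior of a disc or an annulus. On the sphere everything may be removed, and
  the empty set is connected.\<close>

lemma standard_domain_ends:
  assumes "standard_domain \<Omega>" "compact K" "K \<subseteq> \<Omega>"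
  shows "\<exists>K'. compact K' \<and> K \<subseteq> K' \<and> K' \<subseteq> \<Omega> \<and> connected (\<Omega> - K')"
proof (cases "\<Omega> = UNIV")
  case True
  then show ?thesis using compact_UNIV_sphere by (intro exI[of _ UNIV]) auto
next
  case False
  then obtain R where R: "0 < R" "K \<subseteq> Some ` cball 0 R" "Some ` cball 0 R \<subseteq> \<Omega>" "\<Omega> = range Some \<or> R < 1"
    using compact_subset_standard_domain assms by metis
  have "connected (\<Omega> - Some ` cball 0 R)"
    using assms(1)
  proof (cases rule: standard_domain_cases)
    case 2
    have "connected (- cball (0::complex) R)"
      by (intro connected_complement_bounded_convex) auto
    moreover have "\<Omega> - Some ` cball 0 R = Some ` (- cball 0 R)" using 2 by auto
    ultimately show ?thesis by (auto intro!: connected_continuous_image continuous_on_Some)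
  next
    case 3
    have "connected {x::complex. R < norm (x - 0) \<and> norm (x - 0) < 1}"
      by (rule connected_annulus) simp
    moreover have "\<Omega> - Some ` cball 0 R = Some ` {x::complex. R < norm (x - 0) \<and> norm (x - 0) < 1}"
      using 3 by (auto simp: image_iff)
    ultimately show ?thesis by (auto intro!: connected_continuous_image continuous_on_Some)
  qed (use False in auto)
  then show ?thesis using R compact_Some_image[of "cball 0 R"] by (intro exI[of _ "Some ` cball 0 R"]) auto
qed

section \<open>Nonconstancy, and limits at the boundary\<close>

definition locally_const :: "complex option set \<Rightarrow> (complex option \<Rightarrow> complex option) \<Rightarrow> complex option \<Rightarrow> bool" where
  "locally_const \<Omega> w z \<longleftrightarrow> (\<exists>N. open N \<and> z \<in> N \<and> (\<forall>x\<in>N \<inter> \<Omega>. w x = w z))"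

text \<open>In charts, the local expression either vanishes on a disc or has an isolated zero at 0.
  In the second case the identity theorem excludes local constancy at all nearby points as well, so
  that both alternatives are open conditions, as \<open>locally_const_imp_const\<close>
  requires.\<close>

lemma meromorphic_local_dichotomy:
  assumes o: "open \<Omega>" and m: "meromorphic_map \<Omega> w" and z: "z \<in> \<Omega>"
  obtains N where "open N" "z \<in> N" "N \<subseteq> \<Omega>" "\<And>x. x \<in> N \<Longrightarrow> w x = w z"
  | N where "open N" "z \<in> N" "N \<subseteq> \<Omega>" "\<And>x. x \<in> N - {z} \<Longrightarrow> w x \<noteq> w z" "\<And>x. x \<in> N \<Longrightarrow> \<not> locally_const \<Omega> w x"
     "\<And>U. open U \<Longrightarrow> z \<in> U \<Longrightarrow> U \<subseteq> N \<Longrightarrow> w z \<in> interior (w ` U)"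
proof -
  define f where "f = local_expression w z"
  have f0: "f 0 = 0" by (simp add: f_def)
  obtain r where r: "r > 0" "sphere_chart z ` ball 0 r \<subseteq> \<Omega>" "f holomorphic_on ball 0 r"
    "\<And>\<zeta>. \<zeta> \<in> ball 0 r \<Longrightarrow> w (sphere_chart z \<zeta>) = sphere_chart (w z) (f \<zeta>)"
    using meromorphic_local_rep[OF assms] unfolding f_def by metis
  show thesis
  proof (cases "\<forall>\<zeta>\<in>ball 0 r. f \<zeta> = 0")
    case True
    show ?thesis
    proof (rule that(1)[of "sphere_chart z ` ball 0 r"])
      show "z \<in> sphere_chart z ` ball 0 r" using r(1) by (intro image_eqI[of _ _ 0]) auto
      show "w x = w z" if "x \<in> sphere_chart z ` ball 0 r" for x using that r(4) True by auto
    qed (use r in \<open>auto intro: open_sphere_chart_image\<close>)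
  next
    case False
    then obtain \<beta> where \<beta>: "\<beta> \<in> ball 0 r" "f \<beta> \<noteq> 0" by blast
    have z0: "0 \<in> ball (0::complex) r" using r(1) by simp
    have "\<exists>s>0. ball (0::complex) s \<subseteq> ball 0 r \<and> (\<forall>\<zeta>\<in>ball 0 s - {0}. f \<zeta> \<noteq> 0)"
    proof (rule isolated_zeros[OF r(3) open_ball connected_ball z0 f0 \<beta>])
      fix s assume "0 < s" "ball (0::complex) s \<subseteq> ball 0 r" "\<And>\<zeta>. \<zeta> \<in> ball 0 s - {0} \<Longrightarrow> f \<zeta> \<noteq> 0"
      then show ?thesis by (intro exI[of _ s] conjI ballI)
    qed
    then obtain s where s: "s > 0" "ball (0::complex) s \<subseteq> ball 0 r" "\<And>\<zeta>. \<zeta> \<in> ball 0 s - {0} \<Longrightarrow> f \<zeta> \<noteq> 0"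
      by metis
    have hs: "f holomorphic_on ball 0 s" using holomorphic_on_subset[OF r(3) s(2)] .
    have ne: "complex_of_real (s / 2) \<in> ball 0 s - {0}" using s(1) by (auto simp del: of_real_divide)
    show ?thesis
    proof (rule that(2)[of "sphere_chart z ` ball 0 s"])
      show "z \<in> sphere_chart z ` ball 0 s" using s(1) by (intro image_eqI[of _ _ 0]) auto
      show "open (sphere_chart z ` ball 0 s)" by (intro open_sphere_chart_image open_ball)
      show "sphere_chart z ` ball 0 s \<subseteq> \<Omega>" using r(2) s(2) by blast
      show "w x \<noteq> w z" if x: "x \<in> sphere_chart z ` ball 0 s - {z}" for x
      proof -
        obtain \<zeta> where \<zeta>: "\<zeta> \<in> ball 0 s" "x = sphere_chart z \<zeta>" using x by blast
        then have "\<zeta> \<noteq> 0" using x by auto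
        then have "f \<zeta> \<noteq> 0" using s(3) \<zeta> by auto
        moreover have "w x = sphere_chart (w z) (f \<zeta>)" using r(4) \<zeta> s(2) by blast
        ultimately show ?thesis by (metis sphere_coord_chart sphere_coord_self)
      qed
      show "\<not> locally_const \<Omega> w x" if x: "x \<in> sphere_chart z ` ball 0 s" for x
      proof
        assume "locally_const \<Omega> w x"
        then obtain N where N: "open N" "x \<in> N" "\<And>y. y \<in> N \<inter> \<Omega> \<Longrightarrow> w y = w x" by (auto simp: locally_const_def)
        obtain \<zeta>0 where \<zeta>0: "\<zeta>0 \<in> ball 0 s" "x = sphere_chart z \<zeta>0" using x by blast
        define U where "U = ball 0 s \<inter> sphere_chart z -` N"
        have oU: "open U" unfolding U_def
          by (rule continuous_open_preimage[OF continuous_on_sphere_chart open_ball N(1)])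
        have *: "f \<zeta> = f \<zeta>0" if "\<zeta> \<in> U" for \<zeta>
        proof -
          have "\<zeta> \<in> ball 0 r" using that s(2) unfolding U_def by blast
          then have "sphere_chart z \<zeta> \<in> N \<inter> \<Omega>" using that r(2) unfolding U_def by blast
          then have "w (sphere_chart z \<zeta>) = w (sphere_chart z \<zeta>0)" using N(3) \<zeta>0 by blast
          moreover have "\<zeta> \<in> ball 0 r" "\<zeta>0 \<in> ball 0 r" using that \<zeta>0(1) s(2) unfolding U_def by blast+
          ultimately have "sphere_chart (w z) (f \<zeta>) = sphere_chart (w z) (f \<zeta>0)" using r(4) by metis
          then show ?thesis by (metis sphere_coord_chart)
        qed
        have const: "f \<zeta> = f \<zeta>0" if "\<zeta> \<in> ball 0 s" for \<zeta>
        proof (rule analytic_continuation_open[of U "ball 0 s" f "\<lambda>_. f \<zeta>0"])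
          show "U \<noteq> {}" using \<zeta>0 N by (auto simp: U_def)
        qed (use oU hs that * in \<open>auto simp: U_def\<close>)
        have "0 \<in> ball (0::complex) s" using s(1) by simp
        then have "f (complex_of_real (s / 2)) = f 0"
          using const[of "complex_of_real (s / 2)"] const[of 0] ne by auto
        then show False using s(3)[OF ne] f0 by simp
      qed
      show "w z \<in> interior (w ` U)" if U: "open U" "z \<in> U" "U \<subseteq> sphere_chart z ` ball 0 s" for U
      proof -
        define U' where "U' = ball 0 s \<inter> sphere_chart z -` U"
        have oU: "open U'" unfolding U'_def
          by (rule continuous_open_preimage[OF continuous_on_sphere_chart open_ball U(1)])
        have nc: "\<not> f constant_on ball 0 s"
        proof
          assume "f constant_on ball 0 s"
          then obtain c where c: "\<And>\<zeta>. \<zeta> \<in> ball 0 s \<Longrightarrow> f \<zeta> = c" by (auto simp: constant_on_def)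
          have "f (complex_of_real (s / 2)) = f 0" using c[of 0] c[of "complex_of_real (s / 2)"] ne s(1) by auto
          then show False using s(3)[OF ne] f0 by simp
        qed
        have "open (f ` U')"
          by (rule open_mapping_thm[OF hs open_ball connected_ball oU _ nc]) (auto simp: U'_def)
        then have "open (sphere_chart (w z) ` f ` U')" by (rule open_sphere_chart_image)
        moreover have "sphere_chart (w z) ` f ` U' \<subseteq> w ` U"
        proof (rule image_subsetI)
          fix y assume "y \<in> f ` U'"
          then obtain \<zeta> where \<zeta>: "\<zeta> \<in> U'" "y = f \<zeta>" by blast
          then have "\<zeta> \<in> ball 0 r" "sphere_chart z \<zeta> \<in> U" using s(2) unfolding U'_def by blast+
          then show "sphere_chart (w z) y \<in> w ` U" using r(4) \<zeta>(2) by (metis imageI)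
        qed
        moreover have "w z \<in> sphere_chart (w z) ` f ` U'"
        proof -
          have "0 \<in> U'" using U s by (simp add: U'_def)
          then have "f 0 \<in> f ` U'" by (rule imageI)
          then have "sphere_chart (w z) (f 0) \<in> sphere_chart (w z) ` f ` U'" by (rule imageI)
          then show ?thesis using f0 by simp
        qed
        ultimately show ?thesis by (meson interiorI)
      qed
    qed
  qed
qed

lemma locally_const_imp_const:
  assumes o: "open \<Omega>" "connected \<Omega>" and m: "meromorphic_map \<Omega> w" and a: "a \<in> \<Omega>" "locally_const \<Omega> w a"
    and x: "x \<in> \<Omega>"
  shows "w x = w a"
proof -
  have all: "locally_const \<Omega> w x" if "x \<in> \<Omega>" for x
  proof (rule connected_induction_simple[OF o(2) a(1) that, where P = "locally_const \<Omega> w"])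
    fix z assume z: "z \<in> \<Omega>"
    show "\<exists>T. openin (top_of_set \<Omega>) T \<and> z \<in> T \<and>
        (\<forall>x\<in>T. \<forall>y\<in>T. locally_const \<Omega> w x \<longrightarrow> locally_const \<Omega> w y)"
    proof (rule meromorphic_local_dichotomy[OF o(1) m z])
      fix N assume N: "open N" "z \<in> N" "N \<subseteq> \<Omega>" "\<And>x. x \<in> N \<Longrightarrow> w x = w z"
      have "locally_const \<Omega> w y" if "y \<in> N" for y
        unfolding locally_const_def using N(1) that N(4)[OF that] N(4) by (metis IntD1)
      moreover have "openin (top_of_set \<Omega>) N" by (rule open_subset[OF N(3,1)])
      ultimately show ?thesis using N(2) by blast
    next
      fix N assume N: "open N" "z \<in> N" "N \<subseteq> \<Omega>" "\<And>x. x \<in> N \<Longrightarrow> \<not> locally_const \<Omega> w x"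
      then have "openin (top_of_set \<Omega>) N" by (intro open_subset)
      then show ?thesis using N(2,4) by blast
    qed
  qed (rule a(2))
  show ?thesis
  proof (rule connected_induction_simple[OF o(2) a(1) x, where P = "\<lambda>x. w x = w a"])
    fix z assume z: "z \<in> \<Omega>"
    obtain N where N: "open N" "z \<in> N" "\<And>x. x \<in> N \<inter> \<Omega> \<Longrightarrow> w x = w z"
      using all[OF z] by (auto simp: locally_const_def)
    then have "\<forall>x\<in>N \<inter> \<Omega>. \<forall>y\<in>N \<inter> \<Omega>. w x = w a \<longrightarrow> w y = w a" by metis
    moreover have "openin (top_of_set \<Omega>) (N \<inter> \<Omega>)"
      using openin_open_Int[OF N(1), of \<Omega>] by (simp only: Int_commute)
    ultimately show "\<exists>T. openin (top_of_set \<Omega>) T \<and> z \<in> T \<and> (\<forall>x\<in>T. \<forall>y\<in>T. w x = w a \<longrightarrow> w y = w a)"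
      using N(2) z by blast
  qed simp
qed

lemma at_left_nontrivial: "at_left (1::real) \<noteq> bot"
  by simp

text \<open>For a constant map all critical values and all limits along paths coincide with its one
  value, leaving at most one singular value. This also disposes of the constant infinity, which
  \<open>meromorphic_map\<close> admits.\<close>

lemma meromorphic_not_locally_const:
  assumes o: "open \<Omega>" "connected \<Omega>" and m: "meromorphic_map \<Omega> w"
    and card: "finite (singular_values \<Omega> w)" "2 \<le> card (singular_values \<Omega> w)" and a: "a \<in> \<Omega>"
  shows "\<not> locally_const \<Omega> w a"
proof
  assume "locally_const \<Omega> w a"
  note c = locally_const_imp_const[OF o m a this]
  have "singular_values \<Omega> w \<subseteq> {w a}"
  proof
    fix b assume "b \<in> singular_values \<Omega> w"
    then consider "b \<in> w ` {p. critical_point \<Omega> w p}" | "asymptotic_value \<Omega> w b"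
      by (auto simp: singular_values_def)
    then show "b \<in> {w a}"
    proof cases
      case 1 then show ?thesis using c unfolding critical_point_def by blast
    next
      case 2
      then obtain \<gamma> where \<gamma>: "\<gamma> ` {0..<1::real} \<subseteq> \<Omega>" "((w \<circ> \<gamma>) \<longlongrightarrow> b) (at_left 1)"
        by (auto simp: asymptotic_value_def continuous_map_in_subtopology)
      have "\<forall>\<^sub>F t in at_left (1::real). (w \<circ> \<gamma>) t = w a"
        using eventually_at_left_real[of 0 1]
      proof (rule eventually_mono)
        fix t :: real assume "t \<in> {0<..<1}"
        then have "\<gamma> t \<in> \<Omega>" using \<gamma>(1) by auto
        then show "(w \<circ> \<gamma>) t = w a" using c[of "\<gamma> t"] by (simp only: o_def)
      qed simp
      then have "((w \<circ> \<gamma>) \<longlongrightarrow> w a) (at_left 1)" by (rule tendsto_eventually)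
      then show ?thesis using tendsto_unique[OF at_left_nontrivial \<gamma>(2)] by simp
    qed
  qed
  then have "card (singular_values \<Omega> w) \<le> card {w a}" by (intro card_mono) auto
  then show False using card by simp
qed

text \<open>The extended map is continuous on the sphere. Read in the parameter 1/z at infinity and
  in the coordinate around \<open>p\<close>, it is analytic off the single point 0, which is a
  removable singularity.\<close>

lemma limit_at_infinity_extends:
  assumes m: "meromorphic_map (range Some) w"
    and lim: "\<And>V. open V \<Longrightarrow> p \<in> V \<Longrightarrow> \<exists>K. compact K \<and> K \<subseteq> range Some \<and> w ` (range Some - K) \<subseteq> V"
  shows "meromorphic_map UNIV (w(None := p))"
proof -
  let ?g = "w(None := p)"
  have cont: "continuous_on (range Some) w" using m by (simp add: meromorphic_map_def)
  have big: "\<exists>R>0. \<forall>v. R < norm v \<longrightarrow> w (Some v) \<in> V" if V: "open V" "p \<in> V" for V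
  proof -
    obtain K where K: "compact K" "K \<subseteq> range Some" "w ` (range Some - K) \<subseteq> V" using lim[OF V] by blast
    have ne: "range Some \<noteq> (UNIV :: complex option set)" by auto
    obtain R where R: "0 < R" "K \<subseteq> Some ` cball 0 R"
      by (rule compact_subset_standard_domain[OF _ ne K(1,2)]) (auto simp: standard_domain_def)
    have "w (Some v) \<in> V" if "R < norm v" for v
    proof -
      have "Some v \<notin> K" using R(2) that by auto
      then show ?thesis using K(3) by blast
    qed
    then show ?thesis using R(1) by blast
  qed
  have contg: "continuous_on UNIV ?g"
  proof (subst continuous_on_open_vimage[OF open_UNIV], intro allI impI)
    fix V :: "complex option set" assume V: "open V"
    have "open (range Some \<inter> w -` V)" using continuous_open_preimage[OF cont _ V] by simp
    moreover have "Some -` (?g -` V \<inter> UNIV) = Some -` (range Some \<inter> w -` V)" by auto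
    moreover have "\<exists>R. \<forall>v. R < norm v \<longrightarrow> Some v \<in> ?g -` V \<inter> UNIV" if "None \<in> ?g -` V \<inter> UNIV"
      using big[OF V] that by auto
    ultimately show "open (?g -` V \<inter> UNIV)" by (simp only: open_sphere_iff) blast
  qed
  have "local_expression ?g z analytic_on {0}" for z
  proof (cases z)
    case (Some a)
    have "local_expression ?g (Some a) = local_expression w (Some a)"
      by (auto simp: local_expression_def)
    then show ?thesis using m Some by (auto simp: meromorphic_map_def)
  next
    case None
    obtain R where R: "R > 0" "\<And>v. R < norm v \<Longrightarrow> w (Some v) \<in> - {antipode p}"
      using big[of "- {antipode p}"] by auto
    define h where "h = local_expression ?g None"
    have eq: "h \<zeta> = sphere_coord p (w (Some (1 / \<zeta>)))" if "\<zeta> \<noteq> 0" for \<zeta>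
      using that by (simp add: h_def local_expression_def)
    have ball: "R < norm (1 / \<zeta>)" if "\<zeta> \<in> ball 0 (1 / R)" "\<zeta> \<noteq> 0" for \<zeta> :: complex
      using that R(1) by (simp add: norm_divide field_simps)
    have an: "h analytic_on {\<zeta>}" if \<zeta>: "\<zeta> \<in> ball 0 (1 / R)" "\<zeta> \<noteq> 0" for \<zeta>
    proof -
      have "(\<lambda>u. sphere_coord p (w (Some u))) analytic_on {1 / \<zeta>}"
        by (rule analytic_sphere_coord[of "range Some"]) (use m R(2)[OF ball[OF \<zeta>]] in auto)
      then have "((\<lambda>u. sphere_coord p (w (Some u))) \<circ> (\<lambda>\<zeta>. 1 / \<zeta>)) analytic_on {\<zeta>}"
        using \<zeta> by (intro analytic_on_compose) (auto intro!: analytic_intros)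
      moreover have "\<forall>\<^sub>F u in nhds \<zeta>. h u = ((\<lambda>u. sphere_coord p (w (Some u))) \<circ> (\<lambda>\<zeta>. 1 / \<zeta>)) u"
        unfolding eventually_nhds by (intro exI[of _ "- {0}"]) (use \<zeta> eq in \<open>auto intro: open_Compl\<close>)
      ultimately show ?thesis using analytic_at_cong[OF _ refl] by blast
    qed
    have "h holomorphic_on ball 0 (1 / R)"
    proof (rule no_isolated_singularity[of _ _ "{0}"])
      have "h = (\<lambda>\<zeta>. sphere_coord p (?g (sphere_chart None \<zeta>)))"
        by (auto simp: h_def local_expression_def)
      moreover have "continuous_on (ball 0 (1 / R)) (\<lambda>\<zeta>. sphere_coord p (?g (sphere_chart None \<zeta>)))"
      proof (rule continuous_on_compose2[OF continuous_on_sphere_coord[OF order_refl]])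
        show "continuous_on (ball 0 (1 / R)) (\<lambda>\<zeta>. ?g (sphere_chart None \<zeta>))"
          by (rule continuous_on_compose2[OF contg continuous_on_sphere_chart]) auto
        show "(\<lambda>\<zeta>. ?g (sphere_chart None \<zeta>)) ` ball 0 (1 / R) \<subseteq> - {antipode p}"
        proof (rule image_subsetI)
          fix \<zeta> assume "\<zeta> \<in> ball (0::complex) (1 / R)"
          then show "?g (sphere_chart None \<zeta>) \<in> - {antipode p}"
            using R(2)[OF ball[of \<zeta>]] by (cases "\<zeta> = 0") auto
        qed
      qed
      ultimately show "continuous_on (ball 0 (1 / R)) h" by simp
      have "h analytic_on (ball 0 (1 / R) - {0})"
        using an by (subst analytic_on_analytic_at) auto
      then show "h holomorphic_on (ball 0 (1 / R) - {0})" by (rule analytic_imp_holomorphic)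
    qed auto
    then have "h analytic_on {0}"
      using R(1) by (auto simp: analytic_at intro!: exI[of _ "ball 0 (1 / R)"])
    then show ?thesis using None by (simp add: h_def)
  qed
  then show ?thesis using contg by (simp add: meromorphic_map_def)
qed

lemma natural_boundary_plane_not_extendable:
  assumes "natural_boundary (range Some) w" "meromorphic_map UNIV g" "\<And>z. z \<in> range Some \<Longrightarrow> g z = w z"
  shows False
proof -
  have "None \<in> frontier (range (Some :: complex \<Rightarrow> _))"
    by (auto simp: frontier_def closure_range_Some interior_open)
  then have "\<not> (\<exists>V g. open V \<and> None \<in> V \<and> meromorphic_map V g \<and> (\<forall>z\<in>V \<inter> range Some. g z = w z))"
    using assms(1) unfolding natural_boundary_def by simp
  then show False
    using assms(2,3) by (metis IntD2 UNIV_I open_UNIV)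
qed

text \<open>In the plane a limit at the end would extend \<open>w\<close> meromorphically to
  infinity, against the natural boundary. In the unit disk the coordinate of \<open>w\<close> around
  \<open>p\<close> would tend to 0 along the whole circle, hence vanish on an annulus, and
  \<open>w\<close> would be locally constant.\<close>

lemma no_boundary_limit:
  assumes d: "standard_domain \<Omega>" "\<Omega> \<noteq> UNIV" and m: "meromorphic_map \<Omega> w" and nb: "natural_boundary \<Omega> w"
    and nc: "\<And>z. z \<in> \<Omega> \<Longrightarrow> \<not> locally_const \<Omega> w z"
  shows "\<exists>V. open V \<and> p \<in> V \<and> (\<forall>K. compact K \<longrightarrow> K \<subseteq> \<Omega> \<longrightarrow> \<not> w ` (\<Omega> - K) \<subseteq> V)"
proof (rule ccontr)
  assume "\<not> ?thesis"
  then have lim: "\<exists>K. compact K \<and> K \<subseteq> \<Omega> \<and> w ` (\<Omega> - K) \<subseteq> V" if "open V" "p \<in> V" for V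
    using that by metis
  from d(1) show False
  proof (cases rule: standard_domain_cases)
    case 2
    then show False
    proof -
      have a: "meromorphic_map UNIV (w(None := p))"
        by (rule limit_at_infinity_extends) (use m lim 2 in simp_all)
      have b: "natural_boundary (range Some) w" using nb 2 by simp
      have "(w(None := p)) z = w z" if "z \<in> range Some" for z using that by auto
      then show False by (rule natural_boundary_plane_not_extendable[OF b a])
    qed
  next
    case 3
    have far: "\<exists>R>0. R < 1 \<and> (\<forall>v. R < norm v \<and> norm v < 1 \<longrightarrow> w (Some v) \<in> V)" if V: "open V" "p \<in> V" for V
    proof -
      obtain K where K: "compact K" "K \<subseteq> \<Omega>" "w ` (\<Omega> - K) \<subseteq> V" using lim[OF V] by blast
      obtain R where R: "0 < R" "K \<subseteq> Some ` cball 0 R" "Some ` cball 0 R \<subseteq> \<Omega>" "\<Omega> = range Some \<or> R < 1"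
        by (rule compact_subset_standard_domain[OF d K(1,2)])
      have "\<Omega> \<noteq> range Some"
      proof
        assume "\<Omega> = range Some"
        then have "Some 2 \<in> Some ` ball (0::complex) 1" using 3 by blast
        then show False by auto
      qed
      moreover have "w (Some v) \<in> V" if "R < norm v" "norm v < 1" for v
      proof -
        have "Some v \<in> \<Omega> - K" using R(2) that 3 by auto
        then show ?thesis using K(3) by blast
      qed
      ultimately show ?thesis using R by blast
    qed
    obtain R where R: "R > 0" "R < 1" "\<And>v. R < norm v \<Longrightarrow> norm v < 1 \<Longrightarrow> w (Some v) \<in> - {antipode p}"
      using far[of "- {antipode p}"] by auto
    define f where "f v = sphere_coord p (w (Some v))" for v
    have zero: "f z = 0" if z: "R < norm z" "norm z < 1" for z
    proof (rule annulus_boundary_zero[OF R(1,2) _ _ z])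
      have "f analytic_on {z. R < norm z \<and> norm z < 1}"
      proof (subst analytic_on_analytic_at, intro ballI)
        fix a :: complex assume "a \<in> {z. R < norm z \<and> norm z < 1}"
        then show "f analytic_on {a}"
          unfolding f_def by (intro analytic_sphere_coord[of \<Omega>]) (use 3 m R(3)[of a] in auto)
      qed
      then show "f holomorphic_on {z. R < norm z \<and> norm z < 1}" by (rule analytic_imp_holomorphic)
      fix e :: real assume "e > 0"
      have oe: "open (sphere_chart p ` ball 0 e)" by (intro open_sphere_chart_image open_ball)
      have pe: "p \<in> sphere_chart p ` ball 0 e" using \<open>e > 0\<close> by (intro image_eqI[of _ _ 0]) auto
      obtain R' where R': "R' < 1" "\<And>v. R' < norm v \<Longrightarrow> norm v < 1 \<Longrightarrow> w (Some v) \<in> sphere_chart p ` ball 0 e"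
        using far[OF oe pe] by metis
      have "norm (f v) < e" if v: "R' < norm v" "norm v < 1" for v
      proof -
        obtain \<zeta> where "\<zeta> \<in> ball 0 e" "w (Some v) = sphere_chart p \<zeta>" using R'(2)[OF v] by blast
        then show ?thesis by (simp add: f_def)
      qed
      then show "\<exists>r<1. \<forall>z. r < norm z \<and> norm z < 1 \<longrightarrow> norm (f z) < e" using R'(1) by blast
    qed
    have wp: "w (Some v) = p" if "R < norm v" "norm v < 1" for v
    proof -
      have "sphere_chart p (f v) = w (Some v)"
        unfolding f_def using R(3)[OF that] by (intro sphere_chart_coord) auto
      then show ?thesis using zero[OF that] by simp
    qed
    define a where "a = complex_of_real ((R + 1) / 2)"
    have a: "R < norm a" "norm a < 1" using R by (auto simp: a_def simp del: of_real_divide of_real_add)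
    have "open {v::complex. R < norm v \<and> norm v < 1}"
      by (intro open_Collect_conj open_Collect_less continuous_intros)
    then have "locally_const \<Omega> w (Some a)"
      unfolding locally_const_def
      by (intro exI[of _ "Some ` {v. R < norm v \<and> norm v < 1}"]) (use a wp in auto)
    moreover have "Some a \<in> \<Omega>" using 3 a by auto
    ultimately show False using nc by blast
  qed (use d in auto)
qed

text \<open>The bridge from function theory to topology: nonsingular values have no critical
  preimages, which gives local injectivity, and are no asymptotic values, which gives
  \<open>no_asym\<close>.\<close>

theorem speiser_branched:
  assumes "speiser_function \<Omega> w q"
  shows "branched \<Omega> w (singular_values \<Omega> w)"
proof -
  have d: "standard_domain \<Omega>" and m: "meromorphic_map \<Omega> w" and nb: "natural_boundary \<Omega> w"
    and fin: "finite (singular_values \<Omega> w)" and card: "2 \<le> card (singular_values \<Omega> w)"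
    using assms unfolding speiser_function_def standard_domain_def by (simp_all only: simp_thms)
  have o: "open \<Omega>" and c: "connected \<Omega>" by (rule standard_domain_open[OF d], rule standard_domain_connected[OF d])
  have nc: "\<not> locally_const \<Omega> w z" if "z \<in> \<Omega>" for z
    by (rule meromorphic_not_locally_const[OF o c m fin card that])
  have loc: "\<exists>N. open N \<and> z \<in> N \<and> N \<subseteq> \<Omega> \<and> (\<forall>x\<in>N - {z}. w x \<noteq> w z) \<and>
      (\<forall>U. open U \<longrightarrow> z \<in> U \<longrightarrow> U \<subseteq> N \<longrightarrow> w z \<in> interior (w ` U))" if z: "z \<in> \<Omega>" for z
  proof (rule meromorphic_local_dichotomy[OF o m z])
    fix N assume N: "open N" "z \<in> N" "\<And>x. x \<in> N \<Longrightarrow> w x = w z"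
    then have "locally_const \<Omega> w z" unfolding locally_const_def by blast
    then show ?thesis using nc z by blast
  next
    fix N assume "open N" "z \<in> N" "N \<subseteq> \<Omega>" "\<And>x. x \<in> N - {z} \<Longrightarrow> w x \<noteq> w z"
      "\<And>U. open U \<Longrightarrow> z \<in> U \<Longrightarrow> U \<subseteq> N \<Longrightarrow> w z \<in> interior (w ` U)"
    then show ?thesis by (intro exI[of _ N]) auto
  qed
  show ?thesis
  proof
    show "open \<Omega>" by fact
    show "\<Omega> \<noteq> {}" using d by (auto elim!: standard_domain_cases)
    show "continuous_on \<Omega> w" using m by (simp add: meromorphic_map_def)
    show "finite (singular_values \<Omega> w)" by fact
    show "\<exists>N. open N \<and> z \<in> N \<and> N \<subseteq> \<Omega> \<and> inj_on w N" if z: "z \<in> \<Omega>" "w z \<notin> singular_values \<Omega> w" for z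
    proof -
      have "deriv (local_expression w z) 0 \<noteq> 0"
        using z by (auto simp: singular_values_def critical_point_def)
      moreover obtain r where r: "r > 0" "sphere_chart z ` ball 0 r \<subseteq> \<Omega>" "local_expression w z holomorphic_on ball 0 r"
        "\<And>\<zeta>. \<zeta> \<in> ball 0 r \<Longrightarrow> w (sphere_chart z \<zeta>) = sphere_chart (w z) (local_expression w z \<zeta>)"
        using meromorphic_local_rep[OF o m z(1)] by metis
      ultimately obtain s where s: "s > 0" "ball (0::complex) s \<subseteq> ball 0 r" "inj_on (local_expression w z) (ball 0 s)"
        using has_complex_derivative_locally_injective[OF r(3) _ open_ball] by (metis centre_in_ball)
      have "inj_on w (sphere_chart z ` ball 0 s)"
      proof (rule inj_onI)
        fix x y assume xy: "x \<in> sphere_chart z ` ball 0 s" "y \<in> sphere_chart z ` ball 0 s" "w x = w y"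
        then obtain \<zeta> \<eta> where *: "\<zeta> \<in> ball 0 s" "\<eta> \<in> ball 0 s" "x = sphere_chart z \<zeta>" "y = sphere_chart z \<eta>" by blast
        have "sphere_chart (w z) (local_expression w z \<zeta>) = sphere_chart (w z) (local_expression w z \<eta>)"
          using xy(3) * r(4) s(2) by (metis subsetD)
        then have "local_expression w z \<zeta> = local_expression w z \<eta>" by (metis sphere_coord_chart)
        then have "\<zeta> = \<eta>" using inj_onD[OF s(3) _ *(1,2)] by simp
        then show "x = y" using * by simp
      qed
      moreover have "z \<in> sphere_chart z ` ball 0 s" using s(1) by (intro image_eqI[of _ _ 0]) auto
      moreover have "open (sphere_chart z ` ball 0 s)" by (intro open_sphere_chart_image open_ball)
      moreover have "sphere_chart z ` ball 0 s \<subseteq> \<Omega>" using r(2) s(2) by blast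
      ultimately show ?thesis by blast
    qed
    show "open (w ` U)" if U: "open U" "U \<subseteq> \<Omega>" for U
    proof -
      have "w z \<in> interior (w ` U)" if "z \<in> U" for z
      proof -
        have "z \<in> \<Omega>" using that U by blast
        then obtain N where N: "open N" "z \<in> N" "\<And>U. open U \<Longrightarrow> z \<in> U \<Longrightarrow> U \<subseteq> N \<Longrightarrow> w z \<in> interior (w ` U)"
          using loc by metis
        then have "w z \<in> interior (w ` (U \<inter> N))" using U that by auto
        then show ?thesis using interior_mono[of "w ` (U \<inter> N)" "w ` U"] by blast
      qed
      then show ?thesis by (metis image_subsetI interior_eq interior_subset subset_antisym)
    qed
    show "\<exists>N. open N \<and> z \<in> N \<and> (\<forall>x\<in>N \<inter> \<Omega>. w x = w z \<longrightarrow> x = z)" if "z \<in> \<Omega>" for z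
      using loc[OF that] by blast
    show "\<exists>K. compact K \<and> K \<subseteq> \<Omega> \<and> (\<exists>\<^sub>F t in at_left 1. \<gamma> t \<in> K)"
      if \<gamma>: "continuous_on {0..<1::real} \<gamma>" "\<gamma> ` {0..<1} \<subseteq> \<Omega>" "((w \<circ> \<gamma>) \<longlongrightarrow> a) (at_left 1)"
        "a \<notin> singular_values \<Omega> w" for \<gamma> a
    proof (rule ccontr)
      assume "\<not> ?thesis"
      then have "\<forall>K. compact K \<and> K \<subseteq> \<Omega> \<longrightarrow> (\<forall>\<^sub>F t in at_left 1. \<gamma> t \<notin> K)"
        by (auto simp: frequently_def)
      then have "asymptotic_value \<Omega> w a"
        unfolding asymptotic_value_def using \<gamma> by (intro exI[of _ \<gamma>]) (auto simp: continuous_map_in_subtopology)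
      then show False using \<gamma>(4) by (simp add: singular_values_def)
    qed
    show "\<exists>V. open V \<and> p \<in> V \<and> (\<forall>K. compact K \<longrightarrow> K \<subseteq> \<Omega> \<longrightarrow> \<not> w ` (\<Omega> - K) \<subseteq> V)" if "\<Omega> \<noteq> UNIV" for p
      by (rule no_boundary_limit[OF d that m nb nc])
    show "\<exists>K'. compact K' \<and> K \<subseteq> K' \<and> K' \<subseteq> \<Omega> \<and> connected (\<Omega> - K')" if "compact K" "K \<subseteq> \<Omega>" for K
      by (rule standard_domain_ends[OF d that])
    show "\<exists>K :: nat \<Rightarrow> _. (\<forall>n. compact (K n)) \<and> (\<Union>n. K n) = \<Omega>"
      by (rule standard_domain_exhaustion[OF d])
  qed
qed

section \<open>Corners of a slit sphere\<close>

lemma connected_components_of_top_of_set: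
  "connected_components_of (top_of_set A) = {connected_component_set A x |x. x \<in> A}"
proof -
  have "connected_component_of (top_of_set A) x y \<longleftrightarrow> connected_component A x y" for x y
    unfolding connected_component_of_def connected_component_def
    by (auto simp: connectedin_subtopology connectedin_iff_connected)
  then show ?thesis unfolding connected_components_of_def by auto
qed

definition interior_points :: "geodesic \<Rightarrow> complex option set" where
  "interior_points e = segment_points e - endpoints e"

lemma endpoints_opposite [simp]: "endpoints (opposite e) = endpoints e"
  by (cases e) (auto simp: endpoints_def)

lemma interior_points_opposite [simp]: "interior_points (opposite e) = interior_points e"
  by (simp add: interior_points_def)

lemma source_in_segment: "source e \<in> segment_points e"
proof (cases e)
  case (Around a b)
  have "\<exists>t. a = a + of_real t * (a - b) \<and> 0 \<le> t" by (rule exI[of _ 0]) simp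
  then show ?thesis using Around by simp
next
  case (Outward a d)
  have "\<exists>t. a = a + of_real t * d \<and> 0 \<le> t" by (rule exI[of _ 0]) simp
  then show ?thesis using Outward by simp
qed auto

text \<open>
  A system of cuts forming an embedded chain: \<open>up\<close> and \<open>down\<close> are its two sides, \<open>inner\<close> is the chain
  without its two end points (these are the points at which the sheet has two corners),
  \<open>strip e\<close> is a neighbourhood of the relative interior of the cut \<open>e\<close>, and \<open>basic p\<close> is a neighbourhood
  basis at \<open>p\<close> adapted to the cuts.
\<close>

locale tame_cuts =
  fixes S :: "complex option set" and \<Xi> :: "geodesic set" and L up down inner :: "complex option set"
    and strip :: "geodesic \<Rightarrow> complex option set" and basic :: "complex option \<Rightarrow> complex option set \<Rightarrow> bool"
  assumes sheet_type: "sheet_type S \<Xi>" and L_def: "L = sheet \<Xi>"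
    and open_L: "open L" and LS: "L \<inter> S = {}" and star_L: "star_domain L"
    and up: "up \<subseteq> L" "open up" and down: "down \<subseteq> L" "open down" and up_down: "up \<inter> down = {}"
    and oriented: "\<And>e. e \<in> \<Xi> \<Longrightarrow> opposite e \<notin> \<Xi>"
    and strip: "\<And>e. e \<in> \<Xi> \<Longrightarrow> open (strip e)" "\<And>e. e \<in> \<Xi> \<Longrightarrow> strip e \<inter> S = {}"
      "\<And>e. e \<in> \<Xi> \<Longrightarrow> star_domain (strip e)"
      "\<And>e. e \<in> \<Xi> \<Longrightarrow> strip e - L = interior_points e"
      "\<And>e. e \<in> \<Xi> \<Longrightarrow> strip e \<inter> L \<subseteq> up \<union> down"
      "\<And>e. e \<in> \<Xi> \<Longrightarrow> connected (strip e \<inter> up)" "\<And>e. e \<in> \<Xi> \<Longrightarrow> connected (strip e \<inter> down)"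
      "\<And>e. e \<in> \<Xi> \<Longrightarrow> strip e \<inter> left_side e = strip e \<inter> up"
      "\<And>e. e \<in> \<Xi> \<Longrightarrow> strip e \<inter> left_side (opposite e) = strip e \<inter> down"
    and inner_interior: "\<And>e. e \<in> \<Xi> \<Longrightarrow> interior_points e \<subseteq> inner"
    and cut_points: "- L \<subseteq> S \<union> (\<Union>e\<in>\<Xi>. interior_points e)"
    and both_sides: "\<And>e x U. e \<in> \<Xi> \<Longrightarrow> x \<in> interior_points e \<Longrightarrow> open U \<Longrightarrow> x \<in> U \<Longrightarrow> U \<inter> up \<noteq> {} \<and> U \<inter> down \<noteq> {}"
    and edge_dense: "\<And>e p U. e \<in> \<Xi> \<Longrightarrow> p \<in> segment_points e \<Longrightarrow> open U \<Longrightarrow> p \<in> U \<Longrightarrow> U \<inter> interior_points e \<noteq> {}"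
    and basic_ex: "\<And>p U. open U \<Longrightarrow> p \<in> U \<Longrightarrow> \<exists>V. basic p V \<and> V \<subseteq> U"
    and basic: "\<And>p V. basic p V \<Longrightarrow> open V" "\<And>p V. basic p V \<Longrightarrow> p \<in> V" "\<And>p V. basic p V \<Longrightarrow> V \<inter> S \<subseteq> {p}"
      "\<And>p V Q. basic p V \<Longrightarrow> Q \<in> (if p \<in> inner then {up, down} else {L}) \<Longrightarrow> connected (V \<inter> Q)"
      "\<And>p V Q. basic p V \<Longrightarrow> Q \<in> (if p \<in> inner then {up, down} else {L}) \<Longrightarrow> V \<inter> Q \<noteq> {}"
      "\<And>p V. basic p V \<Longrightarrow> p \<in> inner \<Longrightarrow> V \<inter> L \<subseteq> up \<union> down"
      "\<And>p V e. basic p V \<Longrightarrow> e \<in> \<Xi> \<Longrightarrow> V \<inter> interior_points e \<noteq> {} \<Longrightarrow> p \<in> segment_points e"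
begin

section \<open>Corners as boundary germs\<close>

text \<open>Corners at a point are encoded by global open sets: near \<open>p\<close>, the corner
  \<open>Q\<close> is the trace of \<open>Q\<close>. This is possible because the cuts form a single
  chain with two sides, and because at an end point of the chain, as at any point off it, the sheet
  has just one corner.\<close>

definition corners :: "complex option \<Rightarrow> complex option set set" where
  "corners p = (if p \<in> inner then {up, down} else {L})"

text \<open>Segments in \<Xi> are oriented so that \<open>up\<close> lies on their left; their
  opposites then have \<open>down\<close> on the left.\<close>

definition side :: "geodesic \<Rightarrow> complex option set" where
  "side e = (if e \<in> \<Xi> then up else down)"

definition strp :: "geodesic \<Rightarrow> complex option set" where
  "strp e = strip (if e \<in> \<Xi> then e else opposite e)"

abbreviation sides :: "geodesic set" where "sides \<equiv> boundary_sides \<Xi>"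

lemma finite_corners: "finite (corners p)" by (simp add: corners_def)

lemma corners_nonempty: "corners p \<noteq> {}" by (simp add: corners_def)

lemma corners_sub: "Q \<in> corners p \<Longrightarrow> Q \<subseteq> L" using up down by (auto simp: corners_def split: if_splits)

lemma corners_open: "Q \<in> corners p \<Longrightarrow> open Q" using up down open_L by (auto simp: corners_def split: if_splits)

lemma corners_disjoint: "Q \<in> corners p \<Longrightarrow> Q' \<in> corners p \<Longrightarrow> Q \<noteq> Q' \<Longrightarrow> Q \<inter> Q' = {}"
  using up_down by (auto simp: corners_def split: if_splits)

lemma basic_connected: "basic p V \<Longrightarrow> Q \<in> corners p \<Longrightarrow> connected (V \<inter> Q)"
  and basic_nonempty: "basic p V \<Longrightarrow> Q \<in> corners p \<Longrightarrow> V \<inter> Q \<noteq> {}"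
  using basic(4,5) by (auto simp: corners_def)

lemma basic_cover:
  assumes "basic p V" "v \<in> V" "v \<in> L" obtains Q where "Q \<in> corners p" "v \<in> Q"
  using basic(6)[OF assms(1)] assms by (cases "p \<in> inner") (auto simp: corners_def)

lemma dense_L: "open U \<Longrightarrow> U \<noteq> {} \<Longrightarrow> U \<inter> L \<noteq> {}"
proof -
  assume U: "open U" "U \<noteq> {}"
  then obtain x where "x \<in> U" by blast
  then obtain V where V: "basic x V" "V \<subseteq> U" using basic_ex[OF U(1)] by blast
  obtain Q where Q: "Q \<in> corners x" using corners_nonempty by blast
  show ?thesis using basic_nonempty[OF V(1) Q] corners_sub[OF Q] V(2) by blast
qed

lemma side_eq: "e \<in> sides \<Longrightarrow> side e = up \<and> side (opposite e) = down \<or> side e = down \<and> side (opposite e) = up"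
  using oriented by (auto simp: boundary_sides_def side_def)

lemma opposite_sides: "e \<in> sides \<Longrightarrow> opposite e \<in> sides"
  by (auto simp: boundary_sides_def)

lemma sides_cases: "e \<in> sides \<Longrightarrow> e \<in> \<Xi> \<or> opposite e \<in> \<Xi>"
  by (auto simp: boundary_sides_def)

lemma strp_opposite: "e \<in> sides \<Longrightarrow> strp (opposite e) = strp e"
  using oriented by (auto simp: boundary_sides_def strp_def)

lemma side_sub: "side e \<subseteq> L"
  using up down by (auto simp: side_def)

lemma strp:
  assumes "e \<in> sides"
  shows "open (strp e)" "strp e \<inter> S = {}" "star_domain (strp e)" "strp e - L = interior_points e"
    "strp e \<inter> L \<subseteq> side e \<union> side (opposite e)" "connected (strp e \<inter> side e)"
    "strp e \<inter> left_side e = strp e \<inter> side e"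
proof -
  have "open (strp e) \<and> strp e \<inter> S = {} \<and> star_domain (strp e) \<and> strp e - L = interior_points e \<and>
    strp e \<inter> L \<subseteq> side e \<union> side (opposite e) \<and> connected (strp e \<inter> side e) \<and> strp e \<inter> left_side e = strp e \<inter> side e"
  proof (cases "e \<in> \<Xi>")
    case True
    then have "strp e = strip e" "side e = up" "side (opposite e) = down"
      using oriented by (auto simp: strp_def side_def)
    then show ?thesis using strip[OF True] by auto
  next
    case False
    then have o: "opposite e \<in> \<Xi>" using assms sides_cases by blast
    then have "strp e = strip (opposite e)" "side e = down" "side (opposite e) = up"
      using False by (auto simp: strp_def side_def)
    then show ?thesis using strip[OF o] by auto
  qed
  then show "open (strp e)" "strp e \<inter> S = {}" "star_domain (strp e)" "strp e - L = interior_points e"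
    "strp e \<inter> L \<subseteq> side e \<union> side (opposite e)" "connected (strp e \<inter> side e)"
    "strp e \<inter> left_side e = strp e \<inter> side e" by blast+
qed

lemma interior_in_strp: "e \<in> sides \<Longrightarrow> x \<in> interior_points e \<Longrightarrow> x \<in> strp e \<and> x \<notin> L \<and> x \<notin> S"
  using strp(4)[of e] strp(2)[of e] by blast

lemma side_near:
  assumes "e \<in> sides" "x \<in> interior_points e" "open U" "x \<in> U" shows "U \<inter> side e \<noteq> {}"
proof -
  obtain f where f: "f \<in> \<Xi>" "x \<in> interior_points f" using assms sides_cases[of e] by (metis interior_points_opposite)
  then show ?thesis using both_sides[OF f assms(3,4)] by (auto simp: side_def)
qed

lemma edge_near:
  assumes "e \<in> sides" "p \<in> segment_points e" "open U" "p \<in> U" shows "U \<inter> interior_points e \<noteq> {}"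
  using edge_dense[of e p U] edge_dense[of "opposite e" p U] assms sides_cases[of e] by auto

lemma not_L_cases:
  assumes "x \<notin> L" "x \<notin> S" obtains e where "e \<in> sides" "x \<in> interior_points e"
  using cut_points assms by (auto simp: boundary_sides_def)

lemma basic_edge:
  assumes "basic p V" "e \<in> sides" "x \<in> V" "x \<in> interior_points e" shows "p \<in> segment_points e"
proof -
  obtain e' where e': "e' \<in> \<Xi>" "e' = e \<or> e' = opposite e" using sides_cases[OF assms(2)] by blast
  have "p \<in> segment_points e'"
    by (rule basic(7)[OF assms(1) e'(1)]) (use assms e' in auto)
  then show ?thesis using e' by auto
qed

lemma corner_of_side: "\<exists>Q\<in>corners p. side e \<subseteq> Q"
proof (cases "p \<in> inner")
  case True
  then have "side e \<in> corners p" by (simp add: corners_def side_def)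
  then show ?thesis by blast
next
  case False
  then have "L \<in> corners p" by (simp add: corners_def)
  then show ?thesis using side_sub by blast
qed

lemma side_meets_corner:
  assumes "e \<in> sides" "Q \<in> corners p" "x \<in> side e" "x \<in> Q" shows "side e \<subseteq> Q"
  using assms up_down side_sub[of e] unfolding corners_def side_def by (auto split: if_splits)

lemma side_nonempty: "e \<in> sides \<Longrightarrow> strp e \<inter> side e \<noteq> {}"
proof -
  assume e: "e \<in> sides"
  obtain e' where e': "e' \<in> \<Xi>" "e' = e \<or> e' = opposite e" using sides_cases[OF e] by blast
  have "UNIV \<inter> interior_points e' \<noteq> {}"
    by (rule edge_dense[OF e'(1) source_in_segment]) auto
  then obtain x where "x \<in> interior_points e" using e' by auto
  then show ?thesis using side_near[OF e _ strp(1)[OF e]] interior_in_strp[OF e] by blast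
qed

text \<open>Meant is the component of U \<inter> L that contains the corner \<open>Q\<close> near
  \<open>p\<close>. The union over all candidate points avoids a choice; by \<open>germ_eq\<close>
  only one component contributes.\<close>

definition germ :: "complex option \<Rightarrow> complex option set \<Rightarrow> complex option set \<Rightarrow> complex option set" where
  "germ p Q U = (if open U \<and> p \<in> U
     then \<Union>{connected_component_set (U \<inter> L) x |x. \<exists>V. basic p V \<and> V \<subseteq> U \<and> x \<in> V \<inter> Q} else {})"

text \<open>Two basic neighbourhoods contain a third, whose nonempty trace on \<open>Q\<close> lies
  in both of their connected traces; so all candidate points belong to the same component.\<close>

lemma germ_eq:
  assumes Q: "Q \<in> corners p" and U: "open U" and V: "basic p V" "V \<subseteq> U" "x \<in> V \<inter> Q"
  shows "germ p Q U = connected_component_set (U \<inter> L) x"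
proof -
  have QL: "Q \<subseteq> L" using corners_sub Q by blast
  have same: "connected_component_set (U \<inter> L) y = connected_component_set (U \<inter> L) x"
    if V': "basic p V'" "V' \<subseteq> U" "y \<in> V' \<inter> Q" for V' y
  proof -
    have "open (V \<inter> V')" "p \<in> V \<inter> V'" using basic(1,2) V V' by auto
    then obtain V'' where V'': "basic p V''" "V'' \<subseteq> V \<inter> V'" using basic_ex by metis
    then obtain u where u: "u \<in> V'' \<inter> Q" using basic_nonempty[OF V''(1) Q] by blast
    have "V \<inter> Q \<subseteq> U \<inter> L" "V' \<inter> Q \<subseteq> U \<inter> L" "u \<in> V \<inter> Q" "u \<in> V' \<inter> Q"
      using V(2) V'(2) V''(2) u QL by blast+
    then have "u \<in> connected_component_set (U \<inter> L) x" "u \<in> connected_component_set (U \<inter> L) y"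
      using connected_componentI[OF basic_connected[OF V(1) Q]] connected_componentI[OF basic_connected[OF V'(1) Q]]
        V(3) V'(3) by (simp_all only: mem_Collect_eq)
    then show ?thesis by (metis connected_component_eq)
  qed
  have "p \<in> U" using basic(2)[OF V(1)] V(2) by blast
  then have "germ p Q U = \<Union>{connected_component_set (U \<inter> L) x |x. \<exists>V. basic p V \<and> V \<subseteq> U \<and> x \<in> V \<inter> Q}"
    by (simp only: germ_def U simp_thms if_True)
  also have "{connected_component_set (U \<inter> L) x |x. \<exists>V. basic p V \<and> V \<subseteq> U \<and> x \<in> V \<inter> Q} = {connected_component_set (U \<inter> L) x}"
  proof (intro equalityI subsetI)
    fix C assume "C \<in> {connected_component_set (U \<inter> L) x |x. \<exists>V. basic p V \<and> V \<subseteq> U \<and> x \<in> V \<inter> Q}"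
    then obtain y V' where "C = connected_component_set (U \<inter> L) y" "basic p V'" "V' \<subseteq> U" "y \<in> V' \<inter> Q"
      by (elim CollectE exE conjE)
    then show "C \<in> {connected_component_set (U \<inter> L) x}" using same by (simp only: singleton_iff)
  next
    fix C assume "C \<in> {connected_component_set (U \<inter> L) x}"
    then show "C \<in> {connected_component_set (U \<inter> L) x |x. \<exists>V. basic p V \<and> V \<subseteq> U \<and> x \<in> V \<inter> Q}"
      using V by (intro CollectI exI[of _ x] conjI exI[of _ V]) auto
  qed
  finally show ?thesis by simp
qed

text \<open>The trace of \<open>V\<close> on \<open>Q\<close> is connected, and the corners are
  disjoint open sets covering the trace of \<open>V\<close> on \<open>L\<close>, so no component
  meets two of them.\<close>

lemma component_basic:
  assumes V: "basic p V" and Q: "Q \<in> corners p" "x \<in> V \<inter> Q"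
  shows "connected_component_set (V \<inter> L) x = V \<inter> Q"
proof
  show "V \<inter> Q \<subseteq> connected_component_set (V \<inter> L) x"
    by (rule connected_component_maximal[OF Q(2) basic_connected[OF V Q(1)]]) (use corners_sub[OF Q(1)] in blast)
  have "connected_component_set (V \<inter> L) x \<subseteq> Q"
  proof (rule connected_disjoint_UN[of _ "\<lambda>Q. Q" "corners p"])
    show "connected_component_set (V \<inter> L) x \<subseteq> (\<Union>Q\<in>corners p. Q)"
      using connected_component_subset[of "V \<inter> L" x] basic_cover[OF V] by blast
    show "connected_component_set (V \<inter> L) x \<inter> Q \<noteq> {}"
    proof -
      have "x \<in> V \<inter> L" using Q corners_sub[OF Q(1)] by blast
      then have "x \<in> connected_component_set (V \<inter> L) x" by (simp add: connected_component_refl)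
      then show ?thesis using Q(2) by blast
    qed
    show "connected (connected_component_set (V \<inter> L) x)" by (rule connected_connected_component)
    show "Q1 \<inter> Q2 = {}" if "Q1 \<in> corners p" "Q2 \<in> corners p" "Q1 \<noteq> Q2" for Q1 Q2
      by (rule corners_disjoint[OF that])
  qed (rule corners_open Q(1); assumption?)+
  then show "connected_component_set (V \<inter> L) x \<subseteq> V \<inter> Q"
    using connected_component_subset[of "V \<inter> L" x] by blast
qed

lemma germ_basic: "basic p V \<Longrightarrow> Q \<in> corners p \<Longrightarrow> germ p Q V = V \<inter> Q"
proof -
  assume V: "basic p V" and Q: "Q \<in> corners p"
  then obtain x where x: "x \<in> V \<inter> Q" using basic_nonempty by blast
  show ?thesis
    using germ_eq[OF Q basic(1)[OF V] V order_refl x] component_basic[OF V Q x] by simp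
qed

lemma germ_inj: "Q \<in> corners p \<Longrightarrow> Q' \<in> corners p \<Longrightarrow> germ p Q = germ p Q' \<Longrightarrow> Q = Q'"
proof (rule ccontr)
  assume Q: "Q \<in> corners p" "Q' \<in> corners p" "germ p Q = germ p Q'" "Q \<noteq> Q'"
  obtain V where V: "basic p V" using basic_ex[of UNIV p] by auto
  have "V \<inter> Q = V \<inter> Q'" using germ_basic[OF V] Q by metis
  then show False using corners_disjoint[OF Q(1,2,4)] basic_nonempty[OF V Q(1)] by blast
qed

lemma boundary_germ_germ:
  assumes Q: "Q \<in> corners p" shows "boundary_germ L p (germ p Q)"
  unfolding boundary_germ_def riemann_sphere_eq open_openin[symmetric] connected_components_of_top_of_set
proof (intro conjI allI impI)
  fix U assume U: "open U \<and> p \<in> U"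
  then obtain V where V: "basic p V" "V \<subseteq> U" using basic_ex by blast
  then obtain x where x: "x \<in> V \<inter> Q" using basic_nonempty Q by blast
  then have "x \<in> U \<inter> L" using V corners_sub[OF Q] by blast
  then show "germ p Q U \<in> {connected_component_set (U \<inter> L) x |x. x \<in> U \<inter> L}"
    using germ_eq[OF Q _ V x] U by blast
next
  fix U V assume UV: "open U \<and> open V \<and> p \<in> U \<and> U \<subseteq> V"
  then obtain B where B: "basic p B" "B \<subseteq> U" using basic_ex by blast
  then obtain x where x: "x \<in> B \<inter> Q" using basic_nonempty Q by blast
  have "germ p Q U = connected_component_set (U \<inter> L) x" "germ p Q V = connected_component_set (V \<inter> L) x"
    using germ_eq[OF Q _ B(1) _ x] UV B(2) order_trans[OF B(2)] by simp_all
  then show "germ p Q U \<subseteq> germ p Q V"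
    using connected_component_mono[of "U \<inter> L" "V \<inter> L" x] UV by auto
next
  fix U assume "\<not> (open U \<and> p \<in> U)"
  then show "germ p Q U = {}" by (auto simp: germ_def)
qed

text \<open>On a basic neighbourhood a germ has to select the trace of one corner, and coherence
  under shrinking forces the same corner each time; that corner then determines the component in
  every other neighbourhood.\<close>

lemma boundary_germ_iff: "boundary_germ L p C \<longleftrightarrow> (\<exists>Q\<in>corners p. C = germ p Q)"
proof
  assume C: "boundary_germ L p C"
  note C1 = C[unfolded boundary_germ_def riemann_sphere_eq open_openin[symmetric] connected_components_of_top_of_set]
  have comp: "\<exists>x\<in>U \<inter> L. C U = connected_component_set (U \<inter> L) x" if "open U" "p \<in> U" for U
  proof -
    have "C U \<in> {connected_component_set (U \<inter> L) x |x. x \<in> U \<inter> L}"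
      using conjunct1[OF C1] that by (simp only: simp_thms)
    then show ?thesis by (elim CollectE exE conjE) (rule bexI)
  qed
  have mono: "C U \<subseteq> C V" if "open U" "open V" "p \<in> U" "U \<subseteq> V" for U V
    using conjunct1[OF conjunct2[OF C1], rule_format, of U V] that by (simp only: simp_thms)
  have empty: "C U = {}" if "\<not> (open U \<and> p \<in> U)" for U
    using conjunct2[OF conjunct2[OF C1], rule_format, of U] that by (simp only: simp_thms)
  have cb: "\<exists>Q\<in>corners p. C V = V \<inter> Q" if V: "basic p V" for V
  proof -
    obtain x where x: "x \<in> V \<inter> L" "C V = connected_component_set (V \<inter> L) x" using comp[OF basic(1,2)[OF V]] by blast
    obtain Q where Q: "Q \<in> corners p" "x \<in> Q" using basic_cover[OF V, of x] x by blast
    then show ?thesis using component_basic[OF V Q(1), of x] x by auto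
  qed
  obtain V0 where V0: "basic p V0" using basic_ex[of UNIV p] by auto
  obtain Q where Q: "Q \<in> corners p" "C V0 = V0 \<inter> Q" using cb[OF V0] by blast
  have "C U = germ p Q U" for U
  proof (cases "open U \<and> p \<in> U")
    case False
    then show ?thesis using empty by (auto simp: germ_def)
  next
    case True
    then have "open (U \<inter> V0)" "p \<in> U \<inter> V0" using basic(1,2)[OF V0] by auto
    then obtain V where V: "basic p V" "V \<subseteq> U \<inter> V0" using basic_ex by metis
    obtain Q' where Q': "Q' \<in> corners p" "C V = V \<inter> Q'" using cb[OF V(1)] by blast
    have "C V \<subseteq> C V0" using mono[OF basic(1)[OF V(1)] basic(1)[OF V0] basic(2)[OF V(1)]] V by blast
    moreover obtain x where x: "x \<in> V \<inter> Q'" using basic_nonempty[OF V(1) Q'(1)] by blast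
    ultimately have "Q' = Q" using corners_disjoint[OF Q(1) Q'(1)] Q Q' by blast
    have "C V \<subseteq> C U" using mono[OF basic(1)[OF V(1)] _ basic(2)[OF V(1)]] V True by blast
    then have "x \<in> C U" using x Q' by blast
    moreover obtain y where "C U = connected_component_set (U \<inter> L) y" using comp True by blast
    ultimately have "C U = connected_component_set (U \<inter> L) x" by (metis connected_component_eq)
    also have "\<dots> = germ p Q U"
      using germ_eq[OF Q(1) _ V(1), of U x] V True x \<open>Q' = Q\<close> by auto
    finally show ?thesis .
  qed
  then show "\<exists>Q\<in>corners p. C = germ p Q" using Q(1) by blast
qed (use boundary_germ_germ in blast)

text \<open>Inside the strip of \<open>e\<close> the left half plane and the set
  \<open>side e\<close> have the same points, so the geometric condition becomes an inclusion
  between sets among \<open>up\<close>, \<open>down\<close> and \<open>L\<close>.\<close>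

lemma on_left_of_germ:
  assumes e: "e \<in> sides" and Q: "Q \<in> corners p"
  shows "on_left_of (p, germ p Q) e \<longleftrightarrow> p \<in> segment_points e \<and> side e \<subseteq> Q"
proof
  assume l: "on_left_of (p, germ p Q) e"
  then have pe: "p \<in> segment_points e" by simp
  obtain V where V: "basic p V" using basic_ex[of UNIV p] by auto
  obtain x W where x: "x \<in> V" "x \<in> interior_points e" "open W" "x \<in> W" "W \<inter> left_side e \<subseteq> germ p Q V"
    using l basic(1,2)[OF V] unfolding on_left_of.simps riemann_sphere_eq open_openin[symmetric] interior_points_def
    by blast
  have "open (W \<inter> strp e)" "x \<in> W \<inter> strp e" using x strp(1)[OF e] interior_in_strp[OF e x(2)] by auto
  then obtain y where y: "y \<in> W \<inter> strp e" "y \<in> side e" using side_near[OF e x(2)] by blast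
  then have "y \<in> left_side e" using strp(7)[OF e] by blast
  then have "y \<in> Q" using x(5) y germ_basic[OF V Q] by blast
  then show "p \<in> segment_points e \<and> side e \<subseteq> Q" using pe side_meets_corner[OF e Q y(2)] by blast
next
  assume *: "p \<in> segment_points e \<and> side e \<subseteq> Q"
  have "\<exists>x\<in>U \<inter> interior_points e. \<exists>V. open V \<and> x \<in> V \<and> V \<inter> left_side e \<subseteq> germ p Q U"
    if U: "open U" "p \<in> U" for U
  proof -
    obtain V where V: "basic p V" "V \<subseteq> U" using basic_ex[OF U] by blast
    obtain x where x: "x \<in> V" "x \<in> interior_points e" using edge_near[OF e _ basic(1,2)[OF V(1)]] * by blast
    have "V \<inter> strp e \<inter> left_side e \<subseteq> V \<inter> Q" using strp(7)[OF e] * by blast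
    also have "\<dots> = germ p Q V" using germ_basic[OF V(1) Q] by simp
    also have "\<dots> \<subseteq> germ p Q U"
      using boundary_germ_germ[OF Q] U V basic(1,2)[OF V(1)]
      unfolding boundary_germ_def riemann_sphere_eq open_openin[symmetric] by blast
    finally have "V \<inter> strp e \<inter> left_side e \<subseteq> germ p Q U" .
    moreover have "open (V \<inter> strp e)" "x \<in> V \<inter> strp e"
      using basic(1)[OF V(1)] strp(1)[OF e] x interior_in_strp[OF e] by auto
    ultimately show ?thesis using x V by blast
  qed
  then show "on_left_of (p, germ p Q) e"
    using * unfolding on_left_of.simps riemann_sphere_eq open_openin[symmetric] interior_points_def by blast
qed

end

section \<open>Corners and points of the surface\<close>

text \<open>The sections \<sigma> \<theta> are the sheets: their images partition the part of
  \<Omega> over \<open>L\<close>.\<close>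

locale glue = branched \<Omega> w S + tame_cuts S \<Xi> L up down inner strip basic
  for \<Omega> :: "complex option set" and w and S and \<Xi> and L up down inner strip basic +
  fixes I :: "nat set" and \<sigma> :: "nat \<Rightarrow> complex option \<Rightarrow> complex option"
  assumes sec: "\<And>\<theta>. \<theta> \<in> I \<Longrightarrow> sect L (\<sigma> \<theta>)"
    and sec_ex: "\<And>z. z \<in> \<Omega> \<Longrightarrow> w z \<in> L \<Longrightarrow> \<exists>\<theta>\<in>I. \<sigma> \<theta> (w z) = z"
    and sec_inj: "\<And>\<theta> \<theta>' v. \<theta> \<in> I \<Longrightarrow> \<theta>' \<in> I \<Longrightarrow> v \<in> L \<Longrightarrow> \<sigma> \<theta> v = \<sigma> \<theta>' v \<Longrightarrow> \<theta> = \<theta>'"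
begin

lemma sec_in: "\<theta> \<in> I \<Longrightarrow> v \<in> L \<Longrightarrow> \<sigma> \<theta> v \<in> \<Omega>"
  and sec_w: "\<theta> \<in> I \<Longrightarrow> v \<in> L \<Longrightarrow> w (\<sigma> \<theta> v) = v"
  using sec unfolding sect_def by blast+

lemma sec_open:
  assumes "\<theta> \<in> I" "open U" "U \<subseteq> L" shows "open (\<sigma> \<theta> ` U)"
proof (rule sect_open_image[OF assms(2) sect_subset[OF sec[OF assms(1)] assms(3)]])
  show "U \<inter> S = {}" using LS assms(3) by blast
qed

lemma sec_connected:
  assumes "\<theta> \<in> I" "connected U" "U \<subseteq> L" shows "connected (\<sigma> \<theta> ` U)"
  using sec[OF assms(1)] assms(2,3) unfolding sect_def
  by (blast intro: connected_continuous_image continuous_on_subset)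

section \<open>Crossing a cut\<close>

lemma strip_agree:
  assumes e: "e \<in> sides" and \<tau>: "sect (strp e) \<tau>" and \<theta>: "\<theta> \<in> I"
    and x: "x \<in> strp e \<inter> side e" "\<tau> x = \<sigma> \<theta> x" and y: "y \<in> strp e \<inter> side e"
  shows "\<tau> y = \<sigma> \<theta> y"
proof (rule sect_unique[of "strp e \<inter> side e" \<tau> "\<sigma> \<theta>" x y, OF strp(6)[OF e] _ _ _ x(1) x(2) y])
  show "strp e \<inter> side e \<inter> S = {}" using strp(2)[OF e] by blast
  show "sect (strp e \<inter> side e) \<tau>" by (rule sect_subset[OF \<tau>]) blast
  show "sect (strp e \<inter> side e) (\<sigma> \<theta>)" by (rule sect_subset[OF sec[OF \<theta>]]) (use side_sub[of e] in blast)
qed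

text \<open>
  \<open>\<tau>\<close> continues the section \<open>\<theta>\<close> across \<open>e\<close> into the section \<open>\<theta>'\<close>.
\<close>

definition spans :: "geodesic \<Rightarrow> (complex option \<Rightarrow> complex option) \<Rightarrow> nat \<Rightarrow> nat \<Rightarrow> bool" where
  "spans e \<tau> \<theta> \<theta>' \<longleftrightarrow> \<theta> \<in> I \<and> \<theta>' \<in> I \<and> sect (strp e) \<tau> \<and> (\<forall>v\<in>strp e \<inter> side e. \<tau> v = \<sigma> \<theta> v) \<and>
     (\<forall>v\<in>strp e \<inter> side (opposite e). \<tau> v = \<sigma> \<theta>' v)"

lemma strip_spans:
  assumes e: "e \<in> sides" and \<tau>: "sect (strp e) \<tau>"
  shows "\<exists>\<theta> \<theta>'. spans e \<tau> \<theta> \<theta>'"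
proof -
  have half: "\<exists>\<theta>\<in>I. \<forall>v\<in>strp f \<inter> side f. \<tau> v = \<sigma> \<theta> v" if f: "f \<in> sides" and \<tau>: "sect (strp f) \<tau>" for f
  proof -
    obtain x where x: "x \<in> strp f \<inter> side f" using side_nonempty[OF f] by blast
    then have "\<tau> x \<in> \<Omega>" "w (\<tau> x) = x" "x \<in> L" using \<tau> side_sub[of f] unfolding sect_def by blast+
    then obtain \<theta> where \<theta>: "\<theta> \<in> I" "\<sigma> \<theta> x = \<tau> x" using sec_ex[of "\<tau> x"] by auto
    then show ?thesis using strip_agree[OF f \<tau> \<theta>(1) x \<theta>(2)[symmetric]] by blast
  qed
  obtain \<theta> where "\<theta> \<in> I" "\<forall>v\<in>strp e \<inter> side e. \<tau> v = \<sigma> \<theta> v" using half[OF e \<tau>] by blast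
  moreover obtain \<theta>' where "\<theta>' \<in> I" "\<forall>v\<in>strp e \<inter> side (opposite e). \<tau> v = \<sigma> \<theta>' v"
    using half[OF opposite_sides[OF e]] \<tau> unfolding strp_opposite[OF e] by blast
  ultimately show ?thesis using \<tau> unfolding spans_def by blast
qed

lemma spans_opposite: "e \<in> sides \<Longrightarrow> spans e \<tau> \<theta> \<theta>' \<Longrightarrow> spans (opposite e) \<tau> \<theta>' \<theta>"
  unfolding spans_def by (simp add: strp_opposite)

text \<open>The strip is connected, so a section over it is determined by its values on one side.
  Hence the sheet reached across \<open>e\<close> depends only on \<open>e\<close> and \<theta>, not
  on the spanning section.\<close>

lemma spans_unique:
  assumes e: "e \<in> sides" and s: "spans e \<tau> \<theta> \<theta>1" "spans e \<tau>' \<theta> \<theta>2"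
  shows "\<theta>1 = \<theta>2"
proof -
  obtain x where x: "x \<in> strp e \<inter> side e" using side_nonempty[OF e] by blast
  obtain y where "y \<in> strp (opposite e) \<inter> side (opposite e)" using side_nonempty[OF opposite_sides[OF e]] by blast
  then have y: "y \<in> strp e \<inter> side (opposite e)" using strp_opposite[OF e] by simp
  have "\<tau> x = \<tau>' x" using s x unfolding spans_def by simp
  then have "\<tau> y = \<tau>' y"
    using sect_unique[of "strp e" \<tau> \<tau>' x y] s x y strp(2,3)[OF e] star_domain_connected unfolding spans_def by blast
  then have "\<sigma> \<theta>1 y = \<sigma> \<theta>2 y" using s y unfolding spans_def by simp
  moreover have "y \<in> L" using y side_sub by blast
  ultimately show ?thesis using sec_inj[of \<theta>1 \<theta>2 y] s unfolding spans_def by blast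
qed

lemma spans_exists:
  assumes e: "e \<in> sides" and \<theta>: "\<theta> \<in> I"
  shows "\<exists>\<theta>' \<tau>. spans e \<tau> \<theta> \<theta>'"
proof -
  obtain x where x: "x \<in> strp e \<inter> side e" using side_nonempty[OF e] by blast
  then have xL: "x \<in> L" using side_sub by blast
  have z: "\<sigma> \<theta> x \<in> \<Omega>" "w (\<sigma> \<theta> x) = x" using sec_in[OF \<theta> xL] sec_w[OF \<theta> xL] by auto
  have "w (\<sigma> \<theta> x) \<in> strp e" using z(2) x by simp
  then obtain \<tau> where "sect (strp e) \<tau>" "\<tau> (w (\<sigma> \<theta> x)) = \<sigma> \<theta> x"
    by (rule sect_exists[OF strp(3,2)[OF e] z(1)])
  then have \<tau>: "sect (strp e) \<tau>" "\<tau> x = \<sigma> \<theta> x" using z(2) by simp_all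
  obtain \<theta>1 \<theta>2 where s: "spans e \<tau> \<theta>1 \<theta>2" using strip_spans[OF e \<tau>(1)] by blast
  have "\<sigma> \<theta>1 x = \<sigma> \<theta> x" using s x \<tau>(2) unfolding spans_def by simp
  then have "\<theta>1 = \<theta>" using sec_inj[of \<theta>1 \<theta> x] s \<theta> xL unfolding spans_def by blast
  then show ?thesis using s by blast
qed

definition acr :: "nat \<Rightarrow> geodesic \<Rightarrow> nat" where
  "acr \<theta> e = (SOME \<theta>'. \<exists>\<tau>. spans e \<tau> \<theta> \<theta>')"

lemma acr: "e \<in> sides \<Longrightarrow> \<theta> \<in> I \<Longrightarrow> \<exists>\<tau>. spans e \<tau> \<theta> (acr \<theta> e)"
  unfolding acr_def using spans_exists by (rule someI_ex)

lemma spans_in: "spans e \<tau> \<theta> \<theta>' \<Longrightarrow> \<theta> \<in> I" "spans e \<tau> \<theta> \<theta>' \<Longrightarrow> \<theta>' \<in> I"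
  by (simp_all add: spans_def)

lemma acr_in: "e \<in> sides \<Longrightarrow> \<theta> \<in> I \<Longrightarrow> acr \<theta> e \<in> I"
  by (frule (1) acr) (auto dest: spans_in)

lemma acr_eq:
  assumes e: "e \<in> sides" and s: "spans e \<tau> \<theta> \<theta>'" shows "acr \<theta> e = \<theta>'"
proof -
  obtain \<tau>' where "spans e \<tau>' \<theta> (acr \<theta> e)" using acr[OF e spans_in(1)[OF s]] ..
  then show ?thesis using s by (rule spans_unique[OF e])
qed

lemma acr_back:
  assumes e: "e \<in> sides" and \<theta>: "\<theta> \<in> I" shows "acr (acr \<theta> e) (opposite e) = \<theta>"
proof -
  obtain \<tau> where "spans e \<tau> \<theta> (acr \<theta> e)" using acr[OF assms] ..
  then show ?thesis by (intro acr_eq[OF opposite_sides[OF e]] spans_opposite[OF e])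
qed

section \<open>Adjacent corners and components over a neighbourhood\<close>

text \<open>One step around \<open>p\<close>: the corner \<open>Q\<close> of \<theta> and the corner
  \<open>Q'\<close> of its neighbour share a segment containing \<open>p\<close>. The classes of
  this relation turn out to be the glueing classes over \<open>p\<close>.\<close>

definition adj :: "complex option \<Rightarrow> ((nat \<times> complex option set) \<times> (nat \<times> complex option set)) set" where
  "adj p = {((\<theta>, Q), (\<theta>', Q')). \<theta> \<in> I \<and> \<theta>' \<in> I \<and> Q \<in> corners p \<and> Q' \<in> corners p \<and>
     (\<exists>e\<in>sides. p \<in> segment_points e \<and> \<theta>' = acr \<theta> e \<and> side e \<subseteq> Q \<and> side (opposite e) \<subseteq> Q')}"

lemma adj_iff: "((\<theta>, Q), (\<theta>', Q')) \<in> adj p \<longleftrightarrow> \<theta> \<in> I \<and> \<theta>' \<in> I \<and> Q \<in> corners p \<and> Q' \<in> corners p \<and>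
     (\<exists>e\<in>sides. p \<in> segment_points e \<and> \<theta>' = acr \<theta> e \<and> side e \<subseteq> Q \<and> side (opposite e) \<subseteq> Q')"
  unfolding adj_def by simp

lemma adj_in: "(a, b) \<in> adj p \<Longrightarrow> b \<in> I \<times> corners p"
  by (cases a; cases b) (simp add: adj_iff)

lemma adj_sym: "(a, b) \<in> adj p \<Longrightarrow> (b, a) \<in> adj p"
proof -
  assume *: "(a, b) \<in> adj p"
  obtain \<theta> Q where a: "a = (\<theta>, Q)" by (cases a)
  obtain \<theta>' Q' where b: "b = (\<theta>', Q')" by (cases b)
  note ab = *[unfolded a b adj_iff]
  then obtain e where e: "e \<in> sides" "p \<in> segment_points e" "\<theta>' = acr \<theta> e" "side e \<subseteq> Q" "side (opposite e) \<subseteq> Q'"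
    by blast
  have "acr \<theta>' (opposite e) = \<theta>" using acr_back[OF e(1)] e(3) ab by simp
  then have "\<exists>e\<in>sides. p \<in> segment_points e \<and> \<theta> = acr \<theta>' e \<and> side e \<subseteq> Q' \<and> side (opposite e) \<subseteq> Q"
    using e opposite_sides[OF e(1)] by (intro bexI[of _ "opposite e"]) auto
  then show ?thesis using ab unfolding a b adj_iff by blast
qed

lemma adj_rtrancl_sym: "(a, b) \<in> (adj p)\<^sup>* \<Longrightarrow> (b, a) \<in> (adj p)\<^sup>*"
proof (induction rule: rtrancl_induct)
  case (step b c)
  then show ?case using adj_sym converse_rtrancl_into_rtrancl by metis
qed simp

lemma adj_rtrancl_in: "(a, b) \<in> (adj p)\<^sup>* \<Longrightarrow> a \<in> I \<times> corners p \<Longrightarrow> b \<in> I \<times> corners p"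
  by (induction rule: rtrancl_induct) (simp_all add: adj_in)

definition pre :: "complex option set \<Rightarrow> complex option set" where
  "pre V = \<Omega> \<inter> w -` (V - S)"

lemma open_pre: "open V \<Longrightarrow> open (pre V)"
  unfolding pre_def using open_preimage[of "V - S"] finS by (simp add: finite_imp_closed open_Diff)

lemma piece:
  assumes "basic p V" "\<theta> \<in> I" "Q \<in> corners p"
  shows "\<sigma> \<theta> ` (V \<inter> Q) \<subseteq> pre V" "connected (\<sigma> \<theta> ` (V \<inter> Q))" "open (\<sigma> \<theta> ` (V \<inter> Q))" "\<sigma> \<theta> ` (V \<inter> Q) \<noteq> {}"
proof -
  have QL: "V \<inter> Q \<subseteq> L" using corners_sub[OF assms(3)] by blast
  show "\<sigma> \<theta> ` (V \<inter> Q) \<subseteq> pre V"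
  proof (rule image_subsetI)
    fix v assume v: "v \<in> V \<inter> Q"
    then have "v \<in> L" "v \<notin> S" using QL LS by blast+
    then show "\<sigma> \<theta> v \<in> pre V" using v sec_in[OF assms(2)] sec_w[OF assms(2)] by (simp add: pre_def)
  qed
  show "connected (\<sigma> \<theta> ` (V \<inter> Q))" by (rule sec_connected[OF assms(2) basic_connected[OF assms(1,3)] QL])
  show "open (\<sigma> \<theta> ` (V \<inter> Q))"
    by (rule sec_open[OF assms(2) _ QL]) (intro open_Int basic(1)[OF assms(1)] corners_open[OF assms(3)])
  show "\<sigma> \<theta> ` (V \<inter> Q) \<noteq> {}" using basic_nonempty[OF assms(1,3)] by blast
qed

lemma piece_disjoint:
  assumes "\<theta> \<in> I" "\<theta>' \<in> I" "Q \<in> corners p" "Q' \<in> corners p"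
    and "\<sigma> \<theta> ` (V \<inter> Q) \<inter> \<sigma> \<theta>' ` (V' \<inter> Q') \<noteq> {}"
  shows "\<theta> = \<theta>'" "Q = Q'"
proof -
  obtain u u' where u: "u \<in> Q" "u' \<in> Q'" "\<sigma> \<theta> u = \<sigma> \<theta>' u'" using assms(5) by blast
  then have L: "u \<in> L" "u' \<in> L" using corners_sub assms(3,4) by blast+
  have "u = u'" using sec_w[OF assms(1) L(1)] sec_w[OF assms(2) L(2)] u(3) by simp
  then show "\<theta> = \<theta>'" using sec_inj[OF assms(1,2) L(1)] u(3) by simp
  show "Q = Q'" using corners_disjoint[OF assms(3,4)] u \<open>u = u'\<close> by blast
qed

lemma over_L:
  assumes "basic p V" "z \<in> \<Omega>" "w z \<in> V" "w z \<in> L"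
  shows "\<exists>\<theta>\<in>I. \<exists>Q\<in>corners p. z \<in> \<sigma> \<theta> ` (V \<inter> Q)"
proof -
  obtain \<theta> where \<theta>: "\<theta> \<in> I" "\<sigma> \<theta> (w z) = z" using sec_ex[OF assms(2,4)] by blast
  obtain Q where "Q \<in> corners p" "w z \<in> Q" using basic_cover[OF assms(1,3,4)] by blast
  then show ?thesis using \<theta> assms(3) by (metis IntI imageI)
qed

lemma open_meets_L:
  assumes "open U" "U \<subseteq> \<Omega>" "U \<noteq> {}" obtains z where "z \<in> U" "w z \<in> L"
proof -
  have "open (w ` U)" "w ` U \<noteq> {}" using open_map[OF assms(1,2)] assms(3) by auto
  then have "w ` U \<inter> L \<noteq> {}" by (rule dense_L)
  then show thesis using that by blast
qed

text \<open>A point over \<open>L\<close> lies on one piece, which serves as its neighbourhood. A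
  point over a cut lies on a section over the strip, whose image consists of one piece's part on
  each side and the points over the cut between them.\<close>

lemma local_pieces:
  assumes V: "basic p V" and z: "z \<in> pre V"
  shows "\<exists>D a b. open D \<and> z \<in> D \<and> D \<subseteq> pre V \<and> (a = b \<or> (a, b) \<in> adj p) \<and>
    (\<forall>\<theta>\<in>I. \<forall>Q\<in>corners p. D \<inter> \<sigma> \<theta> ` (V \<inter> Q) \<noteq> {} \<longrightarrow> (\<theta>, Q) \<in> {a, b})"
proof (cases "w z \<in> L")
  case True
  have "z \<in> \<Omega>" "w z \<in> V" using z by (auto simp: pre_def)
  then obtain \<theta> Q where \<theta>: "\<theta> \<in> I" "Q \<in> corners p" "z \<in> \<sigma> \<theta> ` (V \<inter> Q)"
    using over_L[OF V _ _ True] by blast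
  have "\<forall>\<theta>'\<in>I. \<forall>Q'\<in>corners p. \<sigma> \<theta> ` (V \<inter> Q) \<inter> \<sigma> \<theta>' ` (V \<inter> Q') \<noteq> {} \<longrightarrow> (\<theta>', Q') \<in> {(\<theta>, Q), (\<theta>, Q)}"
  proof (intro ballI impI)
    fix \<theta>' Q' assume h: "\<theta>' \<in> I" "Q' \<in> corners p" "\<sigma> \<theta> ` (V \<inter> Q) \<inter> \<sigma> \<theta>' ` (V \<inter> Q') \<noteq> {}"
    show "(\<theta>', Q') \<in> {(\<theta>, Q), (\<theta>, Q)}"
      using piece_disjoint(1)[OF \<theta>(1) h(1) \<theta>(2) h(2,3)] piece_disjoint(2)[OF \<theta>(1) h(1) \<theta>(2) h(2,3)] by simp
  qed
  then show ?thesis using piece(1,3)[OF V \<theta>(1,2)] \<theta>(3)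
    by (intro exI[of _ "\<sigma> \<theta> ` (V \<inter> Q)"] exI[of _ "(\<theta>, Q)"] conjI disjI1 refl)
next
  case False
  have wz: "w z \<in> V" "w z \<notin> S" "z \<in> \<Omega>" using z by (auto simp: pre_def)
  obtain e where e: "e \<in> sides" "w z \<in> interior_points e" by (rule not_L_cases[OF False wz(2)])
  have pe: "p \<in> segment_points e" by (rule basic_edge[OF V e(1) wz(1) e(2)])
  have ws: "w z \<in> strp e" using interior_in_strp[OF e] by blast
  obtain \<tau> where \<tau>: "sect (strp e) \<tau>" "\<tau> (w z) = z"
    by (rule sect_exists[OF strp(3,2)[OF e(1)] wz(3) ws])
  obtain \<theta> \<theta>' where s: "spans e \<tau> \<theta> \<theta>'" using strip_spans[OF e(1) \<tau>(1)] by blast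
  have I: "\<theta> \<in> I" "\<theta>' \<in> I" using s unfolding spans_def by blast+
  obtain Q where Q: "Q \<in> corners p" "side e \<subseteq> Q" using corner_of_side by blast
  obtain Q' where Q': "Q' \<in> corners p" "side (opposite e) \<subseteq> Q'" using corner_of_side by blast
  have "((\<theta>, Q), (\<theta>', Q')) \<in> adj p"
    using I Q Q' e(1) pe acr_eq[OF e(1) s] unfolding adj_iff by blast
  moreover have "open (\<tau> ` (V \<inter> strp e))"
  proof (rule sect_open_image)
    show "open (V \<inter> strp e)" using basic(1)[OF V] strp(1)[OF e(1)] by (rule open_Int)
    show "sect (V \<inter> strp e) \<tau>" by (rule sect_subset[OF \<tau>(1)]) blast
    show "V \<inter> strp e \<inter> S = {}" using strp(2)[OF e(1)] by blast
  qed
  moreover have "z \<in> \<tau> ` (V \<inter> strp e)" using \<tau>(2) ws wz(1) by (metis IntI imageI)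
  moreover have "\<tau> ` (V \<inter> strp e) \<subseteq> pre V"
    using \<tau>(1) strp(2)[OF e(1)] unfolding sect_def pre_def by auto
  moreover have "(\<theta>1, Q1) \<in> {(\<theta>, Q), (\<theta>', Q')}"
    if 1: "\<theta>1 \<in> I" "Q1 \<in> corners p" "\<tau> ` (V \<inter> strp e) \<inter> \<sigma> \<theta>1 ` (V \<inter> Q1) \<noteq> {}" for \<theta>1 Q1
  proof -
    obtain u u1 where u: "u \<in> strp e" "u1 \<in> Q1" "\<tau> u = \<sigma> \<theta>1 u1" using 1(3) by blast
    have u1L: "u1 \<in> L" using corners_sub[OF 1(2)] u(2) by blast
    have "w (\<tau> u) = u" using \<tau>(1) u(1) unfolding sect_def by blast
    then have uu: "u1 = u" using sec_w[OF 1(1) u1L] u(3) by simp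
    have "u \<in> strp e \<inter> L" using u(1) u1L uu by simp
    then have "u \<in> side e \<union> side (opposite e)" by (rule subsetD[OF strp(5)[OF e(1)]])
    then show ?thesis
    proof
      assume us: "u \<in> side e"
      then have "\<tau> u = \<sigma> \<theta> u" using s u(1) unfolding spans_def by blast
      then have "\<theta>1 = \<theta>" using sec_inj[OF 1(1) I(1) u1L] u(3) uu by simp
      moreover have "Q1 = Q" using corners_disjoint[OF 1(2) Q(1)] us Q(2) u(2) uu by blast
      ultimately show ?thesis by simp
    next
      assume us: "u \<in> side (opposite e)"
      then have "\<tau> u = \<sigma> \<theta>' u" using s u(1) unfolding spans_def by blast
      then have "\<theta>1 = \<theta>'" using sec_inj[OF 1(1) I(2) u1L] u(3) uu by simp
      moreover have "Q1 = Q'" using corners_disjoint[OF 1(2) Q'(1)] us Q'(2) u(2) uu by blast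
      ultimately show ?thesis by simp
    qed
  qed
  ultimately show ?thesis
    by (intro exI[of _ "\<tau> ` (V \<inter> strp e)"] exI[of _ "(\<theta>, Q)"] exI[of _ "(\<theta>', Q')"] conjI disjI2 ballI impI)
qed

text \<open>What is propagated along \<open>C\<close> is membership in the closure of the union
  \<open>T\<close> of all reachable pieces. The closure is needed because points over the cuts lie
  on no piece; it suffices because, \<open>w\<close> being open and \<open>L\<close> dense, the
  pieces meet every nonempty open subset of \<open>pre V\<close>.\<close>

lemma same_component_imp_adj:
  assumes V: "basic p V" and C: "connected C" "C \<subseteq> pre V"
    and a: "\<theta> \<in> I" "Q \<in> corners p" "C \<inter> \<sigma> \<theta> ` (V \<inter> Q) \<noteq> {}"
    and b: "\<theta>' \<in> I" "Q' \<in> corners p" "C \<inter> \<sigma> \<theta>' ` (V \<inter> Q') \<noteq> {}"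
  shows "((\<theta>, Q), (\<theta>', Q')) \<in> (adj p)\<^sup>*"
proof -
  define E where "E = {b \<in> I \<times> corners p. ((\<theta>, Q), b) \<in> (adj p)\<^sup>*}"
  define T where "T = (\<Union>(\<theta>, Q)\<in>E. \<sigma> \<theta> ` (V \<inter> Q))"
  obtain z0 where z0: "z0 \<in> C" "z0 \<in> \<sigma> \<theta> ` (V \<inter> Q)" using a(3) by blast
  obtain z1 where z1: "z1 \<in> C" "z1 \<in> \<sigma> \<theta>' ` (V \<inter> Q')" using b(3) by blast
  have "(\<theta>, Q) \<in> E" using a by (auto simp: E_def)
  then have "z0 \<in> T" using z0(2) unfolding T_def by blast
  then have c0: "z0 \<in> closure T" using closure_subset by blast
  have "z1 \<in> closure T"
  proof (rule connected_induction_simple[OF C(1) z0(1) z1(1), where P = "\<lambda>z. z \<in> closure T", OF c0])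
    fix z assume z: "z \<in> C"
    then have "z \<in> pre V" using C(2) by blast
    then obtain D a b where D: "open D" "z \<in> D" "D \<subseteq> pre V" "a = b \<or> (a, b) \<in> adj p"
      "\<And>\<theta> Q. \<theta> \<in> I \<Longrightarrow> Q \<in> corners p \<Longrightarrow> D \<inter> \<sigma> \<theta> ` (V \<inter> Q) \<noteq> {} \<Longrightarrow> (\<theta>, Q) \<in> {a, b}"
      using local_pieces[OF V \<open>z \<in> pre V\<close>] by metis
    have pc: "y \<in> closure T" if x: "x \<in> C \<inter> D" "x \<in> closure T" and y: "y \<in> C \<inter> D" for x y
    proof -
      have "x \<in> D \<inter> closure T" using x by simp
      then have "D \<inter> T \<noteq> {}" using open_Int_closure_eq_empty[OF D(1), of T] by (metis empty_iff)
      then obtain y' where y': "y' \<in> D" "y' \<in> T" by (meson disjoint_iff)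
      obtain \<theta>1 Q1 where 1: "(\<theta>1, Q1) \<in> E" "y' \<in> \<sigma> \<theta>1 ` (V \<inter> Q1)" using y'(2) unfolding T_def by (elim UN_E) (auto split: prod.splits)
      have "D \<inter> \<sigma> \<theta>1 ` (V \<inter> Q1) \<noteq> {}" using IntI[OF y'(1) 1(2)] by (metis empty_iff)
      with 1 have "(\<theta>1, Q1) \<in> {a, b}" by (intro D(5)) (auto simp: E_def)
      then have ab: "(\<theta>2, Q2) \<in> E" if "(\<theta>2, Q2) \<in> {a, b}" "\<theta>2 \<in> I" "Q2 \<in> corners p" for \<theta>2 Q2
      proof -
        have "((\<theta>1, Q1), (\<theta>2, Q2)) \<in> (adj p)\<^sup>*"
          using \<open>(\<theta>1, Q1) \<in> {a, b}\<close> that(1) D(4) adj_sym by auto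
        then show ?thesis using 1(1) that(2,3) unfolding E_def by (auto intro: rtrancl_trans)
      qed
      show ?thesis
      proof (rule ccontr)
        assume n: "y \<notin> closure T"
        let ?U = "D \<inter> - closure T"
        have "y \<in> ?U" using n y by simp
        then have U: "open ?U" "?U \<subseteq> \<Omega>" "?U \<noteq> {}" using D(1,3) unfolding pre_def by auto
        obtain u where u: "u \<in> ?U" "w u \<in> L" by (rule open_meets_L[OF U])
        have "u \<in> \<Omega>" "w u \<in> V" using u(1) D(3) unfolding pre_def by blast+
        then obtain \<theta>2 Q2 where 2: "\<theta>2 \<in> I" "Q2 \<in> corners p" "u \<in> \<sigma> \<theta>2 ` (V \<inter> Q2)" using over_L[OF V _ _ u(2)] by blast
        have "u \<in> D" using u(1) by simp
        then have "D \<inter> \<sigma> \<theta>2 ` (V \<inter> Q2) \<noteq> {}" using 2(3) by (metis IntI empty_iff)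
        then have "(\<theta>2, Q2) \<in> {a, b}" by (rule D(5)[OF 2(1,2)])
        then have "(\<theta>2, Q2) \<in> E" using ab 2(1,2) by simp
        then have "u \<in> T" using 2(3) unfolding T_def by (intro UN_I) auto
        then show False using u(1) closure_subset[of T] by auto
      qed
    qed
    have o: "openin (top_of_set C) (C \<inter> D)" by (rule openin_open_Int[OF D(1)])
    have zCD: "z \<in> C \<inter> D" using z D(2) by (rule IntI)
    show "\<exists>T'. openin (top_of_set C) T' \<and> z \<in> T' \<and> (\<forall>x\<in>T'. \<forall>y\<in>T'. x \<in> closure T \<longrightarrow> y \<in> closure T)"
      by (intro exI[of _ "C \<inter> D"] conjI o zCD ballI impI) (rule pc)
  qed
  then have "z1 \<in> \<sigma> \<theta>' ` (V \<inter> Q') \<inter> closure T" using z1(2) by simp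
  then have "\<sigma> \<theta>' ` (V \<inter> Q') \<inter> T \<noteq> {}"
    using open_Int_closure_eq_empty[OF piece(3)[OF V b(1,2)], of T] by (metis empty_iff)
  then obtain y where y: "y \<in> \<sigma> \<theta>' ` (V \<inter> Q')" "y \<in> T" by (meson disjoint_iff)
  obtain \<theta>2 Q2 where 2: "(\<theta>2, Q2) \<in> E" "y \<in> \<sigma> \<theta>2 ` (V \<inter> Q2)" using y(2) unfolding T_def by (elim UN_E) (auto split: prod.splits)
  have ne: "\<sigma> \<theta>' ` (V \<inter> Q') \<inter> \<sigma> \<theta>2 ` (V \<inter> Q2) \<noteq> {}" using IntI[OF y(1) 2(2)] by (metis empty_iff)
  have "\<theta>2 \<in> I" "Q2 \<in> corners p" using 2(1) by (simp_all add: E_def)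
  then have "\<theta>' = \<theta>2" "Q' = Q2"
    using piece_disjoint(1)[OF b(1) _ b(2) _ ne] piece_disjoint(2)[OF b(1) _ b(2) _ ne] by simp_all
  then show ?thesis using 2(1) by (simp add: E_def)
qed

text \<open>Says that \<open>M\<close> is a union of connected components of
  \<open>pre V\<close>.\<close>

definition saturated :: "complex option set \<Rightarrow> complex option set \<Rightarrow> bool" where
  "saturated V M \<longleftrightarrow> M \<subseteq> pre V \<and> (\<forall>C. connected C \<longrightarrow> C \<subseteq> pre V \<longrightarrow> C \<inter> M \<noteq> {} \<longrightarrow> C \<subseteq> M)"

lemma saturatedD: "saturated V M \<Longrightarrow> connected C \<Longrightarrow> C \<subseteq> pre V \<Longrightarrow> C \<inter> M \<noteq> {} \<Longrightarrow> C \<subseteq> M"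
  unfolding saturated_def by blast

text \<open>A small connected neighbourhood \<open>B\<close> of a point of \<open>e\<close> close to
  \<open>p\<close>, lifted by the spanning section, joins the two pieces inside
  \<open>pre V\<close>, since interior points of cuts are not singular.\<close>

lemma adj_saturated:
  assumes V: "basic p V" and M: "saturated V M" and ab: "((\<theta>, Q), (\<theta>', Q')) \<in> adj p"
    and a: "\<sigma> \<theta> ` (V \<inter> Q) \<subseteq> M"
  shows "\<sigma> \<theta>' ` (V \<inter> Q') \<subseteq> M"
proof -
  obtain e where I: "\<theta> \<in> I" "\<theta>' \<in> I" "Q \<in> corners p" "Q' \<in> corners p" and e: "e \<in> sides" "p \<in> segment_points e"
    "\<theta>' = acr \<theta> e" "side e \<subseteq> Q" "side (opposite e) \<subseteq> Q'" using ab unfolding adj_iff by blast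
  obtain \<tau> where s: "spans e \<tau> \<theta> \<theta>'" using acr[OF e(1) I(1)] e(3) by blast
  obtain x where x: "x \<in> V" "x \<in> interior_points e" using edge_near[OF e(1,2) basic(1,2)[OF V]] by blast
  have "open (V \<inter> strp e)" using basic(1)[OF V] strp(1)[OF e(1)] by (rule open_Int)
  moreover have "x \<in> V \<inter> strp e" using x interior_in_strp[OF e(1)] by blast
  ultimately obtain B where B: "open B" "connected B" "x \<in> B" "B \<subseteq> V \<inter> strp e" by (rule sphere_connected_nbhd)
  have \<tau>: "sect B \<tau>" by (rule sect_subset[of "strp e"]) (use s B(4) in \<open>auto simp: spans_def\<close>)
  have con: "connected (\<tau> ` B)" using \<tau> B(2) unfolding sect_def by (blast intro: connected_continuous_image)
  have sub: "\<tau> ` B \<subseteq> pre V"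
  proof (rule image_subsetI)
    fix u assume u: "u \<in> B"
    then have "u \<in> V" "u \<notin> S" using B(4) strp(2)[OF e(1)] by blast+
    then show "\<tau> u \<in> pre V" using u \<tau> unfolding sect_def pre_def by auto
  qed
  obtain u where u: "u \<in> B" "u \<in> side e" using side_near[OF e(1) x(2) B(1,3)] by (meson disjoint_iff)
  have "x \<in> interior_points (opposite e)" using x(2) by simp
  then obtain u' where u': "u' \<in> B" "u' \<in> side (opposite e)"
    using side_near[OF opposite_sides[OF e(1)] _ B(1,3)] by (meson disjoint_iff)
  have "\<tau> u = \<sigma> \<theta> u" "\<tau> u' = \<sigma> \<theta>' u'" using s u u' B(4) unfolding spans_def by blast+
  then have "\<tau> u \<in> \<sigma> \<theta> ` (V \<inter> Q)" "\<tau> u' \<in> \<sigma> \<theta>' ` (V \<inter> Q')" using u u' e(4,5) B(4) by auto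
  then have "\<tau> ` B \<inter> M \<noteq> {}" using a u(1) by blast
  then have "\<tau> ` B \<subseteq> M" by (rule saturatedD[OF M con sub])
  then have "\<sigma> \<theta>' ` (V \<inter> Q') \<inter> M \<noteq> {}" using \<open>\<tau> u' \<in> \<sigma> \<theta>' ` (V \<inter> Q')\<close> u'(1) by blast
  then show ?thesis by (rule saturatedD[OF M piece(2,1)[OF V I(2,4)]])
qed

lemma adj_rtrancl_saturated:
  assumes V: "basic p V" and M: "saturated V M" and ab: "(a, b) \<in> (adj p)\<^sup>*"
    and a: "\<sigma> (fst a) ` (V \<inter> snd a) \<subseteq> M"
  shows "\<sigma> (fst b) ` (V \<inter> snd b) \<subseteq> M"
  using ab
proof (induction rule: rtrancl_induct)
  case base show ?case by (rule a)
next
  case (step b c)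
  then show ?case using adj_saturated[OF V M, of "fst b" "snd b" "fst c" "snd c"] by simp
qed

end

lemma connected_sphere_delete:
  assumes N: "open N" "connected N" "N \<subseteq> - {antipode z}"
  shows "connected (N - {z})"
proof -
  define N' where "N' = sphere_chart z -` N"
  have NN: "N = sphere_chart z ` N'"
  proof (intro equalityI subsetI)
    fix x assume x: "x \<in> N"
    then have "sphere_chart z (sphere_coord z x) = x" using N(3) by (intro sphere_chart_coord) blast
    then show "x \<in> sphere_chart z ` N'" using x unfolding N'_def by (intro rev_image_eqI[of "sphere_coord z x"]) auto
  qed (auto simp: N'_def)
  have "open N'" unfolding N'_def
    using continuous_open_preimage[OF continuous_on_sphere_chart[of UNIV] open_UNIV N(1)] by simp
  moreover have "N' = sphere_coord z ` N" unfolding NN image_image by simp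
  then have "connected N'"
    using connected_continuous_image[OF continuous_on_sphere_coord[OF N(3)] N(2)] by simp
  ultimately have "connected (N' - {0})" by (intro connected_open_delete) simp_all
  then have "connected (sphere_chart z ` (N' - {0}))"
    by (rule connected_continuous_image[OF continuous_on_sphere_chart])
  moreover have "sphere_chart z ` (N' - {0}) = N - {z}"
  proof -
    have "sphere_chart z ` (N' - {0}) = sphere_chart z ` N' - sphere_chart z ` {0}"
      by (rule inj_on_image_set_diff[OF inj_sphere_chart[of _ UNIV]]) auto
    then show ?thesis using NN by simp
  qed
  ultimately show ?thesis by simp
qed

context glue
begin

lemma preI: "z \<in> \<Omega> \<Longrightarrow> w z \<in> V \<Longrightarrow> w z \<notin> S \<Longrightarrow> z \<in> pre V"
  and preD: "z \<in> pre V \<Longrightarrow> z \<in> \<Omega>" "z \<in> pre V \<Longrightarrow> w z \<in> V" "z \<in> pre V \<Longrightarrow> w z \<notin> S"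
  by (simp_all add: pre_def)

section \<open>Corners lying at a point of the domain\<close>

text \<open>Modelled on the component \<open>N\<close> at \<open>z\<close> of the preimage of
  \<open>V\<close>, kept inside a compact set \<open>K\<close> in which \<open>z\<close> is the only
  point over w z. By the last two conditions \<open>N\<close> remains a single component after the
  points over singular values are deleted.\<close>

definition adapted :: "complex option \<Rightarrow> complex option set \<Rightarrow> complex option set \<Rightarrow> complex option set \<Rightarrow> bool" where
  "adapted z V N K \<longleftrightarrow> basic (w z) V \<and> open N \<and> z \<in> N \<and> N \<subseteq> w -` V \<and> compact K \<and> K \<subseteq> \<Omega> \<and> N \<subseteq> K \<and>
     (\<forall>x\<in>K. w x = w z \<longrightarrow> x = z) \<and> connected (N \<inter> pre V) \<and> saturated V (N \<inter> pre V)"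

text \<open>The compact set K \<inter> - B has an image avoiding w z, and \<open>V\<close> is chosen
  off that image; a connected set over \<open>V\<close> through \<open>z\<close> then cannot leave
  \<open>B\<close>. Deleting \<open>z\<close> from \<open>N\<close>, necessary when w z is singular,
  does not disconnect it.\<close>

lemma adapted_ex:
  assumes z: "z \<in> \<Omega>" and U: "open U" "z \<in> U" and O: "open O'" "w z \<in> O'"
  shows "\<exists>V N K. adapted z V N K \<and> N \<subseteq> U \<and> V \<subseteq> O'"
proof -
  obtain N0 where N0: "open N0" "z \<in> N0" "\<And>x. x \<in> N0 \<inter> \<Omega> \<Longrightarrow> w x = w z \<Longrightarrow> x = z"
    using isolated[OF z] by metis
  have "open (U \<inter> \<Omega> \<inter> N0)" "z \<in> U \<inter> \<Omega> \<inter> N0" using U z N0 open_dom by auto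
  then obtain r0 where r0: "r0 > 0" "sphere_chart z ` ball 0 r0 \<subseteq> U \<inter> \<Omega> \<inter> N0" by (rule sphere_chart_nbhd)
  define r where "r = r0 / 2"
  have r: "0 < r" "cball (0::complex) r \<subseteq> ball 0 r0" using r0(1) by (auto simp: r_def)
  define K where "K = sphere_chart z ` cball 0 r"
  define B where "B = sphere_chart z ` ball 0 r"
  have K: "compact K" unfolding K_def by (intro compact_continuous_image continuous_on_sphere_chart compact_cball)
  have KU: "K \<subseteq> U \<inter> \<Omega> \<inter> N0" using image_mono[OF r(2), of "sphere_chart z"] r0(2) unfolding K_def by (rule order_trans)
  have B: "open B" unfolding B_def by (intro open_sphere_chart_image open_ball)
  have BK: "B \<subseteq> K" unfolding B_def K_def by (intro image_mono ball_subset_cball)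
  have zB: "z \<in> B" unfolding B_def by (rule image_eqI[of _ _ 0]) (use r in simp_all)
  have Kz: "x = z" if "x \<in> K" "w x = w z" for x using N0(3)[OF _ that(2)] that(1) KU by blast
  have "compact (K \<inter> - B)" using K B by (intro compact_Int_closed closed_Compl)
  then have "compact (w ` (K \<inter> - B))"
    by (intro compact_continuous_image continuous_on_subset[OF cont]) (use KU in blast)
  then have clo: "closed (w ` (K \<inter> - B))" by (rule compact_imp_closed)
  have "w z \<notin> w ` (K \<inter> - B)"
  proof
    assume "w z \<in> w ` (K \<inter> - B)"
    then obtain x where "x \<in> K" "x \<notin> B" "w x = w z" by force
    then show False using Kz zB by blast
  qed
  then have "w z \<in> O' \<inter> - (w ` (K \<inter> - B))" "open (O' \<inter> - (w ` (K \<inter> - B)))" using O clo by auto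
  then obtain V where V: "basic (w z) V" "V \<subseteq> O' \<inter> - (w ` (K \<inter> - B))" using basic_ex by metis
  define N where "N = connected_component_set (\<Omega> \<inter> w -` V) z"
  have oN: "open N" unfolding N_def by (intro open_connected_component_sphere open_preimage basic(1)[OF V(1)])
  have zN: "z \<in> N" unfolding N_def using z basic(2)[OF V(1)] by (simp add: connected_component_refl)
  have Nsub: "N \<subseteq> \<Omega> \<inter> w -` V" unfolding N_def by (rule connected_component_subset)
  have cN: "connected N" unfolding N_def by (rule connected_connected_component)
  have cov: "N \<subseteq> B \<union> - K"
  proof
    fix x assume x: "x \<in> N"
    then have "w x \<notin> w ` (K \<inter> - B)" using Nsub V(2) by blast
    then show "x \<in> B \<union> - K" by blast
  qed
  have oK: "open (- K)" using K by (simp add: compact_imp_closed open_Compl)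
  have "B \<inter> - K \<inter> N = {}" using BK by blast
  then have "B \<inter> N = {} \<or> - K \<inter> N = {}" by (rule connectedD[OF cN B oK _ cov])
  then have NK: "N \<subseteq> K" using zB zN by blast
  have Npre: "N \<inter> pre V = (if w z \<in> S then N - {z} else N)"
  proof (intro equalityI subsetI)
    fix x assume x: "x \<in> N \<inter> pre V"
    then show "x \<in> (if w z \<in> S then N - {z} else N)" using preD(3)[of x V] by auto
  next
    fix x assume x: "x \<in> (if w z \<in> S then N - {z} else N)"
    then have xN: "x \<in> N" by (auto split: if_splits)
    then have xV: "x \<in> \<Omega>" "w x \<in> V" using Nsub by auto
    have "w x \<notin> S"
    proof
      assume "w x \<in> S"
      then have "w x = w z" using basic(3)[OF V(1)] xV(2) by blast
      then have "x = z" using Kz NK xN by blast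
      then show False using x \<open>w x \<in> S\<close> by simp
    qed
    then show "x \<in> N \<inter> pre V" using xN xV by (simp add: preI)
  qed
  have "N \<subseteq> - {antipode z}"
  proof
    fix x assume "x \<in> N"
    then obtain \<zeta> where "x = sphere_chart z \<zeta>" using NK unfolding K_def by blast
    then show "x \<in> - {antipode z}" by simp
  qed
  then have con: "connected (N \<inter> pre V)" unfolding Npre using connected_sphere_delete[OF oN cN] cN by simp
  have sat: "saturated V (N \<inter> pre V)"
    unfolding saturated_def
  proof (intro conjI allI impI)
    fix C assume C: "connected C" "C \<subseteq> pre V" "C \<inter> (N \<inter> pre V) \<noteq> {}"
    then obtain x where x: "x \<in> C" "x \<in> N" by blast
    have "C \<subseteq> \<Omega> \<inter> w -` V" using C(2) unfolding pre_def by blast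
    then have "C \<subseteq> connected_component_set (\<Omega> \<inter> w -` V) x"
      by (rule connected_component_maximal[OF x(1) C(1)])
    also have "\<dots> = N" unfolding N_def using x(2)[unfolded N_def] by (rule connected_component_eq)
    finally show "C \<subseteq> N \<inter> pre V" using C(2) by blast
  qed blast
  have "adapted z V N K"
    unfolding adapted_def using V(1) oN zN Nsub K KU NK Kz con sat by (intro conjI) blast+
  moreover have "N \<subseteq> U" using NK KU by blast
  moreover have "V \<subseteq> O'" using V(2) by blast
  ultimately show ?thesis by blast
qed

text \<open>
  The corner \<open>Q\<close> of the sheet \<open>\<theta>\<close> lies at the point \<open>z\<close> of \<open>\<Omega>\<close>.
\<close>

definition lim :: "nat \<Rightarrow> complex option set \<Rightarrow> complex option \<Rightarrow> bool" where
  "lim \<theta> Q z \<longleftrightarrow> (\<forall>U. open U \<longrightarrow> z \<in> U \<longrightarrow> (\<exists>V. basic (w z) V \<and> \<sigma> \<theta> ` (V \<inter> Q) \<subseteq> U))"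

lemma limD: "lim \<theta> Q z \<Longrightarrow> open U \<Longrightarrow> z \<in> U \<Longrightarrow> \<exists>V. basic (w z) V \<and> \<sigma> \<theta> ` (V \<inter> Q) \<subseteq> U"
  unfolding lim_def by blast

lemma basic_Int: "basic p V \<Longrightarrow> open V' \<Longrightarrow> p \<in> V' \<Longrightarrow> \<exists>V''. basic p V'' \<and> V'' \<subseteq> V \<inter> V'"
  by (rule basic_ex) (auto intro: basic(1,2))

lemma adapted_meets:
  assumes A: "adapted z V N K" and \<theta>: "\<theta> \<in> I" "Q \<in> corners (w z)"
    and m: "\<sigma> \<theta> u \<in> N" "u \<in> V \<inter> Q"
  shows "\<sigma> \<theta> ` (V \<inter> Q) \<subseteq> N \<inter> pre V"
proof -
  have V: "basic (w z) V" and sat: "saturated V (N \<inter> pre V)" using A by (auto simp: adapted_def)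
  have "\<sigma> \<theta> u \<in> \<sigma> \<theta> ` (V \<inter> Q) \<inter> (N \<inter> pre V)" using m piece(1)[OF V \<theta>] by blast
  then have "\<sigma> \<theta> ` (V \<inter> Q) \<inter> (N \<inter> pre V) \<noteq> {}" by (metis empty_iff)
  then show ?thesis by (rule saturatedD[OF sat piece(2,1)[OF V \<theta>]])
qed

text \<open>Since \<open>z\<close> is the only point of \<open>K\<close> over w z, compactness
  forces the part of \<open>K\<close> over shrinking neighbourhoods of w z into any neighbourhood of
  \<open>z\<close>. So a single adapted neighbourhood decides whether a corner lies at
  \<open>z\<close>.\<close>

lemma lim_adapted:
  assumes A: "adapted z V N K" and \<theta>: "\<theta> \<in> I" "Q \<in> corners (w z)"
  shows "lim \<theta> Q z \<longleftrightarrow> \<sigma> \<theta> ` (V \<inter> Q) \<subseteq> N"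
proof
  have V: "basic (w z) V" and N: "open N" "z \<in> N" using A by (auto simp: adapted_def)
  assume l: "lim \<theta> Q z"
  obtain V' where V': "basic (w z) V'" "\<sigma> \<theta> ` (V' \<inter> Q) \<subseteq> N" using limD[OF l N] by blast
  obtain V'' where V'': "basic (w z) V''" "V'' \<subseteq> V \<inter> V'" using basic_Int[OF V basic(1,2)[OF V'(1)]] by blast
  obtain u where u: "u \<in> V'' \<inter> Q" using basic_nonempty[OF V''(1) \<theta>(2)] by blast
  have "u \<in> V' \<inter> Q" "u \<in> V \<inter> Q" using u V''(2) by blast+
  then show "\<sigma> \<theta> ` (V \<inter> Q) \<subseteq> N" using adapted_meets[OF A \<theta>, of u] V'(2) by blast
next
  have V: "basic (w z) V" and N: "open N" "z \<in> N" and K: "compact K" "K \<subseteq> \<Omega>" "N \<subseteq> K" "\<And>x. x \<in> K \<Longrightarrow> w x = w z \<Longrightarrow> x = z"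
    using A unfolding adapted_def by blast+
  assume sub: "\<sigma> \<theta> ` (V \<inter> Q) \<subseteq> N"
  show "lim \<theta> Q z"
    unfolding lim_def
  proof (intro allI impI)
    fix U assume U: "open U" "z \<in> U"
    have "compact (K \<inter> - U)" using K(1) U(1) by (intro compact_Int_closed closed_Compl)
    then have "compact (w ` (K \<inter> - U))"
      by (intro compact_continuous_image continuous_on_subset[OF cont]) (use K(2) in blast)
    then have o: "open (- (w ` (K \<inter> - U)))" by (simp add: compact_imp_closed open_Compl)
    have "w z \<in> - (w ` (K \<inter> - U))"
    proof (rule ComplI)
      assume "w z \<in> w ` (K \<inter> - U)"
      then obtain x where "x \<in> K" "x \<notin> U" "w x = w z" by force
      then show False using K(4) U(2) by blast
    qed
    then obtain V' where V': "basic (w z) V'" "V' \<subseteq> V \<inter> - (w ` (K \<inter> - U))" using basic_Int[OF V o] by blast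
    have "\<sigma> \<theta> ` (V' \<inter> Q) \<subseteq> U"
    proof (rule image_subsetI)
      fix u assume u: "u \<in> V' \<inter> Q"
      then have "u \<in> V \<inter> Q" "u \<in> L" using V'(2) corners_sub[OF \<theta>(2)] by blast+
      then have 1: "\<sigma> \<theta> u \<in> K" "w (\<sigma> \<theta> u) = u" using sub K(3) sec_w[OF \<theta>(1)] by blast+
      show "\<sigma> \<theta> u \<in> U"
      proof (rule ccontr)
        assume "\<sigma> \<theta> u \<notin> U"
        then have "w (\<sigma> \<theta> u) \<in> w ` (K \<inter> - U)" using 1(1) by blast
        then show False using 1(2) u V'(2) by auto
      qed
    qed
    then show "\<exists>V. basic (w z) V \<and> \<sigma> \<theta> ` (V \<inter> Q) \<subseteq> U" using V'(1) by blast
  qed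
qed

lemma adapted_lim_ex:
  assumes A: "adapted z V N K"
  shows "\<exists>\<theta>\<in>I. \<exists>Q\<in>corners (w z). \<sigma> \<theta> ` (V \<inter> Q) \<subseteq> N \<inter> pre V"
proof -
  have V: "basic (w z) V" and N: "open N" "z \<in> N" "N \<subseteq> w -` V" "N \<subseteq> \<Omega>"
    using A unfolding adapted_def by blast+
  obtain u where u: "u \<in> N" "w u \<in> L" by (rule open_meets_L[OF N(1,4)]) (use N(2) in blast)
  have "u \<in> \<Omega>" "w u \<in> V" using u(1) N by blast+
  then obtain \<theta> Q where \<theta>: "\<theta> \<in> I" "Q \<in> corners (w z)" "u \<in> \<sigma> \<theta> ` (V \<inter> Q)" using over_L[OF V _ _ u(2)] by blast
  then obtain v where v: "v \<in> V \<inter> Q" "u = \<sigma> \<theta> v" by blast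
  then show ?thesis using adapted_meets[OF A \<theta>(1,2) _ v(1)] u(1) \<theta>(1,2) by blast
qed

lemma lim_ex:
  assumes "z \<in> \<Omega>" shows "\<exists>\<theta>\<in>I. \<exists>Q\<in>corners (w z). lim \<theta> Q z"
proof -
  obtain V N K where A: "adapted z V N K" using adapted_ex[OF assms, of UNIV UNIV] by auto
  obtain \<theta> Q where "\<theta> \<in> I" "Q \<in> corners (w z)" "\<sigma> \<theta> ` (V \<inter> Q) \<subseteq> N \<inter> pre V" using adapted_lim_ex[OF A] by blast
  then show ?thesis using lim_adapted[OF A, of \<theta> Q] by blast
qed

text \<open>The corners at \<open>z\<close> are those whose pieces lie in one particular component
  of \<open>pre V\<close>. Adjacent corners cannot leave that component, and pieces inside it are
  linked by adjacencies. This matches points of \<Omega> with adjacency classes.\<close>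

lemma lim_class:
  assumes z: "z \<in> \<Omega>" and a: "\<theta> \<in> I" "Q \<in> corners (w z)" "lim \<theta> Q z" and b: "\<theta>' \<in> I" "Q' \<in> corners (w z)"
  shows "lim \<theta>' Q' z \<longleftrightarrow> ((\<theta>, Q), (\<theta>', Q')) \<in> (adj (w z))\<^sup>*"
proof -
  obtain V N K where A: "adapted z V N K" using adapted_ex[OF z, of UNIV UNIV] by auto
  have V: "basic (w z) V" and con: "connected (N \<inter> pre V)" and sat: "saturated V (N \<inter> pre V)"
    using A by (auto simp: adapted_def)
  have sa: "\<sigma> \<theta> ` (V \<inter> Q) \<subseteq> N \<inter> pre V" using lim_adapted[OF A a(1,2)] a(3) piece(1)[OF V a(1,2)] by blast
  show ?thesis
  proof
    assume "lim \<theta>' Q' z"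
    then have sb: "\<sigma> \<theta>' ` (V \<inter> Q') \<subseteq> N \<inter> pre V" using lim_adapted[OF A b] piece(1)[OF V b] by blast
    show "((\<theta>, Q), (\<theta>', Q')) \<in> (adj (w z))\<^sup>*"
    proof (rule same_component_imp_adj[OF V con _ a(1,2) _ b])
      show "N \<inter> pre V \<inter> \<sigma> \<theta> ` (V \<inter> Q) \<noteq> {}" using sa piece(4)[OF V a(1,2)] by (simp add: Int_absorb1)
      show "N \<inter> pre V \<inter> \<sigma> \<theta>' ` (V \<inter> Q') \<noteq> {}" using sb piece(4)[OF V b] by (simp add: Int_absorb1)
    qed blast
  next
    assume "((\<theta>, Q), (\<theta>', Q')) \<in> (adj (w z))\<^sup>*"
    then have "\<sigma> \<theta>' ` (V \<inter> Q') \<subseteq> N \<inter> pre V" using adj_rtrancl_saturated[OF V sat, of "(\<theta>, Q)" "(\<theta>', Q')"] sa by simp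
    then show "lim \<theta>' Q' z" using lim_adapted[OF A b] by blast
  qed
qed

text \<open>Over a fixed \<open>v\<close> near w z, distinct sheets with the corner \<open>Q\<close>
  at \<open>z\<close> give distinct points of the compact set \<open>K\<close>, and there are only
  finitely many of these.\<close>

lemma lim_finite:
  assumes z: "z \<in> \<Omega>" shows "finite {(\<theta>, Q). \<theta> \<in> I \<and> Q \<in> corners (w z) \<and> lim \<theta> Q z}"
proof -
  obtain V N K where A: "adapted z V N K" using adapted_ex[OF z, of UNIV UNIV] by auto
  have V: "basic (w z) V" and K: "compact K" "K \<subseteq> \<Omega>" "N \<subseteq> K" using A unfolding adapted_def by blast+
  have fin: "finite {\<theta> \<in> I. lim \<theta> Q z}" if Q: "Q \<in> corners (w z)" for Q
  proof -
    obtain v where v: "v \<in> V \<inter> Q" using basic_nonempty[OF V Q] by blast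
    then have vL: "v \<in> L" using corners_sub[OF Q] by blast
    have "inj_on (\<lambda>\<theta>. \<sigma> \<theta> v) {\<theta> \<in> I. lim \<theta> Q z}"
    proof (rule inj_onI)
      fix a b assume "a \<in> {\<theta> \<in> I. lim \<theta> Q z}" "b \<in> {\<theta> \<in> I. lim \<theta> Q z}" "\<sigma> a v = \<sigma> b v"
      then show "a = b" by (intro sec_inj[OF _ _ vL]) simp_all
    qed
    moreover have "(\<lambda>\<theta>. \<sigma> \<theta> v) ` {\<theta> \<in> I. lim \<theta> Q z} \<subseteq> {x \<in> K. w x = v}"
    proof (rule image_subsetI)
      fix \<theta> assume "\<theta> \<in> {\<theta> \<in> I. lim \<theta> Q z}"
      then have \<theta>: "\<theta> \<in> I" "\<sigma> \<theta> ` (V \<inter> Q) \<subseteq> N" using lim_adapted[OF A _ Q] by auto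
      then show "\<sigma> \<theta> v \<in> {x \<in> K. w x = v}" using v K(3) sec_w[OF \<theta>(1) vL] by blast
    qed
    ultimately show ?thesis by (rule finite_imageD[OF finite_subset[OF _ fibre_finite[OF K(1,2)]], rotated])
  qed
  have "{(\<theta>, Q). \<theta> \<in> I \<and> Q \<in> corners (w z) \<and> lim \<theta> Q z} \<subseteq> (\<Union>Q\<in>corners (w z). {\<theta> \<in> I. lim \<theta> Q z} \<times> {Q})" by auto
  then show ?thesis by (rule finite_subset) (use fin finite_corners in auto)
qed

lemma lim_unique:
  assumes "lim \<theta> Q z" "lim \<theta> Q z'" "w z = w z'" "Q \<in> corners (w z)"
  shows "z = z'"
proof (rule ccontr)
  assume "z \<noteq> z'"
  then obtain U U' where U: "open U" "open U'" "z \<in> U" "z' \<in> U'" "U \<inter> U' = {}" using hausdorff by metis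
  obtain V where V: "basic (w z) V" "\<sigma> \<theta> ` (V \<inter> Q) \<subseteq> U" using limD[OF assms(1) U(1,3)] by blast
  obtain V' where V': "basic (w z') V'" "\<sigma> \<theta> ` (V' \<inter> Q) \<subseteq> U'" using limD[OF assms(2) U(2,4)] by blast
  have "w z \<in> V'" using basic(2)[OF V'(1)] assms(3) by simp
  then obtain V'' where V'': "basic (w z) V''" "V'' \<subseteq> V \<inter> V'" using basic_Int[OF V(1) basic(1)[OF V'(1)]] by blast
  obtain u where u: "u \<in> V'' \<inter> Q" using basic_nonempty[OF V''(1) assms(4)] by blast
  then have "\<sigma> \<theta> u \<in> U" "\<sigma> \<theta> u \<in> U'" using V V' V'' by blast+
  then show False using U(5) by blast
qed

section \<open>Every finite class of corners lies at a point\<close>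

text \<open>At a nonsingular point the sheet continues over a neighbourhood: by \<sigma> \<theta>
  itself inside \<open>L\<close>, and by a spanning section over a strip when the point lies on a
  cut. The value of the continuation at \<open>p\<close> is the required point.\<close>

lemma fill_regular:
  assumes p: "p \<notin> S" and \<theta>: "\<theta> \<in> I" "Q \<in> corners p"
  shows "\<exists>z\<in>\<Omega>. w z = p \<and> lim \<theta> Q z"
proof -
  have ext: ?thesis if D: "open D" "p \<in> D" and \<tau>: "sect D \<tau>" and agree: "\<And>v. v \<in> D \<inter> Q \<Longrightarrow> \<tau> v = \<sigma> \<theta> v" for D \<tau>
  proof (intro bexI[of _ "\<tau> p"] conjI)
    have c: "continuous_on D \<tau>" and wp: "w (\<tau> p) = p" and in\<Omega>: "\<tau> p \<in> \<Omega>" using \<tau> D(2) unfolding sect_def by blast+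
    show "w (\<tau> p) = p" "\<tau> p \<in> \<Omega>" by fact+
    show "lim \<theta> Q (\<tau> p)"
      unfolding lim_def wp
    proof (intro allI impI)
      fix U assume U: "open U" "\<tau> p \<in> U"
      have oD: "open (D \<inter> \<tau> -` U)" by (rule continuous_open_preimage[OF c D(1) U(1)])
      have pD: "p \<in> D \<inter> \<tau> -` U" using D(2) U(2) by simp
      obtain V where V: "basic p V" "V \<subseteq> D \<inter> \<tau> -` U" using basic_ex[OF oD pD] by blast
      have "\<sigma> \<theta> ` (V \<inter> Q) \<subseteq> U"
      proof (rule image_subsetI)
        fix v assume v: "v \<in> V \<inter> Q"
        then have "v \<in> D \<inter> Q" "\<tau> v \<in> U" using V(2) by blast+
        then show "\<sigma> \<theta> v \<in> U" using agree by simp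
      qed
      then show "\<exists>V. basic p V \<and> \<sigma> \<theta> ` (V \<inter> Q) \<subseteq> U" using V(1) by blast
    qed
  qed
  show ?thesis
  proof (cases "p \<in> L")
    case True
    show ?thesis by (rule ext[OF open_L True sec[OF \<theta>(1)]]) simp
  next
    case False
    obtain e where e: "e \<in> sides" "p \<in> interior_points e" by (rule not_L_cases[OF False p])
    have "p \<in> inner" using e sides_cases[OF e(1)] inner_interior[of e] inner_interior[of "opposite e"] by auto
    then have "Q \<in> {side e, side (opposite e)}" using \<theta>(2) side_eq[OF e(1)] by (auto simp: corners_def)
    then obtain f where f: "f \<in> sides" "p \<in> interior_points f" "Q = side f"
      using e opposite_sides[OF e(1)] by (metis insertE interior_points_opposite singletonD)
    obtain \<tau> where s: "spans f \<tau> \<theta> (acr \<theta> f)" using acr[OF f(1) \<theta>(1)] ..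
    show ?thesis
    proof (rule ext[of "strp f" \<tau>])
      show "open (strp f)" by (rule strp(1)[OF f(1)])
      show "p \<in> strp f" using interior_in_strp[OF f(1,2)] by blast
      show "sect (strp f) \<tau>" using s by (simp add: spans_def)
      show "\<tau> v = \<sigma> \<theta> v" if "v \<in> strp f \<inter> Q" for v using s that f(3) by (simp add: spans_def)
    qed
  qed
qed

text \<open>
  Every component of the part over a punctured neighbourhood of a singular value that carries only
  finitely many corners has finite degree, hence is closed up by a point of \<open>\<Omega>\<close>.
\<close>

lemma fill_singular:
  assumes p: "p \<in> S" and \<theta>: "\<theta> \<in> I" "Q \<in> corners p" and fin: "finite {b. ((\<theta>, Q), b) \<in> (adj p)\<^sup>*}"
  shows "\<exists>z\<in>\<Omega>. w z = p \<and> lim \<theta> Q z"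
proof -
  obtain V where V: "basic p V" using basic_ex[of UNIV p] by auto
  obtain v0 where v0: "v0 \<in> V \<inter> Q" using basic_nonempty[OF V \<theta>(2)] by blast
  define M where "M = connected_component_set (pre V) (\<sigma> \<theta> v0)"
  have conM: "connected M" unfolding M_def by (rule connected_connected_component)
  have MV: "M \<subseteq> pre V" unfolding M_def by (rule connected_component_subset)
  have oM: "open M" unfolding M_def by (intro open_connected_component_sphere open_pre basic(1)[OF V])
  have sat: "saturated V M"
    unfolding saturated_def
  proof (intro conjI allI impI MV)
    fix C assume C: "connected C" "C \<subseteq> pre V" "C \<inter> M \<noteq> {}"
    then obtain x where x: "x \<in> C" "x \<in> M" by blast
    have "C \<subseteq> connected_component_set (pre V) x" by (rule connected_component_maximal[OF x(1) C(1,2)])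
    also have "\<dots> = M" unfolding M_def using x(2)[unfolded M_def] by (rule connected_component_eq)
    finally show "C \<subseteq> M" .
  qed
  have "\<sigma> \<theta> v0 \<in> \<sigma> \<theta> ` (V \<inter> Q)" using v0 by (rule imageI)
  then have "\<sigma> \<theta> ` (V \<inter> Q) \<subseteq> M"
    unfolding M_def by (rule connected_component_maximal[OF _ piece(2,1)[OF V \<theta>]])
  then have aM: "M \<inter> \<sigma> \<theta> ` (V \<inter> Q) \<noteq> {}" using piece(4)[OF V \<theta>] by (simp add: Int_absorb1)
  have cls: "((\<theta>, Q), (\<theta>', Q')) \<in> (adj p)\<^sup>*" if "\<theta>' \<in> I" "Q' \<in> corners p" "M \<inter> \<sigma> \<theta>' ` (V \<inter> Q') \<noteq> {}" for \<theta>' Q'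
    by (rule same_component_imp_adj[OF V conM MV \<theta> aM that])
  have VS: "V - S = V - {p}" using basic(3)[OF V] p by blast
  then have preV: "pre V = \<Omega> \<inter> w -` (V - {p})" unfolding pre_def by simp
  have "\<exists>z\<in>\<Omega>. z \<in> closure M \<and> w z = p"
  proof (rule puncture_filled[OF basic(1,2,3)[OF V]])
    show "M \<subseteq> \<Omega> \<inter> w -` (V - {p})" using MV preV by simp
    show "C \<subseteq> M" if "connected C" "C \<subseteq> \<Omega> \<inter> w -` (V - {p})" "C \<inter> M \<noteq> {}" for C
      using saturatedD[OF sat that(1)] that(2,3) preV by simp
    \<comment> \<open>Above a value in \<open>L\<close> the points of \<open>M\<close> lie on sheets
      whose corners all belong to the class, so there are at most as many as the class has
      members.\<close>
    show "\<exists>v\<in>U. finite {z \<in> M. w z = v}" if U: "open U" "U \<noteq> {}" "U \<subseteq> V - {p}" for U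
    proof -
      obtain v where v: "v \<in> U" "v \<in> L" using dense_L[OF U(1,2)] by blast
      have "{z \<in> M. w z = v} \<subseteq> (\<lambda>b. \<sigma> (fst b) v) ` {b. ((\<theta>, Q), b) \<in> (adj p)\<^sup>*}"
      proof
        fix z assume z: "z \<in> {z \<in> M. w z = v}"
        then have zM: "z \<in> M" "w z = v" by simp_all
        then have zV: "z \<in> \<Omega>" "w z \<in> V" "w z \<in> L" using MV v(2) unfolding pre_def by blast+
        obtain \<theta>' Q' where b: "\<theta>' \<in> I" "Q' \<in> corners p" "z \<in> \<sigma> \<theta>' ` (V \<inter> Q')" using over_L[OF V zV] by blast
        have "z \<in> M \<inter> \<sigma> \<theta>' ` (V \<inter> Q')" using zM(1) b(3) by (rule IntI)
        then have "M \<inter> \<sigma> \<theta>' ` (V \<inter> Q') \<noteq> {}" by (metis empty_iff)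
        then have r: "((\<theta>, Q), (\<theta>', Q')) \<in> (adj p)\<^sup>*" by (rule cls[OF b(1,2)])
        obtain u where u: "u \<in> V \<inter> Q'" "z = \<sigma> \<theta>' u" using b(3) by blast
        then have "u \<in> L" using corners_sub[OF b(2)] by blast
        then have "u = v" using sec_w[OF b(1), of u] u(2) zM(2) by simp
        then show "z \<in> (\<lambda>b. \<sigma> (fst b) v) ` {b. ((\<theta>, Q), b) \<in> (adj p)\<^sup>*}"
          using r u(2) by (intro rev_image_eqI[of "(\<theta>', Q')"]) auto
      qed
      then have "finite {z \<in> M. w z = v}" by (rule finite_subset) (rule finite_imageI[OF fin])
      then show ?thesis using v(1) by blast
    qed
    show "p \<in> closure (w ` M)"
    proof (rule ccontr)
      assume "p \<notin> closure (w ` M)"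
      then have "p \<in> - closure (w ` M)" "open (- closure (w ` M))" by auto
      then obtain V' where V': "basic p V'" "V' \<subseteq> V \<inter> - closure (w ` M)" using basic_Int[OF V] by blast
      obtain u where u: "u \<in> V' \<inter> Q" using basic_nonempty[OF V'(1) \<theta>(2)] by blast
      then have uV: "u \<in> V \<inter> Q" "u \<in> L" using V'(2) corners_sub[OF \<theta>(2)] by blast+
      then have "\<sigma> \<theta> u \<in> M" using \<open>\<sigma> \<theta> ` (V \<inter> Q) \<subseteq> M\<close> by blast
      then have "u \<in> w ` M" using sec_w[OF \<theta>(1) uV(2)] by (metis imageI)
      then have "u \<in> closure (w ` M)" by (rule subsetD[OF closure_subset])
      then show False using u V'(2) by auto
    qed
  qed
  then obtain z where z: "z \<in> \<Omega>" "z \<in> closure M" "w z = p" by blast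
  \<comment> \<open>An adapted neighbourhood of the limit point \<open>z\<close>, freed from points
    over singular values, lies in \<open>M\<close> and contains the piece of some corner at
    \<open>z\<close>. That corner belongs to the class, so by \<open>lim_class\<close> the given
    corner lies at \<open>z\<close> too.\<close>
  have "open (\<Omega> \<inter> w -` V)" "z \<in> \<Omega> \<inter> w -` V" using open_preimage[OF basic(1)[OF V]] z basic(2)[OF V] by auto
  then obtain V' N K where A: "adapted z V' N K" "N \<subseteq> \<Omega> \<inter> w -` V" "V' \<subseteq> UNIV"
    using adapted_ex[OF z(1), of "\<Omega> \<inter> w -` V" UNIV] by auto
  have V': "basic p V'" and N: "open N" "z \<in> N" "N \<subseteq> w -` V'" and con: "connected (N \<inter> pre V')"
    using A(1) z(3) by (auto simp: adapted_def)
  have sub: "N \<inter> pre V' \<subseteq> pre V"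
  proof
    fix x assume x: "x \<in> N \<inter> pre V'"
    then have "x \<in> \<Omega>" "w x \<in> V" "w x \<notin> S" using A(2) preD(3)[of x V'] by auto
    then show "x \<in> pre V" by (rule preI)
  qed
  have "z \<in> N \<inter> closure M" using N z by simp
  then have "N \<inter> M \<noteq> {}" using open_Int_closure_eq_empty[OF N(1), of M] by (metis empty_iff)
  then obtain x where x: "x \<in> N" "x \<in> M" by (meson disjoint_iff)
  then have "x \<in> pre V'" using MV N(3) preD[of x V] by (intro preI) auto
  then have "N \<inter> pre V' \<inter> M \<noteq> {}" using x by blast
  then have NM: "N \<inter> pre V' \<subseteq> M" by (rule saturatedD[OF sat con sub])
  obtain \<theta>' Q' where b: "\<theta>' \<in> I" "Q' \<in> corners (w z)" "\<sigma> \<theta>' ` (V' \<inter> Q') \<subseteq> N \<inter> pre V'" using adapted_lim_ex[OF A(1)] by blast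
  have bp: "Q' \<in> corners p" using b(2) z(3) by simp
  obtain V'' where V'': "basic p V''" "V'' \<subseteq> V \<inter> V'" using basic_Int[OF V basic(1,2)[OF V']] by blast
  obtain u where u: "u \<in> V'' \<inter> Q'" using basic_nonempty[OF V''(1) bp] by blast
  have "\<sigma> \<theta>' u \<in> \<sigma> \<theta>' ` (V \<inter> Q')" "\<sigma> \<theta>' u \<in> M" using u V''(2) b(3) NM by blast+
  then have "M \<inter> \<sigma> \<theta>' ` (V \<inter> Q') \<noteq> {}" by (metis IntI empty_iff)
  then have r: "((\<theta>, Q), (\<theta>', Q')) \<in> (adj p)\<^sup>*" by (rule cls[OF b(1) bp])
  have l: "lim \<theta>' Q' z" using lim_adapted[OF A(1) b(1,2)] b(3) by blast
  have "Q \<in> corners (w z)" using \<theta>(2) z(3) by simp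
  then have "lim \<theta> Q z"
    using lim_class[OF z(1) b(1,2) l \<theta>(1)] adj_rtrancl_sym[OF r] z(3) by simp
  then show ?thesis using z by blast
qed

lemma fill:
  assumes "\<theta> \<in> I" "Q \<in> corners p" "finite {b. ((\<theta>, Q), b) \<in> (adj p)\<^sup>*}"
  shows "\<exists>z\<in>\<Omega>. w z = p \<and> lim \<theta> Q z"
  using fill_regular fill_singular assms by blast

end

section \<open>The glued surface\<close>

lemma flat_length_cong:
  assumes "\<And>t. t \<in> {0..1} \<Longrightarrow> f t = g t"
  shows "flat_length f = flat_length g"
proof -
  have im: "f ` {0..1} = g ` {0..1}" using assms by (intro image_cong) auto
  have "(\<Sum>i<length ts - 1. ennreal (cmod (finite_part (f (ts ! Suc i)) - finite_part (f (ts ! i))))) =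
        (\<Sum>i<length ts - 1. ennreal (cmod (finite_part (g (ts ! Suc i)) - finite_part (g (ts ! i)))))"
    if ts: "set ts \<subseteq> {0..1}" for ts
  proof (rule sum.cong[OF refl])
    fix i assume "i \<in> {..<length ts - 1}"
    then have "ts ! Suc i \<in> set ts" "ts ! i \<in> set ts" by (auto intro!: nth_mem)
    then have "ts ! Suc i \<in> {0..1}" "ts ! i \<in> {0..1}" using ts by blast+
    then show "ennreal (cmod (finite_part (f (ts ! Suc i)) - finite_part (f (ts ! i)))) =
        ennreal (cmod (finite_part (g (ts ! Suc i)) - finite_part (g (ts ! i))))" using assms by metis
  qed
  then show ?thesis unfolding flat_length_def im by (intro if_cong refl SUP_cong) auto
qed

lemma pullback_flat_dist_le:
  assumes h: "continuous_map X Y h" and \<pi>: "\<And>c. c \<in> topspace X \<Longrightarrow> \<rho> (h c) = \<pi> c"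
  shows "pullback_flat_dist Y \<rho> (h c) (h d) \<le> pullback_flat_dist X \<pi> c d"
  unfolding pullback_flat_dist_def
proof (rule INF_greatest)
  fix \<gamma> assume g: "\<gamma> \<in> {\<gamma>. pathin X \<gamma> \<and> \<gamma> 0 = c \<and> \<gamma> 1 = d}"
  then have p: "pathin X \<gamma>" by simp
  have "pathin Y (h \<circ> \<gamma>)" using p h unfolding pathin_def by (rule continuous_map_compose)
  then have m: "h \<circ> \<gamma> \<in> {\<gamma>. pathin Y \<gamma> \<and> \<gamma> 0 = h c \<and> \<gamma> 1 = h d}" using g by simp
  have "flat_length (\<rho> \<circ> (h \<circ> \<gamma>)) = flat_length (\<pi> \<circ> \<gamma>)"
  proof (rule flat_length_cong)
    fix t :: real assume "t \<in> {0..1}"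
    then have "\<gamma> t \<in> topspace X" using p unfolding pathin_def continuous_map_def by auto
    then show "(\<rho> \<circ> (h \<circ> \<gamma>)) t = (\<pi> \<circ> \<gamma>) t" using \<pi> by simp
  qed
  then show "(INF \<gamma>\<in>{\<gamma>. pathin Y \<gamma> \<and> \<gamma> 0 = h c \<and> \<gamma> 1 = h d}. flat_length (\<rho> \<circ> \<gamma>)) \<le> flat_length (\<pi> \<circ> \<gamma>)"
    using INF_lower[OF m, of "\<lambda>\<gamma>. flat_length (\<rho> \<circ> \<gamma>)"] by simp
qed

text \<open>Paths correspond under \<open>h\<close> and have the same projection, hence the same
  length: a homeomorphism over the sphere is automatically an isometry.\<close>

lemma pullback_flat_dist_homeomorphic:
  assumes h: "homeomorphic_map X Y h" and \<pi>: "\<And>c. c \<in> topspace X \<Longrightarrow> \<rho> (h c) = \<pi> c"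
    and c: "c \<in> topspace X" "d \<in> topspace X"
  shows "pullback_flat_dist Y \<rho> (h c) (h d) = pullback_flat_dist X \<pi> c d"
proof (rule antisym)
  show "pullback_flat_dist Y \<rho> (h c) (h d) \<le> pullback_flat_dist X \<pi> c d"
    by (rule pullback_flat_dist_le[where \<rho> = \<rho> and \<pi> = \<pi>, OF homeomorphic_imp_continuous_map[OF h] \<pi>])
  obtain k where k: "homeomorphic_maps X Y h k" using h homeomorphic_map_maps by blast
  then have kc: "continuous_map Y X k" and kh: "\<And>x. x \<in> topspace X \<Longrightarrow> k (h x) = x" and hk: "\<And>y. y \<in> topspace Y \<Longrightarrow> h (k y) = y"
    unfolding homeomorphic_maps_def by auto
  have "pullback_flat_dist X \<pi> (k (h c)) (k (h d)) \<le> pullback_flat_dist Y \<rho> (h c) (h d)"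
  proof (rule pullback_flat_dist_le[where \<rho> = \<pi> and \<pi> = \<rho>, OF kc])
    fix y assume y: "y \<in> topspace Y"
    then have "k y \<in> topspace X" using kc unfolding continuous_map_def by auto
    then show "\<pi> (k y) = \<rho> y" using \<pi>[of "k y"] hk[OF y] by simp
  qed
  then show "pullback_flat_dist X \<pi> c d \<le> pullback_flat_dist Y \<rho> (h c) (h d)" using kh c by simp
qed

lemma homeomorphic_map_graph:
  assumes "continuous_on \<Omega> w"
  shows "homeomorphic_map (top_of_set \<Omega>) (riemann_surface_of \<Omega> w) (\<lambda>z. (z, w z))"
proof -
  have "embedding_map (top_of_set \<Omega>) (prod_topology (top_of_set \<Omega>) euclidean) (\<lambda>z. (z, w z))"
    using assms by (simp add: embedding_map_graph)
  then have "homeomorphic_map (top_of_set \<Omega>) (subtopology (prod_topology (top_of_set \<Omega>) euclidean) ((\<lambda>z. (z, w z)) ` \<Omega>)) (\<lambda>z. (z, w z))"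
    by (simp add: embedding_map_def)
  moreover have "subtopology (prod_topology (top_of_set \<Omega>) euclidean) ((\<lambda>z. (z, w z)) ` \<Omega>) = riemann_surface_of \<Omega> w"
  proof -
    have "\<Omega> \<times> UNIV \<inter> (\<lambda>z. (z, w z)) ` \<Omega> = (\<lambda>z. (z, w z)) ` \<Omega>" by auto
    then show ?thesis
      unfolding riemann_surface_of_def riemann_sphere_eq prod_topology_subtopology(1) subtopology_subtopology by simp
  qed
  ultimately show ?thesis by simp
qed

lemma rtrancl_symmetric_Un: "sym r \<Longrightarrow> (r \<union> r\<inverse>)\<^sup>* = r\<^sup>*"
  by (simp add: sym_conv_converse_eq)

context tame_cuts
begin

section \<open>The topology of a bordered sheet\<close>

definition germ_nbhd :: "complex option set \<Rightarrow> bpoint set" where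
  "germ_nbhd W = {(p, C). boundary_germ L p C \<and> (\<exists>V. open V \<and> p \<in> V \<and> C V \<subseteq> W)}"

lemma bordered_sheet_eq: "bordered_sheet \<Xi> = topology_generated_by {germ_nbhd W |W. open W}"
  unfolding bordered_sheet_def germ_nbhd_def L_def[symmetric] riemann_sphere_eq open_openin[symmetric] ..

lemma germ_nbhd_germ:
  assumes Q: "Q \<in> corners p"
  shows "(p, germ p Q) \<in> germ_nbhd W \<longleftrightarrow> (\<exists>V. basic p V \<and> V \<inter> Q \<subseteq> W)"
proof
  assume "(p, germ p Q) \<in> germ_nbhd W"
  then obtain V where V: "open V" "p \<in> V" "germ p Q V \<subseteq> W" unfolding germ_nbhd_def by blast
  obtain B where B: "basic p B" "B \<subseteq> V" using basic_ex[OF V(1,2)] by blast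
  have "germ p Q B \<subseteq> germ p Q V"
    using boundary_germ_germ[OF Q] V(1) B basic(1,2)[OF B(1)]
    unfolding boundary_germ_def riemann_sphere_eq open_openin[symmetric] by blast
  then have "B \<inter> Q \<subseteq> W" using germ_basic[OF B(1) Q] V(3) by simp
  then show "\<exists>V. basic p V \<and> V \<inter> Q \<subseteq> W" using B(1) by blast
next
  assume "\<exists>V. basic p V \<and> V \<inter> Q \<subseteq> W"
  then obtain V where V: "basic p V" "V \<inter> Q \<subseteq> W" by blast
  then have "germ p Q V \<subseteq> W" using germ_basic[OF V(1) Q] by simp
  then show "(p, germ p Q) \<in> germ_nbhd W"
    unfolding germ_nbhd_def using boundary_germ_germ[OF Q] basic(1,2)[OF V(1)] by blast
qed

lemma germ_nbhd_cases:
  assumes "x \<in> germ_nbhd W" obtains p Q where "x = (p, germ p Q)" "Q \<in> corners p"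
proof -
  obtain p C where x: "x = (p, C)" by (cases x)
  then have "boundary_germ L p C" using assms by (simp add: germ_nbhd_def)
  then obtain Q where "Q \<in> corners p" "C = germ p Q" using boundary_germ_iff by blast
  then show thesis using that x by blast
qed

lemma germ_nbhd_Int: "germ_nbhd W1 \<inter> germ_nbhd W2 \<subseteq> germ_nbhd (W1 \<inter> W2)"
proof
  fix x assume x: "x \<in> germ_nbhd W1 \<inter> germ_nbhd W2"
  then obtain p Q where p: "x = (p, germ p Q)" "Q \<in> corners p" by (metis germ_nbhd_cases IntD1)
  obtain V1 where V1: "basic p V1" "V1 \<inter> Q \<subseteq> W1" using x p germ_nbhd_germ[OF p(2)] by auto
  obtain V2 where V2: "basic p V2" "V2 \<inter> Q \<subseteq> W2" using x p germ_nbhd_germ[OF p(2)] by auto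
  have "open (V1 \<inter> V2)" "p \<in> V1 \<inter> V2" using basic(1,2) V1(1) V2(1) by auto
  then obtain V where V: "basic p V" "V \<subseteq> V1 \<inter> V2" using basic_ex by metis
  then have "V \<inter> Q \<subseteq> W1 \<inter> W2" using V1 V2 by blast
  then show "x \<in> germ_nbhd (W1 \<inter> W2)" using V(1) p germ_nbhd_germ[OF p(2)] by auto
qed

lemma germ_nbhd_mono: "W1 \<subseteq> W2 \<Longrightarrow> germ_nbhd W1 \<subseteq> germ_nbhd W2"
  unfolding germ_nbhd_def by blast

text \<open>By \<open>germ_nbhd_Int\<close> the generating sets form a basis, so openness can be
  tested point by point.\<close>

lemma openin_bordered:
  "openin (bordered_sheet \<Xi>) X \<longleftrightarrow> (\<forall>x\<in>X. \<exists>W. open W \<and> x \<in> germ_nbhd W \<and> germ_nbhd W \<subseteq> X)"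
proof
  assume "openin (bordered_sheet \<Xi>) X"
  then have "generate_topology_on {germ_nbhd W |W. open W} X"
    unfolding bordered_sheet_eq openin_topology_generated_by_iff .
  then show "\<forall>x\<in>X. \<exists>W. open W \<and> x \<in> germ_nbhd W \<and> germ_nbhd W \<subseteq> X"
  proof (induction rule: generate_topology_on.induct)
    case (Int a b)
    show ?case
    proof
      fix x assume x: "x \<in> a \<inter> b"
      obtain W1 where W1: "open W1" "x \<in> germ_nbhd W1" "germ_nbhd W1 \<subseteq> a" using Int.IH(1) x by blast
      obtain W2 where W2: "open W2" "x \<in> germ_nbhd W2" "germ_nbhd W2 \<subseteq> b" using Int.IH(2) x by blast
      have "open (W1 \<inter> W2)" using W1(1) W2(1) by (rule open_Int)
      moreover have "x \<in> germ_nbhd (W1 \<inter> W2)" by (rule subsetD[OF germ_nbhd_Int IntI[OF W1(2) W2(2)]])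
      moreover have "germ_nbhd (W1 \<inter> W2) \<subseteq> a \<inter> b"
        using germ_nbhd_mono[of "W1 \<inter> W2" W1] germ_nbhd_mono[of "W1 \<inter> W2" W2] W1(3) W2(3) by blast
      ultimately show "\<exists>W. open W \<and> x \<in> germ_nbhd W \<and> germ_nbhd W \<subseteq> a \<inter> b" by blast
    qed
  next
    case (UN K)
    show ?case
    proof
      fix x assume "x \<in> \<Union>K"
      then obtain k where k: "k \<in> K" "x \<in> k" by blast
      obtain W where "open W" "x \<in> germ_nbhd W" "germ_nbhd W \<subseteq> k" using UN.IH[OF k(1)] k(2) by blast
      then show "\<exists>W. open W \<and> x \<in> germ_nbhd W \<and> germ_nbhd W \<subseteq> \<Union>K" using k(1) by blast
    qed
  qed auto
next
  assume *: "\<forall>x\<in>X. \<exists>W. open W \<and> x \<in> germ_nbhd W \<and> germ_nbhd W \<subseteq> X"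
  show "openin (bordered_sheet \<Xi>) X"
  proof (subst openin_subopen, intro ballI)
    fix x assume "x \<in> X"
    then obtain W where W: "open W" "x \<in> germ_nbhd W" "germ_nbhd W \<subseteq> X" using * by blast
    have "openin (bordered_sheet \<Xi>) (germ_nbhd W)"
      unfolding bordered_sheet_eq by (rule topology_generated_by_Basis) (use W(1) in blast)
    then show "\<exists>T. openin (bordered_sheet \<Xi>) T \<and> x \<in> T \<and> T \<subseteq> X" using W by blast
  qed
qed

lemma topspace_bordered: "topspace (bordered_sheet \<Xi>) = {(p, C). boundary_germ L p C}"
proof -
  have "\<Union>{germ_nbhd W |W. open W} = germ_nbhd UNIV"
    using germ_nbhd_mono[OF subset_UNIV] by auto
  moreover have "germ_nbhd UNIV = {(p, C). boundary_germ L p C}"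
    unfolding germ_nbhd_def by auto
  ultimately show ?thesis unfolding bordered_sheet_eq topology_generated_by_topspace by simp
qed

end

context glue
begin

section \<open>Glueing classes and points of the domain\<close>

definition slit_glueing :: glueing where
  "slit_glueing = \<lparr>sheets = I, cuts = (\<lambda>_. \<Xi>), across = acr\<rparr>"

lemma slit_glueing_simps [simp]: "sheets slit_glueing = I" "cuts slit_glueing \<theta> = \<Xi>" "across slit_glueing = acr"
  by (simp_all add: slit_glueing_def)

lemma valid_slit_glueing: "valid_glueing S slit_glueing"
  unfolding valid_glueing_def using sheet_type acr_in opposite_sides acr_back by simp

definition pt :: "nat \<Rightarrow> complex option \<Rightarrow> complex option set \<Rightarrow> nat \<times> bpoint" where
  "pt \<theta> p Q = (\<theta>, p, germ p Q)"

lemma pt_inj: "pt \<theta> p Q = pt \<theta>' p' Q' \<Longrightarrow> Q \<in> corners p \<Longrightarrow> Q' \<in> corners p' \<Longrightarrow> \<theta> = \<theta>' \<and> p = p' \<and> Q = Q'"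
  unfolding pt_def using germ_inj by auto

lemma topspace_DS: "topspace (disjoint_sheets slit_glueing) = {(\<theta>, p, C). \<theta> \<in> I \<and> boundary_germ L p C}"
  unfolding disjoint_sheets_def by (auto simp: topspace_bordered)

lemma DS_iff: "x \<in> topspace (disjoint_sheets slit_glueing) \<longleftrightarrow> (\<exists>\<theta> p Q. \<theta> \<in> I \<and> Q \<in> corners p \<and> x = pt \<theta> p Q)"
  unfolding topspace_DS boundary_germ_iff pt_def by auto

lemma glue_step_iff:
  "(x, y) \<in> glue_step slit_glueing \<longleftrightarrow> (\<exists>\<theta> Q \<theta>' Q' p. x = pt \<theta> p Q \<and> y = pt \<theta>' p Q' \<and> ((\<theta>, Q), (\<theta>', Q')) \<in> adj p)"
proof
  assume *: "(x, y) \<in> glue_step slit_glueing"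
  obtain \<theta> p C where x: "x = (\<theta>, p, C)" by (cases x)
  obtain \<theta>' p' C' where y: "y = (\<theta>', p', C')" by (cases y)
  have 1: "x \<in> topspace (disjoint_sheets slit_glueing)" "y \<in> topspace (disjoint_sheets slit_glueing)" "p' = p"
    "\<exists>e\<in>sides. \<theta>' = acr \<theta> e \<and> on_left_of (p, C) e \<and> on_left_of (p, C') (opposite e)"
    using * unfolding x y glue_step_def by auto
  obtain Q where Q: "\<theta> \<in> I" "Q \<in> corners p" "C = germ p Q" using 1(1) unfolding x topspace_DS boundary_germ_iff by blast
  obtain Q' where Q': "\<theta>' \<in> I" "Q' \<in> corners p" "C' = germ p Q'" using 1(2,3) unfolding y topspace_DS boundary_germ_iff by blast
  obtain e where e: "e \<in> sides" "\<theta>' = acr \<theta> e" "on_left_of (p, C) e" "on_left_of (p, C') (opposite e)" using 1(4) by blast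
  have "p \<in> segment_points e" "side e \<subseteq> Q" "side (opposite e) \<subseteq> Q'"
    using e(3,4) unfolding Q(3) Q'(3) on_left_of_germ[OF e(1) Q(2)] on_left_of_germ[OF opposite_sides[OF e(1)] Q'(2)] by blast+
  then have "((\<theta>, Q), (\<theta>', Q')) \<in> adj p" using Q Q' e unfolding adj_iff by blast
  then show "\<exists>\<theta> Q \<theta>' Q' p. x = pt \<theta> p Q \<and> y = pt \<theta>' p Q' \<and> ((\<theta>, Q), (\<theta>', Q')) \<in> adj p"
    using Q(3) Q'(3) 1(3) x y unfolding pt_def by blast
next
  assume "\<exists>\<theta> Q \<theta>' Q' p. x = pt \<theta> p Q \<and> y = pt \<theta>' p Q' \<and> ((\<theta>, Q), (\<theta>', Q')) \<in> adj p"
  then obtain \<theta> Q \<theta>' Q' p where x: "x = pt \<theta> p Q" and y: "y = pt \<theta>' p Q'" and "((\<theta>, Q), (\<theta>', Q')) \<in> adj p" by blast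
  then obtain e where I: "\<theta> \<in> I" "\<theta>' \<in> I" "Q \<in> corners p" "Q' \<in> corners p" and e: "e \<in> sides" "p \<in> segment_points e"
    "\<theta>' = acr \<theta> e" "side e \<subseteq> Q" "side (opposite e) \<subseteq> Q'" unfolding adj_iff by blast
  have "on_left_of (p, germ p Q) e" using on_left_of_germ[OF e(1) I(3)] e by blast
  moreover have "on_left_of (p, germ p Q') (opposite e)"
    using on_left_of_germ[OF opposite_sides[OF e(1)] I(4)] e by simp
  ultimately have "\<exists>e\<in>sides. \<theta>' = acr \<theta> e \<and> on_left_of (p, germ p Q) e \<and> on_left_of (p, germ p Q') (opposite e)"
    using e(1,3) by blast
  moreover have "x \<in> topspace (disjoint_sheets slit_glueing)" "y \<in> topspace (disjoint_sheets slit_glueing)" using I x y DS_iff by blast+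
  ultimately show "(x, y) \<in> glue_step slit_glueing" unfolding glue_step_def x y pt_def by simp
qed

lemma glue_rel_eq: "glue_rel slit_glueing = (glue_step slit_glueing)\<^sup>*"
  unfolding glue_rel_def by (rule rtrancl_symmetric_Un) (use adj_sym glue_step_iff in \<open>unfold sym_def, blast\<close>)

text \<open>A glueing step keeps the underlying point \<open>p\<close> and acts on pairs of a sheet
  and a corner as \<open>adj p\<close>; hence only corners over the same \<open>p\<close> are
  linked.\<close>

lemma glue_class:
  assumes "\<theta> \<in> I" "Q \<in> corners p"
  shows "glue_rel slit_glueing `` {pt \<theta> p Q} = (\<lambda>b. pt (fst b) p (snd b)) ` {b. ((\<theta>, Q), b) \<in> (adj p)\<^sup>*}"
proof (intro equalityI subsetI)
  fix y assume "y \<in> glue_rel slit_glueing `` {pt \<theta> p Q}"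
  then have "(pt \<theta> p Q, y) \<in> (glue_step slit_glueing)\<^sup>*" by (simp add: glue_rel_eq)
  then show "y \<in> (\<lambda>b. pt (fst b) p (snd b)) ` {b. ((\<theta>, Q), b) \<in> (adj p)\<^sup>*}"
  proof (induction rule: rtrancl_induct)
    case base
    show ?case by (rule image_eqI[of _ _ "(\<theta>, Q)"]) auto
  next
    case (step y z)
    obtain b where b: "y = pt (fst b) p (snd b)" "((\<theta>, Q), b) \<in> (adj p)\<^sup>*" using step.IH by blast
    have bi: "b \<in> I \<times> corners p" by (rule adj_rtrancl_in[OF b(2)]) (use assms in simp)
    obtain \<theta>1 Q1 \<theta>2 Q2 p1 where 1: "y = pt \<theta>1 p1 Q1" "z = pt \<theta>2 p1 Q2" "((\<theta>1, Q1), (\<theta>2, Q2)) \<in> adj p1"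
      using step.hyps(2) unfolding glue_step_iff by blast
    have "Q1 \<in> corners p1" using 1(3) by (simp add: adj_iff)
    then have "fst b = \<theta>1 \<and> p = p1 \<and> snd b = Q1"
      using pt_inj[of "fst b" p "snd b" \<theta>1 p1 Q1] b(1) 1(1) bi by (auto simp: mem_Times_iff)
    then have "(b, (\<theta>2, Q2)) \<in> adj p" "z = pt \<theta>2 p Q2" using 1 by (cases b; simp)+
    then show ?case using b(2) by (intro image_eqI[of _ _ "(\<theta>2, Q2)"]) auto
  qed
next
  fix y assume "y \<in> (\<lambda>b. pt (fst b) p (snd b)) ` {b. ((\<theta>, Q), b) \<in> (adj p)\<^sup>*}"
  then obtain b where b: "y = pt (fst b) p (snd b)" "((\<theta>, Q), b) \<in> (adj p)\<^sup>*" by blast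
  from b(2) have "(pt \<theta> p Q, pt (fst b) p (snd b)) \<in> (glue_step slit_glueing)\<^sup>*"
  proof (induction rule: rtrancl_induct)
    case (step b c)
    have "(pt (fst b) p (snd b), pt (fst c) p (snd c)) \<in> glue_step slit_glueing"
      unfolding glue_step_iff using step.hyps(2) by (metis prod.collapse)
    then show ?case using step.IH by (rule rtrancl_into_rtrancl[rotated])
  qed simp
  then show "y \<in> glue_rel slit_glueing `` {pt \<theta> p Q}" using b(1) by (simp add: glue_rel_eq)
qed

definition X0 :: "(nat \<times> bpoint) topology" where
  "X0 = subtopology (disjoint_sheets slit_glueing) {x. finite (glue_rel slit_glueing `` {x})}"

text \<open>A finite class lies at a point of \<Omega> by \<open>fill\<close>; conversely the
  corners at a point form a finite set by \<open>lim_finite\<close>, which contains the class. So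
  leaving out the infinite classes keeps exactly the points of \<Omega>.\<close>

lemma X0_iff:
  "x \<in> topspace X0 \<longleftrightarrow> (\<exists>z\<in>\<Omega>. \<exists>\<theta>\<in>I. \<exists>Q\<in>corners (w z). lim \<theta> Q z \<and> x = pt \<theta> (w z) Q)"
proof
  assume "x \<in> topspace X0"
  then have "x \<in> topspace (disjoint_sheets slit_glueing)" "finite (glue_rel slit_glueing `` {x})" by (auto simp: X0_def)
  then obtain \<theta> p Q where x: "\<theta> \<in> I" "Q \<in> corners p" "x = pt \<theta> p Q" and
    "finite (glue_rel slit_glueing `` {x})" unfolding DS_iff by blast
  then have "finite ((\<lambda>b. pt (fst b) p (snd b)) ` {b. ((\<theta>, Q), b) \<in> (adj p)\<^sup>*})" using glue_class[OF x(1,2)] by simp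
  moreover have "inj_on (\<lambda>b. pt (fst b) p (snd b)) {b. ((\<theta>, Q), b) \<in> (adj p)\<^sup>*}"
  proof (rule inj_onI)
    fix a b assume ab: "a \<in> {b. ((\<theta>, Q), b) \<in> (adj p)\<^sup>*}" "b \<in> {b. ((\<theta>, Q), b) \<in> (adj p)\<^sup>*}"
      "pt (fst a) p (snd a) = pt (fst b) p (snd b)"
    then have "a \<in> I \<times> corners p" "b \<in> I \<times> corners p" using adj_rtrancl_in[of "(\<theta>, Q)"] x(1,2) by auto
    then show "a = b" using pt_inj[OF ab(3)] by (auto simp: mem_Times_iff prod_eq_iff)
  qed
  ultimately have "finite {b. ((\<theta>, Q), b) \<in> (adj p)\<^sup>*}" by (rule finite_imageD)
  then obtain z where "z \<in> \<Omega>" "w z = p" "lim \<theta> Q z" using fill[OF x(1,2)] by blast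
  then show "\<exists>z\<in>\<Omega>. \<exists>\<theta>\<in>I. \<exists>Q\<in>corners (w z). lim \<theta> Q z \<and> x = pt \<theta> (w z) Q" using x by blast
next
  assume "\<exists>z\<in>\<Omega>. \<exists>\<theta>\<in>I. \<exists>Q\<in>corners (w z). lim \<theta> Q z \<and> x = pt \<theta> (w z) Q"
  then obtain z \<theta> Q where z: "z \<in> \<Omega>" "\<theta> \<in> I" "Q \<in> corners (w z)" "lim \<theta> Q z" "x = pt \<theta> (w z) Q" by blast
  have "{b. ((\<theta>, Q), b) \<in> (adj (w z))\<^sup>*} \<subseteq> {(\<theta>, Q). \<theta> \<in> I \<and> Q \<in> corners (w z) \<and> lim \<theta> Q z}"
  proof
    fix b assume "b \<in> {b. ((\<theta>, Q), b) \<in> (adj (w z))\<^sup>*}"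
    then have b: "((\<theta>, Q), b) \<in> (adj (w z))\<^sup>*" by simp
    have bi: "b \<in> I \<times> corners (w z)" by (rule adj_rtrancl_in[OF b]) (use z in simp)
    obtain \<theta>' Q' where b': "b = (\<theta>', Q')" by (cases b)
    then show "b \<in> {(\<theta>, Q). \<theta> \<in> I \<and> Q \<in> corners (w z) \<and> lim \<theta> Q z}"
      using lim_class[OF z(1,2,3,4), of \<theta>' Q'] b bi by simp
  qed
  then have "finite (glue_rel slit_glueing `` {x})"
    unfolding z(5) glue_class[OF z(2,3)] using lim_finite[OF z(1)] by (intro finite_imageI) (rule finite_subset)
  then show "x \<in> topspace X0" unfolding X0_def using z DS_iff by auto
qed

text \<open>The point of \<Omega> at which a corner lies, unique by \<open>lim_unique\<close>. This
  becomes a quotient map with the glueing classes as fibres.\<close>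

definition ff :: "nat \<times> bpoint \<Rightarrow> complex option" where
  "ff x = (THE z. z \<in> \<Omega> \<and> (\<exists>\<theta>\<in>I. \<exists>Q\<in>corners (w z). lim \<theta> Q z \<and> x = pt \<theta> (w z) Q))"

lemma ff_eq:
  assumes "z \<in> \<Omega>" "\<theta> \<in> I" "Q \<in> corners (w z)" "lim \<theta> Q z"
  shows "ff (pt \<theta> (w z) Q) = z"
  unfolding ff_def
proof (rule the_equality)
  fix z' assume "z' \<in> \<Omega> \<and> (\<exists>\<theta>'\<in>I. \<exists>Q'\<in>corners (w z'). lim \<theta>' Q' z' \<and> pt \<theta> (w z) Q = pt \<theta>' (w z') Q')"
  then obtain \<theta>' Q' where 1: "Q' \<in> corners (w z')" "lim \<theta>' Q' z'" "pt \<theta> (w z) Q = pt \<theta>' (w z') Q'" by blast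
  then have "\<theta> = \<theta>'" "w z = w z'" "Q = Q'" using pt_inj[OF 1(3) assms(3) 1(1)] by blast+
  then show "z' = z" using lim_unique[OF assms(4) _ _ assms(3), of z'] 1(2) by simp
qed (use assms in blast)

lemma X0_E:
  assumes "x \<in> topspace X0"
  obtains z \<theta> Q where "z \<in> \<Omega>" "\<theta> \<in> I" "Q \<in> corners (w z)" "lim \<theta> Q z" "x = pt \<theta> (w z) Q" "ff x = z"
proof -
  obtain z \<theta> Q where z: "z \<in> \<Omega>" "\<theta> \<in> I" "Q \<in> corners (w z)" "lim \<theta> Q z" "x = pt \<theta> (w z) Q"
    using assms unfolding X0_iff by blast
  show thesis by (rule that[OF z]) (simp add: z(5) ff_eq[OF z(1-4)])
qed

lemma ff_class:
  assumes "x \<in> topspace X0" "y \<in> topspace X0"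
  shows "ff x = ff y \<longleftrightarrow> glue_rel slit_glueing `` {x} = glue_rel slit_glueing `` {y}"
proof -
  obtain z \<theta> Q where x: "z \<in> \<Omega>" "\<theta> \<in> I" "Q \<in> corners (w z)" "lim \<theta> Q z" "x = pt \<theta> (w z) Q" "ff x = z"
    by (rule X0_E[OF assms(1)])
  obtain z' \<theta>' Q' where y: "z' \<in> \<Omega>" "\<theta>' \<in> I" "Q' \<in> corners (w z')" "lim \<theta>' Q' z'" "y = pt \<theta>' (w z') Q'" "ff y = z'"
    by (rule X0_E[OF assms(2)])
  show ?thesis
  proof
    assume "ff x = ff y"
    then have zz: "z' = z" using x y by simp
    have r: "((\<theta>, Q), (\<theta>', Q')) \<in> (adj (w z))\<^sup>*"
      using lim_class[OF x(1,2,3,4), of \<theta>' Q'] y zz by simp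
    have "y \<in> (\<lambda>b. pt (fst b) (w z) (snd b)) ` {b. ((\<theta>, Q), b) \<in> (adj (w z))\<^sup>*}"
      using r y(5) zz by (intro rev_image_eqI[of "(\<theta>', Q')"]) simp_all
    then have "(x, y) \<in> glue_rel slit_glueing" unfolding glue_class[OF x(2,3), symmetric] x(5) by simp
    moreover have "x \<in> (\<lambda>b. pt (fst b) (w z') (snd b)) ` {b. ((\<theta>', Q'), b) \<in> (adj (w z'))\<^sup>*}"
      using adj_rtrancl_sym[OF r] x(5) zz by (intro rev_image_eqI[of "(\<theta>, Q)"]) simp_all
    then have "(y, x) \<in> glue_rel slit_glueing" unfolding glue_class[OF y(2,3), symmetric] y(5) by simp
    ultimately show "glue_rel slit_glueing `` {x} = glue_rel slit_glueing `` {y}"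
      unfolding glue_rel_eq by (auto intro: rtrancl_trans)
  next
    assume "glue_rel slit_glueing `` {x} = glue_rel slit_glueing `` {y}"
    moreover have "y \<in> glue_rel slit_glueing `` {y}" by (simp add: glue_rel_eq)
    ultimately have "y \<in> glue_rel slit_glueing `` {pt \<theta> (w z) Q}" using x(5) by simp
    then obtain b where b: "y = pt (fst b) (w z) (snd b)" "((\<theta>, Q), b) \<in> (adj (w z))\<^sup>*"
      unfolding glue_class[OF x(2,3)] by blast
    have bi: "b \<in> I \<times> corners (w z)" by (rule adj_rtrancl_in[OF b(2)]) (use x in simp)
    then have b2: "fst b \<in> I" "snd b \<in> corners (w z)" by (auto simp: mem_Times_iff)
    have "lim (fst b) (snd b) z" using lim_class[OF x(1,2,3,4) b2] b(2) by simp
    then show "ff x = ff y" using ff_eq[OF x(1) b2] b(1) x(6) by simp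
  qed
qed

lemma ff_image: "ff ` topspace X0 = \<Omega>"
proof (intro equalityI subsetI)
  fix z assume "z \<in> ff ` topspace X0"
  then obtain x where x: "x \<in> topspace X0" "z = ff x" by blast
  show "z \<in> \<Omega>" by (rule X0_E[OF x(1)]) (simp add: x(2))
next
  fix z assume z: "z \<in> \<Omega>"
  obtain \<theta> Q where q: "\<theta> \<in> I" "Q \<in> corners (w z)" "lim \<theta> Q z" using lim_ex[OF z] by blast
  then have "pt \<theta> (w z) Q \<in> topspace X0" using z unfolding X0_iff by blast
  then show "z \<in> ff ` topspace X0" using ff_eq[OF z q] by (metis imageI)
qed

lemma lim_closure:
  assumes "lim \<theta> Q z" "Q \<in> corners (w z)" "basic (w z) V" "V \<inter> Q \<subseteq> W"
  shows "z \<in> closure (\<sigma> \<theta> ` W)"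
proof (rule ccontr)
  assume "z \<notin> closure (\<sigma> \<theta> ` W)"
  then have "open (- closure (\<sigma> \<theta> ` W))" "z \<in> - closure (\<sigma> \<theta> ` W)" by auto
  then obtain V' where V': "basic (w z) V'" "\<sigma> \<theta> ` (V' \<inter> Q) \<subseteq> - closure (\<sigma> \<theta> ` W)" using limD[OF assms(1)] by blast
  obtain V'' where V'': "basic (w z) V''" "V'' \<subseteq> V \<inter> V'" using basic_Int[OF assms(3) basic(1,2)[OF V'(1)]] by blast
  obtain u where u: "u \<in> V'' \<inter> Q" using basic_nonempty[OF V''(1) assms(2)] by blast
  then have "u \<in> V \<inter> Q" "u \<in> V' \<inter> Q" using V''(2) by blast+
  then have "\<sigma> \<theta> u \<in> \<sigma> \<theta> ` W" "\<sigma> \<theta> u \<in> - closure (\<sigma> \<theta> ` W)" using assms(4) V'(2) by blast+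
  then show False using closure_subset[of "\<sigma> \<theta> ` W"] by blast
qed

text \<open>A basic open set of the bordered sheet controls the values of \<sigma> \<theta> on an
  open set \<open>W\<close> only, whereas \<open>ff\<close> takes limits of such values; hence the
  closure in \<open>T\<close>, absorbed by a closed ball inside \<open>U\<close>.\<close>

lemma continuous_ff: "openin X0 {x \<in> topspace X0. ff x \<in> U}" if U: "open U"
proof -
  define T where "T \<theta> = {y. \<exists>W. open W \<and> y \<in> germ_nbhd W \<and> closure (\<sigma> \<theta> ` W) \<subseteq> U}" for \<theta>
  have T: "openin (bordered_sheet \<Xi>) (T \<theta>)" for \<theta>
    unfolding openin_bordered
  proof
    fix x assume "x \<in> T \<theta>"
    then obtain W where W: "open W" "x \<in> germ_nbhd W" "closure (\<sigma> \<theta> ` W) \<subseteq> U" unfolding T_def by blast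
    have "germ_nbhd W \<subseteq> T \<theta>" unfolding T_def using W(1,3) by blast
    then show "\<exists>W. open W \<and> x \<in> germ_nbhd W \<and> germ_nbhd W \<subseteq> T \<theta>" using W by blast
  qed
  have o: "openin (disjoint_sheets slit_glueing) (Sigma I T)"
    unfolding disjoint_sheets_def slit_glueing_simps openin_disjoint_union using T by blast
  have "{x \<in> topspace X0. ff x \<in> U} = Sigma I T \<inter> topspace X0"
  proof (intro set_eqI)
    fix x
    show "x \<in> {x \<in> topspace X0. ff x \<in> U} \<longleftrightarrow> x \<in> Sigma I T \<inter> topspace X0"
    proof (cases "x \<in> topspace X0")
      case True
      then obtain z \<theta> Q where x: "z \<in> \<Omega>" "\<theta> \<in> I" "Q \<in> corners (w z)" "lim \<theta> Q z" "x = pt \<theta> (w z) Q" "ff x = z"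
        by (rule X0_E)
      have "z \<in> U \<longleftrightarrow> (w z, germ (w z) Q) \<in> T \<theta>"
      proof
        assume "z \<in> U"
        then obtain e where e: "e > 0" "cball z e \<subseteq> U" using U open_contains_cball by blast
        obtain V where V: "basic (w z) V" "\<sigma> \<theta> ` (V \<inter> Q) \<subseteq> ball z e"
          using limD[OF x(4) open_ball, of z e] e(1) by auto
        have "closure (\<sigma> \<theta> ` (V \<inter> Q)) \<subseteq> cball z e"
          using V(2) ball_subset_cball by (intro closure_minimal closed_cball) (rule order_trans)
        then have "closure (\<sigma> \<theta> ` (V \<inter> Q)) \<subseteq> U" using e(2) by (rule order_trans)
        moreover have "open (V \<inter> Q)" using basic(1)[OF V(1)] corners_open[OF x(3)] by (rule open_Int)
        moreover have "(w z, germ (w z) Q) \<in> germ_nbhd (V \<inter> Q)" using germ_nbhd_germ[OF x(3)] V(1) by blast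
        ultimately show "(w z, germ (w z) Q) \<in> T \<theta>" unfolding T_def by blast
      next
        assume "(w z, germ (w z) Q) \<in> T \<theta>"
        then obtain W where W: "(w z, germ (w z) Q) \<in> germ_nbhd W" "closure (\<sigma> \<theta> ` W) \<subseteq> U" unfolding T_def by blast
        then obtain V where V: "basic (w z) V" "V \<inter> Q \<subseteq> W" using germ_nbhd_germ[OF x(3)] by blast
        then show "z \<in> U" using lim_closure[OF x(4,3) V] W(2) by blast
      qed
      then show ?thesis using x True by (auto simp: pt_def)
    qed simp
  qed
  moreover have "openin X0 (Sigma I T \<inter> topspace X0)"
    unfolding X0_def openin_subtopology topspace_subtopology
    using o by (intro exI[of _ "Sigma I T"]) (use openin_subset[OF o] in blast)
  ultimately show ?thesis by simp
qed

text \<open>Only finitely many corners lie at \<open>z\<close>, so one neighbourhood of w z serves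
  the open sets around all of them. Every point near \<open>z\<close> has a corner whose trace is
  contained in the trace of one of these, and so belongs to the same open set.\<close>

lemma quotient_ff:
  assumes A: "A \<subseteq> \<Omega>" and o: "openin X0 {x \<in> topspace X0. ff x \<in> A}"
  shows "open A"
proof (rule open_subopen[THEN iffD2, rule_format])
  fix z assume zA: "z \<in> A"
  then have z: "z \<in> \<Omega>" using A by blast
  obtain T where T: "openin (disjoint_sheets slit_glueing) T" "{x \<in> topspace X0. ff x \<in> A} = T \<inter> {x. finite (glue_rel slit_glueing `` {x})}"
    using o unfolding X0_def openin_subtopology by blast
  then have "T \<subseteq> topspace (disjoint_sheets slit_glueing)" using openin_subset by blast
  then have Tff: "x \<in> T \<longleftrightarrow> ff x \<in> A" if "x \<in> topspace X0" for x
    using T(2) that unfolding X0_def by auto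
  have To: "openin (bordered_sheet \<Xi>) {y. (\<theta>, y) \<in> T}" if "\<theta> \<in> I" for \<theta>
    using T(1) that unfolding disjoint_sheets_def openin_sum_topology by simp
  let ?F = "{(\<theta>, Q). \<theta> \<in> I \<and> Q \<in> corners (w z) \<and> lim \<theta> Q z}"
  define good where "good b V W \<longleftrightarrow> basic (w z) V \<and> V \<inter> snd b \<subseteq> W \<and> open W \<and> germ_nbhd W \<subseteq> {y. (fst b, y) \<in> T}" for b V W
  have ex: "\<exists>V W. good b V W" if b: "b \<in> ?F" for b
  proof -
    obtain \<theta> Q where b': "b = (\<theta>, Q)" "\<theta> \<in> I" "Q \<in> corners (w z)" "lim \<theta> Q z" using b by blast
    have "pt \<theta> (w z) Q \<in> topspace X0" using b' z unfolding X0_iff by blast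
    then have "pt \<theta> (w z) Q \<in> T" using Tff ff_eq[OF z b'(2,3,4)] zA by simp
    then have "(w z, germ (w z) Q) \<in> {y. (\<theta>, y) \<in> T}" by (simp add: pt_def)
    then obtain W where W: "open W" "(w z, germ (w z) Q) \<in> germ_nbhd W" "germ_nbhd W \<subseteq> {y. (\<theta>, y) \<in> T}"
      using To[OF b'(2)] unfolding openin_bordered by blast
    obtain V where V: "basic (w z) V" "V \<inter> Q \<subseteq> W" using germ_nbhd_germ[OF b'(3)] W(2) by blast
    have "good b V W" unfolding good_def b'(1) using V W by simp
    then show ?thesis by blast
  qed
  define VV where "VV b = (SOME V. \<exists>W. good b V W)" for b
  define WW where "WW b = (SOME W. good b (VV b) W)" for b
  have good: "good b (VV b) (WW b)" if "b \<in> ?F" for b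
    unfolding WW_def by (rule someI_ex) (unfold VV_def, rule someI_ex[OF ex[OF that]])
  have VW: "basic (w z) (VV b)" "VV b \<inter> snd b \<subseteq> WW b" "germ_nbhd (WW b) \<subseteq> {y. (fst b, y) \<in> T}" if "b \<in> ?F" for b
    using good[OF that] unfolding good_def by blast+
  define O' where "O' = (\<Inter>b\<in>?F. VV b)"
  have O': "open O'" "w z \<in> O'"
  proof -
    show "open O'" unfolding O'_def by (rule open_INT[OF lim_finite[OF z]]) (intro ballI basic(1)[OF VW(1)])
    show "w z \<in> O'" unfolding O'_def by (rule INT_I) (rule basic(2)[OF VW(1)])
  qed
  obtain V N K where A': "adapted z V N K" "V \<subseteq> O'" using adapted_ex[OF z open_UNIV UNIV_I O'] by blast
  have V: "basic (w z) V" and N: "open N" "z \<in> N" "N \<subseteq> w -` V" "N \<subseteq> \<Omega>" using A'(1) unfolding adapted_def by blast+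
  have "N \<subseteq> A"
  proof
    fix z' assume z': "z' \<in> N"
    then have z'\<Omega>: "z' \<in> \<Omega>" and wV: "w z' \<in> V" using N by blast+
    obtain \<theta>' Q' where q: "\<theta>' \<in> I" "Q' \<in> corners (w z')" "lim \<theta>' Q' z'" using lim_ex[OF z'\<Omega>] by blast
    obtain V1 where V1: "basic (w z') V1" "\<sigma> \<theta>' ` (V1 \<inter> Q') \<subseteq> N" using limD[OF q(3) N(1) z'] by blast
    obtain V' where V': "basic (w z') V'" "V' \<subseteq> V1 \<inter> V" using basic_Int[OF V1(1) basic(1)[OF V] wV] by blast
    obtain u where u: "u \<in> V' \<inter> Q'" using basic_nonempty[OF V'(1) q(2)] by blast
    have VQL: "V' \<inter> Q' \<subseteq> V \<inter> L" using V'(2) corners_sub[OF q(2)] by blast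
    then have "u \<in> V" "u \<in> L" using u by blast+
    then obtain Q where Q: "Q \<in> corners (w z)" "u \<in> Q" by (rule basic_cover[OF V])
    \<comment> \<open>The corner at \<open>z'\<close> is connected near w z' and therefore lies in a
      single corner at w z, whatever the positions of the two values relative to the cuts.\<close>
    have "V' \<inter> Q' \<subseteq> Q"
    proof (rule connected_disjoint_UN[of _ "\<lambda>Q. Q" "corners (w z)"])
      show "connected (V' \<inter> Q')" by (rule basic_connected[OF V'(1) q(2)])
      show "V' \<inter> Q' \<subseteq> (\<Union>Q\<in>corners (w z). Q)"
      proof
        fix v assume "v \<in> V' \<inter> Q'"
        then have "v \<in> V" "v \<in> L" using VQL by blast+
        then obtain Q where "Q \<in> corners (w z)" "v \<in> Q" by (rule basic_cover[OF V])
        then show "v \<in> (\<Union>Q\<in>corners (w z). Q)" by blast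
      qed
      show "V' \<inter> Q' \<inter> Q \<noteq> {}" using u Q(2) by blast
      show "Q1 \<inter> Q2 = {}" if "Q1 \<in> corners (w z)" "Q2 \<in> corners (w z)" "Q1 \<noteq> Q2" for Q1 Q2
        by (rule corners_disjoint[OF that])
    qed (rule corners_open Q(1); assumption?)+
    then have sub: "V' \<inter> Q' \<subseteq> V \<inter> Q" using VQL by blast
    have uN: "\<sigma> \<theta>' u \<in> N" using V1(2) V'(2) u by blast
    have uVQ: "u \<in> V \<inter> Q" using u sub by blast
    have "\<sigma> \<theta>' ` (V \<inter> Q) \<subseteq> N" using adapted_meets[OF A'(1) q(1) Q(1) uN uVQ] by blast
    then have l: "lim \<theta>' Q z" using lim_adapted[OF A'(1) q(1) Q(1)] by simp
    then have bF: "(\<theta>', Q) \<in> ?F" using q(1) Q(1) by simp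
    have "V \<subseteq> VV (\<theta>', Q)" using A'(2) bF unfolding O'_def by blast
    then have "V' \<inter> Q' \<subseteq> WW (\<theta>', Q)" using sub VW(2)[OF bF] unfolding snd_conv by blast
    then have "(w z', germ (w z') Q') \<in> germ_nbhd (WW (\<theta>', Q))" using germ_nbhd_germ[OF q(2)] V'(1) by blast
    then have "(\<theta>', w z', germ (w z') Q') \<in> T" using subsetD[OF VW(3)[OF bF]] by simp
    then have "pt \<theta>' (w z') Q' \<in> T" by (simp add: pt_def)
    moreover have "pt \<theta>' (w z') Q' \<in> topspace X0" using q z'\<Omega> unfolding X0_iff by blast
    ultimately show "z' \<in> A" using Tff ff_eq[OF z'\<Omega> q] by simp
  qed
  then show "\<exists>T. open T \<and> z \<in> T \<and> T \<subseteq> A" using N by blast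
qed

lemma quotient_map_ff: "quotient_map X0 (top_of_set \<Omega>) ff"
  unfolding quotient_map_def
proof (intro conjI allI impI)
  show "ff ` topspace X0 = topspace (top_of_set \<Omega>)" by (simp add: ff_image)
  fix U assume "U \<subseteq> topspace (top_of_set \<Omega>)"
  then have U: "U \<subseteq> \<Omega>" by simp
  have "openin (top_of_set \<Omega>) U \<longleftrightarrow> open U" using U open_dom by (simp add: openin_open_eq)
  then show "openin X0 {x \<in> topspace X0. ff x \<in> U} \<longleftrightarrow> openin (top_of_set \<Omega>) U"
    using quotient_ff[OF U] continuous_ff[of U] by blast
qed

text \<open>The class map and \<open>ff\<close> are quotient maps of the same space with the same
  fibres, so their targets are homeomorphic; the graph map carries \<Omega> on to the Riemann
  surface.\<close>

theorem glued_homeomorphic: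
  "\<exists>h. homeomorphic_map (glued_surface slit_glueing) (riemann_surface_of \<Omega> w) h \<and>
     (\<forall>c\<in>topspace (glued_surface slit_glueing). snd (h c) = glued_projection c)"
proof -
  define \<pi> where "\<pi> x = glue_rel slit_glueing `` {x}" for x
  have gs: "glued_surface slit_glueing = quotient_topology X0 (glue_rel slit_glueing)" unfolding glued_surface_def X0_def ..
  have q: "quotient_map X0 (glued_surface slit_glueing) \<pi>"
    unfolding gs \<pi>_def by (rule quotient_map_quotient_topology)
  have top: "topspace (glued_surface slit_glueing) = \<pi> ` topspace X0"
    unfolding gs topspace_quotient_topology \<pi>_def ..
  define k where "k c = ff (SOME x. x \<in> topspace X0 \<and> \<pi> x = c)" for c
  have k: "k (\<pi> x) = ff x" if x: "x \<in> topspace X0" for x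
  proof -
    have "\<exists>y. y \<in> topspace X0 \<and> \<pi> y = \<pi> x" using x by blast
    from someI_ex[OF this] have "(SOME y. y \<in> topspace X0 \<and> \<pi> y = \<pi> x) \<in> topspace X0"
      "\<pi> (SOME y. y \<in> topspace X0 \<and> \<pi> y = \<pi> x) = \<pi> x" by blast+
    then show ?thesis unfolding k_def using ff_class[OF _ x] unfolding \<pi>_def by blast
  qed
  have kq: "quotient_map X0 (top_of_set \<Omega>) (k \<circ> \<pi>)"
    by (rule quotient_map_eq[OF quotient_map_ff]) (simp add: k)
  have "continuous_map (glued_surface slit_glueing) (top_of_set \<Omega>) k"
    by (rule continuous_compose_quotient_map[OF q quotient_imp_continuous_map[OF kq]])
  then have "quotient_map (glued_surface slit_glueing) (top_of_set \<Omega>) k"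
    by (rule quotient_map_from_composition[OF quotient_imp_continuous_map[OF q] _ kq])
  moreover have "inj_on k (topspace (glued_surface slit_glueing))"
    unfolding top
  proof (rule inj_onI)
    fix c d assume "c \<in> \<pi> ` topspace X0" "d \<in> \<pi> ` topspace X0" and eq: "k c = k d"
    then obtain x y where xy: "x \<in> topspace X0" "y \<in> topspace X0" "c = \<pi> x" "d = \<pi> y" by blast
    then have "ff x = ff y" using eq k by simp
    then show "c = d" using ff_class[OF xy(1,2)] xy(3,4) unfolding \<pi>_def by simp
  qed
  ultimately have hk: "homeomorphic_map (glued_surface slit_glueing) (top_of_set \<Omega>) k" by (simp add: homeomorphic_map_def)
  have "homeomorphic_map (glued_surface slit_glueing) (riemann_surface_of \<Omega> w) ((\<lambda>z. (z, w z)) \<circ> k)"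
    by (rule homeomorphic_map_compose[OF hk homeomorphic_map_graph[OF cont]])
  moreover have "snd (((\<lambda>z. (z, w z)) \<circ> k) c) = glued_projection c" if c: "c \<in> topspace (glued_surface slit_glueing)" for c
  proof -
    obtain x where x: "x \<in> topspace X0" "c = \<pi> x" using c top by blast
    obtain z \<theta> Q where z: "z \<in> \<Omega>" "\<theta> \<in> I" "Q \<in> corners (w z)" "lim \<theta> Q z" "x = pt \<theta> (w z) Q" "ff x = z"
      by (rule X0_E[OF x(1)])
    have ceq: "c = (\<lambda>b. pt (fst b) (w z) (snd b)) ` {b. ((\<theta>, Q), b) \<in> (adj (w z))\<^sup>*}"
      unfolding x(2) \<pi>_def z(5) by (rule glue_class[OF z(2,3)])
    have "(\<lambda>(\<theta>, p, C). p) ` c = {w z}"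
    proof (intro equalityI subsetI)
      fix p assume "p \<in> {w z}"
      moreover have "x \<in> c" unfolding x(2) \<pi>_def by (simp add: glue_rel_eq)
      ultimately show "p \<in> (\<lambda>(\<theta>, p, C). p) ` c" using z(5) by (intro rev_image_eqI[of x]) (auto simp: pt_def)
    qed (auto simp: ceq pt_def)
    then have "glued_projection c = w z" by (simp add: glued_projection_def)
    then show ?thesis using k[OF x(1)] x(2) z(6) by simp
  qed
  ultimately show ?thesis by blast
qed

end

section \<open>Existence of a tame system of cuts\<close>

text \<open>A homeomorphism of the plane is proper: the preimage of a large disc is the image of
  that disc under the inverse, hence bounded, so the map extends continuously by fixing
  infinity.\<close>

lemma map_option_continuous:
  fixes g g' :: "complex \<Rightarrow> complex"
  assumes h: "homeomorphism UNIV UNIV g g'"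
  shows "continuous_on UNIV (map_option g)"
proof -
  have g: "continuous_on UNIV g" "continuous_on UNIV g'" "\<And>x. g' (g x) = x"
    using h by (auto simp: homeomorphism_def)
  have "open (map_option g -` V)" if V: "open V" for V
    unfolding open_sphere_iff
  proof (intro conjI impI)
    have "open (Some -` V)" using V by (simp add: open_sphere_iff)
    then have "open (g -` (Some -` V))" using g(1) by (simp add: continuous_on_open_vimage)
    moreover have "Some -` map_option g -` V = g -` (Some -` V)" by auto
    ultimately show "open (Some -` map_option g -` V)" by simp
    assume "None \<in> map_option g -` V"
    then have "None \<in> V" by simp
    then obtain R where R: "\<And>v. R < norm v \<Longrightarrow> Some v \<in> V" using V unfolding open_sphere_iff by blast
    have "compact (g' ` cball 0 R)"
      by (intro compact_continuous_image continuous_on_subset[OF g(2)]) auto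
    then obtain B where B: "\<And>v. v \<in> g' ` cball 0 R \<Longrightarrow> norm v \<le> B"
      using compact_imp_bounded[of "g' ` cball 0 R"] unfolding bounded_iff by blast
    have "Some v \<in> map_option g -` V" if v: "B < norm v" for v
    proof -
      have "v \<notin> g' ` cball 0 R" using B[of v] v by auto
      then have "g v \<notin> cball 0 R" using g(3)[of v] by (metis imageI)
      then show ?thesis using R[of "g v"] by simp
    qed
    then show "\<exists>R. \<forall>v. R < norm v \<longrightarrow> Some v \<in> map_option g -` V" by blast
  qed
  then show ?thesis by (simp add: continuous_on_open_vimage)
qed

lemma homeomorphism_map_option:
  fixes g g' :: "complex \<Rightarrow> complex"
  assumes h: "homeomorphism UNIV UNIV g g'"
  shows "homeomorphism UNIV UNIV (map_option g) (map_option g')"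
proof -
  have g: "\<And>x. g' (g x) = x" "\<And>x. g (g' x) = x" using h by (auto simp: homeomorphism_def)
  have 1: "map_option g' (map_option g p) = p" "map_option g (map_option g' p) = p" for p
    by (cases p; simp add: g)+
  have "surj (map_option g)" "surj (map_option g')"
    by (rule surjI[of _ "map_option g'"], rule 1, rule surjI[of _ "map_option g"], rule 1)
  then show ?thesis
    using map_option_continuous[OF h] map_option_continuous[OF homeomorphism_symD[OF h]] 1
    unfolding homeomorphism_def by simp
qed

lemma homeomorphism_restrict:
  "homeomorphism UNIV UNIV g g' \<Longrightarrow> homeomorphism A (g ` A) g g'"
  by (auto simp: homeomorphism_def image_image intro: continuous_on_subset)

text \<open>In the star coordinate every loop is contracted along rays to the constant loop at the
  centre; any two loops are freely homotopic through it.\<close>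

lemma star_domain_simply_connected:
  assumes "star_domain L"
  shows "simply_connected_space (top_of_set L)"
proof -
  obtain A \<phi> \<phi>' and a :: complex where A: "open A" "a \<in> A" "\<And>x. x \<in> A \<Longrightarrow> closed_segment a x \<subseteq> A"
    and h: "homeomorphism A L \<phi> \<phi>'" using assms unfolding star_domain_def by blast
  have h': "continuous_on A \<phi>" "\<phi> ` A = L" "continuous_on L \<phi>'" "\<phi>' ` L = A" "\<And>y. y \<in> L \<Longrightarrow> \<phi> (\<phi>' y) = y"
    using h by (auto simp: homeomorphism_def)
  \<comment> \<open>At time 0 the homotopy has to equal \<open>p\<close> on all reals, not only on
    [0,1], hence the separate clause.\<close>
  define k where "k ts p = (if fst ts = 0 then p (snd ts) else \<phi> (a + of_real (1 - fst ts) * (\<phi>' (p (snd ts)) - a)))"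
    for ts :: "real \<times> real" and p :: "real \<Rightarrow> complex option"
  have contract: "homotopic_with (\<lambda>r. r 1 = r 0) (top_of_set {0..1}) (top_of_set L) p (\<lambda>_. \<phi> a)"
    if p: "pathin (top_of_set L) p" "p 1 = p 0" for p
  proof -
    have cp: "continuous_on {0..1} p" and pL: "p ` {0..1} \<subseteq> L"
      using p(1) unfolding pathin_def by (auto simp: continuous_map_in_subtopology)
    have inA: "a + of_real (1 - fst x) * (\<phi>' (p (snd x)) - a) \<in> A" if x: "x \<in> {0..1} \<times> {0..1}" for x :: "real \<times> real"
    proof -
      have "p (snd x) \<in> L" using pL x by auto
      then have m: "\<phi>' (p (snd x)) \<in> A" using h'(4) by blast
      have "a + of_real (1 - fst x) * (\<phi>' (p (snd x)) - a) \<in> closed_segment a (\<phi>' (p (snd x)))"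
        unfolding in_segment using x by (intro exI[of _ "1 - fst x"]) (auto simp: scaleR_conv_of_real algebra_simps)
      then show ?thesis using A(3)[OF m] by blast
    qed
    have eq: "k x p = \<phi> (a + of_real (1 - fst x) * (\<phi>' (p (snd x)) - a))" if x: "x \<in> {0..1} \<times> {0..1}" for x :: "real \<times> real"
    proof -
      have "p (snd x) \<in> L" using pL x by auto
      then show ?thesis using h'(5) by (simp add: k_def)
    qed
    have "continuous_on ({0..1} \<times> {0..1}) (\<lambda>x. \<phi> (a + of_real (1 - fst x) * (\<phi>' (p (snd x)) - a)))"
    proof (rule continuous_on_compose2[OF h'(1)])
      have "continuous_on ({0..1} \<times> {0..1}) (\<lambda>x::real\<times>real. p (snd x))"
        by (rule continuous_on_compose2[OF cp]) (auto intro!: continuous_intros)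
      then have "continuous_on ({0..1} \<times> {0..1}) (\<lambda>x::real\<times>real. \<phi>' (p (snd x)))"
        by (rule continuous_on_compose2[OF h'(3)]) (use pL in auto)
      then show "continuous_on ({0..1} \<times> {0..1}) (\<lambda>x. a + of_real (1 - fst x) * (\<phi>' (p (snd x)) - a))"
        by (intro continuous_intros)
      show "(\<lambda>x. a + of_real (1 - fst x) * (\<phi>' (p (snd x)) - a)) ` ({0..1} \<times> {0..1}) \<subseteq> A"
        using inA by blast
    qed
    then have ck: "continuous_on ({0..1} \<times> {0..1}) (\<lambda>x. k x p)"
      by (subst continuous_on_cong[OF refl eq])
    have kL: "k x p \<in> L" if "x \<in> {0..1} \<times> {0..1}" for x :: "real \<times> real"
      using eq[OF that] inA[OF that] h'(2) by auto
    show ?thesis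
      unfolding homotopic_with_def
    proof (intro exI[of _ "\<lambda>x. k x p"] conjI allI ballI)
      have "prod_topology (top_of_set {0..1}) (top_of_set {0..1}) = top_of_set ({0..1} \<times> {0..1::real})"
        by (simp add: subtopology_Times[symmetric])
      then show "continuous_map (prod_topology (top_of_set {0..1}) (top_of_set {0..1})) (top_of_set L) (\<lambda>x. k x p)"
        using ck kL by (auto simp: continuous_map_in_subtopology)
      show "k (1, s) p = \<phi> a" for s by (simp add: k_def)
      show "k (0, s) p = p s" for s by (simp add: k_def)
      show "k (t, 1) p = k (t, 0) p" for t by (simp add: k_def p(2))
    qed
  qed
  show ?thesis
    unfolding simply_connected_space_def
  proof (intro allI impI)
    fix p q assume pq: "pathin (top_of_set L) p \<and> p 1 = p 0 \<and> pathin (top_of_set L) q \<and> q 1 = q 0"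
    have "homotopic_with (\<lambda>r. r 1 = r 0) (top_of_set {0..1}) (top_of_set L) p (\<lambda>_. \<phi> a)"
      "homotopic_with (\<lambda>r. r 1 = r 0) (top_of_set {0..1}) (top_of_set L) (\<lambda>_. \<phi> a) q"
      using contract pq homotopic_with_sym by blast+
    then show "homotopic_with (\<lambda>r. r 1 = r 0) (top_of_set {0..1}) (top_of_set L) p q"
      by (rule homotopic_with_trans)
  qed
qed

text \<open>The function is a constant plus multiples of clamped ramps: \<open>c i\<close> rises
  from 0 to 1 over the i-th interval and is constant outside. Continuity is then clear; on each
  interval the earlier terms telescope and the later ones vanish.\<close>

lemma piecewise_linear_exists:
  fixes x y :: "nat \<Rightarrow> real"
  assumes "m > 0" and mono: "\<And>i j. i < j \<Longrightarrow> j < m \<Longrightarrow> x i < x j"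
  obtains f where "continuous_on UNIV f"
    "\<And>i t. Suc i < m \<Longrightarrow> x i \<le> t \<Longrightarrow> t \<le> x (Suc i) \<Longrightarrow> f t = y i + (t - x i) / (x (Suc i) - x i) * (y (Suc i) - y i)"
    "\<And>t. x (m - 1) \<le> t \<Longrightarrow> f t = y (m - 1)"
proof -
  define c where "c i t = max 0 (min 1 ((t - x i) / (x (Suc i) - x i)))" for i t
  define f where "f t = y 0 + (\<Sum>i<m - 1. c i t * (y (Suc i) - y i))" for t
  have pos: "x (Suc i) - x i > 0" if "i < m - 1" for i using mono[of i "Suc i"] that by simp
  have mono': "x i \<le> x j" if "i \<le> j" "j < m" for i j using mono[of i j] that by (cases "i = j") auto
  have c1: "c i t = 1" if "i < m - 1" "x (Suc i) \<le> t" for i t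
    using pos[OF that(1)] that(2) by (simp add: c_def min_def field_simps)
  have c0: "c i t = 0" if "i < m - 1" "t \<le> x i" for i t
    using pos[OF that(1)] that(2) by (simp add: c_def min_def max_def field_simps)
  have tele: "(\<Sum>i<j. y (Suc i) - y i) = y j - y 0" for j by (rule sum_lessThan_telescope)
  show thesis
  proof (rule that[of f])
    have "continuous_on UNIV (c i)" if "i < m - 1" for i
      unfolding c_def using pos[OF that] by (intro continuous_intros) auto
    then show "continuous_on UNIV f"
      unfolding f_def by (intro continuous_intros) auto
    show "f t = y (m - 1)" if "x (m - 1) \<le> t" for t
    proof -
      have "c i t = 1" if "i < m - 1" for i
        using c1[OF that] mono'[of "Suc i" "m - 1"] that \<open>x (m - 1) \<le> t\<close> assms(1) by simp
      then have "f t = y 0 + (\<Sum>i<m - 1. y (Suc i) - y i)" by (simp add: f_def)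
      then show ?thesis using tele by simp
    qed
    show "f t = y j + (t - x j) / (x (Suc j) - x j) * (y (Suc j) - y j)" if j: "Suc j < m" "x j \<le> t" "t \<le> x (Suc j)" for j t
    proof -
      have split: "{..<m - 1} = {..<j} \<union> {j} \<union> {Suc j..<m - 1}" using j(1) by auto
      have "(\<Sum>i<m - 1. c i t * (y (Suc i) - y i)) =
          (\<Sum>i<j. c i t * (y (Suc i) - y i)) + c j t * (y (Suc j) - y j) + (\<Sum>i=Suc j..<m - 1. c i t * (y (Suc i) - y i))"
        unfolding split by (subst sum.union_disjoint; auto)+
      moreover have "(\<Sum>i<j. c i t * (y (Suc i) - y i)) = (\<Sum>i<j. y (Suc i) - y i)"
      proof (rule sum.cong[OF refl])
        fix i assume "i \<in> {..<j}"
        then have "c i t = 1" using c1[of i t] mono'[of "Suc i" j] j by auto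
        then show "c i t * (y (Suc i) - y i) = y (Suc i) - y i" by simp
      qed
      moreover have "(\<Sum>i=Suc j..<m - 1. c i t * (y (Suc i) - y i)) = 0"
      proof (rule sum.neutral, intro ballI)
        fix i assume "i \<in> {Suc j..<m - 1}"
        then have i: "i < m - 1" "Suc j \<le> i" "i < m" by auto
        then have "t \<le> x i" using mono'[of "Suc j" i] j(3) by linarith
        then have "c i t = 0" by (rule c0[OF i(1)])
        then show "c i t * (y (Suc i) - y i) = 0" by simp
      qed
      moreover have "c j t = (t - x j) / (x (Suc j) - x j)"
      proof -
        have d: "x (Suc j) - x j > 0" using pos[of j] j(1) by simp
        have "0 \<le> (t - x j) / (x (Suc j) - x j)" "(t - x j) / (x (Suc j) - x j) \<le> 1" using d j by simp_all
        then show ?thesis by (simp add: c_def)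
      qed
      ultimately show ?thesis unfolding f_def using tele[of j] by simp
    qed
  qed
qed

section \<open>A polygon through the singular values, straightened\<close>

definition shear :: "real \<Rightarrow> complex \<Rightarrow> real" where
  "shear \<epsilon> v = Re v + \<epsilon> * Im v"

text \<open>
  The shear gives the finite singular values \<open>as\<close> distinct real parts, so the polygon through them is
  the graph of a function \<open>f\<close> of the sheared real part \<open>X\<close>, and \<open>\<phi>\<close> straightens it to a part
  of the real axis.  If infinity is singular, the chain ends with a horizontal ray.
\<close>

locale cut_path =
  fixes \<epsilon> :: real and as :: "complex list" and infin :: bool and f :: "real \<Rightarrow> real"
  assumes as_ne: "as \<noteq> []" and long: "\<not> infin \<Longrightarrow> 2 \<le> length as"
    and sorted_as: "\<And>i j. i < j \<Longrightarrow> j < length as \<Longrightarrow> shear \<epsilon> (as ! i) < shear \<epsilon> (as ! j)"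
    and cont_f: "continuous_on UNIV f"
    and f_seg: "\<And>i t. Suc i < length as \<Longrightarrow> shear \<epsilon> (as ! i) \<le> t \<Longrightarrow> t \<le> shear \<epsilon> (as ! Suc i) \<Longrightarrow>
      f t = Im (as ! i) + (t - shear \<epsilon> (as ! i)) / (shear \<epsilon> (as ! Suc i) - shear \<epsilon> (as ! i)) * (Im (as ! Suc i) - Im (as ! i))"
    and f_last: "\<And>t. shear \<epsilon> (as ! (length as - 1)) \<le> t \<Longrightarrow> f t = Im (as ! (length as - 1))"
begin

abbreviation X :: "complex \<Rightarrow> real" where "X \<equiv> shear \<epsilon>"

definition m :: nat where "m = length as"
definition x :: "nat \<Rightarrow> real" where "x i = X (as ! i)"
text \<open>Signed vertical distance from the polygon. In the coordinates \<open>X\<close> and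
  \<open>h\<close> the finite part of the chain of cuts becomes an interval or a half-line of the
  real axis.\<close>

definition h :: "complex \<Rightarrow> real" where "h v = Im v - f (X v)"
definition \<phi> :: "complex \<Rightarrow> complex" where "\<phi> v = Complex (X v) (h v)"
definition \<phi>' :: "complex \<Rightarrow> complex" where
  "\<phi>' \<zeta> = Complex (Re \<zeta> - \<epsilon> * (Im \<zeta> + f (Re \<zeta>))) (Im \<zeta> + f (Re \<zeta>))"

text \<open>The last vertex starts a segment only if infinity is singular, namely the ray to
  infinity.\<close>

definition E :: "nat set" where "E = {i. i < m \<and> (Suc i < m \<or> infin)}"
definition edge :: "nat \<Rightarrow> geodesic" where
  "edge i = (if Suc i < m then Direct (as ! i) (as ! Suc i) else Outward (as ! i) 1)"
definition Jo :: "nat \<Rightarrow> real set" where "Jo i = {t. x i < t \<and> (Suc i < m \<longrightarrow> t < x (Suc i))}"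
definition Jc :: "nat \<Rightarrow> real set" where "Jc i = {t. x i \<le> t \<and> (Suc i < m \<longrightarrow> t \<le> x (Suc i))}"
text \<open>\<open>T\<close> is the finite part of the chain in the straightened coordinate,
  \<open>T'\<close> the same without its finite end points; with a ray there is no right end
  point.\<close>

definition T :: "real set" where "T = {t. x 0 \<le> t \<and> (\<not> infin \<longrightarrow> t \<le> x (m - 1))}"
definition T' :: "real set" where "T' = {t. x 0 < t \<and> (\<not> infin \<longrightarrow> t < x (m - 1))}"
definition cut_sheet :: "complex option set" where
  "cut_sheet = Some ` {v. \<not> (h v = 0 \<and> X v \<in> T)} \<union> (if infin then {} else {None})"
definition up :: "complex option set" where "up = Some ` {v. 0 < h v}"
definition dn :: "complex option set" where "dn = Some ` {v. h v < 0}"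
definition inn :: "complex option set" where "inn = Some ` {v. h v = 0 \<and> X v \<in> T'}"
definition vertices :: "complex option set" where "vertices = Some ` set as \<union> (if infin then {None} else {})"
text \<open>Strips are demanded for segments rather than indices, so the index is recovered by
  inverting \<open>edge\<close>, which is injective on \<open>E\<close>.\<close>

definition strp :: "geodesic \<Rightarrow> complex option set" where
  "strp e = Some ` {v. X v \<in> Jo (inv_into E edge e)}"
definition box :: "complex \<Rightarrow> real \<Rightarrow> complex set" where
  "box \<zeta> r = {\<eta>. \<bar>Re \<eta> - Re \<zeta>\<bar> < r \<and> \<bar>Im \<eta> - Im \<zeta>\<bar> < r}"
text \<open>A box of such a radius avoids the real axis unless \<zeta> lies on it, and avoids the
  abscissae of all vertices except that of \<zeta> itself.\<close>

definition small :: "complex \<Rightarrow> real \<Rightarrow> bool" where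
  "small \<zeta> r \<longleftrightarrow> 0 < r \<and> (Im \<zeta> \<noteq> 0 \<longrightarrow> r \<le> \<bar>Im \<zeta>\<bar>) \<and> (\<forall>j<m. x j \<noteq> Re \<zeta> \<longrightarrow> r \<le> \<bar>x j - Re \<zeta>\<bar>)"
fun bas :: "complex option \<Rightarrow> complex option set \<Rightarrow> bool" where
  "bas (Some v) V \<longleftrightarrow> (\<exists>r. small (\<phi> v) r \<and> V = Some ` (\<phi> -` box (\<phi> v) r))"
| "bas None V \<longleftrightarrow> (\<exists>R. (\<forall>j<m. \<bar>x j\<bar> < R) \<and> V = insert None (Some ` (\<phi> -` {\<eta>. R < \<bar>Re \<eta>\<bar> \<or> R < \<bar>Im \<eta>\<bar>})))"

lemma m_pos: "m > 0" using as_ne by (simp add: m_def)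

lemma x_mono: "i < j \<Longrightarrow> j < m \<Longrightarrow> x i < x j" using sorted_as by (simp add: m_def x_def)
lemma x_mono': "i \<le> j \<Longrightarrow> j < m \<Longrightarrow> x i \<le> x j" using x_mono[of i j] by (cases "i = j") auto
lemma x_inj: "i < m \<Longrightarrow> j < m \<Longrightarrow> x i = x j \<Longrightarrow> i = j" using x_mono by (metis less_irrefl nat_neq_iff)

lemma phi_inv [simp]: "\<phi>' (\<phi> v) = v" "\<phi> (\<phi>' \<zeta>) = \<zeta>"
  by (simp_all add: \<phi>_def \<phi>'_def h_def shear_def complex_eq_iff)

lemma Re_phi [simp]: "Re (\<phi> v) = X v" and Im_phi [simp]: "Im (\<phi> v) = h v"
  by (simp_all add: \<phi>_def)

lemma X_phi' [simp]: "X (\<phi>' \<zeta>) = Re \<zeta>" and h_phi' [simp]: "h (\<phi>' \<zeta>) = Im \<zeta>"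
  using Re_phi[of "\<phi>' \<zeta>"] Im_phi[of "\<phi>' \<zeta>"] by simp_all

lemma phi_inj: "X u = X v \<Longrightarrow> h u = h v \<Longrightarrow> u = v"
  by (metis \<phi>_def phi_inv(1))

lemma cont_X: "continuous_on A X" unfolding shear_def[abs_def] by (intro continuous_intros)
lemma cont_h: "continuous_on A h"
  unfolding h_def[abs_def] by (intro continuous_intros continuous_on_compose2[OF cont_f cont_X]) auto
lemma cont_phi: "continuous_on A \<phi>"
  unfolding \<phi>_def[abs_def] Complex_eq by (intro continuous_intros cont_X cont_h)
lemma cont_phi': "continuous_on A \<phi>'"
proof -
  have "continuous_on A (\<lambda>\<zeta>::complex. f (Re \<zeta>))"
    by (intro continuous_on_compose2[OF cont_f] continuous_intros) auto
  then show ?thesis unfolding \<phi>'_def[abs_def] Complex_eq by (intro continuous_intros)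
qed

lemma homeo_phi: "homeomorphism UNIV UNIV \<phi> \<phi>'"
proof -
  have "surj \<phi>" "surj \<phi>'"
    by (rule surjI[of _ \<phi>'], rule phi_inv, rule surjI[of _ \<phi>], rule phi_inv)
  then show ?thesis unfolding homeomorphism_def using cont_phi cont_phi' by simp
qed

lemma phi_vimage: "\<phi> -` A = \<phi>' ` A" by (auto intro: rev_image_eqI)

lemma open_phi_vimage: "open A \<Longrightarrow> open (\<phi> -` A)"
  using continuous_on_open_vimage[of UNIV \<phi>] cont_phi by simp

lemma f_Jc: "i < m \<Longrightarrow> t \<in> Jc i \<Longrightarrow> f t = Im (as ! i) + (if Suc i < m then (t - x i) / (x (Suc i) - x i) * (Im (as ! Suc i) - Im (as ! i)) else 0)"
proof -
  assume i: "i < m" "t \<in> Jc i"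
  show ?thesis
  proof (cases "Suc i < m")
    case True
    then show ?thesis using f_seg[of i t] i(2) by (simp add: Jc_def x_def m_def)
  next
    case False
    then have "i = m - 1" using i(1) by simp
    then show ?thesis using f_last[of t] i(2) False by (simp add: Jc_def x_def m_def)
  qed
qed

lemma h_as: "i < m \<Longrightarrow> h (as ! i) = 0"
proof -
  assume i: "i < m"
  have "x i \<in> Jc i" using i x_mono[of i "Suc i"] by (auto simp: Jc_def)
  then show ?thesis using f_Jc[OF i] by (simp add: h_def x_def)
qed

lemma in_as: "h v = 0 \<Longrightarrow> X v = x i \<Longrightarrow> i < m \<Longrightarrow> v = as ! i"
  by (rule phi_inj) (simp_all add: h_as x_def)

lemma Some_in_vertices: "Some v \<in> vertices \<longleftrightarrow> (\<exists>i<m. h v = 0 \<and> X v = x i)"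
proof -
  have "Some v \<in> vertices \<longleftrightarrow> v \<in> set as" by (auto simp: vertices_def)
  also have "\<dots> \<longleftrightarrow> (\<exists>i<m. v = as ! i)" by (auto simp: in_set_conv_nth m_def)
  also have "\<dots> \<longleftrightarrow> (\<exists>i<m. h v = 0 \<and> X v = x i)" using in_as h_as by (auto simp: x_def)
  finally show ?thesis .
qed

lemma None_in_vertices: "None \<in> vertices \<longleftrightarrow> infin" by (auto simp: vertices_def)

lemma Some_in_cut_sheet: "Some v \<in> cut_sheet \<longleftrightarrow> \<not> (h v = 0 \<and> X v \<in> T)" by (auto simp: cut_sheet_def)
lemma None_in_cut_sheet: "None \<in> cut_sheet \<longleftrightarrow> \<not> infin" by (auto simp: cut_sheet_def)

lemma E_m: "i \<in> E \<Longrightarrow> i < m" by (simp add: E_def)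

lemma inj_edge: "inj_on edge E"
proof (rule inj_onI)
  fix i j assume ij: "i \<in> E" "j \<in> E" "edge i = edge j"
  have "source (edge i) = Some (as ! i)" "source (edge j) = Some (as ! j)" by (simp_all add: edge_def)
  then have "as ! i = as ! j" using ij(3) by simp
  then show "i = j" using x_inj[of i j] E_m ij(1,2) by (simp add: x_def)
qed

lemma strp_edge: "i \<in> E \<Longrightarrow> strp (edge i) = Some ` {v. X v \<in> Jo i}"
  by (simp add: strp_def inv_into_f_f[OF inj_edge])

text \<open>\<open>X\<close> is affine along the segment, so its value recovers the parameter; the
  imaginary part is then the affine interpolation prescribed for \<open>f\<close>.\<close>

lemma segment_edge:
  assumes i: "i \<in> E"
  shows "Some v \<in> segment_points (edge i) \<longleftrightarrow> h v = 0 \<and> X v \<in> Jc i"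
proof (cases "Suc i < m")
  case True
  have d: "x (Suc i) - x i > 0" using x_mono[of i "Suc i"] True by simp
  let ?a = "as ! i" and ?b = "as ! Suc i"
  have "v \<in> closed_segment ?a ?b \<longleftrightarrow> h v = 0 \<and> X v \<in> Jc i"
  proof
    assume "v \<in> closed_segment ?a ?b"
    then obtain u where u: "0 \<le> u" "u \<le> 1" "v = (1 - u) *\<^sub>R ?a + u *\<^sub>R ?b" by (auto simp: in_segment)
    have Xv: "X v = x i + u * (x (Suc i) - x i)" unfolding u(3) x_def shear_def by (simp add: algebra_simps)
    have Iv: "Im v = Im ?a + u * (Im ?b - Im ?a)" unfolding u(3) by (simp add: algebra_simps)
    have "u * (x (Suc i) - x i) \<le> x (Suc i) - x i" "0 \<le> u * (x (Suc i) - x i)" using u d by (auto simp: mult_left_le_one_le)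
    then have J: "X v \<in> Jc i" using True by (simp add: Jc_def Xv)
    have "(X v - x i) / (x (Suc i) - x i) = u" using d by (simp add: Xv)
    then have "f (X v) = Im ?a + u * (Im ?b - Im ?a)" using f_Jc[OF E_m[OF i] J] True by simp
    then show "h v = 0 \<and> X v \<in> Jc i" using J Iv by (simp add: h_def)
  next
    assume hv: "h v = 0 \<and> X v \<in> Jc i"
    define u where "u = (X v - x i) / (x (Suc i) - x i)"
    have u: "0 \<le> u" "u \<le> 1" using hv True d by (auto simp: u_def Jc_def field_simps)
    have Xu: "X v = x i + u * (x (Suc i) - x i)" using d by (simp add: u_def)
    have Iu: "Im v = Im ?a + u * (Im ?b - Im ?a)" using hv f_Jc[OF E_m[OF i], of "X v"] True by (simp add: h_def u_def)
    have "v = (1 - u) *\<^sub>R ?a + u *\<^sub>R ?b"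
    proof (rule complex_eqI)
      show "Im v = Im ((1 - u) *\<^sub>R ?a + u *\<^sub>R ?b)" using Iu by (simp add: algebra_simps)
      have "Re v = X v - \<epsilon> * Im v" by (simp add: shear_def)
      then show "Re v = Re ((1 - u) *\<^sub>R ?a + u *\<^sub>R ?b)" unfolding Xu Iu by (simp add: x_def shear_def algebra_simps)
    qed
    then show "v \<in> closed_segment ?a ?b" using u by (auto simp: in_segment)
  qed
  then show ?thesis using True by (auto simp: edge_def)
next
  case False
  let ?a = "as ! i"
  have "(\<exists>t. v = ?a + of_real t * 1 \<and> 0 \<le> t) \<longleftrightarrow> h v = 0 \<and> X v \<in> Jc i"
  proof
    assume "\<exists>t. v = ?a + of_real t * 1 \<and> 0 \<le> t"
    then obtain t where t: "v = ?a + of_real t" "0 \<le> t" by auto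
    have Xv: "X v = x i + t" "Im v = Im ?a" by (simp_all add: t x_def shear_def)
    then have J: "X v \<in> Jc i" using t False by (simp add: Jc_def)
    then show "h v = 0 \<and> X v \<in> Jc i" using f_Jc[OF E_m[OF i] J] False Xv by (simp add: h_def)
  next
    assume hv: "h v = 0 \<and> X v \<in> Jc i"
    have "v = ?a + of_real (X v - x i)"
      using hv f_Jc[OF E_m[OF i], of "X v"] False by (simp add: h_def complex_eq_iff x_def shear_def)
    moreover have "0 \<le> X v - x i" using hv by (simp add: Jc_def)
    ultimately show "\<exists>t. v = ?a + of_real t * 1 \<and> 0 \<le> t" by (metis mult.right_neutral)
  qed
  then show ?thesis using False by (auto simp: edge_def)
qed

lemma None_segment: "i \<in> E \<Longrightarrow> None \<in> segment_points (edge i) \<longleftrightarrow> \<not> Suc i < m"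
  by (auto simp: edge_def)

lemma endpoints_edge: "i \<in> E \<Longrightarrow> endpoints (edge i) = {Some (as ! i), if Suc i < m then Some (as ! Suc i) else None}"
  by (auto simp: edge_def endpoints_def)

lemma interior_edge:
  assumes i: "i \<in> E"
  shows "interior_points (edge i) = Some ` {v. h v = 0 \<and> X v \<in> Jo i}"
proof (rule set_eqI)
  fix p
  show "p \<in> interior_points (edge i) \<longleftrightarrow> p \<in> Some ` {v. h v = 0 \<and> X v \<in> Jo i}"
  proof (cases p)
    case None
    then show ?thesis using None_segment[OF i] endpoints_edge[OF i] by (auto simp: interior_points_def)
  next
    case (Some v)
    have "v = as ! i \<longleftrightarrow> h v = 0 \<and> X v = x i" using in_as[of v i] h_as E_m[OF i] by (auto simp: x_def)
    moreover have "Suc i < m \<Longrightarrow> v = as ! Suc i \<longleftrightarrow> h v = 0 \<and> X v = x (Suc i)" using in_as[of v "Suc i"] h_as by (auto simp: x_def)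
    ultimately show ?thesis
      using Some segment_edge[OF i, of v] endpoints_edge[OF i] by (auto simp: interior_points_def Jo_def Jc_def)
  qed
qed

text \<open>The sign of Im (z / u) is that of a 2 by 2 determinant. For a bounded edge this
  determinant equals \<open>h v\<close> times the positive length of the parameter interval, and for
  the opposite edge its negative; along the ray \<open>h\<close> is the height itself.\<close>

lemma left_edge:
  assumes i: "i \<in> E" and v: "X v \<in> Jo i"
  shows "Some v \<in> left_side (edge i) \<longleftrightarrow> 0 < h v" "Some v \<in> left_side (opposite (edge i)) \<longleftrightarrow> h v < 0"
proof -
  let ?a = "as ! i"
  have J: "X v \<in> Jc i" using v by (auto simp: Jo_def Jc_def)
  have "(Some v \<in> left_side (edge i) \<longleftrightarrow> 0 < h v) \<and> (Some v \<in> left_side (opposite (edge i)) \<longleftrightarrow> h v < 0)"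
  proof (cases "Suc i < m")
    case True
    let ?b = "as ! Suc i"
    have d: "x (Suc i) - x i > 0" using x_mono[of i "Suc i"] True by simp
    have Imdiv: "0 < Im (z / u) \<longleftrightarrow> 0 < Im z * Re u - Re z * Im u" if "u \<noteq> 0" for z u :: complex
    proof -
      have "(Re u)\<^sup>2 + (Im u)\<^sup>2 > 0" using that by (simp add: complex_neq_0)
      then show ?thesis by (simp add: Im_divide zero_less_divide_iff)
    qed
    have hv: "h v * (x (Suc i) - x i) = (Im v - Im ?a) * (x (Suc i) - x i) - (X v - x i) * (Im ?b - Im ?a)"
      using f_Jc[OF E_m[OF i] J] True d by (simp add: h_def field_simps)
    have ne: "?b - ?a \<noteq> 0" using d by (auto simp: x_def)
    have 1: "Im (v - ?a) * Re (?b - ?a) - Re (v - ?a) * Im (?b - ?a) = h v * (x (Suc i) - x i)"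
      unfolding hv by (simp add: x_def shear_def algebra_simps)
    have 2: "Im (v - ?b) * Re (?a - ?b) - Re (v - ?b) * Im (?a - ?b) = - h v * (x (Suc i) - x i)"
      using hv by (simp add: x_def shear_def algebra_simps)
    have "Some v \<in> left_side (edge i) \<longleftrightarrow> 0 < h v * (x (Suc i) - x i)"
      using True Imdiv[OF ne, of "v - ?a"] 1 by (auto simp: left_side_def edge_def)
    moreover have "Some v \<in> left_side (opposite (edge i)) \<longleftrightarrow> 0 < - h v * (x (Suc i) - x i)"
      using True Imdiv[of "?a - ?b" "v - ?b"] ne 2 by (auto simp: left_side_def edge_def)
    ultimately show ?thesis using d by (simp add: zero_less_mult_iff mult_less_0_iff)
  next
    case False
    then show ?thesis using f_Jc[OF E_m[OF i] J] by (auto simp: left_side_def edge_def h_def)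
  qed
  then show "Some v \<in> left_side (edge i) \<longleftrightarrow> 0 < h v" "Some v \<in> left_side (opposite (edge i)) \<longleftrightarrow> h v < 0" by auto
qed

lemma Jo_T': "i \<in> E \<Longrightarrow> Jo i \<subseteq> T'"
proof
  fix t assume i: "i \<in> E" and t: "t \<in> Jo i"
  have "x 0 \<le> x i" using x_mono'[of 0 i] E_m[OF i] by simp
  moreover have "x (Suc i) \<le> x (m - 1)" if "Suc i < m" using x_mono'[of "Suc i" "m - 1"] that by simp
  ultimately show "t \<in> T'" using t i by (auto simp: Jo_def T'_def E_def)
qed

lemma T'_T: "T' \<subseteq> T" by (auto simp: T_def T'_def)

lemma Jo_x: "i \<in> E \<Longrightarrow> j < m \<Longrightarrow> x j \<notin> Jo i"
proof
  assume i: "i \<in> E" and j: "j < m" "x j \<in> Jo i"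
  then have "x i < x j" "Suc i < m \<Longrightarrow> x j < x (Suc i)" by (auto simp: Jo_def)
  then have "i < j" using x_mono'[of j i] E_m[OF i] by (meson leI not_le)
  then have "x (Suc i) \<le> x j" using x_mono'[of "Suc i" j] j by simp
  then show False using \<open>Suc i < m \<Longrightarrow> x j < x (Suc i)\<close> \<open>i < j\<close> j(1) by simp
qed

lemma T_cases:
  assumes t: "t \<in> T" "\<And>j. j < m \<Longrightarrow> t \<noteq> x j"
  shows "\<exists>i\<in>E. t \<in> Jo i"
proof -
  define A where "A = {j. j < m \<and> x j \<le> t}"
  have A: "finite A" "0 \<in> A" using t m_pos by (auto simp: A_def T_def)
  define i where "i = Max A"
  have "i \<in> A" unfolding i_def using A by (intro Max_in) auto
  then have i: "i < m" "x i < t" using t(2)[of i] by (auto simp: A_def)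
  have s: "t < x (Suc i)" if "Suc i < m"
  proof (rule ccontr)
    assume "\<not> t < x (Suc i)"
    then have "Suc i \<in> A" using that by (simp add: A_def)
    then have "Suc i \<le> i" unfolding i_def using A(1) by simp
    then show False by simp
  qed
  have "Suc i < m \<or> infin"
  proof (rule ccontr)
    assume "\<not> ?thesis"
    then have "i = m - 1" "\<not> infin" using i(1) by auto
    then show False using t(1)[unfolded T_def] i(2) by simp
  qed
  then have "i \<in> E" using i by (simp add: E_def)
  moreover have "t \<in> Jo i" using i s by (simp add: Jo_def)
  ultimately show ?thesis by blast
qed

lemma Jc_T: "i \<in> E \<Longrightarrow> Jc i \<subseteq> T"
proof
  fix t assume i: "i \<in> E" and t: "t \<in> Jc i"
  have "x 0 \<le> x i" using x_mono'[of 0 i] E_m[OF i] by simp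
  moreover have "x (Suc i) \<le> x (m - 1)" if "Suc i < m" using x_mono'[of "Suc i" "m - 1"] that by simp
  ultimately show "t \<in> T" using t i by (auto simp: Jc_def T_def E_def)
qed

lemma sheet_eq: "sheet (edge ` E) = cut_sheet"
proof -
  have "p \<in> (\<Union>e\<in>edge ` E. segment_points e) \<longleftrightarrow> p \<notin> cut_sheet" for p
  proof (cases p)
    case None
    have "(\<exists>i\<in>E. \<not> Suc i < m) \<longleftrightarrow> infin"
    proof
      assume infin
      then have "m - 1 \<in> E" "\<not> Suc (m - 1) < m" unfolding E_def using m_pos by auto
      then show "\<exists>i\<in>E. \<not> Suc i < m" by blast
    qed (auto simp: E_def)
    then show ?thesis using None None_segment None_in_cut_sheet by auto
  next
    case (Some v)
    have "(\<exists>i\<in>E. X v \<in> Jc i) \<longleftrightarrow> X v \<in> T"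
    proof
      assume t: "X v \<in> T"
      show "\<exists>i\<in>E. X v \<in> Jc i"
      proof (cases "\<exists>j<m. X v = x j")
        case True
        then obtain j where j: "j < m" "X v = x j" by blast
        show ?thesis
        proof (cases "j \<in> E")
          case True
          then show ?thesis using j x_mono[of j "Suc j"] by (intro bexI[of _ j]) (auto simp: Jc_def)
        next
          \<comment> \<open>Without a ray no segment starts at the last vertex, but one ends there;
            it exists because there are at least two vertices.\<close>
          case False
          then have n: "j = m - 1" "\<not> infin" using j(1) unfolding E_def by auto
          then have "2 \<le> m" using long by (simp add: m_def)
          then have "j - 1 \<in> E" "Suc (j - 1) = j" "j - 1 < j" using n(1) unfolding E_def by auto
          then show ?thesis using j x_mono[of "j - 1" j] by (intro bexI[of _ "j - 1"]) (auto simp: Jc_def)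
        qed
      next
        case False
        then obtain i where "i \<in> E" "X v \<in> Jo i" using T_cases[OF t] by blast
        then show ?thesis by (intro bexI[of _ i]) (auto simp: Jo_def Jc_def)
      qed
    qed (use Jc_T in blast)
    then show ?thesis using Some segment_edge Some_in_cut_sheet by auto
  qed
  then show ?thesis unfolding sheet_def by blast
qed

lemma connected_vimage: "connected A \<Longrightarrow> connected (Some ` (\<phi> -` A))"
  unfolding phi_vimage by (intro connected_continuous_image continuous_on_Some cont_phi')

lemma up_eq: "up = Some ` (\<phi> -` {\<eta>. 0 < Im \<eta>})" and dn_eq: "dn = Some ` (\<phi> -` {\<eta>. Im \<eta> < 0})"
  by (simp_all add: up_def dn_def vimage_def)

lemma Some_in_up [simp]: "Some v \<in> up \<longleftrightarrow> 0 < h v" and Some_in_dn [simp]: "Some v \<in> dn \<longleftrightarrow> h v < 0"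
  by (auto simp: up_def dn_def)

lemma Some_in_image [simp]: "Some u \<in> Some ` A \<longleftrightarrow> u \<in> A"
  by auto

lemma open_up: "open up"
  unfolding up_eq by (rule open_Some_image[THEN iffD2, OF open_phi_vimage[OF open_halfspace_Im_gt]])

lemma open_dn: "open dn"
  unfolding dn_eq by (rule open_Some_image[THEN iffD2, OF open_phi_vimage[OF open_halfspace_Im_lt]])

lemma closed_real_ray: "closed {\<eta>. Im \<eta> = 0 \<and> Re \<eta> \<in> T}"
proof -
  have "closed T"
  proof (cases infin)
    case True
    have "T = {x 0..}" unfolding T_def using True by auto
    then show ?thesis by simp
  next
    case False
    have "T = {x 0..x (m - 1)}" unfolding T_def using False by auto
    then show ?thesis by simp
  qed
  then have "closed (Re -` T)" by (intro continuous_closed_vimage) (auto intro: continuous_intros)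
  moreover have "closed {\<eta>. Im \<eta> = 0}" by (intro closed_Collect_eq continuous_intros)
  moreover have "{\<eta>. Im \<eta> = 0 \<and> Re \<eta> \<in> T} = {\<eta>. Im \<eta> = 0} \<inter> Re -` T" by auto
  ultimately show ?thesis by (metis closed_Int)
qed

lemma cut_sheet_infin: "infin \<Longrightarrow> cut_sheet = Some ` (\<phi> -` (- {\<eta>. Im \<eta> = 0 \<and> Re \<eta> \<in> T}))"
  unfolding cut_sheet_def by (auto simp: vimage_def)

text \<open>The complement of a half-line is star-shaped about a point of the same line before its
  tip; the point one unit to the left is taken.\<close>

lemma star_infin:
  assumes inf: infin shows "star_domain cut_sheet"
proof -
  let ?A = "- {\<eta>. Im \<eta> = 0 \<and> Re \<eta> \<in> T}"
  have T: "t \<in> T \<longleftrightarrow> x 0 \<le> t" for t unfolding T_def using inf by simp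
  have "homeomorphism ?A (Some ` (\<phi>' ` ?A)) (Some \<circ> \<phi>') (\<phi> \<circ> finite_part)"
    by (rule homeomorphism_compose[OF homeomorphism_restrict[OF homeomorphism_symD[OF homeo_phi]] homeomorphism_Some])
  then have hom: "homeomorphism ?A cut_sheet (Some \<circ> \<phi>') (\<phi> \<circ> finite_part)"
    unfolding cut_sheet_infin[OF inf] phi_vimage .
  show ?thesis
  proof (rule star_domainI[OF _ _ _ hom])
    show "open ?A" using closed_real_ray by (rule open_Compl)
    show "Complex (x 0 - 1) 0 \<in> ?A" by (simp add: T)
    fix \<eta> assume \<eta>: "\<eta> \<in> ?A"
    show "closed_segment (Complex (x 0 - 1) 0) \<eta> \<subseteq> ?A"
    proof
      fix \<zeta> assume "\<zeta> \<in> closed_segment (Complex (x 0 - 1) 0) \<eta>"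
      then obtain u where u: "0 \<le> u" "u \<le> 1" "\<zeta> = (1 - u) *\<^sub>R Complex (x 0 - 1) 0 + u *\<^sub>R \<eta>" by (auto simp: in_segment)
      have R: "Re \<zeta> = (1 - u) * (x 0 - 1) + u * Re \<eta>" and I: "Im \<zeta> = u * Im \<eta>" by (simp_all add: u(3))
      show "\<zeta> \<in> ?A"
      proof (rule ccontr)
        assume "\<zeta> \<notin> ?A"
        then have z: "Im \<zeta> = 0" "x 0 \<le> Re \<zeta>" using T by auto
        show False
        proof (cases "u = 0")
          case True then show False using z(2) R by simp
        next
          case False
          then have "Im \<eta> = 0" using z(1) I by simp
          then have "Re \<eta> < x 0" using \<eta> T by auto
          then have "u * Re \<eta> < u * x 0" using False u(1) by simp
          moreover have "(1 - u) * (x 0 - 1) \<le> (1 - u) * x 0" using u by (intro mult_left_mono) auto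
          ultimately show False using z(2) R by (simp add: algebra_simps)
        qed
      qed
    qed
  qed
qed

lemma open_cut_sheet: "open cut_sheet"
proof (cases infin)
  case True
  then show ?thesis unfolding cut_sheet_infin[OF True]
    using open_phi_vimage[OF open_Compl[OF closed_real_ray]] by simp
next
  case False
  let ?K = "{\<eta>. Im \<eta> = 0 \<and> Re \<eta> \<in> T}"
  have "norm \<eta> \<le> \<bar>x 0\<bar> + \<bar>x (m - 1)\<bar>" if "\<eta> \<in> ?K" for \<eta>
  proof -
    have "x 0 \<le> Re \<eta>" "Re \<eta> \<le> x (m - 1)" "Im \<eta> = 0" using that False unfolding T_def by auto
    moreover have "norm \<eta> \<le> \<bar>Re \<eta>\<bar> + \<bar>Im \<eta>\<bar>" by (rule cmod_le)
    ultimately show ?thesis by linarith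
  qed
  then have "bounded ?K" unfolding bounded_iff by blast
  then have "compact ?K" using closed_real_ray by (simp add: compact_eq_bounded_closed)
  then have "compact (Some ` (\<phi>' ` ?K))" by (intro compact_continuous_image continuous_on_Some cont_phi')
  then have "closed (Some ` (\<phi> -` ?K))" unfolding phi_vimage by (rule compact_imp_closed)
  moreover have "cut_sheet = - Some ` (\<phi> -` ?K)"
  proof (rule set_eqI)
    have "None \<in> cut_sheet" using False None_in_cut_sheet by blast
    then show "p \<in> cut_sheet \<longleftrightarrow> p \<in> - Some ` (\<phi> -` ?K)" for p
      by (cases p) (auto simp: Some_in_cut_sheet)
  qed
  ultimately show ?thesis by (metis open_Compl)
qed

text \<open>Infinity belongs to the sheet, so a coordinate centred there is used. Inversion about
  the left end of the slit sends infinity to 0 and the slit to a half-line of the real axis running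
  to infinity, whose complement is star-shaped about 0: if 1/(u \<eta>) lies between 0 and the
  length of the slit, so does its u-fold multiple 1/\<eta>, for 0 < u \<le> 1.\<close>

lemma star_finite:
  assumes fin: "\<not> infin" shows "star_domain cut_sheet"
proof -
  have T: "t \<in> T \<longleftrightarrow> x 0 \<le> t \<and> t \<le> x (m - 1)" for t unfolding T_def using fin by simp
  define c where "c = Complex (x 0) 0"
  define \<Psi> where "\<Psi> = map_option \<phi>' \<circ> (map_option (\<lambda>\<eta>. c + \<eta>) \<circ> sphere_inversion)"
  define \<Psi>' where "\<Psi>' = (sphere_inversion \<circ> map_option (\<lambda>\<eta>. \<eta> - c)) \<circ> map_option \<phi>"
  have tr: "homeomorphism UNIV UNIV (\<lambda>\<eta>. c + \<eta>) (\<lambda>\<eta>. \<eta> - c)"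
  proof -
    have "surj (\<lambda>\<eta>. c + \<eta>)" "surj (\<lambda>\<eta>. \<eta> - c)" by (rule surjI[of _ "\<lambda>\<eta>. \<eta> - c"], simp, rule surjI[of _ "\<lambda>\<eta>. \<eta> + c"], simp)
    then show ?thesis unfolding homeomorphism_def by (simp add: continuous_intros)
  qed
  have inv: "homeomorphism UNIV UNIV sphere_inversion sphere_inversion"
  proof -
    have "surj sphere_inversion" by (rule surjI[of _ sphere_inversion]) simp
    then show ?thesis using homeomorphism_sphere_inversion[of UNIV] by simp
  qed
  have hom: "homeomorphism UNIV UNIV \<Psi> \<Psi>'"
    unfolding \<Psi>_def \<Psi>'_def
    by (rule homeomorphism_compose[OF homeomorphism_compose[OF inv homeomorphism_map_option[OF tr]]
        homeomorphism_map_option[OF homeomorphism_symD[OF homeo_phi]]])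
  have NL: "None \<in> cut_sheet" using fin None_in_cut_sheet by blast
  define A where "A = Some -` (\<Psi> -` cut_sheet)"
  have val: "\<Psi> (Some \<eta>) = (if \<eta> = 0 then None else Some (\<phi>' (c + 1 / \<eta>)))" for \<eta> by (simp add: \<Psi>_def)
  have A_iff: "\<eta> \<in> A \<longleftrightarrow> \<eta> = 0 \<or> \<not> (Im (c + 1 / \<eta>) = 0 \<and> Re (c + 1 / \<eta>) \<in> T)" for \<eta>
    unfolding A_def using NL by (simp add: val Some_in_cut_sheet)
  have "\<Psi> None = Some (\<phi>' c)" by (simp add: \<Psi>_def)
  moreover have "Re c \<in> T" "Im c = 0" unfolding T using x_mono'[of 0 "m - 1"] m_pos by (simp_all add: c_def)
  ultimately have N: "\<Psi> None \<notin> cut_sheet" by (simp add: Some_in_cut_sheet)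
  have im: "\<Psi> ` (Some ` A) = cut_sheet"
  proof (intro equalityI subsetI)
    fix p assume p: "p \<in> cut_sheet"
    have "surj \<Psi>" using hom by (simp add: homeomorphism_def)
    then obtain q where q: "p = \<Psi> q" by (rule surjE)
    then obtain \<eta> where "q = Some \<eta>" using N p by (cases q) auto
    then show "p \<in> \<Psi> ` (Some ` A)" using q p by (auto simp: A_def)
  qed (auto simp: A_def)
  have "homeomorphism (Some ` A) (\<Psi> ` (Some ` A)) \<Psi> \<Psi>'" by (rule homeomorphism_restrict[OF hom])
  then have homA: "homeomorphism A cut_sheet (\<Psi> \<circ> Some) (finite_part \<circ> \<Psi>')"
    unfolding im by (rule homeomorphism_compose[OF homeomorphism_Some])
  show ?thesis
  proof (rule star_domainI[OF _ _ _ homA])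
    have "continuous_on UNIV \<Psi>" using hom by (simp add: homeomorphism_def)
    then have "open (\<Psi> -` cut_sheet)" using open_cut_sheet by (simp add: continuous_on_open_vimage)
    then show "open A" unfolding A_def by (simp add: open_sphere_iff)
    show "0 \<in> A" by (simp add: A_iff)
    fix \<eta> assume \<eta>: "\<eta> \<in> A"
    show "closed_segment 0 \<eta> \<subseteq> A"
    proof
      fix \<zeta> assume "\<zeta> \<in> closed_segment 0 \<eta>"
      then obtain u where u: "0 \<le> u" "u \<le> 1" "\<zeta> = of_real u * \<eta>" by (auto simp: in_segment scaleR_conv_of_real)
      show "\<zeta> \<in> A"
      proof (rule ccontr)
        assume n: "\<zeta> \<notin> A"
        then have z: "\<zeta> \<noteq> 0" "Im (1 / \<zeta>) = 0" "0 \<le> Re (1 / \<zeta>)" "Re (1 / \<zeta>) \<le> x (m - 1) - x 0"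
          by (auto simp: A_iff T c_def)
        have u0: "u \<noteq> 0" "\<eta> \<noteq> 0" using z(1) u(3) by auto
        have "1 / \<eta> = of_real u * (1 / \<zeta>)" using u0 u(3) by (simp add: field_simps)
        then have "Im (1 / \<eta>) = u * Im (1 / \<zeta>)" "Re (1 / \<eta>) = u * Re (1 / \<zeta>)" by (simp_all only: complex_scaleR[symmetric] scaleR_conv_of_real[symmetric] scaleR_complex.sel)
        moreover have "0 \<le> u * Re (1 / \<zeta>)" "u * Re (1 / \<zeta>) \<le> Re (1 / \<zeta>)" using u(1,2) z(3) by (auto simp: mult_left_le_one_le)
        ultimately have "Im (c + 1 / \<eta>) = 0" "Re (c + 1 / \<eta>) \<in> T" using z unfolding T by (simp_all add: c_def)
        then show False using \<eta> u0(2) by (simp add: A_iff)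
      qed
    qed
  qed
qed

lemma star_cut_sheet: "star_domain cut_sheet"
  using star_infin star_finite by blast

lemma sheet_type_cuts: "sheet_type vertices (edge ` E)"
  unfolding sheet_type_def
proof (intro conjI ballI impI)
  have "0 \<in> E"
  proof (cases infin)
    case True then show ?thesis unfolding E_def using m_pos by simp
  next
    case False
    have "2 \<le> m" using long[OF False] by (simp add: m_def)
    then show ?thesis unfolding E_def by simp
  qed
  then show "edge ` E \<noteq> {}" by blast
  fix e assume "e \<in> edge ` E"
  then obtain i where i: "i \<in> E" "e = edge i" by blast
  have a: "Some (as ! i) \<in> vertices" using E_m[OF i(1)] by (auto simp: vertices_def m_def)
  show "geodesic_between vertices e"
  proof (cases "Suc i < m")
    case True
    then have "Some (as ! Suc i) \<in> vertices" by (auto simp: vertices_def m_def)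
    moreover have "as ! i \<noteq> as ! Suc i" using x_mono[of i "Suc i"] True by (auto simp: x_def)
    ultimately show ?thesis using a True i(2) by (simp add: edge_def)
  next
    case False
    then have infin using i(1) unfolding E_def by simp
    then have "None \<in> vertices" using None_in_vertices by blast
    then show ?thesis using a False i(2) by (simp add: edge_def)
  qed
  fix e' assume "e' \<in> edge ` E" "e \<noteq> e'"
  then obtain j where j: "j \<in> E" "e' = edge j" "i \<noteq> j" using i by blast
  have *: "segment_points (edge i) \<inter> segment_points (edge j) \<subseteq> endpoints (edge i) \<inter> endpoints (edge j)"
    if ij: "i \<in> E" "j \<in> E" "i < j" for i j
  proof
    fix p assume p: "p \<in> segment_points (edge i) \<inter> segment_points (edge j)"
    have si: "Suc i < m" using ij E_m[OF ij(2)] by simp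
    then have "None \<notin> segment_points (edge i)" using None_segment[OF ij(1)] by simp
    then obtain v where v: "p = Some v" using p by (cases p) auto
    have hv: "h v = 0" "X v \<in> Jc i" "X v \<in> Jc j" using p v segment_edge ij by auto
    then have "X v \<le> x (Suc i)" "x j \<le> X v" using si by (auto simp: Jc_def)
    moreover have "x (Suc i) \<le> x j" using x_mono'[of "Suc i" j] ij E_m by simp
    ultimately have e: "X v = x (Suc i)" "X v = x j" by auto
    have "v = as ! Suc i" by (rule in_as[OF hv(1) e(1) si])
    moreover have "v = as ! j" by (rule in_as[OF hv(1) e(2) E_m[OF ij(2)]])
    ultimately have "v = as ! Suc i" "v = as ! j" by blast+
    then show "p \<in> endpoints (edge i) \<inter> endpoints (edge j)" using v si endpoints_edge[OF ij(1)] endpoints_edge[OF ij(2)] by auto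
  qed
  show "segment_points e \<inter> segment_points e' \<subseteq> endpoints e \<inter> endpoints e'"
  proof (cases "i < j")
    case True then show ?thesis using *[OF i(1) j(1)] i(2) j(2) by simp
  next
    case False
    then have "j < i" using j(3) by simp
    then show ?thesis using *[OF j(1) i(1)] i(2) j(2) by blast
  qed
next
  show "simply_connected_space (subtopology riemann_sphere (sheet (edge ` E)))"
    unfolding riemann_sphere_eq sheet_eq by (rule star_domain_simply_connected[OF star_cut_sheet])
qed

section \<open>Basic neighbourhoods and their traces on the sheet\<close>

lemma small_ex: "e > 0 \<Longrightarrow> \<exists>r. small \<zeta> r \<and> r \<le> e"
proof -
  assume e: "e > 0"
  define D where "D = insert e ((if Im \<zeta> = 0 then {} else {\<bar>Im \<zeta>\<bar>}) \<union> (\<lambda>j. \<bar>x j - Re \<zeta>\<bar>) ` {j. j < m \<and> x j \<noteq> Re \<zeta>})"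
  have f: "finite D" and ne: "D \<noteq> {}" and eD: "e \<in> D" by (auto simp: D_def)
  have pos: "0 < d" if "d \<in> D" for d using that e by (auto simp: D_def split: if_splits)
  have "0 < Min D" using pos[OF Min_in[OF f ne]] .
  moreover have "Min D \<le> \<bar>Im \<zeta>\<bar>" if "Im \<zeta> \<noteq> 0" by (rule Min_le[OF f]) (use that in \<open>simp add: D_def\<close>)
  moreover have "Min D \<le> \<bar>x j - Re \<zeta>\<bar>" if "j < m" "x j \<noteq> Re \<zeta>" for j
    by (rule Min_le[OF f]) (use that in \<open>auto simp: D_def\<close>)
  ultimately have "small \<zeta> (Min D)" unfolding small_def by blast
  moreover have "Min D \<le> e" by (rule Min_le[OF f eD])
  ultimately show ?thesis by blast
qed

text \<open>No end point of \<open>T\<close> other than possibly Re \<zeta> lies within distance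
  \<open>r\<close> of Re \<zeta>. So locally \<open>T\<close> is everything at an inner point, empty
  at an outer point, and a half-line at an end point.\<close>

lemma small_T:
  assumes s: "small \<zeta> r" "Im \<zeta> = 0" and \<eta>: "\<bar>t - Re \<zeta>\<bar> < r"
  shows "Re \<zeta> \<in> T' \<Longrightarrow> t \<in> T'" "Re \<zeta> \<notin> T \<Longrightarrow> t \<notin> T"
    "Re \<zeta> \<in> T \<Longrightarrow> Re \<zeta> \<notin> T' \<Longrightarrow> Re \<zeta> = x 0 \<Longrightarrow> t \<in> T \<longleftrightarrow> x 0 \<le> t"
    "Re \<zeta> \<in> T \<Longrightarrow> Re \<zeta> \<notin> T' \<Longrightarrow> Re \<zeta> \<noteq> x 0 \<Longrightarrow> Re \<zeta> = x (m - 1) \<and> (t \<in> T \<longleftrightarrow> t \<le> x (m - 1))"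
proof -
  have ends: "x j \<noteq> Re \<zeta> \<Longrightarrow> r \<le> \<bar>x j - Re \<zeta>\<bar>" if "j < m" for j using s(1) that by (simp add: small_def)
  note e0 = ends[OF m_pos] and e1 = ends[of "m - 1"]
  have l: "2 \<le> m" if "\<not> infin" using long that by (simp add: m_def)
  have lt: "x 0 < x (m - 1)" if "\<not> infin" using x_mono[of 0 "m - 1"] l[OF that] by simp
  show "t \<in> T'" if "Re \<zeta> \<in> T'"
    using that e0 e1 m_pos \<eta> unfolding T'_def by (auto simp: abs_if split: if_splits)
  show "t \<notin> T" if "Re \<zeta> \<notin> T"
    using that e0 e1 m_pos \<eta> unfolding T_def by (auto simp: abs_if split: if_splits)
  show "t \<in> T \<longleftrightarrow> x 0 \<le> t" if "Re \<zeta> \<in> T" "Re \<zeta> \<notin> T'" "Re \<zeta> = x 0"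
    using that e1 m_pos \<eta> lt unfolding T_def T'_def by (auto simp: abs_if split: if_splits)
  show "Re \<zeta> = x (m - 1) \<and> (t \<in> T \<longleftrightarrow> t \<le> x (m - 1))" if "Re \<zeta> \<in> T" "Re \<zeta> \<notin> T'" "Re \<zeta> \<noteq> x 0"
    using that e0 m_pos \<eta> lt unfolding T_def T'_def by (auto simp: abs_if split: if_splits)
qed

lemma open_box: "open (box \<zeta> r)"
  unfolding box_def by (intro open_Collect_conj open_Collect_less continuous_intros)

lemma convex_box: "convex (box \<zeta> r)"
proof -
  have "box \<zeta> r = {\<eta>. Re \<eta> < Re \<zeta> + r} \<inter> {\<eta>. Re \<zeta> - r < Re \<eta>} \<inter> {\<eta>. Im \<eta> < Im \<zeta> + r} \<inter> {\<eta>. Im \<zeta> - r < Im \<eta>}"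
    by (auto simp: box_def abs_if split: if_splits)
  then show ?thesis
    by (simp only: convex_Int convex_halfspace_Re_lt convex_halfspace_Re_gt convex_halfspace_Im_lt convex_halfspace_Im_gt)
qed

text \<open>The set is starlike about a point \<open>c\<close> of the axis off the slit: a segment
  from \<open>c\<close> meets the axis again only if it stays on it, and there the hypothesis on
  \<open>P\<close> applies.\<close>

lemma slit_connected:
  assumes C: "convex C" "c \<in> C" "Im c = 0" and P: "\<And>t s. 0 < s \<Longrightarrow> s \<le> 1 \<Longrightarrow> \<not> P t \<Longrightarrow> \<not> P (Re c + s * (t - Re c))" "\<not> P (Re c)"
  shows "connected {\<eta> \<in> C. \<not> (Im \<eta> = 0 \<and> P (Re \<eta>))}"
proof (rule starlike_imp_connected)
  show "starlike {\<eta> \<in> C. \<not> (Im \<eta> = 0 \<and> P (Re \<eta>))}"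
    unfolding starlike_def
  proof (intro bexI[of _ c] ballI subsetI)
    show "c \<in> {\<eta> \<in> C. \<not> (Im \<eta> = 0 \<and> P (Re \<eta>))}" using C P by simp
    fix \<eta> \<zeta> assume \<eta>: "\<eta> \<in> {\<eta> \<in> C. \<not> (Im \<eta> = 0 \<and> P (Re \<eta>))}" and \<zeta>: "\<zeta> \<in> closed_segment c \<eta>"
    then obtain u where u: "0 \<le> u" "u \<le> 1" "\<zeta> = (1 - u) *\<^sub>R c + u *\<^sub>R \<eta>" by (auto simp: in_segment)
    have "closed_segment c \<eta> \<subseteq> C" using C(1,2) \<eta> by (intro closed_segment_subset) auto
    moreover have "\<not> (Im \<zeta> = 0 \<and> P (Re \<zeta>))"
    proof (cases "u = 0")
      case True then show ?thesis using P(2) u(3) by simp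
    next
      case False
      have "Im \<zeta> = u * Im \<eta>" "Re \<zeta> = Re c + u * (Re \<eta> - Re c)" by (simp_all add: u(3) C(3) algebra_simps)
      then show ?thesis using P(1)[of u "Re \<eta>"] u False \<eta> by auto
    qed
    ultimately show "\<zeta> \<in> {\<eta> \<in> C. \<not> (Im \<eta> = 0 \<and> P (Re \<eta>))}" using \<zeta> by blast
  qed
qed

lemma bas_open: "bas p V \<Longrightarrow> open V"
proof (cases p)
  case (Some v)
  assume "bas p V"
  then show ?thesis using Some open_phi_vimage[OF open_box] by auto
next
  case None
  assume "bas p V"
  then obtain R where R: "V = insert None (Some ` (\<phi> -` {\<eta>. R < \<bar>Re \<eta>\<bar> \<or> R < \<bar>Im \<eta>\<bar>}))" using None by auto
  let ?B = "{\<eta>::complex. \<bar>Re \<eta>\<bar> \<le> R \<and> \<bar>Im \<eta>\<bar> \<le> R}"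
  have "closed ?B" by (intro closed_Collect_conj closed_Collect_le continuous_intros)
  moreover have "bounded ?B"
  proof (rule boundedI)
    fix \<eta> assume "\<eta> \<in> ?B"
    then show "norm \<eta> \<le> 2 * R" using cmod_le[of \<eta>] by simp
  qed
  ultimately have "compact ?B" by (simp add: compact_eq_bounded_closed)
  then have "compact (Some ` (\<phi>' ` ?B))" by (intro compact_continuous_image continuous_on_Some cont_phi')
  then have "closed (Some ` (\<phi> -` ?B))" unfolding phi_vimage by (rule compact_imp_closed)
  moreover have "V = - Some ` (\<phi> -` ?B)"
  proof (rule set_eqI)
    fix q show "q \<in> V \<longleftrightarrow> q \<in> - Some ` (\<phi> -` ?B)" unfolding R by (cases q) auto
  qed
  ultimately show ?thesis by (metis open_Compl)
qed

lemma bas_mem: "bas p V \<Longrightarrow> p \<in> V"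
  by (cases p) (auto simp: box_def small_def)

lemma bas_vertices: "bas p V \<Longrightarrow> V \<inter> vertices \<subseteq> {p}"
proof
  fix s assume b: "bas p V" and s: "s \<in> V \<inter> vertices"
  show "s \<in> {p}"
  proof (cases p)
    case (Some v)
    then obtain r where r: "small (\<phi> v) r" "V = Some ` (\<phi> -` box (\<phi> v) r)" using b by auto
    then obtain u where u: "s = Some u" "\<phi> u \<in> box (\<phi> v) r" using s by auto
    then obtain j where j: "j < m" "h u = 0" "X u = x j" using s Some_in_vertices by auto
    have ab: "\<bar>x j - X v\<bar> < r" "\<bar>h v\<bar> < r" using u(2) j by (simp_all add: box_def)
    then have "h v = 0" using r(1) by (auto simp: small_def)
    moreover have "x j = X v" using r(1) j(1) ab(1) by (auto simp: small_def)
    ultimately have "u = v" using j by (intro phi_inj) simp_all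
    then show ?thesis using u(1) Some by simp
  next
    case None
    then obtain R where R: "\<And>j. j < m \<Longrightarrow> \<bar>x j\<bar> < R" "V = insert None (Some ` (\<phi> -` {\<eta>. R < \<bar>Re \<eta>\<bar> \<or> R < \<bar>Im \<eta>\<bar>}))"
      using b by auto
    have "s = None"
    proof (rule ccontr)
      assume "s \<noteq> None"
      then obtain u where u: "s = Some u" by auto
      then obtain j where j: "j < m" "h u = 0" "X u = x j" using s Some_in_vertices by auto
      have "R < \<bar>X u\<bar> \<or> R < \<bar>h u\<bar>" using s u R(2) by auto
      then show False using R(1)[OF j(1)] j by auto
    qed
    then show ?thesis using None by simp
  qed
qed

lemma bas_ex:
  assumes U: "open U" "p \<in> U" shows "\<exists>V. bas p V \<and> V \<subseteq> U"
proof -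
  have c: "continuous_on UNIV (map_option \<phi>')"
    by (rule map_option_continuous[OF homeomorphism_symD[OF homeo_phi]])
  have o: "open (map_option \<phi>' -` U)" using c U(1) by (simp add: continuous_on_open_vimage)
  show ?thesis
  proof (cases p)
    case (Some v)
    have "open (Some -` map_option \<phi>' -` U)" using o by (simp add: open_sphere_iff)
    moreover have "\<phi> v \<in> Some -` map_option \<phi>' -` U" using U(2) Some by simp
    ultimately obtain e where e: "e > 0" "ball (\<phi> v) e \<subseteq> Some -` map_option \<phi>' -` U" using openE by blast
    \<comment> \<open>Half of \<open>e\<close>, as the norm is bounded by the sum of the absolute
      real and imaginary parts.\<close>
    obtain r where r: "small (\<phi> v) r" "r \<le> e / 2" using small_ex[of "e / 2" "\<phi> v"] e(1) by auto
    have "box (\<phi> v) r \<subseteq> ball (\<phi> v) e"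
    proof
      fix \<eta> assume "\<eta> \<in> box (\<phi> v) r"
      then have "\<bar>Re (\<eta> - \<phi> v)\<bar> + \<bar>Im (\<eta> - \<phi> v)\<bar> < e" using r(2) by (auto simp: box_def)
      then show "\<eta> \<in> ball (\<phi> v) e" using cmod_le[of "\<eta> - \<phi> v"] by (simp add: dist_norm norm_minus_commute)
    qed
    then have "Some ` (\<phi> -` box (\<phi> v) r) \<subseteq> U" using e(2) by (auto dest!: subsetD)
    then show ?thesis using r(1) Some by auto
  next
    case None
    then obtain R where R: "\<And>\<eta>. R < norm \<eta> \<Longrightarrow> Some \<eta> \<in> map_option \<phi>' -` U"
      using o U(2) unfolding open_sphere_iff by auto
    \<comment> \<open>At least \<open>R\<close>, and by the summand 1 strictly beyond the abscissae
      of all vertices.\<close>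
    define R' where "R' = max R (Max (insert 0 ((\<lambda>j. \<bar>x j\<bar>) ` {..<m})) + 1)"
    have "\<bar>x j\<bar> < R'" if "j < m" for j
    proof -
      have "\<bar>x j\<bar> \<le> Max (insert 0 ((\<lambda>j. \<bar>x j\<bar>) ` {..<m}))" using that by (intro Max_ge) auto
      then show ?thesis by (simp add: R'_def)
    qed
    moreover have "insert None (Some ` (\<phi> -` {\<eta>. R' < \<bar>Re \<eta>\<bar> \<or> R' < \<bar>Im \<eta>\<bar>})) \<subseteq> U"
    proof
      fix q assume q: "q \<in> insert None (Some ` (\<phi> -` {\<eta>. R' < \<bar>Re \<eta>\<bar> \<or> R' < \<bar>Im \<eta>\<bar>}))"
      show "q \<in> U"
      proof (cases q)
        case None then show ?thesis using U(2) \<open>p = None\<close> by simp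
      next
        case (Some u)
        then have "R' < \<bar>Re (\<phi> u)\<bar> \<or> R' < \<bar>Im (\<phi> u)\<bar>" using q by auto
        then have "R < norm (\<phi> u)" using abs_Re_le_cmod[of "\<phi> u"] abs_Im_le_cmod[of "\<phi> u"] by (auto simp: R'_def)
        then show ?thesis using R[of "\<phi> u"] Some by simp
      qed
    qed
    ultimately show ?thesis using None by auto
  qed
qed

lemma bas_edge:
  assumes b: "bas p V" and i: "i \<in> E" and v: "h u = 0" "X u \<in> Jo i" "Some u \<in> V"
  shows "p \<in> segment_points (edge i)"
proof (cases p)
  case (Some v)
  then obtain r where r: "small (\<phi> v) r" "\<phi> u \<in> box (\<phi> v) r" using b v(3) by auto
  have ab: "\<bar>X u - X v\<bar> < r" "\<bar>h v\<bar> < r" using r(2) v(1) by (simp_all add: box_def)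
  have hv: "h v = 0" using r(1) ab(2) by (auto simp: small_def)
  have s: "x j = X v \<or> r \<le> \<bar>x j - X v\<bar>" if "j < m" for j using r(1) that by (auto simp: small_def)
  have "x i \<le> X v" using s[OF E_m[OF i]] ab(1) v(2) by (auto simp: Jo_def)
  moreover have "X v \<le> x (Suc i)" if "Suc i < m" using s[OF that] ab(1) v(2) that by (auto simp: Jo_def)
  ultimately have "X v \<in> Jc i" by (simp add: Jc_def)
  then show ?thesis using segment_edge[OF i] hv Some by simp
next
  case None
  then obtain R where R: "\<And>j. j < m \<Longrightarrow> \<bar>x j\<bar> < R" "R < \<bar>X u\<bar> \<or> R < \<bar>h u\<bar>" using b v(3) by auto
  have "R > 0" using R(1)[OF m_pos] by simp
  then have "R < \<bar>X u\<bar>" using R(2) v(1) by simp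
  have "\<not> Suc i < m"
  proof
    assume s: "Suc i < m"
    then have "x i < X u" "X u < x (Suc i)" using v(2) by (auto simp: Jo_def)
    then show False using R(1)[OF E_m[OF i]] R(1)[OF s] \<open>R < \<bar>X u\<bar>\<close> by simp
  qed
  then show ?thesis using None_segment[OF i] None by simp
qed

lemma inn_cover: "bas p V \<Longrightarrow> p \<in> inn \<Longrightarrow> V \<inter> cut_sheet \<subseteq> up \<union> dn"
proof
  fix q assume b: "bas p V" and p: "p \<in> inn" and q: "q \<in> V \<inter> cut_sheet"
  obtain v where v: "p = Some v" "h v = 0" "X v \<in> T'" using p by (auto simp: inn_def)
  then obtain r where r: "small (\<phi> v) r" "V = Some ` (\<phi> -` box (\<phi> v) r)" using b by auto
  then obtain u where u: "q = Some u" "\<phi> u \<in> box (\<phi> v) r" using q by auto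
  have "h u \<noteq> 0"
  proof
    assume hu: "h u = 0"
    have "X u \<in> T'" using small_T(1)[OF r(1)] v u(2) by (simp add: box_def)
    then show False using q u(1) hu T'_T by (auto simp: Some_in_cut_sheet)
  qed
  then show "q \<in> up \<union> dn" using u(1) by (simp add: linorder_neq_iff disj_commute)
qed

lemma bas_inner:
  assumes b: "bas p V" and p: "p \<in> inn" and Q: "Q = up \<or> Q = dn"
  shows "connected (V \<inter> Q)" "V \<inter> Q \<noteq> {}"
proof -
  obtain v where v: "p = Some v" "h v = 0" using p by (auto simp: inn_def)
  then obtain r where r: "small (\<phi> v) r" "V = Some ` (\<phi> -` box (\<phi> v) r)" using b by auto
  have r0: "r > 0" using r(1) by (simp add: small_def)
  have Vup: "V \<inter> up = Some ` (\<phi> -` (box (\<phi> v) r \<inter> {\<eta>. 0 < Im \<eta>}))"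
    and Vdn: "V \<inter> dn = Some ` (\<phi> -` (box (\<phi> v) r \<inter> {\<eta>. Im \<eta> < 0}))"
    unfolding r(2) up_eq dn_eq by auto
  have "connected (V \<inter> up)" "connected (V \<inter> dn)"
    unfolding Vup Vdn by (intro connected_vimage convex_connected convex_Int convex_box convex_halfspace_Im_gt convex_halfspace_Im_lt)+
  then show "connected (V \<inter> Q)" using Q by blast
  have "Some (\<phi>' (Complex (X v) (r / 2))) \<in> V \<inter> up" "Some (\<phi>' (Complex (X v) (- r / 2))) \<in> V \<inter> dn"
    using r0 v(2) unfolding Vup Vdn by (simp_all add: box_def)
  then show "V \<inter> Q \<noteq> {}" using Q by blast
qed

text \<open>Off the chain the box contains no point of it and is convex. At an end point of the
  chain the box is slit from its centre to one side, and it is star-shaped about the point of the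
  axis at half the radius on the other side.\<close>

lemma bas_outer_finite:
  assumes s: "small (\<phi> v) r" and V: "V = Some ` (\<phi> -` box (\<phi> v) r)" and p: "Some v \<notin> inn"
  shows "connected (V \<inter> cut_sheet)" "V \<inter> cut_sheet \<noteq> {}"
proof -
  have r0: "r > 0" using s by (simp add: small_def)
  have VL: "V \<inter> cut_sheet = Some ` (\<phi> -` {\<eta> \<in> box (\<phi> v) r. \<not> (Im \<eta> = 0 \<and> Re \<eta> \<in> T)})"
    unfolding V by (auto simp: Some_in_cut_sheet)
  have ne: "V \<inter> cut_sheet \<noteq> {}" if "\<eta> \<in> box (\<phi> v) r" "\<not> (Im \<eta> = 0 \<and> Re \<eta> \<in> T)" for \<eta>
  proof -
    have "Some (\<phi>' \<eta>) \<in> V \<inter> cut_sheet" unfolding VL using that by simp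
    then show ?thesis by blast
  qed
  show "V \<inter> cut_sheet \<noteq> {}"
  proof (cases "h v = 0")
    case True
    show ?thesis by (rule ne[of "Complex (X v) (r / 2)"]) (use True r0 in \<open>simp_all add: box_def\<close>)
  next
    case False
    show ?thesis by (rule ne[of "\<phi> v"]) (use False r0 in \<open>simp_all add: box_def\<close>)
  qed
  have "connected {\<eta> \<in> box (\<phi> v) r. \<not> (Im \<eta> = 0 \<and> Re \<eta> \<in> T)}"
  proof (cases "h v = 0 \<and> X v \<in> T")
    case False
    have "{\<eta> \<in> box (\<phi> v) r. \<not> (Im \<eta> = 0 \<and> Re \<eta> \<in> T)} = box (\<phi> v) r"
    proof -
      have "\<not> (Im \<eta> = 0 \<and> Re \<eta> \<in> T)" if \<eta>: "\<eta> \<in> box (\<phi> v) r" for \<eta>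
      proof (cases "h v = 0")
        case True
        then have "X v \<notin> T" using False by simp
        then show ?thesis using small_T(2)[OF s _ , of "Re \<eta>"] True \<eta> by (simp add: box_def)
      next
        case False
        then show ?thesis using s \<eta> by (auto simp: small_def box_def)
      qed
      then show ?thesis by blast
    qed
    then show ?thesis using convex_connected[OF convex_box] by simp
  next
    case True
    then have T': "X v \<notin> T'" using p by (auto simp: inn_def)
    have hv: "Im (\<phi> v) = 0" using True by simp
    show ?thesis
    proof (cases "X v = x 0")
      case x0: True
      have "{\<eta> \<in> box (\<phi> v) r. \<not> (Im \<eta> = 0 \<and> Re \<eta> \<in> T)} = {\<eta> \<in> box (\<phi> v) r. \<not> (Im \<eta> = 0 \<and> x 0 \<le> Re \<eta>)}"
      proof -
        have "Re \<eta> \<in> T \<longleftrightarrow> x 0 \<le> Re \<eta>" if "\<eta> \<in> box (\<phi> v) r" for \<eta>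
          using small_T(3)[OF s hv, of "Re \<eta>"] True T' x0 that by (simp add: box_def)
        then show ?thesis by blast
      qed
      moreover have "connected {\<eta> \<in> box (\<phi> v) r. \<not> (Im \<eta> = 0 \<and> x 0 \<le> Re \<eta>)}"
      proof (rule slit_connected[OF convex_box, of "Complex (x 0 - r / 2) 0"])
        fix t s :: real assume s: "0 < s" "s \<le> 1" "\<not> x 0 \<le> t"
        then have "s * (t - x 0) < 0" by (simp add: mult_less_0_iff)
        moreover have "0 \<le> (1 - s) * (r / 2)" using s(2) r0 by simp
        ultimately show "\<not> x 0 \<le> Re (Complex (x 0 - r / 2) 0) + s * (t - Re (Complex (x 0 - r / 2) 0))"
          by (simp add: algebra_simps)
      qed (use r0 x0 True in \<open>simp_all add: box_def\<close>)
      ultimately show ?thesis by simp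
    next
      case False
      have last: "X v = x (m - 1)" using small_T(4)[OF s hv, of "X v"] True T' False r0 by simp
      have "{\<eta> \<in> box (\<phi> v) r. \<not> (Im \<eta> = 0 \<and> Re \<eta> \<in> T)} = {\<eta> \<in> box (\<phi> v) r. \<not> (Im \<eta> = 0 \<and> Re \<eta> \<le> x (m - 1))}"
      proof -
        have "Re \<eta> \<in> T \<longleftrightarrow> Re \<eta> \<le> x (m - 1)" if "\<eta> \<in> box (\<phi> v) r" for \<eta>
          using small_T(4)[OF s hv, of "Re \<eta>"] True T' False that by (simp add: box_def)
        then show ?thesis by blast
      qed
      moreover have "connected {\<eta> \<in> box (\<phi> v) r. \<not> (Im \<eta> = 0 \<and> Re \<eta> \<le> x (m - 1))}"
      proof (rule slit_connected[OF convex_box, of "Complex (x (m - 1) + r / 2) 0"])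
        fix t s :: real assume s: "0 < s" "s \<le> 1" "\<not> t \<le> x (m - 1)"
        then have "0 < s * (t - x (m - 1))" by simp
        moreover have "0 \<le> (1 - s) * (r / 2)" using s(2) r0 by simp
        ultimately show "\<not> Re (Complex (x (m - 1) + r / 2) 0) + s * (t - Re (Complex (x (m - 1) + r / 2) 0)) \<le> x (m - 1)"
          by (simp add: algebra_simps)
      qed (use r0 last True in \<open>simp_all add: box_def\<close>)
      ultimately show ?thesis by simp
    qed
  qed
  then show "connected (V \<inter> cut_sheet)" unfolding VL by (rule connected_vimage)
qed

text \<open>The outside of a square is a union of overlapping half-planes; replacing the right one
  by its upper and lower quarter removes the ray to infinity and keeps the union connected. Without
  a ray the right half-plane is put back, and infinity is added as a limit point.\<close>

lemma bas_outer_infinite: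
  assumes R: "\<And>j. j < m \<Longrightarrow> \<bar>x j\<bar> < R" and V: "V = insert None (Some ` (\<phi> -` {\<eta>. R < \<bar>Re \<eta>\<bar> \<or> R < \<bar>Im \<eta>\<bar>}))"
  shows "connected (V \<inter> cut_sheet)" "V \<inter> cut_sheet \<noteq> {}"
proof -
  have R0: "R > 0" using R[OF m_pos] by simp
  have x0: "x 0 < R" "- R < x 0" using R[OF m_pos] by auto
  define H where "H = {\<eta>. R < Im \<eta>} \<union> {\<eta>. Re \<eta> < - R} \<union> {\<eta>. Im \<eta> < - R} \<union> ({\<eta>. R < Re \<eta>} \<inter> {\<eta>. 0 < Im \<eta>}) \<union> ({\<eta>. R < Re \<eta>} \<inter> {\<eta>. Im \<eta> < 0})"
  have cH: "connected H"
    unfolding H_def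
  proof (intro connected_Un convex_connected convex_Int convex_halfspace_Im_gt convex_halfspace_Im_lt convex_halfspace_Re_gt convex_halfspace_Re_lt)
    have "Complex (- R - 1) (R + 1) \<in> {\<eta>. R < Im \<eta>} \<inter> {\<eta>. Re \<eta> < - R}" by simp
    then show "{\<eta>. R < Im \<eta>} \<inter> {\<eta>. Re \<eta> < - R} \<noteq> {}" by blast
    have "Complex (- R - 1) (- R - 1) \<in> ({\<eta>. R < Im \<eta>} \<union> {\<eta>. Re \<eta> < - R}) \<inter> {\<eta>. Im \<eta> < - R}" by simp
    then show "({\<eta>. R < Im \<eta>} \<union> {\<eta>. Re \<eta> < - R}) \<inter> {\<eta>. Im \<eta> < - R} \<noteq> {}" by blast
    have "Complex (R + 1) (R + 1) \<in> ({\<eta>. R < Im \<eta>} \<union> {\<eta>. Re \<eta> < - R} \<union> {\<eta>. Im \<eta> < - R}) \<inter> ({\<eta>. R < Re \<eta>} \<inter> {\<eta>. 0 < Im \<eta>})"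
      using R0 by simp
    then show "({\<eta>. R < Im \<eta>} \<union> {\<eta>. Re \<eta> < - R} \<union> {\<eta>. Im \<eta> < - R}) \<inter> ({\<eta>. R < Re \<eta>} \<inter> {\<eta>. 0 < Im \<eta>}) \<noteq> {}" by blast
    have "Complex (R + 1) (- R - 1) \<in> ({\<eta>. R < Im \<eta>} \<union> {\<eta>. Re \<eta> < - R} \<union> {\<eta>. Im \<eta> < - R} \<union> ({\<eta>. R < Re \<eta>} \<inter> {\<eta>. 0 < Im \<eta>})) \<inter> ({\<eta>. R < Re \<eta>} \<inter> {\<eta>. Im \<eta> < 0})"
      using R0 by simp
    then show "({\<eta>. R < Im \<eta>} \<union> {\<eta>. Re \<eta> < - R} \<union> {\<eta>. Im \<eta> < - R} \<union> ({\<eta>. R < Re \<eta>} \<inter> {\<eta>. 0 < Im \<eta>})) \<inter> ({\<eta>. R < Re \<eta>} \<inter> {\<eta>. Im \<eta> < 0}) \<noteq> {}" by blast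
  qed
  have HR: "\<eta> \<in> H \<longleftrightarrow> (R < \<bar>Re \<eta>\<bar> \<or> R < \<bar>Im \<eta>\<bar>) \<and> \<not> (Im \<eta> = 0 \<and> R < Re \<eta>)" for \<eta>
    using R0 unfolding H_def by (auto simp: abs_if)
  have outT: "(R < \<bar>Re \<eta>\<bar> \<or> R < \<bar>Im \<eta>\<bar>) \<Longrightarrow> (Im \<eta> = 0 \<and> Re \<eta> \<in> T) \<longleftrightarrow> infin \<and> Im \<eta> = 0 \<and> R < Re \<eta>" for \<eta>
    using R0 x0 R[of "m - 1"] m_pos unfolding T_def by (auto simp: abs_if split: if_splits)
  have n: "Some (\<phi>' (Complex 0 (R + 1))) \<in> V \<inter> cut_sheet" unfolding V using R0 by (simp add: Some_in_cut_sheet)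
  then show "V \<inter> cut_sheet \<noteq> {}" by blast
  show "connected (V \<inter> cut_sheet)"
  proof (cases infin)
    case True
    have outT': "(R < \<bar>Re \<eta>\<bar> \<or> R < \<bar>Im \<eta>\<bar>) \<Longrightarrow> (Im \<eta> = 0 \<and> Re \<eta> \<in> T) \<longleftrightarrow> Im \<eta> = 0 \<and> R < Re \<eta>" for \<eta>
      using outT[of \<eta>] True by blast
    have nL: "None \<notin> cut_sheet" using True None_in_cut_sheet by blast
    have "V \<inter> cut_sheet = Some ` (\<phi> -` H)"
    proof (rule set_eqI)
      fix q show "q \<in> V \<inter> cut_sheet \<longleftrightarrow> q \<in> Some ` (\<phi> -` H)"
      proof (cases q)
        case None then show ?thesis using nL by auto
      next
        case (Some u)
        show ?thesis using HR[of "\<phi> u"] outT'[of "\<phi> u"] unfolding V Some by (auto simp: Some_in_cut_sheet)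
      qed
    qed
    then show ?thesis using connected_vimage[OF cH] by simp
  next
    case False
    have outT': "(R < \<bar>Re \<eta>\<bar> \<or> R < \<bar>Im \<eta>\<bar>) \<Longrightarrow> \<not> (Im \<eta> = 0 \<and> Re \<eta> \<in> T)" for \<eta>
      using outT[of \<eta>] False by blast
    have nL: "None \<in> cut_sheet" using False None_in_cut_sheet by blast
    let ?O = "H \<union> {\<eta>. R < Re \<eta>}"
    have cO: "connected ?O"
    proof (intro connected_Un cH convex_connected convex_halfspace_Re_gt)
      have "Complex (R + 1) 1 \<in> H \<inter> {\<eta>. R < Re \<eta>}" by (simp add: H_def)
      then show "H \<inter> {\<eta>. R < Re \<eta>} \<noteq> {}" by blast
    qed
    have OR: "\<eta> \<in> ?O \<longleftrightarrow> R < \<bar>Re \<eta>\<bar> \<or> R < \<bar>Im \<eta>\<bar>" for \<eta> using HR[of \<eta>] by auto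
    have VL: "V \<inter> cut_sheet = insert None (Some ` (\<phi> -` ?O))"
    proof (rule set_eqI)
      fix q show "q \<in> V \<inter> cut_sheet \<longleftrightarrow> q \<in> insert None (Some ` (\<phi> -` ?O))"
      proof (cases q)
        case None then show ?thesis using nL V by auto
      next
        case (Some u)
        show ?thesis using OR[of "\<phi> u"] outT'[of "\<phi> u"] unfolding V Some by (auto simp: Some_in_cut_sheet)
      qed
    qed
    have "None \<in> closure (Some ` (\<phi> -` ?O))"
    proof (rule ccontr)
      assume a: "None \<notin> closure (Some ` (\<phi> -` ?O))"
      have "open (V \<inter> - closure (Some ` (\<phi> -` ?O)))"
        using bas_open[of None V] R V by (intro open_Int) auto
      then obtain u :: complex where "Some u \<in> V \<inter> - closure (Some ` (\<phi> -` ?O))"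
        using sphere_dense_Some[of "V \<inter> - closure (Some ` (\<phi> -` ?O))"] a V by auto
      then have u: "Some u \<in> V" "Some u \<notin> closure (Some ` (\<phi> -` ?O))" by auto
      from u(1) have "\<phi> u \<in> ?O" unfolding OR V by simp
      then have "Some u \<in> Some ` (\<phi> -` ?O)" by blast
      then show False using u(2) closure_subset by (metis subsetD)
    qed
    then show ?thesis
      unfolding VL using closure_subset[of "Some ` (\<phi> -` ?O)"]
      by (intro connected_intermediate_closure[OF connected_vimage[OF cO]]) auto
  qed
qed

lemma bas_corner:
  assumes b: "bas p V" and Q: "Q \<in> (if p \<in> inn then {up, dn} else {cut_sheet})"
  shows "connected (V \<inter> Q)" "V \<inter> Q \<noteq> {}"
proof -
  have "connected (V \<inter> Q) \<and> V \<inter> Q \<noteq> {}"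
  proof (cases "p \<in> inn")
    case True
    then show ?thesis using bas_inner[OF b True, of Q] Q by auto
  next
    case False
    then have QL: "Q = cut_sheet" using Q by simp
    show ?thesis
    proof (cases p)
      case (Some v)
      then obtain r where r: "small (\<phi> v) r" "V = Some ` (\<phi> -` box (\<phi> v) r)" using b by auto
      then show ?thesis using bas_outer_finite[OF r] False Some QL by simp
    next
      case None
      then obtain R where "\<And>j. j < m \<Longrightarrow> \<bar>x j\<bar> < R" "V = insert None (Some ` (\<phi> -` {\<eta>. R < \<bar>Re \<eta>\<bar> \<or> R < \<bar>Im \<eta>\<bar>}))"
        using b by auto
      then show ?thesis using bas_outer_infinite[of R V] QL by simp
    qed
  qed
  then show "connected (V \<inter> Q)" "V \<inter> Q \<noteq> {}" by blast+
qed

lemma near_both: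
  assumes U: "open U" "Some v \<in> U" and v: "h v = 0"
  shows "U \<inter> up \<noteq> {} \<and> U \<inter> dn \<noteq> {}"
proof -
  obtain B where B: "bas (Some v) B" "B \<subseteq> U" using bas_ex[OF U] by blast
  then obtain r where r: "small (\<phi> v) r" "B = Some ` (\<phi> -` box (\<phi> v) r)" by auto
  have r0: "r > 0" using r(1) by (simp add: small_def)
  have "Some (\<phi>' (Complex (X v) (r / 2))) \<in> B \<inter> up" "Some (\<phi>' (Complex (X v) (- r / 2))) \<in> B \<inter> dn"
    using r0 v unfolding r(2) by (simp_all add: box_def)
  then show ?thesis using B(2) by blast
qed

lemma near_edge:
  assumes i: "i \<in> E" and p: "p \<in> segment_points (edge i)" and U: "open U" "p \<in> U"
  shows "U \<inter> interior_points (edge i) \<noteq> {}"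
proof -
  obtain B where B: "bas p B" "B \<subseteq> U" using bas_ex[OF U] by blast
  have "\<exists>t. t \<in> Jo i \<and> Some (\<phi>' (Complex t 0)) \<in> B"
  proof (cases p)
    case (Some v)
    then obtain r where r: "small (\<phi> v) r" "B = Some ` (\<phi> -` box (\<phi> v) r)" using B by auto
    have r0: "r > 0" using r(1) by (simp add: small_def)
    have v: "h v = 0" "X v \<in> Jc i" using p Some segment_edge[OF i] by auto
    have d: "Suc i < m \<Longrightarrow> x i < x (Suc i)" using x_mono[of i "Suc i"] by simp
    \<comment> \<open>From a vertex, \<open>t\<close> moves into the edge by at most half the radius
      and half the length of the edge; otherwise it is X v itself.\<close>
    define t where "t = (if Suc i < m \<and> X v = x (Suc i) then X v - min (r / 2) ((x (Suc i) - x i) / 2)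
        else if X v = x i then X v + (if Suc i < m then min (r / 2) ((x (Suc i) - x i) / 2) else r / 2) else X v)"
    have "t \<in> Jo i \<and> \<bar>t - X v\<bar> < r"
      using v(2) d r0 unfolding t_def Jo_def Jc_def by (auto simp: min_def field_simps split: if_splits)
    then have "t \<in> Jo i" "Some (\<phi>' (Complex t 0)) \<in> B" using v(1) r0 unfolding r(2) by (simp_all add: box_def)
    then show ?thesis by blast
  next
    case None
    then obtain R where R: "\<And>j. j < m \<Longrightarrow> \<bar>x j\<bar> < R" "B = insert None (Some ` (\<phi> -` {\<eta>. R < \<bar>Re \<eta>\<bar> \<or> R < \<bar>Im \<eta>\<bar>}))" using B by auto
    have "\<not> Suc i < m" using p None None_segment[OF i] by simp
    then have "R + 1 \<in> Jo i" using R(1)[OF E_m[OF i]] by (auto simp: Jo_def)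
    moreover have "R < \<bar>R + 1\<bar>" by linarith
    then have "Some (\<phi>' (Complex (R + 1) 0)) \<in> B" unfolding R(2) by simp
    ultimately show ?thesis by blast
  qed
  then obtain t where t: "t \<in> Jo i" "Some (\<phi>' (Complex t 0)) \<in> B" by blast
  then have "Some (\<phi>' (Complex t 0)) \<in> interior_points (edge i)" unfolding interior_edge[OF i] by simp
  then show ?thesis using t(2) B(2) by blast
qed

lemma open_Jo: "open (Jo i)"
proof (cases "Suc i < m")
  case True
  have "Jo i = {x i<..<x (Suc i)}" using True by (auto simp: Jo_def)
  then show ?thesis by simp
next
  case False
  have "Jo i = {x i<..}" using False by (auto simp: Jo_def)
  then show ?thesis by simp
qed

lemma convex_Jo: "convex (Jo i)"
proof (cases "Suc i < m")
  case True
  have "Jo i = {x i<..<x (Suc i)}" using True by (auto simp: Jo_def)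
  then show ?thesis by simp
next
  case False
  have "Jo i = {x i<..}" using False by (auto simp: Jo_def)
  then show ?thesis by simp
qed

lemma Jo_nonempty: "i \<in> E \<Longrightarrow> Jo i \<noteq> {}"
proof -
  assume i: "i \<in> E"
  show ?thesis
  proof (cases "Suc i < m")
    case True
    then have "(x i + x (Suc i)) / 2 \<in> Jo i" using x_mono[of i "Suc i"] by (simp add: Jo_def)
    then show ?thesis by blast
  next
    case False
    then have "x i + 1 \<in> Jo i" by (simp add: Jo_def)
    then show ?thesis by blast
  qed
qed

lemma linear_X: "linear X"
  by (rule linearI) (simp_all add: shear_def algebra_simps)

lemma strip_props:
  assumes i: "i \<in> E"
  shows "open (strp (edge i))" "strp (edge i) \<inter> vertices = {}" "star_domain (strp (edge i))"
    "strp (edge i) - cut_sheet = interior_points (edge i)" "strp (edge i) \<inter> cut_sheet \<subseteq> up \<union> dn"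
    "connected (strp (edge i) \<inter> up)" "connected (strp (edge i) \<inter> dn)"
    "strp (edge i) \<inter> left_side (edge i) = strp (edge i) \<inter> up"
    "strp (edge i) \<inter> left_side (opposite (edge i)) = strp (edge i) \<inter> dn"
proof -
  have s: "strp (edge i) = Some ` (X -` Jo i)" using strp_edge[OF i] by (simp add: vimage_def)
  have o: "open (X -` Jo i)" using continuous_on_open_vimage[of UNIV X] cont_X open_Jo by simp
  have c: "convex (X -` Jo i)" by (rule convex_linear_vimage[OF linear_X convex_Jo])
  obtain t where t: "t \<in> Jo i" using Jo_nonempty[OF i] by blast
  have "\<phi>' (Complex t 0) \<in> X -` Jo i" using t by simp
  then have ne: "X -` Jo i \<noteq> {}" by blast
  show "open (strp (edge i))" unfolding s using o by simp
  show "strp (edge i) \<inter> vertices = {}"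
  proof (rule equals0I)
    fix p assume p: "p \<in> strp (edge i) \<inter> vertices"
    then obtain v where v: "p = Some v" "X v \<in> Jo i" unfolding s by auto
    then obtain j where "j < m" "X v = x j" using p Some_in_vertices by auto
    then show False using Jo_x[OF i] v(2) by auto
  qed
  show "star_domain (strp (edge i))" unfolding s by (rule star_domain_convex[OF o c ne])
  have JT: "t \<in> T" if "t \<in> Jo i" for t using Jo_T'[OF i] T'_T that by blast
  show "strp (edge i) - cut_sheet = interior_points (edge i)"
    unfolding interior_edge[OF i] s using JT by (auto simp: Some_in_cut_sheet)
  show "strp (edge i) \<inter> cut_sheet \<subseteq> up \<union> dn"
    unfolding s using JT by (auto simp: Some_in_cut_sheet)
  have "convex (Re -` Jo i)" by (rule convex_linear_vimage[OF _ convex_Jo]) (simp add: linear_iff)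
  then have "connected (Some ` (\<phi> -` (Re -` Jo i \<inter> {\<eta>. 0 < Im \<eta>})))" "connected (Some ` (\<phi> -` (Re -` Jo i \<inter> {\<eta>. Im \<eta> < 0})))"
    by (intro connected_vimage convex_connected convex_Int convex_halfspace_Im_gt convex_halfspace_Im_lt; assumption)+
  moreover have "Some ` (\<phi> -` (Re -` Jo i \<inter> {\<eta>. 0 < Im \<eta>})) = strp (edge i) \<inter> up"
    "Some ` (\<phi> -` (Re -` Jo i \<inter> {\<eta>. Im \<eta> < 0})) = strp (edge i) \<inter> dn"
    unfolding s up_def dn_def by auto
  ultimately show "connected (strp (edge i) \<inter> up)" "connected (strp (edge i) \<inter> dn)" by simp_all
  have l: "Some v \<in> left_side (edge i) \<longleftrightarrow> 0 < h v" "Some v \<in> left_side (opposite (edge i)) \<longleftrightarrow> h v < 0" if "X v \<in> Jo i" for v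
    using left_edge[OF i that] by auto
  show "strp (edge i) \<inter> left_side (edge i) = strp (edge i) \<inter> up"
    unfolding s up_def using l(1) by auto
  show "strp (edge i) \<inter> left_side (opposite (edge i)) = strp (edge i) \<inter> dn"
    unfolding s dn_def using l(2) by auto
qed

lemma oriented_edge:
  assumes i: "i \<in> E" shows "opposite (edge i) \<notin> edge ` E"
proof
  assume "opposite (edge i) \<in> edge ` E"
  then obtain j where j: "j \<in> E" "opposite (edge i) = edge j" by blast
  show False
  proof (cases "Suc i < m")
    case True
    then have s: "Suc j < m" "as ! Suc i = as ! j" "as ! i = as ! Suc j"
      using j(2) by (auto simp: edge_def split: if_splits)
    then have "x (Suc i) = x j" "x i = x (Suc j)" by (simp_all add: x_def)
    then show False using x_mono[of i "Suc i"] x_mono[of j "Suc j"] True s(1) by simp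
  next
    case False
    then show False using j(2) by (auto simp: edge_def split: if_splits)
  qed
qed

theorem tame: "tame_cuts vertices (edge ` E) cut_sheet up dn inn strp bas"
proof
  show "sheet_type vertices (edge ` E)" by (rule sheet_type_cuts)
  show "cut_sheet = sheet (edge ` E)" by (simp add: sheet_eq)
  show "open cut_sheet" by (rule open_cut_sheet)
  show "cut_sheet \<inter> vertices = {}"
  proof (rule equals0I)
    fix p assume p: "p \<in> cut_sheet \<inter> vertices"
    show False
    proof (cases p)
      case None then show False using p None_in_cut_sheet None_in_vertices by simp
    next
      case (Some v)
      then obtain j where j: "j < m" "h v = 0" "X v = x j" using p Some_in_vertices by auto
      have "x j \<in> T" using x_mono'[of 0 j] x_mono'[of j "m - 1"] j(1) unfolding T_def by auto
      then show False using p Some j by (simp add: Some_in_cut_sheet)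
    qed
  qed
  show "star_domain cut_sheet" by (rule star_cut_sheet)
  show "up \<subseteq> cut_sheet" unfolding up_def by (auto simp: Some_in_cut_sheet)
  show "dn \<subseteq> cut_sheet" unfolding dn_def by (auto simp: Some_in_cut_sheet)
  show "open up" "open dn" by (rule open_up open_dn)+
  show "up \<inter> dn = {}" by (auto simp: up_def dn_def)
  show "opposite e \<notin> edge ` E" if "e \<in> edge ` E" for e using that oriented_edge by auto
  show "open (strp e)" "strp e \<inter> vertices = {}" "star_domain (strp e)" "strp e - cut_sheet = interior_points e"
    "strp e \<inter> cut_sheet \<subseteq> up \<union> dn" "connected (strp e \<inter> up)" "connected (strp e \<inter> dn)"
    "strp e \<inter> left_side e = strp e \<inter> up" "strp e \<inter> left_side (opposite e) = strp e \<inter> dn" if e: "e \<in> edge ` E" for e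
  proof -
    obtain i where i: "i \<in> E" "e = edge i" using e by blast
    note P = strip_props[OF i(1), folded i(2)]
    show "open (strp e)" "strp e \<inter> vertices = {}" "star_domain (strp e)" "strp e - cut_sheet = interior_points e"
      "strp e \<inter> cut_sheet \<subseteq> up \<union> dn" "connected (strp e \<inter> up)" "connected (strp e \<inter> dn)"
      "strp e \<inter> left_side e = strp e \<inter> up" "strp e \<inter> left_side (opposite e) = strp e \<inter> dn" by (fact P)+
  qed
  show "interior_points e \<subseteq> inn" if e: "e \<in> edge ` E" for e
  proof -
    obtain i where i: "i \<in> E" "e = edge i" using e by blast
    show ?thesis unfolding i(2) interior_edge[OF i(1)] inn_def using Jo_T'[OF i(1)] by blast
  qed
  show "- cut_sheet \<subseteq> vertices \<union> (\<Union>e\<in>edge ` E. interior_points e)"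
  proof
    fix p assume p: "p \<in> - cut_sheet"
    show "p \<in> vertices \<union> (\<Union>e\<in>edge ` E. interior_points e)"
    proof (cases p)
      case None then show ?thesis using p None_in_cut_sheet None_in_vertices by simp
    next
      case (Some v)
      then have v: "h v = 0" "X v \<in> T" using p by (auto simp: Some_in_cut_sheet)
      show ?thesis
      proof (cases "\<exists>j<m. X v = x j")
        case True then show ?thesis using v(1) Some Some_in_vertices by auto
      next
        case False
        then obtain i where i: "i \<in> E" "X v \<in> Jo i" using T_cases[OF v(2)] by blast
        then have "p \<in> interior_points (edge i)" unfolding interior_edge[OF i(1)] using Some v(1) by simp
        then show ?thesis using i(1) by blast
      qed
    qed
  qed
  show "U \<inter> up \<noteq> {} \<and> U \<inter> dn \<noteq> {}" if e: "e \<in> edge ` E" and q: "q \<in> interior_points e" and U: "open U" "q \<in> U" for e q U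
  proof -
    obtain i where i: "i \<in> E" "e = edge i" using e by blast
    obtain v where v: "q = Some v" "h v = 0" using q unfolding i(2) interior_edge[OF i(1)] by auto
    show ?thesis by (rule near_both[OF U(1) _ v(2)]) (use U(2) v(1) in simp)
  qed
  show "U \<inter> interior_points e \<noteq> {}" if e: "e \<in> edge ` E" and p: "p \<in> segment_points e" and U: "open U" "p \<in> U" for e p U
  proof -
    obtain i where i: "i \<in> E" "e = edge i" using e by blast
    show ?thesis unfolding i(2) by (rule near_edge[OF i(1) p[unfolded i(2)] U])
  qed
  show "\<exists>V. bas p V \<and> V \<subseteq> U" if "open U" "p \<in> U" for p U by (rule bas_ex[OF that])
  show "open V" "p \<in> V" "V \<inter> vertices \<subseteq> {p}" if "bas p V" for p V
    by (rule bas_open[OF that], rule bas_mem[OF that], rule bas_vertices[OF that])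
  show "connected (V \<inter> Q)" "V \<inter> Q \<noteq> {}" if "bas p V" "Q \<in> (if p \<in> inn then {up, dn} else {cut_sheet})" for p V Q
    by (rule bas_corner[OF that])+
  show "V \<inter> cut_sheet \<subseteq> up \<union> dn" if "bas p V" "p \<in> inn" for p V by (rule inn_cover[OF that])
  show "p \<in> segment_points e" if b: "bas p V" and e: "e \<in> edge ` E" "V \<inter> interior_points e \<noteq> {}" for p V e
  proof -
    obtain i where i: "i \<in> E" "e = edge i" using e(1) by blast
    obtain q where q: "q \<in> V" "q \<in> interior_points (edge i)" using e(2) i(2) by (meson disjoint_iff)
    then obtain u where u: "q = Some u" "h u = 0" "X u \<in> Jo i" unfolding interior_edge[OF i(1)] by auto
    show ?thesis unfolding i(2) by (rule bas_edge[OF b i(1) u(2,3)]) (use q(1) u(1) in simp)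
  qed
qed

end

section \<open>Construction of the cuts and of the sheets\<close>

text \<open>Two points with different imaginary parts get the same sheared real part for exactly one
  \<epsilon>; distinct points with equal imaginary parts never do. So only finitely many values have
  to be avoided.\<close>

lemma shear_injective_exists:
  fixes F :: "complex set"
  assumes "finite F" shows "\<exists>\<epsilon>. inj_on (shear \<epsilon>) F"
proof -
  let ?B = "(\<lambda>(a, b). (Re b - Re a) / (Im a - Im b)) ` (F \<times> F)"
  have "finite ?B" using assms by simp
  then obtain \<epsilon> :: real where \<epsilon>: "\<epsilon> \<notin> ?B" using ex_new_if_finite infinite_UNIV_char_0 by blast
  have "inj_on (shear \<epsilon>) F"
  proof (rule inj_onI)
    fix a b assume ab: "a \<in> F" "b \<in> F" "shear \<epsilon> a = shear \<epsilon> b"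
    then have eq: "\<epsilon> * (Im a - Im b) = Re b - Re a" by (simp add: shear_def algebra_simps)
    show "a = b"
    proof (cases "Im a = Im b")
      case True then show ?thesis using eq by (simp add: complex_eq_iff)
    next
      case False
      then have "\<epsilon> = (Re b - Re a) / (Im a - Im b)" using eq by (simp add: field_simps)
      then have "\<epsilon> \<in> ?B" using ab(1,2) by (intro image_eqI[of _ _ "(a, b)"]) auto
      then show ?thesis using \<epsilon> by simp
    qed
  qed
  then show ?thesis by blast
qed

text \<open>The finite singular values, sorted by sheared real part, become the vertices. Two
  singular values leave at least one vertex, and at least two if infinity is not singular, as
  \<open>cut_path\<close> demands.\<close>

theorem tame_cuts_exist:
  fixes S :: "complex option set"
  assumes "finite S" "2 \<le> card S"
  shows "\<exists>\<Xi> L up down inner strip basic. tame_cuts S \<Xi> L up down inner strip basic"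
proof -
  define F where "F = Some -` S"
  have F: "finite F" unfolding F_def using assms(1) by (rule finite_vimageI) simp
  have S: "S = Some ` F \<union> (if None \<in> S then {None} else {})"
  proof (rule set_eqI)
    fix p show "p \<in> S \<longleftrightarrow> p \<in> Some ` F \<union> (if None \<in> S then {None} else {})"
      by (cases p) (auto simp: F_def)
  qed
  have cF: "card S = card F + (if None \<in> S then 1 else 0)"
  proof (cases "None \<in> S")
    case True
    then have "S = insert None (Some ` F)" using S by simp
    moreover have "card (insert None (Some ` F)) = Suc (card F)" using F by (subst card_insert_disjoint) (auto simp: card_image)
    ultimately show ?thesis using True by simp
  next
    case False
    then have "S = Some ` F" using S by simp
    then show ?thesis using False by (simp add: card_image)
  qed
  obtain \<epsilon> where \<epsilon>: "inj_on (shear \<epsilon>) F" using shear_injective_exists[OF F] by blast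
  define xs where "xs = sorted_list_of_set (shear \<epsilon> ` F)"
  define as where "as = map (inv_into F (shear \<epsilon>)) xs"
  have xs: "set xs = shear \<epsilon> ` F" "sorted xs" "distinct xs" using F by (auto simp: xs_def)
  have Xas: "shear \<epsilon> (as ! i) = xs ! i" if "i < length as" for i
  proof -
    have "xs ! i \<in> shear \<epsilon> ` F" using that xs(1) by (auto simp: as_def intro: nth_mem)
    then show ?thesis using that by (simp add: as_def f_inv_into_f)
  qed
  have setas: "set as = F"
    unfolding as_def set_map xs(1) using inv_into_image_cancel[OF \<epsilon> order_refl] by (simp add: image_image inv_into_f_f[OF \<epsilon>])
  have len: "length as = card F" unfolding as_def xs_def using card_image[OF \<epsilon>] by simp
  have sorted: "shear \<epsilon> (as ! i) < shear \<epsilon> (as ! j)" if "i < j" "j < length as" for i j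
  proof -
    have ij: "i < length xs" "j < length xs" using that by (simp_all add: as_def)
    have "xs ! i \<le> xs ! j" using sorted_nth_mono[OF xs(2)] that(1) ij(2) by simp
    moreover have "xs ! i \<noteq> xs ! j" using nth_eq_iff_index_eq[OF xs(3) ij] that(1) by simp
    ultimately have "xs ! i < xs ! j" by simp
    then show ?thesis using Xas that by simp
  qed
  have pos: "length as > 0" using cF assms(2) len by (cases "None \<in> S") auto
  obtain f where f: "continuous_on UNIV f"
    "\<And>i t. Suc i < length as \<Longrightarrow> shear \<epsilon> (as ! i) \<le> t \<Longrightarrow> t \<le> shear \<epsilon> (as ! Suc i) \<Longrightarrow>
      f t = Im (as ! i) + (t - shear \<epsilon> (as ! i)) / (shear \<epsilon> (as ! Suc i) - shear \<epsilon> (as ! i)) * (Im (as ! Suc i) - Im (as ! i))"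
    "\<And>t. shear \<epsilon> (as ! (length as - 1)) \<le> t \<Longrightarrow> f t = Im (as ! (length as - 1))"
    by (rule piecewise_linear_exists[OF pos, of "\<lambda>i. shear \<epsilon> (as ! i)" "\<lambda>i. Im (as ! i)"]) (use sorted in auto)
  interpret cut_path \<epsilon> as "None \<in> S" f
  proof
    show "as \<noteq> []" using pos by auto
    show "2 \<le> length as" if "None \<notin> S" using cF assms(2) len that by simp
  qed (use sorted f in auto)
  have "vertices = S" unfolding vertices_def setas using S by simp
  then show ?thesis using tame by metis
qed

lemma star_domain_nonempty: "star_domain L \<Longrightarrow> L \<noteq> {}"
  unfolding star_domain_def homeomorphism_def by auto

context branched
begin

text \<open>Sections over the connected set \<open>L\<close> are determined by their value at one
  point \<open>v0\<close>, so they are indexed by the fibre over \<open>v0\<close>, coded by natural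
  numbers.\<close>

lemma sections_enumerated:
  assumes L: "star_domain L" and LS: "L \<inter> S = {}"
  shows "\<exists>(I :: nat set) \<sigma>. (\<forall>\<theta>\<in>I. sect L (\<sigma> \<theta>)) \<and>
    (\<forall>z\<in>\<Omega>. w z \<in> L \<longrightarrow> (\<exists>\<theta>\<in>I. \<sigma> \<theta> (w z) = z)) \<and>
    (\<forall>\<theta>\<in>I. \<forall>\<theta>'\<in>I. \<forall>v\<in>L. \<sigma> \<theta> v = \<sigma> \<theta>' v \<longrightarrow> \<theta> = \<theta>')"
proof -
  have cL: "connected L" using L by (rule star_domain_connected)
  obtain v0 where v0: "v0 \<in> L" using star_domain_nonempty[OF L] by blast
  define F where "F = {z \<in> \<Omega>. w z = v0}"
  have cF: "countable F" unfolding F_def by (rule fibre_countable)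
  have "\<exists>\<sigma>. sect L \<sigma> \<and> \<sigma> v0 = z" if z: "z \<in> F" for z
  proof -
    have z': "z \<in> \<Omega>" "w z = v0" using z by (auto simp: F_def)
    show ?thesis using sect_exists[OF L LS z'(1)] z'(2) v0 by metis
  qed
  then obtain s where s: "\<And>z. z \<in> F \<Longrightarrow> sect L (s z)" "\<And>z. z \<in> F \<Longrightarrow> s z v0 = z" by metis
  define g where "g = inv_into F (to_nat_on F)"
  define I where "I = to_nat_on F ` F"
  have inj: "inj_on (to_nat_on F) F" using cF by (rule inj_on_to_nat_on)
  have gF: "g \<theta> \<in> F" "to_nat_on F (g \<theta>) = \<theta>" if "\<theta> \<in> I" for \<theta>
    using that unfolding g_def I_def by (auto intro: inv_into_into f_inv_into_f)
  have gI: "g (to_nat_on F z) = z" if "z \<in> F" for z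
    using inj that unfolding g_def by (rule inv_into_f_f)
  show ?thesis
  proof (intro exI[of _ I] exI[of _ "\<lambda>\<theta>. s (g \<theta>)"] conjI ballI impI)
    show "sect L (s (g \<theta>))" if "\<theta> \<in> I" for \<theta> by (rule s(1)[OF gF(1)[OF that]])
  next
    fix z assume z: "z \<in> \<Omega>" "w z \<in> L"
    obtain \<tau> where \<tau>: "sect L \<tau>" "\<tau> (w z) = z" using sect_exists[OF L LS z] by blast
    have F: "\<tau> v0 \<in> F" using \<tau>(1) v0 by (auto simp: F_def sect_def)
    have "s (\<tau> v0) (w z) = \<tau> (w z)"
      by (rule sect_unique[OF cL LS s(1)[OF F] \<tau>(1) v0 s(2)[OF F] z(2)])
    then have "s (g (to_nat_on F (\<tau> v0))) (w z) = z" unfolding gI[OF F] using \<tau>(2) by simp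
    moreover have "to_nat_on F (\<tau> v0) \<in> I" unfolding I_def using F by (rule imageI)
    ultimately show "\<exists>\<theta>\<in>I. s (g \<theta>) (w z) = z" by blast
  next
    fix \<theta> \<theta>' v assume t: "\<theta> \<in> I" "\<theta>' \<in> I" "v \<in> L" "s (g \<theta>) v = s (g \<theta>') v"
    have "s (g \<theta>) v0 = s (g \<theta>') v0"
      by (rule sect_unique[OF cL LS s(1)[OF gF(1)[OF t(1)]] s(1)[OF gF(1)[OF t(2)]] t(3,4) v0])
    then have "g \<theta> = g \<theta>'" using s(2)[OF gF(1)[OF t(1)]] s(2)[OF gF(1)[OF t(2)]] by simp
    then have "to_nat_on F (g \<theta>) = to_nat_on F (g \<theta>')" by (rule arg_cong)
    then show "\<theta> = \<theta>'" unfolding gF(2)[OF t(1)] gF(2)[OF t(2)] .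
  qed
qed

end

theorem glueing_exists:
  assumes sp: "speiser_function \<Omega> w q"
  shows "\<exists>G. constructed_by_glueing \<Omega> w G \<and> finite (cuts G ` sheets G)"
proof -
  let ?S = "singular_values \<Omega> w"
  have S: "finite ?S" "2 \<le> card ?S" using sp by (auto simp: speiser_function_def)
  interpret branched \<Omega> w ?S using sp by (rule speiser_branched)
  obtain \<Xi> L up down inner strip basic where tc: "tame_cuts ?S \<Xi> L up down inner strip basic"
    using tame_cuts_exist[OF S] by (elim exE)
  interpret tame_cuts ?S \<Xi> L up down inner strip basic by (rule tc)
  obtain I :: "nat set" and \<sigma> where s: "(\<forall>\<theta>\<in>I. sect L (\<sigma> \<theta>)) \<and>
    (\<forall>z\<in>\<Omega>. w z \<in> L \<longrightarrow> (\<exists>\<theta>\<in>I. \<sigma> \<theta> (w z) = z)) \<and>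
    (\<forall>\<theta>\<in>I. \<forall>\<theta>'\<in>I. \<forall>v\<in>L. \<sigma> \<theta> v = \<sigma> \<theta>' v \<longrightarrow> \<theta> = \<theta>')"
    using sections_enumerated[OF star_L LS] by (elim exE)
  note \<sigma> = s[THEN conjunct1] s[THEN conjunct2, THEN conjunct1] s[THEN conjunct2, THEN conjunct2]
  interpret glue \<Omega> w ?S \<Xi> L up down inner strip basic I \<sigma>
    by unfold_locales (rule \<sigma>[rule_format]; assumption)+
  obtain h where h: "homeomorphic_map (glued_surface slit_glueing) (riemann_surface_of \<Omega> w) h"
    "\<forall>c\<in>topspace (glued_surface slit_glueing). snd (h c) = glued_projection c"
    using glued_homeomorphic by (elim exE conjE)
  have "pullback_flat_dist (riemann_surface_of \<Omega> w) snd (h c) (h d) =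
      pullback_flat_dist (glued_surface slit_glueing) glued_projection c d"
    if "c \<in> topspace (glued_surface slit_glueing)" "d \<in> topspace (glued_surface slit_glueing)" for c d
  proof (rule pullback_flat_dist_homeomorphic[where \<rho> = snd and \<pi> = glued_projection, OF h(1) _ that])
    fix c assume "c \<in> topspace (glued_surface slit_glueing)"
    then show "snd (h c) = glued_projection c" using h(2) by (rule bspec[rotated])
  qed
  then have "constructed_by_glueing \<Omega> w slit_glueing"
    unfolding constructed_by_glueing_def using valid_slit_glueing h by blast
  \<comment> \<open>All sheets carry the same cuts, so only one type occurs.\<close>
  moreover have "finite (cuts slit_glueing ` sheets slit_glueing)"
    by (rule finite_subset[of _ "{\<Xi>}"]) (auto simp: slit_glueing_simps)
  ultimately show ?thesis by blast
qed

section \<open>Counting sheets\<close>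

lemma quotient_projection_eq:
  assumes "(x, y) \<in> glue_rel G"
  shows "fst (snd x) = fst (snd y)"
  using assms unfolding glue_rel_def
  by (induction rule: rtrancl_induct) (auto simp: glue_step_def)

section \<open>Values off all possible cuts\<close>

lemma closed_insert_None: "closed (C :: complex set) \<Longrightarrow> closed (insert None (Some ` C))"
proof -
  assume "closed C"
  then have "open (Some ` (- C))" by (simp add: open_Compl)
  moreover have "insert None (Some ` C) = - Some ` (- C)"
  proof (rule set_eqI)
    fix p show "p \<in> insert None (Some ` C) \<longleftrightarrow> p \<in> - Some ` (- C)" by (cases p) auto
  qed
  ultimately show ?thesis by (simp add: closed_def)
qed

lemma closed_ray: "closed {a + of_real t * d |t. 0 \<le> t}" for a d :: complex
proof (cases "d = 0")
  case True
  have "{a + of_real t * d |t. 0 \<le> t} = {a}" using True by auto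
  then show ?thesis by simp
next
  case False
  have "{a + of_real t * d |t. 0 \<le> t} = (\<lambda>v. (v - a) / d) -` \<real>\<^sub>\<ge>\<^sub>0"
  proof (intro equalityI subsetI)
    fix v assume "v \<in> (\<lambda>v. (v - a) / d) -` \<real>\<^sub>\<ge>\<^sub>0"
    then obtain t where t: "0 \<le> t" "(v - a) / d = of_real t" by (auto elim: nonneg_Reals_cases)
    have "v = a + of_real t * d" using t(2) False by (simp add: field_simps)
    then show "v \<in> {a + of_real t * d |t. 0 \<le> t}" using t(1) by blast
  qed (use False in auto)
  moreover have "closed ((\<lambda>v. (v - a) / d) -` \<real>\<^sub>\<ge>\<^sub>0)"
    using False by (intro continuous_closed_vimage closed_nonneg_Reals_complex) (auto intro!: continuous_intros)
  ultimately show ?thesis by simp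
qed

lemma closed_segment_points: "closed (segment_points e)"
proof (cases e)
  case (Direct a b)
  then show ?thesis by (simp add: compact_Some_image compact_imp_closed)
next
  case (Around a b)
  then show ?thesis by (simp only: segment_points.simps) (intro closed_insert_None closed_Un closed_ray)
next
  case (Outward a d)
  then show ?thesis by (simp only: segment_points.simps) (intro closed_insert_None closed_ray)
next
  case (Inward d b)
  have "{b - of_real t * d |t. 0 \<le> t} = {b + of_real t * (- d) |t. 0 \<le> t}" by simp
  then show ?thesis unfolding Inward segment_points.simps by (simp only:) (intro closed_insert_None closed_ray)
qed

text \<open>Each geodesic lies on a straight line, written here as a hyperplane with normal vector i
  times the heading, since hyperplanes are known to be negligible.\<close>

lemma segment_points_line:
  assumes "Some v \<in> segment_points e"
  shows "(\<i> * heading e) \<bullet> v = (\<i> * heading e) \<bullet> basepoint e"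
proof -
  have "\<exists>t. v = basepoint e + of_real t * heading e"
  proof (cases e)
    case (Direct a b)
    then obtain u where "v = (1 - u) *\<^sub>R a + u *\<^sub>R b" using assms by (auto simp: in_segment)
    then have "v = a + of_real u * (b - a)" by (simp add: scaleR_conv_of_real algebra_simps)
    then show ?thesis using Direct by auto
  next
    case (Around a b)
    then consider t where "v = a + of_real t * (a - b)" | t where "v = b + of_real t * (b - a)" using assms by auto
    then show ?thesis
    proof cases
      case 1 then show ?thesis using Around by auto
    next
      case 2
      then have "v = a + of_real (- 1 - t) * (a - b)" by (simp add: algebra_simps)
      then show ?thesis using Around by (intro exI[of _ "- 1 - t"]) simp
    qed
  next
    case (Outward a d)
    then show ?thesis using assms by auto
  next
    case (Inward d b)
    then obtain t where "v = b - of_real t * d" using assms by auto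
    then have "v = b + of_real (- t) * d" by simp
    then show ?thesis using Inward by (intro exI[of _ "- t"]) simp
  qed
  then obtain t where t: "v = basepoint e + of_real t * heading e" by blast
  show ?thesis unfolding t by (simp add: inner_complex_def algebra_simps)
qed

lemma finite_geodesics:
  assumes "finite S" shows "finite {e. geodesic_between S e}"
proof -
  define F where "F = Some -` S"
  have F: "finite F" unfolding F_def using assms by (rule finite_vimageI) simp
  let ?D = "{1, - 1} :: complex set"
  have "{e. geodesic_between S e} \<subseteq> (\<lambda>(a, b). Direct a b) ` (F \<times> F) \<union> (\<lambda>(a, b). Around a b) ` (F \<times> F) \<union>
      (\<lambda>(a, d). Outward a d) ` (F \<times> ?D) \<union> (\<lambda>(d, b). Inward d b) ` (?D \<times> F)"
  proof
    fix e assume "e \<in> {e. geodesic_between S e}"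
    then show "e \<in> (\<lambda>(a, b). Direct a b) ` (F \<times> F) \<union> (\<lambda>(a, b). Around a b) ` (F \<times> F) \<union>
      (\<lambda>(a, d). Outward a d) ` (F \<times> ?D) \<union> (\<lambda>(d, b). Inward d b) ` (?D \<times> F)"
      by (cases e) (auto simp: F_def image_iff)
  qed
  moreover have "finite \<dots>" using F by simp
  ultimately show ?thesis by (rule finite_subset)
qed

text \<open>All geodesics between singular values are treated at once, so that a single null set
  serves every sheet type of every decomposition.\<close>

lemma geodesics_negligible:
  assumes "finite S"
  shows "negligible {v. \<exists>e. geodesic_between S e \<and> Some v \<in> segment_points e}"
proof (rule negligible_subset)
  let ?H = "\<lambda>e. {v. (\<i> * heading e) \<bullet> v = (\<i> * heading e) \<bullet> basepoint e}"
  show "negligible (\<Union>(?H ` {e. geodesic_between S e}))"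
  proof (rule negligible_Union)
    fix T assume "T \<in> ?H ` {e. geodesic_between S e}"
    then obtain e where e: "geodesic_between S e" "T = ?H e" by blast
    have "heading e \<noteq> 0" using e(1) by (cases e) auto
    then show "negligible T" unfolding e(2) by (intro negligible_hyperplane) simp
  qed (use finite_geodesics[OF assms] in simp)
  show "{v. \<exists>e. geodesic_between S e \<and> Some v \<in> segment_points e} \<subseteq> \<Union>(?H ` {e. geodesic_between S e})"
    using segment_points_line by blast
qed

lemma not_negligible_nonempty_open:
  assumes "open U" "U \<noteq> {}" "negligible N"
  shows "\<exists>v. Some v \<in> U \<and> v \<notin> (N :: complex set)"
proof (rule ccontr)
  assume "\<not> ?thesis"
  then have "Some -` U \<subseteq> N" by auto
  then have "negligible (Some -` U)" using assms(3) negligible_subset by blast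
  moreover have "open (Some -` U)" using assms(1) by (simp add: open_sphere_iff)
  moreover have "Some -` U \<noteq> {}"
  proof -
    obtain p where p: "p \<in> U" using assms(2) by blast
    have "\<exists>v::complex. Some v \<in> U"
      using p sphere_dense_Some[OF assms(1)] by (cases p) auto
    then show ?thesis by blast
  qed
  ultimately show False using open_not_negligible by blast
qed

lemma boundary_germ_alt:
  "boundary_germ L p C \<longleftrightarrow> (\<forall>U. open U \<and> p \<in> U \<longrightarrow> C U \<in> components (U \<inter> L)) \<and>
     (\<forall>U V. open U \<and> open V \<and> p \<in> U \<and> U \<subseteq> V \<longrightarrow> C U \<subseteq> C V) \<and> (\<forall>U. \<not> (open U \<and> p \<in> U) \<longrightarrow> C U = {})"
  unfolding boundary_germ_def riemann_sphere_eq open_openin[symmetric] connected_components_of_top_of_set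
    components_def Setcompr_eq_image[symmetric] by blast

text \<open>The sheet may be of any type here. A coherent choice must select the component through
  \<open>p\<close>: applied to that component \<open>D\<close> itself, which is open and connected,
  it can only give \<open>D\<close>, and monotonicity puts \<open>p\<close> into the component
  selected in the larger set.\<close>

lemma boundary_germ_interior:
  assumes L: "open L" "p \<in> L"
  shows "boundary_germ L p C \<longleftrightarrow> C = (\<lambda>U. if open U \<and> p \<in> U then connected_component_set (U \<inter> L) p else {})"
    (is "_ \<longleftrightarrow> C = ?C")
proof
  assume "boundary_germ L p C"
  then have C1: "\<And>U. open U \<Longrightarrow> p \<in> U \<Longrightarrow> C U \<in> components (U \<inter> L)"
    and C2: "\<And>U V. open U \<Longrightarrow> open V \<Longrightarrow> p \<in> U \<Longrightarrow> U \<subseteq> V \<Longrightarrow> C U \<subseteq> C V"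
    and C3: "\<And>U. \<not> (open U \<and> p \<in> U) \<Longrightarrow> C U = {}"
    unfolding boundary_germ_alt by simp_all
  have comp: "C U = connected_component_set (U \<inter> L) p" if U: "open U" "p \<in> U" for U
  proof -
    define D where "D = connected_component_set (U \<inter> L) p"
    have pUL: "p \<in> U \<inter> L" using U L by simp
    have D1: "open D" unfolding D_def by (rule open_connected_component_sphere[OF open_Int[OF U(1) L(1)]])
    have D2: "p \<in> D" unfolding D_def using connected_component_refl[OF pUL] by simp
    have D3: "D \<subseteq> U \<inter> L" unfolding D_def by (rule connected_component_subset)
    have "connected D" unfolding D_def by (rule connected_connected_component)
    then have "components D = {D}" unfolding components_eq_sing_iff using D2 by (metis empty_iff)
    moreover have "D \<inter> L = D" using D3 by auto
    ultimately have "C D = D" using C1[OF D1 D2] by simp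
    moreover have "C D \<subseteq> C U" using C2[OF D1 U(1) D2] D3 by simp
    ultimately have p: "p \<in> C U" using D2 by auto
    obtain y where y: "C U = connected_component_set (U \<inter> L) y"
      using C1[OF U] unfolding components_def by (rule imageE)
    have "connected_component_set (U \<inter> L) y = connected_component_set (U \<inter> L) p"
      by (rule connected_component_eq) (metis connected_component_sym mem_Collect_eq p y)
    then show ?thesis using y by simp
  qed
  show "C = ?C"
  proof (rule ext)
    show "C U = ?C U" for U
    proof (cases "open U \<and> p \<in> U")
      case True
      then have "open U" "p \<in> U" by blast+
      then show ?thesis using comp[of U] by simp
    next
      case False
      show ?thesis unfolding if_not_P[OF False] by (rule C3[OF False])
    qed
  qed
next
  assume C: "C = ?C"
  have C1: "C U = connected_component_set (U \<inter> L) p" if "open U" "p \<in> U" for U using that unfolding C by simp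
  show "boundary_germ L p C"
    unfolding boundary_germ_alt
  proof (intro conjI allI impI)
    fix U assume "open U \<and> p \<in> U"
    then show "C U \<in> components (U \<inter> L)" using L(2) C1[of U] by (simp add: components_def)
  next
    fix U assume "\<not> (open U \<and> p \<in> U)"
    then show "C U = {}" unfolding C by (rule if_not_P)
  next
    fix U V assume UV: "open U \<and> open V \<and> p \<in> U \<and> U \<subseteq> V"
    then have "p \<in> V" by auto
    moreover have "U \<inter> L \<subseteq> V \<inter> L" using UV by auto
    ultimately show "C U \<subseteq> C V" using C1[of U] C1[of V] UV connected_component_mono[of "U \<inter> L" "V \<inter> L" p] by simp
  qed
qed

lemma topspace_bordered_sheet: "topspace (bordered_sheet \<Xi>) = {(p, C). boundary_germ (sheet \<Xi>) p C}"
proof (intro equalityI subsetI)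
  fix x assume "x \<in> topspace (bordered_sheet \<Xi>)"
  then show "x \<in> {(p, C). boundary_germ (sheet \<Xi>) p C}"
    unfolding bordered_sheet_def topology_generated_by_topspace by auto
next
  fix x assume x: "x \<in> {(p, C). boundary_germ (sheet \<Xi>) p C}"
  obtain p C where pC: "x = (p, C)" by (cases x)
  have "x \<in> {(p, C). boundary_germ (sheet \<Xi>) p C \<and> (\<exists>V. openin riemann_sphere V \<and> p \<in> V \<and> C V \<subseteq> UNIV)}"
    using x unfolding pC by (auto simp: riemann_sphere_eq intro!: exI[of _ UNIV])
  moreover have "openin riemann_sphere UNIV" by (simp add: riemann_sphere_eq)
  ultimately show "x \<in> topspace (bordered_sheet \<Xi>)"
    unfolding bordered_sheet_def topology_generated_by_topspace by blast
qed

text \<open>Off the cuts each sheet has exactly one boundary germ over \<open>p\<close>, and no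
  glueing step involves it. The classes over \<open>p\<close> are therefore singletons, one for each
  sheet, and the homeomorphism, being compatible with the projections, carries them to the
  fibre.\<close>

lemma generic_fibre:
  assumes G: "constructed_by_glueing \<Omega> w G" and S: "finite (singular_values \<Omega> w)"
    and v: "\<And>e. geodesic_between (singular_values \<Omega> w) e \<Longrightarrow> p \<notin> segment_points e"
  shows "\<exists>b. bij_betw b (sheets G) {z \<in> \<Omega>. w z = p}"
proof -
  let ?S = "singular_values \<Omega> w"
  have val: "valid_glueing ?S G" using G by (simp add: constructed_by_glueing_def)
  obtain h where h: "homeomorphic_map (glued_surface G) (riemann_surface_of \<Omega> w) h"
    "\<forall>c\<in>topspace (glued_surface G). snd (h c) = glued_projection c"
    using G by (auto simp: constructed_by_glueing_def)
  have gb: "geodesic_between ?S e" if "\<theta> \<in> sheets G" "e \<in> cuts G \<theta>" for \<theta> e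
    using val that by (auto simp: valid_glueing_def sheet_type_def)
  have off: "p \<notin> segment_points e" if "\<theta> \<in> sheets G" "e \<in> boundary_sides (cuts G \<theta>)" for \<theta> e
    using that gb v by (auto simp: boundary_sides_def)
  define C where "C \<theta> = (\<lambda>U. if open U \<and> p \<in> U then connected_component_set (U \<inter> sheet (cuts G \<theta>)) p else {})" for \<theta>
  have op: "open (sheet (cuts G \<theta>))" "p \<in> sheet (cuts G \<theta>)" if \<theta>: "\<theta> \<in> sheets G" for \<theta>
  proof -
    have "finite (cuts G \<theta>)" by (rule finite_subset[OF _ finite_geodesics[OF S]]) (use gb[OF \<theta>] in auto)
    then show "open (sheet (cuts G \<theta>))" unfolding sheet_def
      by (intro open_Compl closed_UN) (auto intro: closed_segment_points)
    show "p \<in> sheet (cuts G \<theta>)" unfolding sheet_def using gb[OF \<theta>] v by auto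
  qed
  have top: "(\<theta>, p', D) \<in> topspace (disjoint_sheets G) \<longleftrightarrow> \<theta> \<in> sheets G \<and> boundary_germ (sheet (cuts G \<theta>)) p' D" for \<theta> p' D
    unfolding disjoint_sheets_def by (auto simp: topspace_bordered_sheet)
  have topp: "(\<theta>, p, D) \<in> topspace (disjoint_sheets G) \<longleftrightarrow> \<theta> \<in> sheets G \<and> D = C \<theta>" for \<theta> D
    unfolding top using boundary_germ_interior[OF op] unfolding C_def by blast
  have step: "fst (snd a) \<noteq> p \<and> fst (snd b) \<noteq> p" if ab: "(a, b) \<in> glue_step G" for a b
  proof -
    obtain \<theta> p' D \<theta>' D' where ab: "a = (\<theta>, p', D)" "b = (\<theta>', p', D')" "(\<theta>, p', D) \<in> topspace (disjoint_sheets G)"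
      and e: "\<exists>e \<in> boundary_sides (cuts G \<theta>). \<theta>' = across G \<theta> e \<and> on_left_of (p', D) e \<and> on_left_of (p', D') (opposite e)"
      using ab unfolding glue_step_def by blast
    obtain e where e: "e \<in> boundary_sides (cuts G \<theta>)" "on_left_of (p', D) e" using e by blast
    have "\<theta> \<in> sheets G" using ab(3) top by blast
    then have "p' \<noteq> p" using off[OF _ e(1)] e(2) by auto
    then show ?thesis using ab(1,2) by simp
  qed
  have nostep: "fst (snd x) \<noteq> p" if xy: "(x, y) \<in> glue_step G \<union> (glue_step G)\<inverse>" for x y
    using xy step[of x y] step[of y x] by blast
  have cls: "glue_rel G `` {x} = {x}" if x: "fst (snd x) = p" for x
  proof -
    have "y = x" if "(x, y) \<in> (glue_step G \<union> (glue_step G)\<inverse>)\<^sup>*" for y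
      using that nostep x by (metis converse_rtranclE)
    then show ?thesis unfolding glue_rel_def by auto
  qed
  define Y where "Y = {x \<in> topspace (disjoint_sheets G). finite (glue_rel G `` {x})}"
  have gt: "topspace (glued_surface G) = (\<lambda>x. glue_rel G `` {x}) ` Y"
    unfolding glued_surface_def topspace_quotient_topology Y_def by auto
  have gp: "glued_projection (glue_rel G `` {x}) = fst (snd x)" for x
  proof -
    have "x \<in> glue_rel G `` {x}" by (simp add: glue_rel_def)
    then have "(\<lambda>(\<theta>, p, C). p) ` (glue_rel G `` {x}) = {fst (snd x)}"
      using quotient_projection_eq[of x _ G] by (force simp: case_prod_beta image_iff)
    then show ?thesis by (simp add: glued_projection_def)
  qed
  define K where "K = {c \<in> topspace (glued_surface G). glued_projection c = p}"
  have "bij_betw (\<lambda>\<theta>. {(\<theta>, p, C \<theta>)}) (sheets G) K"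
  proof (rule bij_betwI')
    fix \<theta> assume \<theta>: "\<theta> \<in> sheets G"
    have c: "glue_rel G `` {(\<theta>, p, C \<theta>)} = {(\<theta>, p, C \<theta>)}" by (rule cls) simp
    have "(\<theta>, p, C \<theta>) \<in> Y" unfolding Y_def using c topp \<theta> by simp
    then have "{(\<theta>, p, C \<theta>)} \<in> topspace (glued_surface G)" unfolding gt using c by force
    moreover have "glued_projection {(\<theta>, p, C \<theta>)} = p" using gp[of "(\<theta>, p, C \<theta>)"] c by simp
    ultimately show "{(\<theta>, p, C \<theta>)} \<in> K" by (simp add: K_def)
  next
    fix c assume c: "c \<in> K"
    then obtain x where x: "x \<in> Y" "c = glue_rel G `` {x}" unfolding K_def gt by blast
    have xp: "fst (snd x) = p" using c gp[of x] x(2) by (simp add: K_def)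
    obtain \<theta> D where t: "x = (\<theta>, p, D)" using xp by (cases x) auto
    have "\<theta> \<in> sheets G \<and> D = C \<theta>" using x(1) topp t unfolding Y_def by blast
    then show "\<exists>\<theta>\<in>sheets G. c = {(\<theta>, p, C \<theta>)}" using cls[OF xp] x(2) t by auto
  qed auto
  moreover have "bij_betw (fst \<circ> h) K {z \<in> \<Omega>. w z = p}"
  proof -
    have inj: "inj_on h (topspace (glued_surface G))" and im: "h ` topspace (glued_surface G) = (\<lambda>z. (z, w z)) ` \<Omega>"
      using homeomorphic_imp_injective_map[OF h(1)] homeomorphic_imp_surjective_map[OF h(1)]
      by (auto simp: riemann_surface_of_def riemann_sphere_eq)
    have hw: "\<exists>z\<in>\<Omega>. h c = (z, w z)" if "c \<in> topspace (glued_surface G)" for c using im that by blast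
    show ?thesis
    proof (rule bij_betw_imageI)
      show "inj_on (fst \<circ> h) K"
      proof (rule inj_onI)
        fix c d assume cd: "c \<in> K" "d \<in> K" "(fst \<circ> h) c = (fst \<circ> h) d"
        then have "h c = h d" using h(2) by (intro prod_eqI) (auto simp: K_def)
        then show "c = d" using inj cd(1,2) by (auto simp: K_def dest: inj_onD)
      qed
      show "(fst \<circ> h) ` K = {z \<in> \<Omega>. w z = p}"
      proof (intro equalityI subsetI)
        fix z assume "z \<in> (fst \<circ> h) ` K"
        then obtain c where c: "c \<in> K" "z = fst (h c)" by auto
        then obtain y where "y \<in> \<Omega>" "h c = (y, w y)" using hw[of c] by (auto simp: K_def)
        then show "z \<in> {z \<in> \<Omega>. w z = p}" using c h(2) by (auto simp: K_def)
      next
        fix z assume z: "z \<in> {z \<in> \<Omega>. w z = p}"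
        then have "(z, w z) \<in> h ` topspace (glued_surface G)" using im by blast
        then obtain c where c: "c \<in> topspace (glued_surface G)" "h c = (z, w z)" by (metis imageE)
        then have "c \<in> K" using h(2) z by (auto simp: K_def)
        then show "z \<in> (fst \<circ> h) ` K" using c(2) by (metis comp_apply fst_conv image_eqI)
      qed
    qed
  qed
  ultimately show ?thesis using bij_betw_trans by blast
qed

section \<open>Generic fibres of rational functions\<close>

lemma coprime_no_common_root:
  assumes "coprime P Q" "poly P z = 0" shows "poly Q z \<noteq> (0 :: complex)"
proof
  assume "poly Q z = 0"
  then have "[:- z, 1:] dvd P" "[:- z, 1:] dvd Q" using assms(2) by (simp_all add: poly_eq_0_iff_dvd)
  then have "is_unit [:- z, 1:]" using assms(1) by (rule coprime_common_divisor[rotated])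
  then show False by (simp add: is_unit_iff_degree)
qed

lemma coprime_if_no_common_root:
  fixes P Q :: "complex poly"
  assumes "Q \<noteq> 0" "\<And>z. poly Q z = 0 \<Longrightarrow> poly P z \<noteq> 0" shows "coprime P Q"
proof (rule coprimeI)
  fix c assume c: "c dvd P" "c dvd Q"
  have "c \<noteq> 0" using c(2) assms(1) by auto
  moreover have "degree c = 0"
  proof (rule ccontr)
    assume "degree c \<noteq> 0"
    then obtain z where "poly c z = 0"
      using fundamental_theorem_of_algebra[of c] constant_degree[of c] by auto
    then have "poly P z = 0" "poly Q z = 0" using c by (auto elim!: dvdE)
    then show False using assms(2) by blast
  qed
  ultimately show "is_unit c" by (simp add: is_unit_iff_degree)
qed

lemma card_roots_rsquarefree:
  fixes R :: "complex poly"
  assumes "rsquarefree R" shows "card {z. poly R z = 0} = degree R"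
proof -
  have R0: "R \<noteq> 0" using assms by (simp add: rsquarefree_def)
  have "degree R = degree (smult (lead_coeff R) (\<Prod>z|poly R z = 0. [:-z, 1:]))"
    using complex_poly_decompose_rsquarefree[OF assms] by simp
  also have "\<dots> = degree (\<Prod>z|poly R z = 0. [:-z, 1:])" using R0 by simp
  also have "\<dots> = card {z. poly R z = 0}" by (subst degree_prod_sum_eq) auto
  finally show ?thesis by simp
qed

text \<open>The values put aside include the one for which the leading coefficient cancels and the
  critical values, taken at zeros of the Wronskian \<open>W\<close>. For the others, the polynomial
  whose roots form the finite part of the fibre has full degree and simple roots.\<close>

lemma rational_generic_value:
  fixes P Q :: "complex poly"
  assumes Q: "Q \<noteq> 0" and cop: "coprime P Q" and d: "max (degree P) (degree Q) = d" "d > 0"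
  shows "\<exists>B. finite B \<and> (\<forall>v. v \<notin> B \<longrightarrow> degree (P - smult v Q) = d \<and> rsquarefree (P - smult v Q))"
proof -
  define W where "W = pderiv P * Q - P * pderiv Q"
  have W0: "W \<noteq> 0"
  proof
    assume "W = 0"
    then have eq: "pderiv P * Q = P * pderiv Q" by (simp add: W_def)
    \<comment> \<open>A root of \<open>Q\<close> of order k is a root of its derivative of order k -
      1. As it is no root of \<open>P\<close>, the left side of \<open>eq\<close> would vanish there
      to order at least k, the right side to order k - 1 only.\<close>
    have "degree Q = 0"
    proof (rule ccontr)
      assume dQ: "degree Q \<noteq> 0"
      then obtain z where z: "poly Q z = 0"
        using fundamental_theorem_of_algebra[of Q] constant_degree[of Q] by auto
      have Pz: "poly P z \<noteq> 0" using coprime_no_common_root[OF cop] z by blast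
      have Q': "pderiv Q \<noteq> 0" using dQ by (simp add: pderiv_eq_0_iff)
      have P0: "P \<noteq> 0" using Pz by auto
      have n: "P * pderiv Q \<noteq> 0" using Q' P0 by simp
      then have n': "pderiv P * Q \<noteq> 0" using eq by simp
      have "order z P = 0" using Pz by (rule order_0I)
      then have "order z (P * pderiv Q) = order z (pderiv Q)" using order_mult[OF n] by simp
      moreover have "order z (P * pderiv Q) = order z (pderiv P) + order z Q" using order_mult[OF n'] eq by simp
      moreover have "order z Q = Suc (order z (pderiv Q))"
        using order_pderiv[OF Q, of z] z Q by (simp add: order_root)
      ultimately show False by simp
    qed
    then have "pderiv Q = 0" by (simp add: pderiv_eq_0_iff)
    then have "pderiv P = 0" using eq Q by simp
    then have "degree P = 0" by (simp add: pderiv_eq_0_iff)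
    then show False using d \<open>degree Q = 0\<close> by simp
  qed
  define B where "B = {0, coeff P (degree Q) / lead_coeff Q} \<union> (\<lambda>z. poly P z / poly Q z) ` {z. poly W z = 0}"
  have "finite B" using W0 by (simp add: B_def poly_roots_finite)
  moreover have "degree (P - smult v Q) = d \<and> rsquarefree (P - smult v Q)" if v: "v \<notin> B" for v
  proof
    have v0: "v \<noteq> 0" and v1: "v \<noteq> coeff P (degree Q) / lead_coeff Q" using v by (auto simp: B_def)
    show "degree (P - smult v Q) = d"
    proof (cases "degree Q < degree P")
      case True
      then have "degree (P + smult (- v) Q) = degree P" by (intro degree_add_eq_left) simp
      then show ?thesis using True d by simp
    next
      case False
      have "coeff (P - smult v Q) (degree Q) \<noteq> 0"
      proof
        assume "coeff (P - smult v Q) (degree Q) = 0"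
        then have "coeff P (degree Q) = v * lead_coeff Q" by simp
        then show False using v1 Q by (simp add: field_simps)
      qed
      then have "degree Q \<le> degree (P - smult v Q)" by (rule le_degree)
      moreover have "degree (P - smult v Q) \<le> degree Q" using False by (intro degree_diff_le) auto
      ultimately show ?thesis using False d by simp
    qed
    show "rsquarefree (P - smult v Q)"
      unfolding rsquarefree_roots
    proof (intro allI notI)
      fix z assume "poly (P - smult v Q) z = 0 \<and> poly (pderiv (P - smult v Q)) z = 0"
      then have z: "poly P z = v * poly Q z" "poly (pderiv P) z = v * poly (pderiv Q) z"
        by (simp_all add: pderiv_diff pderiv_smult)
      then have "poly W z = 0" by (simp add: W_def)
      have "poly Q z \<noteq> 0"
      proof
        assume "poly Q z = 0"
        then have "poly P z = 0" using z(1) by simp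
        then show False using coprime_no_common_root[OF cop] \<open>poly Q z = 0\<close> by blast
      qed
      then have "v = poly P z / poly Q z" using z(1) by simp
      then have "v \<in> B" unfolding B_def using \<open>poly W z = 0\<close> by blast
      then show False using v by simp
    qed
  qed
  ultimately show ?thesis by blast
qed

lemma rational_map_Some_iff:
  assumes cop: "coprime P Q"
  shows "rational_map P Q (Some z) = Some v \<longleftrightarrow> poly (P - smult v Q) z = 0"
proof (cases "poly Q z = 0")
  case True
  then have "poly P z \<noteq> 0" using coprime_no_common_root[OF cop] by blast
  then show ?thesis using True by (simp add: rational_map_def)
next
  case False
  then show ?thesis by (auto simp: rational_map_def field_simps)
qed

text \<open>Over a generic value the fibre consists of the \<open>d\<close> simple roots of a
  polynomial: finiteness of generic fibres forces \<Omega> to be the sphere, so that all roots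
  count, and the value at infinity is avoided. Degree 0 is impossible because \<open>w\<close> is
  open.\<close>

lemma (in branched) rational_generic_fibre:
  assumes rat: "rational_of_degree \<Omega> w d"
  shows "\<Omega> = UNIV \<and> (\<exists>B. finite B \<and> (\<forall>v. v \<notin> B \<longrightarrow> finite {z \<in> \<Omega>. w z = Some v} \<and> card {z \<in> \<Omega>. w z = Some v} = d))"
proof -
  obtain P Q where Q: "Q \<noteq> 0" and cop: "coprime P Q" and d: "max (degree P) (degree Q) = d"
    and w: "\<And>p. p \<in> \<Omega> \<Longrightarrow> w p = rational_map P Q p"
    using rat by (auto simp: rational_of_degree_def)
  have d0: "d > 0"
  proof (rule ccontr)
    assume "\<not> d > 0"
    then have "degree P = 0" "degree Q = 0" using d by auto
    then obtain a b where ab: "P = [:a:]" "Q = [:b:]" by (metis degree_eq_zeroE)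
    have "w z = Some (a / b)" if "z \<in> \<Omega>" for z
      using w[OF that] Q ab by (simp add: rational_map_def split: option.splits)
    then have im: "w ` \<Omega> = {Some (a / b)}" using dom_nonempty by auto
    have "open (w ` \<Omega>)" by (rule open_map[OF open_dom order_refl])
    then have "\<exists>v. Some v \<in> w ` \<Omega> \<and> v \<notin> {a / b}"
      using im by (intro not_negligible_nonempty_open) auto
    then show False using im by auto
  qed
  obtain B where B: "finite B" "\<And>v. v \<notin> B \<Longrightarrow> degree (P - smult v Q) = d" "\<And>v. v \<notin> B \<Longrightarrow> rsquarefree (P - smult v Q)"
    using rational_generic_value[OF Q cop d d0] by blast
  have root: "w (Some z) = Some v \<longleftrightarrow> poly (P - smult v Q) z = 0" if "Some z \<in> \<Omega>" for z v
    unfolding w[OF that] by (rule rational_map_Some_iff[OF cop])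
  have rfin: "finite {z. poly (P - smult v Q) z = 0}" if "v \<notin> B" for v
    using B(2)[OF that] d0 by (intro poly_roots_finite) auto
  have fin: "finite {z \<in> \<Omega>. w z = Some v}" if v: "v \<notin> B" for v
  proof (rule finite_subset)
    show "{z \<in> \<Omega>. w z = Some v} \<subseteq> insert None (Some ` {z. poly (P - smult v Q) z = 0})"
    proof
      fix z assume "z \<in> {z \<in> \<Omega>. w z = Some v}"
      then show "z \<in> insert None (Some ` {z. poly (P - smult v Q) z = 0})" using root by (cases z) auto
    qed
    show "finite (insert None (Some ` {z. poly (P - smult v Q) z = 0}))" using rfin[OF v] by simp
  qed
  have U: "\<Omega> = UNIV"
  proof (rule finite_fibres_imp_UNIV)
    fix U :: "complex option set" assume "open U" "U \<noteq> {}"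
    then obtain v where "Some v \<in> U" "v \<notin> B"
      using not_negligible_nonempty_open negligible_finite[OF B(1)] by blast
    then show "\<exists>v\<in>U. finite {z \<in> \<Omega>. w z = v}" using fin by blast
  qed
  have "card {z \<in> \<Omega>. w z = Some v} = d" if v: "v \<notin> insert (finite_part (w None)) B" for v
  proof -
    have "{z \<in> \<Omega>. w z = Some v} = Some ` {z. poly (P - smult v Q) z = 0}"
    proof (rule set_eqI)
      fix z show "z \<in> {z \<in> \<Omega>. w z = Some v} \<longleftrightarrow> z \<in> Some ` {z. poly (P - smult v Q) z = 0}"
        using v root U by (cases z) auto
    qed
    moreover have "card {z. poly (P - smult v Q) z = 0} = d"
      using card_roots_rsquarefree[OF B(3)] B(2) v by simp
    ultimately show ?thesis by (simp add: card_image)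
  qed
  then show ?thesis using U fin B(1) by (intro conjI exI[of _ "insert (finite_part (w None)) B"]) auto
qed

section \<open>Rationality from a finite simple fibre\<close>

lemma poly_over_power_tendsto:
  fixes p :: "complex poly"
  assumes "degree p \<le> n" shows "((\<lambda>z. poly p z / z ^ n) \<longlongrightarrow> coeff p n) at_infinity"
proof (cases "degree p = n")
  case True
  then show ?thesis using poly_divide_tendsto_aux[of p] by simp
next
  case False
  then have d: "degree p < n" using assms by simp
  have "((\<lambda>z::complex. inverse (z ^ (n - degree p))) \<longlongrightarrow> 0) at_infinity"
    using d by (intro filterlim_compose[OF tendsto_inverse_0] filterlim_power_at_infinity filterlim_ident) simp
  then have "((\<lambda>z. poly p z / z ^ degree p * inverse (z ^ (n - degree p))) \<longlongrightarrow> lead_coeff p * 0) at_infinity"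
    by (intro tendsto_mult poly_divide_tendsto_aux)
  moreover have "poly p z / z ^ degree p * inverse (z ^ (n - degree p)) = poly p z / z ^ n" for z :: complex
    using d by (simp add: field_simps flip: power_add)
  ultimately show ?thesis using d by (simp add: coeff_eq_0)
qed

text \<open>
  At \<open>u = v\<close> the value is the meaningless \<open>1 / 0 = 0\<close>.
\<close>

definition reciprocal_difference :: "complex \<Rightarrow> complex option \<Rightarrow> complex" where
  "reciprocal_difference v y = (case y of None \<Rightarrow> 0 | Some u \<Rightarrow> 1 / (u - v))"

lemma reciprocal_difference_continuous: "continuous_on (- {Some v}) (reciprocal_difference v)"
proof -
  let ?t = "\<lambda>u. u - v"
  have "homeomorphism UNIV UNIV ?t (\<lambda>u. u + v)"
  proof -
    have "surj ?t" "surj (\<lambda>u. u + v)"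
      by (rule surjI[of _ "\<lambda>u. u + v"], simp, rule surjI[of _ ?t], simp)
    then show ?thesis unfolding homeomorphism_def by (simp add: continuous_intros)
  qed
  then have t: "continuous_on (- {Some v}) (map_option ?t)"
    by (rule continuous_on_subset[OF map_option_continuous]) simp
  have "map_option ?t ` (- {Some v}) \<subseteq> - {antipode None}"
  proof
    fix y assume "y \<in> map_option ?t ` (- {Some v})"
    then show "y \<in> - {antipode None}" by (auto simp: map_option_case split: option.splits)
  qed
  then have "continuous_on (- {Some v}) (\<lambda>y. sphere_coord None (map_option ?t y))"
    by (intro continuous_on_compose2[OF continuous_on_sphere_coord[OF order_refl] t])
  moreover have "sphere_coord None (map_option ?t y) = reciprocal_difference v y" for y
    by (cases y) (auto simp: reciprocal_difference_def)
  ultimately show ?thesis by simp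
qed

lemma tendsto_None_at_infinity: "((Some :: complex \<Rightarrow> _) \<longlongrightarrow> None) at_infinity"
proof (rule topological_tendstoI)
  fix V :: "complex option set" assume "open V" "None \<in> V"
  then obtain R where R: "\<And>v. R < norm v \<Longrightarrow> Some v \<in> V" unfolding open_sphere_iff by auto
  show "\<forall>\<^sub>F x in at_infinity. Some x \<in> V"
    unfolding eventually_at_infinity using R by (intro exI[of _ "R + 1"]) auto
qed

text \<open>At a pole the coordinate k = 1/w is used, with 1/(w - v) = k / (1 - v k) and denominator
  1 at the pole itself; at a finite value different from \<open>v\<close> the reciprocal of w - v is
  analytic directly.\<close>

lemma reciprocal_difference_analytic:
  assumes mero: "meromorphic_map UNIV w" and a: "w (Some a) \<noteq> Some v"
  shows "(\<lambda>\<zeta>. reciprocal_difference v (w (Some \<zeta>))) analytic_on {a}"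
proof -
  have cw: "continuous_on UNIV w" using mero by (simp add: meromorphic_map_def)
  have cs: "continuous_on UNIV (\<lambda>\<zeta>. w (Some \<zeta>))"
    by (rule continuous_on_compose2[OF cw continuous_on_Some]) simp
  have ev: "\<forall>\<^sub>F \<zeta> in nhds a. w (Some \<zeta>) \<noteq> c" if "w (Some a) \<noteq> c" for c
  proof -
    have "open ((\<lambda>\<zeta>. w (Some \<zeta>)) -` (- {c}))"
      using cs by (simp add: continuous_on_open_vimage open_Compl)
    then show ?thesis using that unfolding eventually_nhds by (intro exI[of _ "(\<lambda>\<zeta>. w (Some \<zeta>)) -` (- {c})"]) auto
  qed
  show ?thesis
  proof (cases "w (Some a)")
    case None
    define k where "k \<zeta> = sphere_coord None (w (Some \<zeta>))" for \<zeta>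
    have k: "k analytic_on {a}" unfolding k_def[abs_def]
      by (rule analytic_sphere_coord[OF open_UNIV mero UNIV_I]) (simp add: None)
    have k0: "k a = 0" by (simp add: k_def None)
    have "(\<lambda>\<zeta>. k \<zeta> / (1 - v * k \<zeta>)) analytic_on {a}"
      by (intro analytic_on_divide analytic_on_diff analytic_on_mult analytic_on_const k) (simp add: k0)
    moreover have ev': "\<forall>\<^sub>F \<zeta> in nhds a. k \<zeta> / (1 - v * k \<zeta>) = reciprocal_difference v (w (Some \<zeta>))"
      using ev[of "Some 0"]
    proof (rule eventually_mono)
      show "w (Some a) \<noteq> Some 0" by (simp add: None)
      fix \<zeta> assume n: "w (Some \<zeta>) \<noteq> Some 0"
      show "k \<zeta> / (1 - v * k \<zeta>) = reciprocal_difference v (w (Some \<zeta>))"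
      proof (cases "w (Some \<zeta>)")
        case (Some u)
        then have "u \<noteq> 0" using n by simp
        then have "1 - v * (1 / u) = (u - v) / u" by (simp add: field_simps)
        then show ?thesis using Some \<open>u \<noteq> 0\<close> by (simp add: k_def reciprocal_difference_def)
      qed (simp add: k_def reciprocal_difference_def)
    qed
    ultimately show ?thesis by (simp only: analytic_at_cong[OF ev' refl])
  next
    case (Some u0)
    define g where "g \<zeta> = sphere_coord (Some v) (w (Some \<zeta>))" for \<zeta>
    have g: "g analytic_on {a}" unfolding g_def[abs_def]
      by (rule analytic_sphere_coord[OF open_UNIV mero UNIV_I]) (simp add: Some)
    have "(\<lambda>\<zeta>. 1 / g \<zeta>) analytic_on {a}"
      by (intro analytic_on_divide analytic_on_const g) (use a Some in \<open>simp add: g_def\<close>)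
    moreover have ev': "\<forall>\<^sub>F \<zeta> in nhds a. 1 / g \<zeta> = reciprocal_difference v (w (Some \<zeta>))"
      using ev[of None]
    proof (rule eventually_mono)
      show "w (Some a) \<noteq> None" by (simp add: Some)
      fix \<zeta> assume n: "w (Some \<zeta>) \<noteq> None"
      then show "1 / g \<zeta> = reciprocal_difference v (w (Some \<zeta>))"
        by (auto simp: g_def reciprocal_difference_def)
    qed
    ultimately show ?thesis by (simp only: analytic_at_cong[OF ev' refl])
  qed
qed

text \<open>
  If \<open>D\<close> has simple zeros at the finite fibre \<open>Z\<close> over \<open>v\<close>, then \<open>D / (w - v)\<close> extends to an entire function
  of polynomial growth, hence is a polynomial.
\<close>

lemma simple_fibre_rational:
  assumes mero: "meromorphic_map UNIV w" and Z: "finite Z" "Z \<noteq> {}" "{z. w z = Some v} = Some ` Z"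
    and simple: "\<And>z. z \<in> Z \<Longrightarrow> deriv (local_expression w (Some z)) 0 \<noteq> 0"
  shows "\<exists>d. rational_of_degree UNIV w d"
proof -
  have cw: "continuous_on UNIV w" using mero by (simp add: meromorphic_map_def)
  have cs: "continuous_on UNIV (\<lambda>\<zeta>. w (Some \<zeta>))"
    by (rule continuous_on_compose2[OF cw continuous_on_Some]) simp
  have wS: "w x = Some v \<longleftrightarrow> x \<in> Some ` Z" for x unfolding Z(3)[symmetric] by simp
  have wZ: "w (Some z) = Some v \<longleftrightarrow> z \<in> Z" for z unfolding wS by (rule inj_image_mem_iff) simp
  have wN: "w None \<noteq> Some v" unfolding wS by blast
  define u where "u \<zeta> = reciprocal_difference v (w (Some \<zeta>))" for \<zeta>
  define n where "n = card Z"
  define D where "D = (\<Prod>z\<in>Z. [:- z, 1:])"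
  define D' where "D' z = (\<Prod>x\<in>Z - {z}. [:- x, 1:])" for z
  define g where "g \<zeta> = sphere_coord (Some v) (w (Some \<zeta>))" for \<zeta>
  \<comment> \<open>On \<open>Z\<close> the value is the limit of D / (w - v): both have simple
    zeros, and the quotient of \<open>D'\<close> by the derivative of w - v remains.\<close>
  define F where "F \<zeta> = (if \<zeta> \<in> Z then poly (D' \<zeta>) \<zeta> / deriv g \<zeta> else poly D \<zeta> * u \<zeta>)" for \<zeta>
  have Dz: "poly D \<zeta> = 0 \<longleftrightarrow> \<zeta> \<in> Z" for \<zeta> using Z(1) by (auto simp: D_def poly_prod)
  have DD': "poly D \<zeta> = (\<zeta> - z) * poly (D' z) \<zeta>" if "z \<in> Z" for z \<zeta>
    unfolding D_def D'_def poly_prod using prod.remove[OF Z(1) that, of "\<lambda>x. poly [:- x, 1:] \<zeta>"] by simp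
  have D'z: "poly (D' z) z \<noteq> 0" for z using Z(1) by (auto simp: D'_def poly_prod)
  have degD: "degree D = n" unfolding D_def n_def by (subst degree_prod_sum_eq) auto
  have lcD: "lead_coeff D = 1" unfolding D_def by (simp add: lead_coeff_prod)
  have n0: "n > 0" using Z(1,2) by (simp add: n_def card_gt_0_iff)
  have g': "g analytic_on {z}" "g z = 0" "deriv g z \<noteq> 0" if z: "z \<in> Z" for z
  proof -
    have wz: "w (Some z) = Some v" using wZ z by simp
    show g: "g analytic_on {z}" unfolding g_def[abs_def]
      by (rule analytic_sphere_coord[OF open_UNIV mero UNIV_I]) (simp add: wz)
    show "g z = 0" by (simp add: g_def wz)
    have "(g has_field_derivative deriv g z) (at (0 + z))"
      using g analytic_on_imp_differentiable_at[of g "{z}" z] by (simp add: DERIV_deriv_iff_field_differentiable)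
    then have "((\<lambda>\<zeta>. g (\<zeta> + z)) has_field_derivative deriv g z) (at 0)" unfolding DERIV_shift .
    then have "deriv (\<lambda>\<zeta>. g (\<zeta> + z)) 0 = deriv g z" by (rule DERIV_imp_deriv)
    moreover have "local_expression w (Some z) = (\<lambda>\<zeta>. g (\<zeta> + z))"
      by (rule ext) (simp add: local_expression_def g_def wz add.commute)
    ultimately show "deriv g z \<noteq> 0" using simple[OF z] by simp
  qed
  have "F holomorphic_on UNIV"
  proof (rule no_isolated_singularity'[OF _ _ open_UNIV Z(1)])
    have "u analytic_on UNIV - Z"
    proof (rule analytic_on_analytic_at[THEN iffD2], rule ballI)
      fix z assume "z \<in> UNIV - Z"
      then have "w (Some z) \<noteq> Some v" using wZ by blast
      then show "u analytic_on {z}" unfolding u_def[abs_def] by (rule reciprocal_difference_analytic[OF mero])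
    qed
    then have "(\<lambda>\<zeta>. poly D \<zeta> * u \<zeta>) holomorphic_on UNIV - Z"
      by (intro holomorphic_intros analytic_imp_holomorphic)
    then show "F holomorphic_on UNIV - Z"
      by (rule holomorphic_transform) (simp add: F_def)
  next
    fix z assume z: "z \<in> Z"
    have wz: "w (Some z) = Some v" using wZ z by simp
    have "(g has_field_derivative deriv g z) (at z)"
      using g'(1)[OF z] analytic_on_imp_differentiable_at[of g "{z}" z] by (simp add: DERIV_deriv_iff_field_differentiable)
    then have 1: "((\<lambda>\<zeta>. (g \<zeta> - g z) / (\<zeta> - z)) \<longlongrightarrow> deriv g z) (at z)" by (simp add: has_field_derivative_iff)
    have "((\<lambda>\<zeta>. poly (D' z) \<zeta>) \<longlongrightarrow> poly (D' z) z) (at z)" by (intro tendsto_intros)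
    from tendsto_divide[OF this 1 g'(3)[OF z]]
    have 2: "((\<lambda>\<zeta>. poly (D' z) \<zeta> / ((g \<zeta> - g z) / (\<zeta> - z))) \<longlongrightarrow> F z) (at z)" using z by (simp add: F_def)
    have "open ((\<lambda>\<zeta>. w (Some \<zeta>)) -` (- {None}) - (Z - {z}))"
      using cs Z(1) by (intro open_Diff finite_imp_closed) (simp_all add: continuous_on_open_vimage open_Compl)
    then have "\<forall>\<^sub>F \<zeta> in at z. \<zeta> \<in> (\<lambda>\<zeta>. w (Some \<zeta>)) -` (- {None}) - (Z - {z})"
      by (intro eventually_at_in_open') (use wz in auto)
    moreover have "\<forall>\<^sub>F \<zeta> in at z. \<zeta> \<noteq> z" by (rule eventually_neq_at_within)
    ultimately have "\<forall>\<^sub>F \<zeta> in at z. poly (D' z) \<zeta> / ((g \<zeta> - g z) / (\<zeta> - z)) = F \<zeta>"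
    proof eventually_elim
      case (elim \<zeta>)
      then obtain y where y: "w (Some \<zeta>) = Some y" by auto
      have "u \<zeta> = 1 / g \<zeta>" by (simp add: u_def g_def y reciprocal_difference_def)
      then show ?case using elim DD'[OF z, of \<zeta>] g'(2)[OF z] by (simp add: F_def)
    qed
    then show "(F \<longlongrightarrow> F z) (at z within UNIV)" using Lim_transform_eventually[OF 2] by simp
  qed
  note holF = this
  \<comment> \<open>The fibre over \<open>v\<close> does not contain infinity, so 1 / (w - v) has a
    finite limit \<open>U\<close> there. As \<open>D\<close> is monic of degree \<open>n\<close>,
    this bounds \<open>F\<close> by a multiple of the n-th power, and \<open>U\<close> becomes the
    coefficient of that power.\<close>
  define U where "U = reciprocal_difference v (w None)"
  have "(u \<longlongrightarrow> U) at_infinity"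
  proof -
    have "isCont w None" using cw by (simp add: continuous_on_eq_continuous_at)
    then have "((\<lambda>\<zeta>. w (Some \<zeta>)) \<longlongrightarrow> w None) at_infinity"
      by (rule isCont_tendsto_compose[OF _ tendsto_None_at_infinity])
    moreover have "isCont (reciprocal_difference v) (w None)"
      using reciprocal_difference_continuous[of v] wN by (simp add: continuous_on_eq_continuous_at open_Compl)
    ultimately show ?thesis unfolding u_def[abs_def] U_def by (rule isCont_tendsto_compose[rotated])
  qed
  then have "((\<lambda>\<zeta>. poly D \<zeta> / \<zeta> ^ n * u \<zeta>) \<longlongrightarrow> 1 * U) at_infinity"
    using poly_divide_tendsto_aux[of D] lcD degD by (intro tendsto_mult) simp_all
  moreover have "\<forall>\<^sub>F \<zeta> in at_infinity. poly D \<zeta> / \<zeta> ^ n * u \<zeta> = F \<zeta> / \<zeta> ^ n"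
  proof -
    obtain r where r: "\<And>z. z \<in> Z \<Longrightarrow> norm z \<le> r" using finite_imp_bounded[OF Z(1)] unfolding bounded_iff by blast
    show ?thesis unfolding eventually_at_infinity
    proof (intro exI[of _ "r + 1"] allI impI)
      fix \<zeta> :: complex assume "r + 1 \<le> norm \<zeta>"
      then have "\<zeta> \<notin> Z" using r[of \<zeta>] by auto
      then show "poly D \<zeta> / \<zeta> ^ n * u \<zeta> = F \<zeta> / \<zeta> ^ n" by (simp add: F_def)
    qed
  qed
  ultimately have limF: "((\<lambda>\<zeta>. F \<zeta> / \<zeta> ^ n) \<longlongrightarrow> U) at_infinity"
    using Lim_transform_eventually by fastforce
  have "\<forall>\<^sub>F \<zeta> in at_infinity. norm (F \<zeta> / \<zeta> ^ n) < norm U + 1"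
    by (rule order_tendstoD(2)[OF tendsto_norm[OF limF]]) simp
  then obtain A where A: "\<And>\<zeta>. A \<le> norm \<zeta> \<Longrightarrow> norm (F \<zeta> / \<zeta> ^ n) < norm U + 1"
    unfolding eventually_at_infinity by blast
  have growth: "norm (F \<zeta>) \<le> (norm U + 1) * norm \<zeta> ^ n" if "max A 1 \<le> norm \<zeta>" for \<zeta>
  proof -
    have "norm \<zeta> > 0" using that by linarith
    then show ?thesis using A[of \<zeta>] that by (simp add: norm_divide norm_power pos_divide_less_eq)
  qed
  define p where "p = (\<Sum>k\<le>n. monom ((deriv ^^ k) F 0 / fact k) k)"
  have Fp: "F \<zeta> = poly p \<zeta>" for \<zeta>
  proof -
    have "F \<zeta> = (\<Sum>k\<le>n. (deriv ^^ k) F 0 / fact k * \<zeta> ^ k)"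
      by (rule Liouville_polynomial[OF holF growth])
    then show ?thesis by (simp add: p_def poly_sum poly_monom)
  qed
  have degp: "degree p \<le> n" unfolding p_def
    by (intro degree_sum_le) (auto intro: order_trans[OF degree_monom_le])
  have U: "coeff p n = U"
    using tendsto_unique[OF trivial_limit_at_infinity poly_over_power_tendsto[OF degp]] limF Fp by simp
  have pZ: "poly p z \<noteq> 0" if "z \<in> Z" for z
    using that D'z[of z] g'(3)[OF that] unfolding Fp[symmetric] by (simp add: F_def)
  have p0: "p \<noteq> 0" using pZ Z(2) by fastforce
  \<comment> \<open>From p = D / (w - v) follows w = (v p + D) / p.\<close>
  define P where "P = smult v p + D"
  have cop: "coprime P p"
  proof (rule coprime_if_no_common_root[OF p0])
    fix z assume z: "poly p z = 0"
    then have "z \<notin> Z" using pZ by blast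
    then show "poly P z \<noteq> 0" using z Dz by (simp add: P_def)
  qed
  have "w q = rational_map P p q" for q
  proof (cases q)
    case (Some z)
    show ?thesis
    proof (cases "z \<in> Z")
      case True
      then have "poly P z / poly p z = v" using pZ[OF True] Dz[of z] by (simp add: P_def)
      then show ?thesis using Some True wZ[of z] pZ[OF True] by (simp add: rational_map_def)
    next
      case False
      then have pz: "poly p z = poly D z * u z" unfolding Fp[symmetric] by (simp add: F_def)
      have D0: "poly D z \<noteq> 0" using Dz False by simp
      show ?thesis
      proof (cases "w (Some z)")
        case None
        then have "poly p z = 0" using pz by (simp add: u_def reciprocal_difference_def)
        then show ?thesis using None Some by (simp add: rational_map_def)
      next
        case y: (Some y)
        have yv: "y \<noteq> v" using wZ[of z] y False by simp
        have e: "poly p z = poly D z / (y - v)" using pz y by (simp add: u_def reciprocal_difference_def)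
        then have pz0: "poly p z \<noteq> 0" using D0 yv by simp
        have "poly P z = y * poly p z" using e yv by (simp add: P_def field_simps)
        then have "poly P z / poly p z = y" using pz0 by simp
        then show ?thesis using y Some pz0 by (simp add: rational_map_def)
      qed
    qed
  next
    case N: None
    show ?thesis
    proof (cases "w None")
      case None
      then have "coeff p n = 0" by (simp add: U U_def reciprocal_difference_def)
      then have "degree p \<noteq> n" using p0 by (metis leading_coeff_0_iff)
      then have "degree p < n" using degp by simp
      then have "degree P = n" unfolding P_def using degD degree_add_eq_right[of "smult v p" D]
        by (metis degree_smult_le order_le_less_trans)
      then show ?thesis using N None \<open>degree p < n\<close> by (simp add: rational_map_def)
    next
      case (Some y)
      then have yv: "y \<noteq> v" using wN by auto
      have c: "coeff p n = 1 / (y - v)" by (simp add: U U_def Some reciprocal_difference_def)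
      then have c0: "coeff p n \<noteq> 0" using yv by simp
      then have dp: "degree p = n" using degp le_degree by (metis antisym)
      have "degree P \<le> n" unfolding P_def using degp degD
        by (intro degree_add_le) (auto intro: order_trans[OF degree_smult_le])
      moreover have "coeff P n = y * coeff p n"
        using c yv lcD degD by (simp add: P_def field_simps)
      then have "coeff P n / coeff p n = y" using c0 by simp
      ultimately show ?thesis using N Some dp by (simp add: rational_map_def)
    qed
  qed
  then show ?thesis unfolding rational_of_degree_def using p0 cop by blast
qed

text \<open>An injective holomorphic function has nonvanishing derivative. The domain is shrunk so
  that \<open>w\<close> avoids the antipode of w p, off which the coordinate is injective.\<close>

lemma injective_imp_not_critical:
  assumes mero: "meromorphic_map UNIV w" and inj: "inj w"
  shows "deriv (local_expression w p) 0 \<noteq> 0"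
proof -
  have cw: "continuous_on UNIV w" and an: "local_expression w p analytic_on {0}"
    using mero by (simp_all add: meromorphic_map_def)
  have cc: "continuous_on UNIV (\<lambda>\<zeta>. w (sphere_chart p \<zeta>))"
    by (rule continuous_on_compose2[OF cw continuous_on_sphere_chart]) simp
  obtain U where U: "open U" "0 \<in> U" "local_expression w p holomorphic_on U"
    using an unfolding analytic_at by blast
  define N where "N = U \<inter> (\<lambda>\<zeta>. w (sphere_chart p \<zeta>)) -` (- {antipode (w p)})"
  have N: "open N" using cc U(1) unfolding N_def
    by (intro open_Int) (simp_all add: continuous_on_open_vimage open_Compl)
  have "0 \<in> N" using U(2) by (simp add: N_def)
  moreover have "local_expression w p holomorphic_on N" using U(3) by (rule holomorphic_on_subset) (simp add: N_def)
  moreover have "inj_on (local_expression w p) N"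
  proof (rule inj_onI)
    fix x y assume xy: "x \<in> N" "y \<in> N" "local_expression w p x = local_expression w p y"
    have n: "w (sphere_chart p x) \<noteq> antipode (w p)" "w (sphere_chart p y) \<noteq> antipode (w p)"
      using xy(1,2) by (simp_all add: N_def)
    have "sphere_coord (w p) (w (sphere_chart p x)) = sphere_coord (w p) (w (sphere_chart p y))"
      using xy(3) by (simp add: local_expression_def)
    then have "w (sphere_chart p x) = w (sphere_chart p y)"
      using sphere_chart_coord[OF n(1)] sphere_chart_coord[OF n(2)] by metis
    then have "sphere_chart p x = sphere_chart p y" using inj by (simp add: inj_eq)
    then show "x = y" using inj_sphere_chart[of p UNIV] by (simp add: inj_eq)
  qed
  ultimately show ?thesis using holomorphic_injective_imp_regular[OF _ N] by blast
qed

lemma no_asymptotic_value_UNIV: "\<not> asymptotic_value UNIV w a"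
proof
  assume "asymptotic_value UNIV w a"
  then obtain \<gamma> :: "real \<Rightarrow> complex option" where
    "\<forall>K. compactin riemann_sphere K \<and> K \<subseteq> UNIV \<longrightarrow> (\<forall>\<^sub>F t in at_left 1. \<gamma> t \<notin> K)"
    unfolding asymptotic_value_def by blast
  then have "\<forall>\<^sub>F t in at_left (1 :: real). \<gamma> t \<notin> UNIV"
    by (rule allE[of _ UNIV]) (simp add: compact_UNIV_sphere)
  then show False using at_left_nontrivial by (simp add: trivial_limit_def)
qed

section \<open>Counting the sheets of an arbitrary decomposition\<close>

context
  fixes \<Omega> w q G
  assumes sp: "speiser_function \<Omega> w q" and G: "constructed_by_glueing \<Omega> w G"
begin

interpretation branched \<Omega> w "singular_values \<Omega> w"
  using sp by (rule speiser_branched)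

text \<open>Avoiding w None as well places the fibre in the finite plane when \<Omega> is the
  sphere.\<close>

lemma generic_value:
  obtains N where "negligible N" "\<And>v. v \<notin> N \<Longrightarrow> Some v \<notin> singular_values \<Omega> w"
    "\<And>v. v \<notin> N \<Longrightarrow> w None \<noteq> Some v"
    "\<And>v. v \<notin> N \<Longrightarrow> \<exists>b. bij_betw b (sheets G) {z \<in> \<Omega>. w z = Some v}"
proof -
  let ?S = "singular_values \<Omega> w"
  define N where "N = {v. \<exists>e. geodesic_between ?S e \<and> Some v \<in> segment_points e} \<union> (Some -` ?S \<union> {finite_part (w None)})"
  have "finite (Some -` ?S)" using finS by (rule finite_vimageI) simp
  then have "negligible N" unfolding N_def
    by (intro negligible_Un geodesics_negligible[OF finS] negligible_finite) simp_all
  moreover have "Some v \<notin> ?S" if "v \<notin> N" for v using that by (simp add: N_def)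
  moreover have "w None \<noteq> Some v" if "v \<notin> N" for v using that by (auto simp: N_def)
  moreover have "\<exists>b. bij_betw b (sheets G) {z \<in> \<Omega>. w z = Some v}" if "v \<notin> N" for v
    by (rule generic_fibre[OF G finS]) (use that in \<open>auto simp: N_def\<close>)
  ultimately show thesis by (rule that[of N])
qed

text \<open>Over almost every value the fibre has as many points as there are sheets, and finite
  fibres force \<Omega> to be the sphere. A generic value is nonsingular, so its fibre is simple;
  since the image of \<open>w\<close> is open, such a value can be chosen among those
  attained.\<close>

lemma finite_sheets_rational:
  assumes fin: "finite (sheets G)"
  shows "\<Omega> = UNIV" "\<exists>d. rational_of_degree \<Omega> w d"
proof -
  let ?S = "singular_values \<Omega> w"
  obtain N where N: "negligible N" "\<And>v. v \<notin> N \<Longrightarrow> Some v \<notin> ?S" "\<And>v. v \<notin> N \<Longrightarrow> w None \<noteq> Some v"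
    "\<And>v. v \<notin> N \<Longrightarrow> \<exists>b. bij_betw b (sheets G) {z \<in> \<Omega>. w z = Some v}"
    using generic_value by metis
  have ff: "finite {z \<in> \<Omega>. w z = Some v}" if "v \<notin> N" for v
    using N(4)[OF that] fin bij_betw_finite by metis
  show U: "\<Omega> = UNIV"
  proof (rule finite_fibres_imp_UNIV)
    fix U :: "complex option set" assume "open U" "U \<noteq> {}"
    then obtain v where "Some v \<in> U" "v \<notin> N" using not_negligible_nonempty_open N(1) by blast
    then show "\<exists>v\<in>U. finite {z \<in> \<Omega>. w z = v}" using ff by blast
  qed
  have "open (w ` \<Omega>)" "w ` \<Omega> \<noteq> {}" using open_map[OF open_dom order_refl] dom_nonempty by auto
  then obtain v where v: "Some v \<in> w ` \<Omega>" "v \<notin> N" using not_negligible_nonempty_open N(1) by blast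
  define Z where "Z = {z. w (Some z) = Some v}"
  have wS: "{z. w z = Some v} = Some ` Z"
  proof (rule set_eqI)
    fix z show "z \<in> {z. w z = Some v} \<longleftrightarrow> z \<in> Some ` Z"
      using N(3)[OF v(2)] by (cases z) (auto simp: Z_def)
  qed
  have "finite (Some ` Z)" using ff[OF v(2)] unfolding U wS[symmetric] by simp
  then have Z: "finite Z" by (rule finite_imageD) simp
  have "Z \<noteq> {}" using v(1) wS by auto
  have mero: "meromorphic_map UNIV w" using sp U by (simp add: speiser_function_def)
  have "deriv (local_expression w (Some z)) 0 \<noteq> 0" if z: "z \<in> Z" for z
  proof
    assume "deriv (local_expression w (Some z)) 0 = 0"
    then have "critical_point \<Omega> w (Some z)" unfolding critical_point_def U by simp
    then have "w (Some z) \<in> ?S" by (auto simp: singular_values_def)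
    then show False using N(2)[OF v(2)] z by (simp add: Z_def)
  qed
  then show "\<exists>d. rational_of_degree \<Omega> w d"
    unfolding U using simple_fibre_rational[OF mero Z \<open>Z \<noteq> {}\<close> wS] by blast
qed

text \<open>A value generic both for the decomposition and for the rational function compares the
  two counts.\<close>

lemma rational_num_sheets:
  assumes "rational_of_degree \<Omega> w d" shows "finite (sheets G)" "card (sheets G) = d"
proof -
  obtain N where N: "negligible N" "\<And>v. v \<notin> N \<Longrightarrow> \<exists>b. bij_betw b (sheets G) {z \<in> \<Omega>. w z = Some v}"
    using generic_value by metis
  obtain B where B: "finite B" "\<And>v. v \<notin> B \<Longrightarrow> finite {z \<in> \<Omega>. w z = Some v} \<and> card {z \<in> \<Omega>. w z = Some v} = d"
    using rational_generic_fibre[OF assms] by blast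
  have "\<exists>v. Some v \<in> (UNIV :: complex option set) \<and> v \<notin> N \<union> B"
    by (rule not_negligible_nonempty_open[OF open_UNIV UNIV_not_empty negligible_Un[OF N(1) negligible_finite[OF B(1)]]])
  then obtain v where v: "v \<notin> N" "v \<notin> B" by blast
  obtain b where b: "bij_betw b (sheets G) {z \<in> \<Omega>. w z = Some v}" using N(2)[OF v(1)] by blast
  show "finite (sheets G)" using bij_betw_finite[OF b] B(2)[OF v(2)] by simp
  show "card (sheets G) = d" using bij_betw_same_card[OF b] B(2)[OF v(2)] by simp
qed

lemma card_sheets_ge_two:
  assumes fin: "finite (sheets G)" shows "2 \<le> card (sheets G)"
proof -
  let ?S = "singular_values \<Omega> w"
  obtain N where N: "negligible N" "\<And>v. v \<notin> N \<Longrightarrow> \<exists>b. bij_betw b (sheets G) {z \<in> \<Omega>. w z = Some v}"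
    using generic_value by metis
  have card: "card {z \<in> \<Omega>. w z = Some v} = card (sheets G)" "finite {z \<in> \<Omega>. w z = Some v}" if "v \<notin> N" for v
    using N(2)[OF that] fin bij_betw_same_card bij_betw_finite by metis+
  have U: "\<Omega> = UNIV" by (rule finite_sheets_rational(1)[OF fin])
  have "card ?S \<noteq> 0" using sp by (auto simp: speiser_function_def)
  moreover have "?S = {}" if inj: "inj w"
  proof -
    have mero: "meromorphic_map UNIV w" using sp U by (simp add: speiser_function_def)
    have "\<not> critical_point UNIV w p" for p
      using injective_imp_not_critical[OF mero inj] by (simp add: critical_point_def)
    then show ?thesis unfolding singular_values_def U using no_asymptotic_value_UNIV by simp
  qed
  ultimately have "\<not> inj w" by (metis card.empty)
  then obtain x y where xy: "w x = w y" "x \<noteq> y" unfolding inj_def by blast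
  \<comment> \<open>The value taken twice need not be generic; disjoint neighbourhoods of
    \<open>x\<close> and \<open>y\<close> have images overlapping in a nonempty open set, in which a
    generic value taken twice is found.\<close>
  obtain A B where AB: "open A" "open B" "x \<in> A" "y \<in> B" "A \<inter> B = {}" using hausdorff[OF xy(2)] by blast
  have "open (w ` A \<inter> w ` B)" using AB U by (intro open_Int open_map) auto
  moreover have "w x \<in> w ` A \<inter> w ` B"
    by (rule IntI[OF imageI[OF AB(3)]]) (unfold xy(1), rule imageI[OF AB(4)])
  ultimately obtain v where v: "Some v \<in> w ` A \<inter> w ` B" "v \<notin> N"
    using not_negligible_nonempty_open[OF _ _ N(1)] by (metis empty_iff)
  then obtain a b where ab: "a \<in> A" "w a = Some v" "b \<in> B" "w b = Some v" by (metis IntE imageE)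
  then have "a \<noteq> b" using AB(5) by (metis disjoint_iff)
  then have "2 = card {a, b}" by simp
  also have "\<dots> \<le> card {z \<in> \<Omega>. w z = Some v}"
    by (rule card_mono[OF card(2)[OF v(2)]]) (use ab U in auto)
  finally show ?thesis unfolding card(1)[OF v(2)] .
qed

end

theorem proposition4p7:
  fixes \<Omega> :: "complex option set" and w :: "complex option \<Rightarrow> complex option" and q :: nat
  assumes "speiser_function \<Omega> w q"
  shows "(\<exists>G. constructed_by_glueing \<Omega> w G \<and> finite (cuts G ` sheets G)) \<and>
         (\<forall>G. constructed_by_glueing \<Omega> w G \<longrightarrow>
            2 \<le> num_sheets G \<and>
            (num_sheets G < \<infinity> \<longleftrightarrow> (\<exists>d. rational_of_degree \<Omega> w d)) \<and>
            (\<forall>d. rational_of_degree \<Omega> w d \<longrightarrow> 2 \<le> d \<and> num_sheets G = enat d))"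
proof (intro conjI allI impI)
  show "\<exists>G. constructed_by_glueing \<Omega> w G \<and> finite (cuts G ` sheets G)" by (rule glueing_exists[OF assms])
  fix G assume G: "constructed_by_glueing \<Omega> w G"
  note rational = rational_num_sheets[OF assms G]
  show "2 \<le> num_sheets G"
    using card_sheets_ge_two[OF assms G] by (simp add: num_sheets_def numeral_eq_enat)
  show "num_sheets G < \<infinity> \<longleftrightarrow> (\<exists>d. rational_of_degree \<Omega> w d)"
    using finite_sheets_rational(2)[OF assms G] rational(1) by (auto simp: num_sheets_def)
  fix d assume d: "rational_of_degree \<Omega> w d"
  show "2 \<le> d" using card_sheets_ge_two[OF assms G rational(1)[OF d]] rational(2)[OF d] by simp
  show "num_sheets G = enat d" using rational[OF d] by (simp add: num_sheets_def)
qed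

end
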